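(* Let $\Lambda_1,\ldots,\Lambda_n$ be finite nonempty centrally symmetric subsets of the lattice ${\mathbb Z^n}^*\subset\mathfrak h^*$. Then $$\mathfrak M(\Lambda_1,\ldots,\Lambda_n)=n!\,\mathrm{vol}\bigl(\mathrm{ell}(\Lambda_1),\ldots,\mathrm{ell}(\Lambda_n)\bigr),$$ where $\mathfrak M(\Lambda_1,\ldots,\Lambda_n)$ is the average number of roots of a system of random trigonometric polynomials with supports $\Lambda_1,\ldots,\Lambda_n$, and the mixed volume is measured so that the fundamental cube of the lattice ${\mathbb Z^n}^*$ has volume $1$.
   Context: $T^n=\{z\in(\mathbb C\setminus 0)^n: |z_j|=1 \text{ for all } j\}$ is the compact torus, with points written $z=(e^{i\theta_1},\ldots,e^{i\theta_n})$, and $d\chi$ is its normalized Haar measure. $\mathfrak h\cong\mathbb R^n$ (coordinates $\theta$) and $\mathfrak h^*$ are the tangent and cotangent spaces of $T^n$ at its identity; ${\mathbb Z^n}^*\subset\mathfrak h^*$ is the lattice of integer linear forms, so that $\lambda=(\lambda_1,\ldots,\lambda_n)\in{\mathbb Z^n}^*$ is the form $\lambda(\xi)=\sum_j\lambda_j\xi_j$ and corresponds to the monomial $z^\lambda=z_1^{\lambda_1}\cdots z_n^{\lambda_n}$. For a finite centrally symmetric ($\Lambda=-\Lambda$) set $\Lambda\subset{\mathbb Z^n}^*$, a real Laurent polynomial with support $\Lambda$ is $\sum_{\lambda\in\Lambda}a_\lambda z^\lambda$ with $a_\lambda\in\mathbb C$ and $a_{-\lambda}=\overline{a_\lambda}$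 for all $\lambda\in\Lambda$. Its restriction to $T^n$ is real-valued and is called a trigonometric polynomial with support $\Lambda$. These form a real vector space $V(\Lambda)$ of dimension $\#\Lambda$, with the inner product of $L^2(T^n,d\chi)$. Let $S_i\subset V(\Lambda_i)$ be the unit sphere centered at $0$ and $ds_i$ the orthogonally invariant volume form on $S_i$ with $\int_{S_i}ds_i=1$. For $s_i\in S_i$ let $N(s_1,\ldots,s_n)$ be the number of isolated points of the set of common zeros of $s_1,\ldots,s_n$ on $T^n$. Then $$\mathfrak M(\Lambda_1,\ldots,\Lambda_n)=\int_{S_1\times\cdots\times S_n}N(s_1,\ldots,s_n)\,ds_1\cdots ds_n .$$ For a finite nonempty centrally symmetric $\Lambda\subset{\mathbb Z^n}^*$, $\mathrm{ell}(\Lambda)\subset\mathfrak h^*$ is the (possibly degenerate) ellipsoid with support function $h_\Lambda(\xi)=\sqrt{\frac1{\#\Lambda}\sum_{\lambda\in\Lambda}\lambda(\xi)^2}$, $\xi\in\mathfrak h$; the support function of a compact convex set $A\subset\mathfrak h^*$ is $\xi\mapsto\max_{a\in A}a(\xi)$. The mixed volume $\mathrm{vol}(A_1,\ldots,A_n)$ of compact convex sets is normalized by $\mathrm{vol}(A,\ldots,A)=\mathrm{vol}(A)$. *)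

theory Defs
  imports "HOL-Probability.Probability" "HOL-Combinatorics.Permutations"
begin

definition torus :: "(complex ^ 'n) set" where
  "torus = {z. \<forall>j. cmod (z $ j) = 1}"

definition haar_torus :: "(complex ^ 'n) measure" where
  "haar_torus = distr (uniform_measure lborel (cbox 0 (\<chi> j. 2 * pi))) borel (\<lambda>\<theta>. \<chi> j. cis (\<theta> $ j))"

definition laurent_monomial :: "int ^ 'n \<Rightarrow> complex ^ 'n \<Rightarrow> complex" where
  "laurent_monomial \<mu> z = (\<Prod>j\<in>UNIV. (z $ j) powi (\<mu> $ j))"

text \<open>Real functions on the torus are represented by functions on the ambient space that vanish off
  the torus, so that each of them has exactly one representative and pointwise linear combinations
  stay within the representation.\<close>

definition trig_polys :: "(int ^ 'n) set \<Rightarrow> (complex ^ 'n \<Rightarrow> real) set" where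
  "trig_polys \<Lambda> = {f. (\<exists>a. (\<forall>\<mu>\<in>\<Lambda>. a (- \<mu>) = cnj (a \<mu>)) \<and>
      (\<forall>z\<in>torus. complex_of_real (f z) = (\<Sum>\<mu>\<in>\<Lambda>. a \<mu> * laurent_monomial \<mu> z))) \<and>
      (\<forall>z. z \<notin> torus \<longrightarrow> f z = 0)}"

definition L2_inner :: "(complex ^ 'n \<Rightarrow> real) \<Rightarrow> (complex ^ 'n \<Rightarrow> real) \<Rightarrow> real" where
  "L2_inner f g = (\<integral>z. f z * g z \<partial>haar_torus)"

definition unit_sphere :: "(int ^ 'n) set \<Rightarrow> (complex ^ 'n \<Rightarrow> real) set" where
  "unit_sphere \<Lambda> = {f \<in> trig_polys \<Lambda>. L2_inner f f = 1}"

definition orthogonal_trans ::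
    "(int ^ 'n) set \<Rightarrow> ((complex ^ 'n \<Rightarrow> real) \<Rightarrow> (complex ^ 'n \<Rightarrow> real)) \<Rightarrow> bool" where
  "orthogonal_trans \<Lambda> U \<longleftrightarrow> bij_betw U (trig_polys \<Lambda>) (trig_polys \<Lambda>) \<and>
     (\<forall>f\<in>trig_polys \<Lambda>. \<forall>g\<in>trig_polys \<Lambda>. \<forall>c d.
        U (\<lambda>z. c * f z + d * g z) = (\<lambda>z. c * U f z + d * U g z)) \<and>
     (\<forall>f\<in>trig_polys \<Lambda>. \<forall>g\<in>trig_polys \<Lambda>. L2_inner (U f) (U g) = L2_inner f g)"

text \<open>Here \<open>borel\<close> belongs to the topology of pointwise convergence on the function type. On the
  finite-dimensional space of trigonometric polynomials with a given support this is the topology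
  of the norm, so the trace of \<open>borel\<close> is the Borel \<open>\<sigma>\<close>-algebra of the sphere. An orthogonally
  invariant Borel probability measure on a Euclidean sphere is unique, which justifies the
  definite description.\<close>

definition sphere_measure :: "(int ^ 'n) set \<Rightarrow> (complex ^ 'n \<Rightarrow> real) measure" where
  "sphere_measure \<Lambda> = (THE \<sigma>. space \<sigma> = unit_sphere \<Lambda> \<and>
     sets \<sigma> = sets (restrict_space borel (unit_sphere \<Lambda>)) \<and>
     emeasure \<sigma> (unit_sphere \<Lambda>) = 1 \<and>
     (\<forall>U. orthogonal_trans \<Lambda> U \<longrightarrow> (\<forall>A\<in>sets \<sigma>. emeasure \<sigma> (U ` A) = emeasure \<sigma> A)))"

definition num_roots :: "('n \<Rightarrow> complex ^ 'n \<Rightarrow> real) \<Rightarrow> ennreal" where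
  "num_roots s = emeasure (count_space UNIV) {x. x isolated_in {z \<in> torus. \<forall>i. s i z = 0}}"

definition avg_roots :: "('n :: finite \<Rightarrow> (int ^ 'n) set) \<Rightarrow> ennreal" where
  "avg_roots \<Lambda> = (\<integral>\<^sup>+ s. num_roots s \<partial>(\<Pi>\<^sub>M i\<in>UNIV. sphere_measure (\<Lambda> i)))"

text \<open>The cotangent space is identified with \<open>real ^ 'n\<close> through the dual basis; the pairing with
  the tangent space is then the inner product, and Lebesgue measure gives the fundamental cube of
  the lattice of integer forms volume 1.\<close>

definition support_fun :: "'a::euclidean_space set \<Rightarrow> 'a \<Rightarrow> real" where
  "support_fun A \<xi> = (SUP a\<in>A. a \<bullet> \<xi>)"

definition ell_support :: "(int ^ 'n) set \<Rightarrow> real ^ 'n \<Rightarrow> real" where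
  "ell_support \<Lambda> \<xi> = sqrt (1 / real (card \<Lambda>) * (\<Sum>\<mu>\<in>\<Lambda>. (\<Sum>j\<in>UNIV. real_of_int (\<mu> $ j) * \<xi> $ j)\<^sup>2))"

definition ell :: "(int ^ 'n) set \<Rightarrow> (real ^ 'n) set" where
  "ell \<Lambda> = (THE A. A \<noteq> {} \<and> compact A \<and> convex A \<and> support_fun A = ell_support \<Lambda>)"

lemma ell_unique:
  fixes \<Lambda> :: "(int ^ 'n) set"
  assumes "finite \<Lambda>" "\<Lambda> \<noteq> {}"
  shows "\<exists>!A. A \<noteq> {} \<and> compact A \<and> convex A \<and> support_fun A = ell_support \<Lambda>"
proof -
  define v :: "int ^ 'n \<Rightarrow> real ^ 'n" where "v \<mu> = (\<chi> j. real_of_int (\<mu> $ j))" for \<mu>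
  define m where "m = real (card \<Lambda>)"
  define h where "h = ell_support \<Lambda>"
  have m: "m > 0" using assms by (simp add: m_def card_gt_0_iff)
  have h_eq: "h \<xi> = sqrt (1 / m * (\<Sum>\<mu>\<in>\<Lambda>. (v \<mu> \<bullet> \<xi>)\<^sup>2))" for \<xi>
    by (simp add: h_def ell_support_def v_def m_def inner_vec_def)
  have h_nonneg: "h \<xi> \<ge> 0" for \<xi>
    using m by (simp add: h_eq sum_nonneg)
  have h_sq: "m * (h \<xi>)\<^sup>2 = (\<Sum>\<mu>\<in>\<Lambda>. (v \<mu> \<bullet> \<xi>)\<^sup>2)" for \<xi>
    using m by (simp add: h_eq sum_nonneg)
  define C where "C = sqrt (1 / m * (\<Sum>\<mu>\<in>\<Lambda>. (norm (v \<mu>))\<^sup>2))"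
  have h_le: "h \<xi> \<le> C * norm \<xi>" for \<xi>
  proof -
    have "1 / m * (\<Sum>\<mu>\<in>\<Lambda>. (v \<mu> \<bullet> \<xi>)\<^sup>2) \<le> 1 / m * (\<Sum>\<mu>\<in>\<Lambda>. (norm (v \<mu>))\<^sup>2 * (norm \<xi>)\<^sup>2)"
    proof (intro mult_left_mono sum_mono)
      fix \<mu>
      have "\<bar>v \<mu> \<bullet> \<xi>\<bar> \<le> \<bar>norm (v \<mu>) * norm \<xi>\<bar>" using Cauchy_Schwarz_ineq2[of "v \<mu>" \<xi>] by simp
      then have "(v \<mu> \<bullet> \<xi>)\<^sup>2 \<le> (norm (v \<mu>) * norm \<xi>)\<^sup>2" by (rule abs_le_square_iff[THEN iffD1])
      then show "(v \<mu> \<bullet> \<xi>)\<^sup>2 \<le> (norm (v \<mu>))\<^sup>2 * (norm \<xi>)\<^sup>2" by (simp add: power_mult_distrib)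
    qed (use m in auto)
    also have "\<dots> = (1 / m * (\<Sum>\<mu>\<in>\<Lambda>. (norm (v \<mu>))\<^sup>2)) * (norm \<xi>)\<^sup>2"
      by (simp add: sum_distrib_right)
    finally have "h \<xi> \<le> sqrt ((1 / m * (\<Sum>\<mu>\<in>\<Lambda>. (norm (v \<mu>))\<^sup>2)) * (norm \<xi>)\<^sup>2)"
      unfolding h_eq by (rule real_sqrt_le_mono)
    then show ?thesis by (simp only: C_def real_sqrt_mult real_sqrt_abs) simp
  qed
  define E where "E = {a. \<forall>\<xi>. a \<bullet> \<xi> \<le> h \<xi>}"
  have 0: "0 \<in> E" by (simp add: E_def h_nonneg)
  have E_Int: "E = (\<Inter>\<xi>. {a. \<xi> \<bullet> a \<le> h \<xi>})" by (auto simp: E_def inner_commute)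
  have "closed E" unfolding E_Int by (intro closed_INT ballI closed_halfspace_le)
  moreover have "bounded E"
  proof (rule boundedI)
    fix a assume "a \<in> E"
    then have "a \<bullet> a \<le> C * norm a" using h_le[of a] by (auto simp: E_def intro: order_trans)
    then have "norm a * norm a \<le> C * norm a" by (simp add: dot_square_norm power2_eq_square)
    moreover have "C \<ge> 0" using m by (simp add: C_def sum_nonneg)
    ultimately show "norm a \<le> C" by (cases "a = 0") auto
  qed
  ultimately have comp: "compact E" by (simp add: compact_eq_bounded_closed)
  have conv: "convex E" unfolding E_Int by (intro convex_INT convex_halfspace_le)
  have attained: "\<exists>a\<in>E. a \<bullet> \<xi> = h \<xi>" for \<xi>
  proof (cases "h \<xi> = 0")
    case True
    then show ?thesis using 0 by (intro bexI[of _ 0]) auto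
  next
    case False
    then have hp: "h \<xi> > 0" using h_nonneg[of \<xi>] by simp
    define a where "a = (1 / (m * h \<xi>)) *\<^sub>R (\<Sum>\<mu>\<in>\<Lambda>. (v \<mu> \<bullet> \<xi>) *\<^sub>R v \<mu>)"
    have a: "a \<bullet> \<eta> = (\<Sum>\<mu>\<in>\<Lambda>. (v \<mu> \<bullet> \<xi>) * (v \<mu> \<bullet> \<eta>)) / (m * h \<xi>)" for \<eta>
      by (simp add: a_def inner_sum_left)
    have "a \<bullet> \<eta> \<le> h \<eta>" for \<eta>
    proof -
      have "(\<Sum>\<mu>\<in>\<Lambda>. (v \<mu> \<bullet> \<xi>) * (v \<mu> \<bullet> \<eta>))\<^sup>2 \<le> (m * (h \<xi>)\<^sup>2) * (m * (h \<eta>)\<^sup>2)"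
        unfolding h_sq by (rule Cauchy_Schwarz_ineq_sum)
      also have "\<dots> = (m * h \<xi> * h \<eta>)\<^sup>2" by (simp add: power2_eq_square)
      finally have "(\<Sum>\<mu>\<in>\<Lambda>. (v \<mu> \<bullet> \<xi>) * (v \<mu> \<bullet> \<eta>)) \<le> m * h \<xi> * h \<eta>"
        by (rule power2_le_imp_le) (use m hp h_nonneg in auto)
      then show ?thesis using m hp by (simp add: a pos_divide_le_eq mult_ac)
    qed
    moreover have "a \<bullet> \<xi> = h \<xi>"
      unfolding a using h_sq[of \<xi>] m hp by (simp add: power2_eq_square divide_eq_eq mult_ac)
    ultimately show ?thesis by (auto simp: E_def)
  qed
  have supp: "support_fun E = h"
  proof
    fix \<xi>
    obtain a where "a \<in> E" "a \<bullet> \<xi> = h \<xi>" using attained by blast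
    then show "support_fun E \<xi> = h \<xi>"
      unfolding support_fun_def by (intro cSup_eq_maximum) (auto simp: E_def image_iff intro: bexI[of _ a])
  qed
  have "B = E" if B: "B \<noteq> {}" "compact B" "convex B" "support_fun B = h" for B
  proof
    have bdd: "bdd_above ((\<lambda>a. a \<bullet> \<xi>) ` B)" for \<xi>
      using B by (intro compact_imp_bounded[THEN bounded_imp_bdd_above] compact_continuous_image
        continuous_intros)
    show "B \<subseteq> E"
    proof
      fix a assume "a \<in> B"
      then have "a \<bullet> \<xi> \<le> support_fun B \<xi>" for \<xi>
        unfolding support_fun_def by (intro cSUP_upper bdd)
      then show "a \<in> E" by (simp add: B E_def)
    qed
    show "E \<subseteq> B"
    proof
      fix a assume a: "a \<in> E"
      show "a \<in> B"
      proof (rule ccontr)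
        assume "a \<notin> B"
        then obtain \<xi> b where *: "\<xi> \<bullet> a < b" "\<forall>x\<in>B. b < \<xi> \<bullet> x"
          using separating_hyperplane_closed_point[of B a] B compact_imp_closed by blast
        have "support_fun B (- \<xi>) \<le> - b"
          unfolding support_fun_def using * B
          by (intro cSUP_least) (auto simp: inner_commute less_imp_le)
        then show False
          using a * B by (auto simp: E_def inner_commute dest: spec[of _ "- \<xi>"])
      qed
    qed
  qed
  then show ?thesis
    using 0 comp conv supp unfolding h_def by (intro ex1I[of _ E]) auto
qed

definition minkowski_sum :: "'i set \<Rightarrow> ('i \<Rightarrow> 'a::real_vector set) \<Rightarrow> 'a set" where
  "minkowski_sum J A = {\<Sum>j\<in>J. a j | a. \<forall>j\<in>J. a j \<in> A j}"

text \<open>The polarization of the volume, divided by \<open>n!\<close>.\<close>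

definition mixed_volume :: "('n :: finite \<Rightarrow> (real ^ 'n) set) \<Rightarrow> real" where
  "mixed_volume A = (\<Sum>J\<in>Pow UNIV. (- 1) ^ (CARD('n) - card J) * measure lebesgue (minkowski_sum J A))
     / fact CARD('n)"

lemma minkowski_sum_const:
  fixes A :: "'a::real_vector set"
  assumes "finite J" "J \<noteq> {}" "convex A"
  shows "minkowski_sum J (\<lambda>_. A) = (*\<^sub>R) (real (card J)) ` A"
proof
  have k: "real (card J) > 0" using assms by (simp add: card_gt_0_iff)
  show "minkowski_sum J (\<lambda>_. A) \<subseteq> (*\<^sub>R) (real (card J)) ` A"
  proof
    fix x assume "x \<in> minkowski_sum J (\<lambda>_. A)"
    then obtain a where a: "x = (\<Sum>j\<in>J. a j)" "\<forall>j\<in>J. a j \<in> A"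
      by (auto simp: minkowski_sum_def)
    have "(\<Sum>j\<in>J. (1 / real (card J)) *\<^sub>R a j) \<in> A"
      using assms a k by (intro convex_sum) auto
    moreover have "x = real (card J) *\<^sub>R (\<Sum>j\<in>J. (1 / real (card J)) *\<^sub>R a j)"
      using k a by (simp add: scaleR_sum_right)
    ultimately show "x \<in> (*\<^sub>R) (real (card J)) ` A" by blast
  qed
  show "(*\<^sub>R) (real (card J)) ` A \<subseteq> minkowski_sum J (\<lambda>_. A)"
  proof
    fix x assume "x \<in> (*\<^sub>R) (real (card J)) ` A"
    then obtain a where "a \<in> A" "x = real (card J) *\<^sub>R a" by blast
    then show "x \<in> minkowski_sum J (\<lambda>_. A)"
      unfolding minkowski_sum_def by (auto simp: sum_constant_scaleR intro!: exI[of _ "\<lambda>_. a"])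
  qed
qed

lemma alternating_sum_card_power:
  "(\<Sum>J\<in>Pow (UNIV :: 'n :: finite set). (- 1) ^ (CARD('n) - card J) * real (card J) ^ CARD('n))
    = fact CARD('n)"
proof -
  let ?n = "CARD('n)"
  let ?F = "UNIV :: ('n \<Rightarrow> 'n) set"
  have card_pow: "real (card J) ^ ?n = (\<Sum>f\<in>?F. if range f \<subseteq> J then 1 else 0)" for J :: "'n set"
  proof -
    have "real (card J) ^ ?n = (\<Prod>k\<in>(UNIV::'n set). \<Sum>y\<in>(UNIV::'n set). if y \<in> J then 1 else 0)"
      by (simp add: sum.If_cases)
    also have "\<dots> = (\<Sum>f\<in>?F. \<Prod>k\<in>UNIV. if f k \<in> J then 1 else 0)"
      by (subst prod_sum_PiE) (auto simp: PiE_UNIV_domain)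
    also have "\<dots> = (\<Sum>f\<in>?F. if range f \<subseteq> J then 1 else 0)"
      by (intro sum.cong refl) (auto simp: image_subset_iff)
    finally show ?thesis .
  qed
  have alt: "(\<Sum>J\<in>Pow (UNIV::'n set). (- 1) ^ (?n - card J) * (if R \<subseteq> J then 1 else 0))
      = (if R = UNIV then 1 else (0::real))" for R :: "'n set"
  proof -
    have "(\<Sum>J\<in>Pow (UNIV::'n set). (- 1) ^ (?n - card J) * (if R \<subseteq> J then 1 else 0))
        = (\<Sum>J | J \<subseteq> UNIV \<and> R \<subseteq> J. (- 1::real) ^ (?n - card J))"
      by (intro sum.mono_neutral_cong_right) auto
    also have "\<dots> = (\<Sum>J | J \<subseteq> UNIV \<and> R \<subseteq> J. (- 1) ^ ?n * (- 1) ^ card J)"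
    proof (intro sum.cong refl)
      fix J :: "'n set"
      have "card J \<le> ?n" by (simp add: card_mono)
      then show "(- 1::real) ^ (?n - card J) = (- 1) ^ ?n * (- 1) ^ card J"
        by (auto simp: minus_one_power_iff)
    qed
    also have "\<dots> = (- 1) ^ ?n * (\<Sum>J | J \<subseteq> UNIV \<and> R \<subseteq> J. (- 1) ^ card J)"
      by (simp add: sum_distrib_left)
    also have "\<dots> = (if R = UNIV then 1 else 0)"
    proof (cases "R = UNIV")
      case True
      then have "{J. J \<subseteq> UNIV \<and> R \<subseteq> J} = {UNIV}" by auto
      then show ?thesis using True by (simp flip: power_add)
    next
      case False
      have "(\<Sum>J\<in>{J. J \<subseteq> UNIV \<and> R \<subseteq> J}. (- 1) ^ card J) = (0::real)"
        using card_subsupersets_even_odd[of "UNIV :: 'n set" R] False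
        by (intro sum_alternating_cancels) auto
      then show ?thesis using False by simp
    qed
    finally show ?thesis .
  qed
  have "(\<Sum>J\<in>Pow (UNIV::'n set). (- 1) ^ (?n - card J) * real (card J) ^ ?n)
      = (\<Sum>f\<in>?F. \<Sum>J\<in>Pow UNIV. (- 1) ^ (?n - card J) * (if range f \<subseteq> J then 1 else 0))"
    unfolding card_pow sum_distrib_left by (rule sum.swap)
  also have "\<dots> = (\<Sum>f\<in>?F. if range f = UNIV then 1 else 0)"
    unfolding alt ..
  also have "\<dots> = real (card {f :: 'n \<Rightarrow> 'n. surj f})"
    by (simp add: sum.If_cases)
  also have "{f :: 'n \<Rightarrow> 'n. surj f} = {p. p permutes UNIV}"
    by (auto simp: permutes_univ finite_UNIV_surj_inj bij_iff[symmetric] bij_def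
        dest: finite_UNIV_surj_inj[OF finite])
  finally show ?thesis by (simp add: card_permutations)
qed

lemma mixed_volume_diag:
  fixes A :: "(real ^ 'n) set"
  assumes "convex A"
  shows "mixed_volume (\<lambda>_. A) = measure lebesgue A"
proof -
  have "measure lebesgue (minkowski_sum J (\<lambda>_. A)) = real (card J) ^ CARD('n) * measure lebesgue A"
    for J :: "'n set"
  proof (cases "J = {}")
    case True
    then show ?thesis by (simp add: minkowski_sum_def)
  next
    case False
    then show ?thesis
      using assms measure_lebesgue_affine[of "real (card J)" 0 A]
      by (simp add: minkowski_sum_const)
  qed
  then have "mixed_volume (\<lambda>_. A) = (\<Sum>J\<in>Pow (UNIV :: 'n set).
      (- 1) ^ (CARD('n) - card J) * real (card J) ^ CARD('n)) * measure lebesgue A / fact CARD('n)"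
    by (simp add: mixed_volume_def sum_distrib_right mult.assoc)
  then show ?thesis unfolding alternating_sum_card_power by simp
qed

end

theory Submission
  imports Defs
begin

text \<open>Both sides are \<open>(2 \<pi>)\<^bsup>n/2\<^esup> E \<bar>det Y\<bar>\<close>, where the rows \<open>Y\<^sub>i\<close> are independent centred
  Gaussian vectors with covariance \<open>Q\<^sub>i = 1/m\<^sub>i \<Sum>\<mu>\<in>\<Lambda>\<^sub>i. \<mu> \<mu>\<^sup>T\<close>, \<open>m\<^sub>i = card \<Lambda>\<^sub>i\<close>.

  For the mixed volume let \<open>h\<^sub>j = sqrt (x \<bullet> (Q\<^sub>j *v x))\<close> be the support function of the \<open>j\<close>-th ellipsoid.
  The gradient of \<open>\<Sum>j\<in>J. sqrt (1 + h\<^sub>j\<^sup>2)\<close> maps the space injectively onto a set that fills the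
  Minkowski sum over \<open>J\<close> up to its boundary, so the volume of the sum is the integral of the determinant
  of a sum of Hessians. Polarization leaves the mixed discriminant of the Hessians, and each Hessian is a
  Gaussian expectation \<open>E (exp (- (Y\<^sub>j \<bullet> x)\<^sup>2 / 2) Y\<^sub>j Y\<^sub>j\<^sup>T)\<close>. The mixed discriminant therefore becomes
  \<open>E (exp (- \<bar>Y x\<bar>\<^sup>2 / 2) (det Y)\<^sup>2)\<close>, and the integral over \<open>x\<close> cancels one factor \<open>\<bar>det Y\<bar>\<close>.

  For the zeros, a uniform point of the sphere is a normalized Gaussian combination of an orthonormal basis.
  Take the basis whose first member is the normalized reproducing kernel at the identity \<open>1\<close> of the torus;
  the other members vanish at \<open>1\<close>. Near \<open>1\<close> the zeros are then the solutions of \<open>G\<^sub>r \<theta> = y\<close>, with \<open>y\<close> the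
  first coefficients and \<open>G\<^sub>r\<close> determined by the remaining ones, and the area formula gives their expected
  number. The torus is cut into \<open>M\<^sup>n\<close> translates of a small box, which contribute equally by invariance,
  and \<open>M\<close> tends to infinity.\<close>

section \<open>Change of variables for unordered index types\<close>

text \<open>The support functions \<open>h\<close> cannot be used directly: they are homogeneous of
  degree one, so their gradients are constant along rays and their Hessians are singular. The
  summand 1 under the root repairs this, and it is matched to the Gaussian: if \<open>Z\<close> is a
  centred normal variable with variance \<open>s\<close>, then exp (- Z^2 / 2) has expectation 1 /
  sqrt (1 + s). Two facts on the kernel at the identity tie the halves together. As
  \<open>\<Lambda>\<close> is symmetric, the kernel is orthogonal to the functions representing the
  partial derivatives at the identity, so the gradient there involves only the remaining basis
  members; and by Parseval their gradients have the Gram matrix \<open>m Q\<close>. Division by sqrt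
  m, the value of the first member at the identity, produces the covariance \<open>Q\<close>. The
  constant is (2 pi)^n, the volume of the box of angles, times the normal density (2 pi)^(- n / 2)
  at 0. Two obstacles come from the statement: the sphere carries a measure given by a definite
  description, so existence and uniqueness of an invariant measure have to be proved; and only
  isolated zeros are counted, so degenerate zeros must be shown to be almost surely absent.\<close>

text \<open>The change of variables theorem of the library is stated for well-ordered index types only.\<close>

typedef (overloaded) ('a::finite) ix = "{..<CARD('a)} :: nat set"
  by (rule exI[of _ 0]) auto

instantiation ix :: (finite) "{finite, wellorder}"
begin
definition less_eq_ix :: "'a ix \<Rightarrow> 'a ix \<Rightarrow> bool" where "less_eq_ix x y \<longleftrightarrow> Rep_ix x \<le> Rep_ix y"
definition less_ix :: "'a ix \<Rightarrow> 'a ix \<Rightarrow> bool" where "less_ix x y \<longleftrightarrow> Rep_ix x < Rep_ix y"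
instance
proof
  show "finite (UNIV :: 'a ix set)"
    by (rule finite_imageD[of Rep_ix])
      (auto simp: inj_on_def Rep_ix_inject intro: finite_subset[OF _ finite_lessThan[of "CARD('a)"]] Rep_ix[simplified])
  show "P a" if "\<And>x::'a ix. (\<And>y. y < x \<Longrightarrow> P y) \<Longrightarrow> P x" for P :: "'a ix \<Rightarrow> bool" and a
    using that unfolding less_ix_def by (rule measure_induct_rule[of Rep_ix])
qed (auto simp: less_eq_ix_def less_ix_def Rep_ix_inject)
end

section \<open>Determinants and Lebesgue measure under a renaming of coordinates\<close>

lemma bij_ix_exists: "\<exists>f :: 'a::finite ix \<Rightarrow> 'a. bij f"
proof -
  have "card (UNIV :: 'a ix set) = CARD('a)"
    using type_definition.card[OF type_definition_ix[where 'a='a]] by simp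
  then show ?thesis
    using finite_same_card_bij[of "UNIV :: 'a ix set" "UNIV :: 'a set"] by auto
qed

text \<open>Conjugation by \<open>f\<close> turns the transposition of \<open>a\<close> and
  \<open>b\<close> into that of \<open>f a\<close> and \<open>f b\<close>, so a product of
  \<open>n\<close> transpositions stays one and the parity is kept. The permutation and its
  conjugate live on different types.\<close>

lemma sign_conj_bij:
  fixes f :: "'b::finite \<Rightarrow> 'a::finite"
  assumes f: "bij f" and p: "p permutes (UNIV :: 'b set)"
  shows "sign (f \<circ> p \<circ> inv f) = sign p"
proof -
  have "permutation p" using permutes_imp_permutation[OF finite p] .
  then obtain n where n: "swapidseq n p" by (auto simp: permutation_def)
  have "swapidseq n (f \<circ> p \<circ> inv f)"
    using n
  proof (induction rule: swapidseq.induct)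
    case id
    have "f \<circ> id \<circ> inv f = id" by (simp add: fun_eq_iff surj_f_inv_f[OF bij_is_surj[OF f]])
    then show ?case by (simp only: swapidseq.id)
  next
    case (comp_Suc n p a b)
    have "f \<circ> (Transposition.transpose a b \<circ> p) \<circ> inv f = Transposition.transpose (f a) (f b) \<circ> (f \<circ> p \<circ> inv f)"
      using f by (auto simp: fun_eq_iff Transposition.transpose_def bij_def inj_eq)
    moreover have "f a \<noteq> f b" using comp_Suc f by (simp add: bij_def inj_eq)
    ultimately show ?case using comp_Suc swapidseq.comp_Suc by metis
  qed
  then have "evenperm (f \<circ> p \<circ> inv f) = even n" "evenperm p = even n"
    using evenperm_unique[OF _ refl] n by blast+
  then show ?thesis
    by (simp only: sign_def)
qed

text \<open>Rows and columns are renamed together, so the Leibniz sum is reindexed from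
  \<open>p\<close> to \<open>f \<circ> p \<circ> inv f\<close>, and conjugation does not change the
  sign.\<close>

lemma det_reindex:
  fixes f :: "'b::finite \<Rightarrow> 'a::finite" and A :: "'c::comm_ring_1 ^ 'a ^ 'a"
  assumes f: "bij f"
  shows "det (\<chi> i j. A $ f i $ f j) = det A"
proof -
  have [simp]: "f (inv f x) = x" "inv f (f y) = y" for x y
    using f by (simp_all add: bij_is_surj surj_f_inv_f bij_is_inj)
  have pp: "f \<circ> p \<circ> inv f permutes UNIV" if "p permutes UNIV" for p
    using bij_comp[OF bij_comp[OF bij_imp_bij_inv[OF f] permutes_bij[OF that]] f]
    by (intro bij_imp_permutes) (simp_all add: o_assoc)
  have pp': "inv f \<circ> q \<circ> f permutes UNIV" if "q permutes UNIV" for q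
    using bij_comp[OF bij_comp[OF f permutes_bij[OF that]] bij_imp_bij_inv[OF f]]
    by (intro bij_imp_permutes) (simp_all add: o_assoc)
  have pr: "(\<Prod>i\<in>UNIV. A $ f i $ f (p i)) = (\<Prod>i\<in>UNIV. A $ i $ (f \<circ> p \<circ> inv f) i)" for p
    using prod.reindex_bij_betw[OF f, of "\<lambda>i. A $ i $ (f \<circ> p \<circ> inv f) i"] by simp
  show ?thesis
    unfolding det_def
    by (rule sum.reindex_bij_witness[of _ "\<lambda>q. inv f \<circ> q \<circ> f" "\<lambda>p. f \<circ> p \<circ> inv f"])
      (auto simp: pp pp' pr[simplified] sign_conj_bij[OF f] fun_eq_iff)
qed

definition perm_vec :: "('b \<Rightarrow> 'a) \<Rightarrow> real ^ 'a \<Rightarrow> real ^ 'b" where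
  "perm_vec f x = (\<chi> k. x $ f k)"

lemma linear_perm_vec: "linear (perm_vec f)"
  by (rule linearI) (auto simp: perm_vec_def vec_eq_iff)

lemma perm_vec_inverse:
  assumes "bij f"
  shows "perm_vec f (perm_vec (inv f) y) = y" "perm_vec (inv f) (perm_vec f x) = x"
  using assms by (simp_all add: perm_vec_def vec_eq_iff bij_is_inj bij_is_surj surj_f_inv_f)

lemma prod_Basis_cart:
  fixes \<phi> :: "real \<Rightarrow> 'b::comm_monoid_mult" and z :: "real ^ 'c::finite"
  shows "(\<Prod>b\<in>Basis. \<phi> (z \<bullet> b)) = (\<Prod>k\<in>UNIV. \<phi> (z $ k))"
proof -
  have "Basis = (\<lambda>k. axis k (1::real)) ` (UNIV :: 'c set)" by (auto simp: Basis_vec_def)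
  moreover have "inj (\<lambda>k::'c. axis k (1::real))" by (auto simp: inj_on_def axis_eq_axis)
  ultimately have "(\<Prod>b\<in>Basis. \<phi> (z \<bullet> b)) = (\<Prod>k\<in>UNIV. \<phi> (z \<bullet> axis k 1))"
    using prod.reindex[of "\<lambda>k. axis k 1" UNIV "\<lambda>b. \<phi> (z \<bullet> b)"] by (simp add: o_def)
  then show ?thesis by (simp add: inner_axis)
qed

text \<open>Lebesgue measure is determined by its values on boxes; the preimage of a box is a box
  with the same side lengths in another order.\<close>

lemma distr_lborel_perm_vec:
  fixes f :: "'b::finite \<Rightarrow> 'a::finite"
  assumes f: "bij f"
  shows "distr lborel borel (perm_vec f) = lborel"
proof (rule lborel_eqI[symmetric])
  have [measurable]: "perm_vec f \<in> borel_measurable borel"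
    by (intro borel_measurable_continuous_onI linear_continuous_on linear_perm_vec[unfolded linear_conv_bounded_linear])
  fix l u :: "real ^ 'b"
  assume le: "\<And>b. b \<in> Basis \<Longrightarrow> l \<bullet> b \<le> u \<bullet> b"
  then have le': "l $ k \<le> u $ k" for k
    by (metis axis_in_Basis_iff inner_axis mult.right_neutral inner_real_def Basis_real_def singletonI)
  have le2: "perm_vec (inv f) l \<bullet> b \<le> perm_vec (inv f) u \<bullet> b" if "b \<in> Basis" for b
    using that le' by (auto simp: Basis_vec_def perm_vec_def inner_axis)
  have vim: "perm_vec f -` box l u \<inter> space lborel = box (perm_vec (inv f) l) (perm_vec (inv f) u)"
    using f by (auto simp: mem_box_cart perm_vec_def bij_is_inj bij_is_surj surj_f_inv_f)
      (metis bij_is_surj surj_f_inv_f bij_is_inj inv_f_f)+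
  have "(\<Prod>b\<in>Basis. (perm_vec (inv f) u - perm_vec (inv f) l) \<bullet> b) = (\<Prod>k\<in>UNIV. (u - l) $ inv f k)"
    unfolding prod_Basis_cart[of "\<lambda>x. x"] by (simp add: perm_vec_def)
  also have "\<dots> = (\<Prod>k\<in>UNIV. (u - l) $ k)"
    using prod.reindex_bij_betw[OF bij_imp_bij_inv[OF f], of "\<lambda>k. (u - l) $ k"] .
  finally have pr: "(\<Prod>b\<in>Basis. (perm_vec (inv f) u - perm_vec (inv f) l) \<bullet> b) = (\<Prod>b\<in>Basis. (u - l) \<bullet> b)"
    unfolding prod_Basis_cart[of "\<lambda>x. x"] by simp
  show "emeasure (distr lborel borel (perm_vec f)) (box l u) = (\<Prod>b\<in>Basis. (u - l) \<bullet> b)"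
    using emeasure_lborel_box[OF le2] pr vim by (simp add: emeasure_distr)
qed simp

text \<open>The domain is a countable union of compact sets, so its image under the continuous
  \<open>g\<close> is of the same kind and hence Borel; this allows an integral over the
  image.\<close>

lemma nn_integral_change_of_variables_wellorder:
  fixes g :: "real ^ 'm::{finite,wellorder} \<Rightarrow> real ^ 'm::_" and f :: "real ^ 'm::_ \<Rightarrow> real"
  assumes cpt: "\<And>n::nat. compact (F n)" and S: "S = (\<Union>n. F n)"
    and der: "\<And>x. x \<in> S \<Longrightarrow> (g has_derivative (\<lambda>h. J x *v h)) (at x within S)"
    and inj: "inj_on g S"
    and f: "integrable lborel f" "\<And>x. f x \<ge> 0"
  shows "(\<integral>\<^sup>+ y\<in>g ` S. ennreal (f y) \<partial>lborel) = (\<integral>\<^sup>+ x\<in>S. ennreal (\<bar>det (J x)\<bar> * f (g x)) \<partial>lborel)"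
    and "g ` S \<in> sets borel"
proof -
  have cont: "continuous_on S g"
    using der by (auto simp: continuous_on_eq_continuous_within intro: has_derivative_continuous)
  have "compact (g ` F n)" for n
    using cpt cont S by (intro compact_continuous_image continuous_on_subset[OF cont]) auto
  then have "g ` S = (\<Union>n. g ` F n)" "\<And>n. g ` F n \<in> sets borel"
    using S by (auto intro: borel_closed compact_imp_closed)
  then show gS: "g ` S \<in> sets borel" by (metis sets.countable_UN UNIV_I image_subsetI)
  have SB: "S \<in> sets borel"
    unfolding S by (rule sets.countable_UN) (use cpt in \<open>auto intro: borel_closed compact_imp_closed\<close>)
  have "f absolutely_integrable_on UNIV"
    using f(1) by (simp add: set_integrable_def integrable_completion borel_measurable_integrable)
  then have "f absolutely_integrable_on (g ` S)"
    by (rule set_integrable_subset) (use gS in auto)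
  \<comment> \<open>The change of variables theorem speaks of vector-valued functions, so
    \<open>f\<close> enters as a function into \<open>real ^ 1\<close>.\<close>
  then have 1: "(\<lambda>x. vec (f x) :: real ^ 1) absolutely_integrable_on (g ` S)"
    by (subst absolutely_integrable_on_1_iff) simp
  have fi: "f absolutely_integrable_on (g ` S)" by fact
  have mat: "matrix (\<lambda>h. J x *v h) = J x" for x by simp
  have "(\<lambda>x. \<bar>det (matrix (\<lambda>h. J x *v h))\<bar> *\<^sub>R (vec (f (g x)) :: real^1)) absolutely_integrable_on S \<and>
      integral S (\<lambda>x. \<bar>det (matrix (\<lambda>h. J x *v h))\<bar> *\<^sub>R (vec (f (g x)) :: real^1)) = integral (g ` S) (\<lambda>x. vec (f x))"
    using has_absolute_integral_change_of_variables[of S g "\<lambda>x h. J x *v h" "\<lambda>x. vec (f x) :: real^1" "integral (g ` S) (\<lambda>x. vec (f x))"]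
      SB der inj 1 by auto
  then have 2: "(\<lambda>x. \<bar>det (J x)\<bar> * f (g x)) absolutely_integrable_on S"
      and 3: "integral S (\<lambda>x. \<bar>det (J x)\<bar> * f (g x)) = integral (g ` S) f"
    by (auto simp: mat absolutely_integrable_on_1_iff integral_on_1_eq)
  have nn: "(\<integral>\<^sup>+ x\<in>T. ennreal (h x) \<partial>lborel) = ennreal (integral T h)"
    if "h absolutely_integrable_on T" "\<And>x. h x \<ge> 0" for T and h :: "real ^ 'm::_ \<Rightarrow> real"
  proof -
    have "(\<integral>\<^sup>+ x\<in>T. ennreal (h x) \<partial>lborel) = (\<integral>\<^sup>+ x. ennreal (indicator T x *\<^sub>R h x) \<partial>lebesgue)"
      by (subst nn_integral_completion[symmetric]) (auto intro!: nn_integral_cong simp: indicator_def)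
    also have "\<dots> = ennreal (LINT x:T|lebesgue. h x)"
      unfolding set_lebesgue_integral_def using that
      by (intro nn_integral_eq_integral) (auto simp: set_integrable_def indicator_def)
    also have "(LINT x:T|lebesgue. h x) = integral T h"
      using that by (intro set_lebesgue_integral_eq_integral)
    finally show ?thesis .
  qed
  show "(\<integral>\<^sup>+ y\<in>g ` S. ennreal (f y) \<partial>lborel) = (\<integral>\<^sup>+ x\<in>S. ennreal (\<bar>det (J x)\<bar> * f (g x)) \<partial>lborel)"
    using nn[OF fi f(2)] nn[OF 2] f(2) 3 by simp
qed

text \<open>\<open>g\<close> is conjugated with the coordinate permutation \<open>a\<close>, whose
  inverse is \<open>b\<close>. The Jacobian matrix of the conjugate is the old one with rows and
  columns renamed, so the determinant is unchanged, and \<open>a\<close> and \<open>b\<close>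
  preserve Lebesgue measure.\<close>

lemma nn_integral_change_of_variables:
  fixes g :: "real ^ 'n::finite \<Rightarrow> real ^ 'n" and f :: "real ^ 'n \<Rightarrow> real"
  assumes cpt: "\<And>n::nat. compact (F n)" and S: "S = (\<Union>n. F n)"
    and der: "\<And>x. x \<in> S \<Longrightarrow> (g has_derivative (\<lambda>h. J x *v h)) (at x within S)"
    and inj: "inj_on g S"
    and f: "integrable lborel f" "\<And>x. f x \<ge> 0"
  shows "(\<integral>\<^sup>+ y\<in>g ` S. ennreal (f y) \<partial>lborel) = (\<integral>\<^sup>+ x\<in>S. ennreal (\<bar>det (J x)\<bar> * f (g x)) \<partial>lborel)"
    and "g ` S \<in> sets borel"
proof -
  obtain p :: "'n ix \<Rightarrow> 'n" where p: "bij p" using bij_ix_exists by blast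
  define a where "a = perm_vec p"
  define b where "b = perm_vec (inv p)"
  have ab[simp]: "a (b y) = y" "b (a x) = x" for x y
    using perm_vec_inverse[OF p] by (auto simp: a_def b_def)
  have bl: "bounded_linear a" "bounded_linear b"
    unfolding a_def b_def by (simp_all add: linear_perm_vec linear_linear)
  have cont_ab: "continuous_on X a" "continuous_on Y b" for X Y
    using bl by (simp_all add: linear_continuous_on)
  have meas[measurable]: "a \<in> borel_measurable borel" "b \<in> borel_measurable borel"
    by (intro borel_measurable_continuous_onI cont_ab)+
  have da: "lborel = distr lborel borel a" and db: "lborel = distr lborel borel b"
    unfolding a_def b_def using distr_lborel_perm_vec[OF p] distr_lborel_perm_vec[OF bij_imp_bij_inv[OF p]] by simp_all
  have bimg: "b ` X = a -` X" for X by (force simp: image_iff)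
  have aimg: "a ` X = b -` X" for X by (force simp: image_iff)
  define g' where "g' = a \<circ> g \<circ> b"
  define J' where "J' y = (\<chi> i j. J (b y) $ p i $ p j)" for y
  have J'v: "J' y *v h = a (J (b y) *v b h)" for y h
  proof -
    have "(\<Sum>j\<in>UNIV. J (b y) $ p i $ p j * h $ j) = (\<Sum>j\<in>UNIV. J (b y) $ p i $ j * h $ inv p j)" for i
      using sum.reindex_bij_betw[OF p, of "\<lambda>j. J (b y) $ p i $ j * h $ inv p j"] p
      by (simp add: bij_is_inj)
    then show ?thesis
      by (simp add: J'_def matrix_vector_mult_def a_def b_def perm_vec_def vec_eq_iff)
  qed
  have detJ': "det (J' y) = det (J (b y))" for y
    unfolding J'_def by (rule det_reindex[OF p])
  have der': "(g' has_derivative (\<lambda>h. J' y *v h)) (at y within a ` S)" if "y \<in> a ` S" for y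
  proof -
    have bS: "b y \<in> S" using that by auto
    have "b ` a ` S = S" by (force simp: image_iff)
    then have "((g \<circ> b) has_derivative (\<lambda>h. J (b y) *v h) \<circ> b) (at y within a ` S)"
      using der[OF bS] bl(2)
      by (intro diff_chain_within) (auto intro: bounded_linear_imp_has_derivative)
    then have "((\<lambda>x. a ((g \<circ> b) x)) has_derivative (\<lambda>h. a (((\<lambda>h. J (b y) *v h) \<circ> b) h))) (at y within a ` S)"
      by (rule bounded_linear.has_derivative[OF bl(1)])
    then show ?thesis by (simp add: g'_def o_def J'v)
  qed
  have inj': "inj_on g' (a ` S)"
    using inj unfolding g'_def inj_on_def by (metis ab comp_apply imageE)
  have cpt': "compact (a ` F n)" for n by (intro compact_continuous_image cont_ab cpt)
  have f': "integrable lborel (\<lambda>y. f (b y))"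
  proof -
    have "integrable (distr lborel borel b) f" using f(1) db by simp
    then show ?thesis using f(1) by (subst (asm) integrable_distr_eq) auto
  qed
  note W = nn_integral_change_of_variables_wellorder[of "\<lambda>n. a ` F n" "a ` S" g' J' "\<lambda>y. f (b y)"]
  have SU: "a ` S = (\<Union>n. a ` F n)" using S by auto
  have w1: "(\<integral>\<^sup>+ y\<in>g' ` a ` S. ennreal (f (b y)) \<partial>lborel) = (\<integral>\<^sup>+ x\<in>a ` S. ennreal (\<bar>det (J' x)\<bar> * f (b (g' x))) \<partial>lborel)"
    and w2: "g' ` a ` S \<in> sets borel"
    using W[OF cpt' SU der' inj' f'] f(2) by auto
  have img: "g' ` a ` S = b -` (g ` S)" 
  proof -
    have "g' ` a ` S = a ` g ` S" by (simp add: g'_def image_comp o_def)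
    then show ?thesis by (simp only: aimg)
  qed
  have "a -` (g' ` a ` S) = g ` S" by (auto simp: img)
  moreover have "a -` (g' ` a ` S) \<in> sets borel"
    using measurable_sets[OF meas(1) w2] by simp
  ultimately show gS: "g ` S \<in> sets borel" by simp
  have SB: "S \<in> sets borel"
    unfolding S by (rule sets.countable_UN) (use cpt in \<open>auto intro: borel_closed compact_imp_closed\<close>)
  have "(\<integral>\<^sup>+ y\<in>g ` S. ennreal (f y) \<partial>lborel) = (\<integral>\<^sup>+ y\<in>g' ` a ` S. ennreal (f (b y)) \<partial>lborel)"
  proof -
    have "(\<integral>\<^sup>+ y\<in>g ` S. ennreal (f y) \<partial>lborel) = (\<integral>\<^sup>+ y. ennreal (f y) * indicator (g ` S) y \<partial>distr lborel borel b)"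
      using db by simp
    also have "\<dots> = (\<integral>\<^sup>+ y. ennreal (f (b y)) * indicator (g ` S) (b y) \<partial>lborel)"
      using gS f(1) by (intro nn_integral_distr) (auto simp: borel_measurable_integrable)
    also have "\<dots> = (\<integral>\<^sup>+ y\<in>g' ` a ` S. ennreal (f (b y)) \<partial>lborel)"
      by (intro nn_integral_cong) (auto simp: img indicator_def)
    finally show ?thesis .
  qed
  also note w1
  also have "(\<integral>\<^sup>+ x\<in>a ` S. ennreal (\<bar>det (J' x)\<bar> * f (b (g' x))) \<partial>lborel)
      = (\<integral>\<^sup>+ x. ennreal (\<bar>det (J (b x))\<bar> * f (g (b x))) * indicator S (b x) \<partial>lborel)"
    by (intro nn_integral_cong) (auto simp: detJ' g'_def indicator_def aimg)
  also have "\<dots> = (\<integral>\<^sup>+ x\<in>S. ennreal (\<bar>det (J x)\<bar> * f (g x)) \<partial>lborel)"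
    (is "(\<integral>\<^sup>+ x. ?h (b x) \<partial>lborel) = (\<integral>\<^sup>+ x. ?h x \<partial>lborel)")
  proof -
    \<comment> \<open>Nothing is known about the measurability of \<open>J\<close>, so the
      substitution rule for measurable integrands does not apply. The nonnegative integral is a
      supremum over simple functions below the integrand, and each of these can be transported;
      applied to \<open>a\<close> and to \<open>b\<close> this gives both inequalities.\<close>
    have le: "(\<integral>\<^sup>+ x. h (q x) \<partial>lborel) \<le> (\<integral>\<^sup>+ x. h x \<partial>lborel)"
      if d: "lborel = distr lborel borel q" and qm: "q \<in> borel_measurable borel"
        and q: "\<And>x. r (q x) = x" "\<And>x. q (r x) = x" and rm: "r \<in> borel_measurable borel"
      for h :: "real ^ 'c::finite \<Rightarrow> ennreal" and q :: "real ^ 'd::finite \<Rightarrow> real ^ 'c" and r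
    proof -
      note [measurable] = qm rm
      have "(\<integral>\<^sup>+ x. h (q x) \<partial>lborel) = (SUP s\<in>{s. simple_function lborel s \<and> s \<le> (\<lambda>x. h (q x))}. integral\<^sup>S lborel s)"
        by (simp add: nn_integral_def)
      also have "\<dots> \<le> (\<integral>\<^sup>+ x. h x \<partial>lborel)"
      proof (rule SUP_least)
        fix s assume s: "s \<in> {s. simple_function lborel s \<and> s \<le> (\<lambda>x. h (q x))}"
        then have [measurable]: "s \<in> borel_measurable borel"
          using borel_measurable_simple_function[of lborel s] by simp
        have "integral\<^sup>S lborel s = (\<integral>\<^sup>+ x. s x \<partial>lborel)"
          using s by (simp add: nn_integral_eq_simple_integral)
        also have "\<dots> = (\<integral>\<^sup>+ x. s (r (q x)) \<partial>lborel)" by (simp add: q)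
        also have "\<dots> = (\<integral>\<^sup>+ y. s (r y) \<partial>distr lborel borel q)"
          by (subst nn_integral_distr) auto
        also have "\<dots> = (\<integral>\<^sup>+ y. s (r y) \<partial>lborel)" using d by simp
        also have "\<dots> \<le> (\<integral>\<^sup>+ x. h x \<partial>lborel)"
        proof (intro nn_integral_mono)
          fix x show "s (r x) \<le> h x"
            using s q(2)[of x] by (auto simp: le_fun_def dest: spec[of _ "r x"])
        qed
        finally show "integral\<^sup>S lborel s \<le> (\<integral>\<^sup>+ x. h x \<partial>lborel)" .
      qed
      finally show ?thesis .
    qed
    show ?thesis
      using le[OF db meas(2) ab(1,2) meas(1), of ?h] le[OF da meas(1) ab(2,1) meas(2), of "\<lambda>x. ?h (b x)"]
      by (intro antisym) simp_all
  qed
  finally show "(\<integral>\<^sup>+ y\<in>g ` S. ennreal (f y) \<partial>lborel) = (\<integral>\<^sup>+ x\<in>S. ennreal (\<bar>det (J x)\<bar> * f (g x)) \<partial>lborel)" .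
qed

text \<open>Sard's theorem in equal dimensions, reduced to the well-ordered index type by the same
  conjugation; a vanishing determinant means a rank below the dimension.\<close>

lemma negligible_critical_values:
  fixes g :: "real ^ 'n::finite \<Rightarrow> real ^ 'n"
  assumes der: "\<And>x. x \<in> S \<Longrightarrow> (g has_derivative (\<lambda>h. J x *v h)) (at x within S)"
    and det0: "\<And>x. x \<in> S \<Longrightarrow> det (J x) = 0"
  shows "negligible (g ` S)"
proof -
  obtain p :: "'n ix \<Rightarrow> 'n" where p: "bij p" using bij_ix_exists by blast
  define a where "a = perm_vec p"
  define b where "b = perm_vec (inv p)"
  have ab[simp]: "a (b y) = y" "b (a x) = x" for x y
    using perm_vec_inverse[OF p] by (auto simp: a_def b_def)
  have bl: "bounded_linear a" "bounded_linear b"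
    unfolding a_def b_def by (simp_all add: linear_perm_vec linear_linear)
  define g' where "g' = a \<circ> g \<circ> b"
  define J' where "J' y = (\<chi> i j. J (b y) $ p i $ p j)" for y
  have J'v: "J' y *v h = a (J (b y) *v b h)" for y h
  proof -
    have "(\<Sum>j\<in>UNIV. J (b y) $ p i $ p j * h $ j) = (\<Sum>j\<in>UNIV. J (b y) $ p i $ j * h $ inv p j)" for i
      using sum.reindex_bij_betw[OF p, of "\<lambda>j. J (b y) $ p i $ j * h $ inv p j"] p
      by (simp add: bij_is_inj)
    then show ?thesis
      by (simp add: J'_def matrix_vector_mult_def a_def b_def perm_vec_def vec_eq_iff)
  qed
  have detJ': "det (J' y) = det (J (b y))" for y
    unfolding J'_def by (rule det_reindex[OF p])
  have der': "(g' has_derivative (\<lambda>h. J' y *v h)) (at y within a ` S)" if "y \<in> a ` S" for y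
  proof -
    have bS: "b y \<in> S" using that by auto
    have "b ` a ` S = S" by (force simp: image_iff)
    then have "((g \<circ> b) has_derivative (\<lambda>h. J (b y) *v h) \<circ> b) (at y within a ` S)"
      using der[OF bS] bl(2)
      by (intro diff_chain_within) (auto intro: bounded_linear_imp_has_derivative)
    then have "((\<lambda>x. a ((g \<circ> b) x)) has_derivative (\<lambda>h. a (((\<lambda>h. J (b y) *v h) \<circ> b) h))) (at y within a ` S)"
      by (rule bounded_linear.has_derivative[OF bl(1)])
    then show ?thesis by (simp add: g'_def o_def J'v)
  qed
  have "negligible (g' ` a ` S)"
  proof (rule baby_Sard[OF _ der'])
    fix x assume "x \<in> a ` S"
    then have "det (J' x) = 0" using det0 by (auto simp: detJ')
    then show "rank (matrix (\<lambda>h. J' x *v h)) < CARD('n ix)"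
      by (simp add: det_eq_0_rank)
  qed auto
  then have "negligible (b ` g' ` a ` S)"
    by (rule negligible_differentiable_image_negligible[rotated])
      (use bl(2) in \<open>auto simp: bounded_linear_imp_differentiable_on bij_betw_same_card[OF p]\<close>)
  moreover have "b ` g' ` a ` S = g ` S" by (force simp: g'_def image_iff)
  ultimately show ?thesis by simp
qed

section \<open>Mixed volumes of ellipsoids\<close>

lemma alternating_sum_supersets:
  fixes R :: "'n::finite set"
  shows "(\<Sum>J\<in>Pow UNIV. (- 1) ^ (CARD('n) - card J) * (if R \<subseteq> J then 1 else 0))
      = (if R = UNIV then 1 else (0::real))"
proof -
  have "(\<Sum>J\<in>Pow UNIV. (- 1) ^ (CARD('n) - card J) * (if R \<subseteq> J then 1 else 0))
      = (\<Sum>J | J \<subseteq> UNIV \<and> R \<subseteq> J. (- 1::real) ^ (CARD('n) - card J))"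
    by (intro sum.mono_neutral_cong_right) auto
  also have "\<dots> = (\<Sum>J | J \<subseteq> UNIV \<and> R \<subseteq> J. (- 1) ^ CARD('n) * (- 1) ^ card J)"
  proof (intro sum.cong refl)
    fix J :: "'n set"
    have "card J \<le> CARD('n)" by (simp add: card_mono)
    then show "(- 1::real) ^ (CARD('n) - card J) = (- 1) ^ CARD('n) * (- 1) ^ card J"
      by (auto simp: minus_one_power_iff)
  qed
  also have "\<dots> = (- 1) ^ CARD('n) * (\<Sum>J | J \<subseteq> UNIV \<and> R \<subseteq> J. (- 1) ^ card J)"
    by (simp add: sum_distrib_left)
  also have "\<dots> = (if R = UNIV then 1 else 0)"
  proof (cases "R = UNIV")
    case True
    then have "{J. J \<subseteq> UNIV \<and> R \<subseteq> J} = {UNIV}" by auto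
    then show ?thesis using True by (simp flip: power_add)
  next
    case False
    \<comment> \<open>A proper subset has as many supersets of even as of odd size.\<close>
    have "(\<Sum>J\<in>{J. J \<subseteq> UNIV \<and> R \<subseteq> J}. (- 1) ^ card J) = (0::real)"
      using card_subsupersets_even_odd[of "UNIV :: 'n set" R] False
      by (intro sum_alternating_cancels) auto
    then show ?thesis using False by simp
  qed
  finally show ?thesis .
qed

lemma surj_finite_permutes: "{f :: 'n::finite \<Rightarrow> 'n. surj f} = {p. p permutes UNIV}"
  by (auto simp: permutes_univ finite_UNIV_surj_inj bij_iff[symmetric] bij_def
      dest: finite_UNIV_surj_inj[OF finite])

text \<open>Expanding \<open>det (\<Sum>j\<in>J. H j)\<close> chooses a summand \<open>f a\<close>
  for every row \<open>a\<close>, and the choice \<open>f\<close> occurs for \<open>J\<close>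
  exactly if \<open>J\<close> contains its range. The alternating sum over \<open>J\<close>
  therefore keeps only surjective \<open>f\<close>, which are permutations. The right side is
  \<open>n!\<close> times the mixed discriminant of the \<open>H j\<close>.\<close>

lemma det_sum_polarization:
  fixes H :: "'n::finite \<Rightarrow> real ^ 'n ^ 'n"
  shows "(\<Sum>J\<in>Pow UNIV. (- 1) ^ (CARD('n) - card J) * det (\<Sum>j\<in>J. H j)) =
    (\<Sum>\<pi> | \<pi> permutes UNIV. \<Sum>\<tau> | \<tau> permutes UNIV.
      of_int (sign \<pi>) * of_int (sign \<tau>) * (\<Prod>j\<in>UNIV. H j $ \<pi> j $ \<tau> j))"
proof -
  let ?P = "{p. p permutes (UNIV :: 'n set)}"
  let ?F = "UNIV :: ('n \<Rightarrow> 'n) set"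
  define T where "T f \<sigma> = (\<Prod>a\<in>UNIV. H (f a) $ a $ \<sigma> a)" for f \<sigma> :: "'n \<Rightarrow> 'n"
  have prod_eq: "(\<Prod>a\<in>UNIV. (\<Sum>j\<in>J. H j) $ a $ \<sigma> a) = (\<Sum>f\<in>?F. (if range f \<subseteq> J then 1 else 0) * T f \<sigma>)"
    for J and \<sigma> :: "'n \<Rightarrow> 'n"
  proof -
    have "(\<Prod>a\<in>UNIV. (\<Sum>j\<in>J. H j) $ a $ \<sigma> a)
        = (\<Prod>a\<in>(UNIV::'n set). \<Sum>j\<in>(UNIV::'n set). if j \<in> J then H j $ a $ \<sigma> a else 0)"
      by (simp add: sum.If_cases)
    also have "\<dots> = (\<Sum>f\<in>?F. \<Prod>a\<in>UNIV. if f a \<in> J then H (f a) $ a $ \<sigma> a else 0)"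
      by (subst prod_sum_PiE) (auto simp: PiE_UNIV_domain)
    also have "\<dots> = (\<Sum>f\<in>?F. (if range f \<subseteq> J then 1 else 0) * T f \<sigma>)"
    proof (intro sum.cong refl)
      fix f :: "'n \<Rightarrow> 'n"
      show "(\<Prod>a\<in>UNIV. if f a \<in> J then H (f a) $ a $ \<sigma> a else 0) = (if range f \<subseteq> J then 1 else 0) * T f \<sigma>"
      proof (cases "range f \<subseteq> J")
        case True
        then have "f a \<in> J" for a by auto
        then show ?thesis using True by (simp add: T_def)
      next
        case False
        then obtain a where "f a \<notin> J" by auto
        then show ?thesis using False by (auto intro!: prod_zero bexI[of _ a])
      qed
    qed
    finally show ?thesis .
  qed
  have "(\<Sum>J\<in>Pow UNIV. (- 1) ^ (CARD('n) - card J) * det (\<Sum>j\<in>J. H j))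
      = (\<Sum>J\<in>Pow UNIV. \<Sum>\<sigma>\<in>?P. \<Sum>f\<in>?F. of_int (sign \<sigma>) * T f \<sigma> *
          ((- 1) ^ (CARD('n) - card J) * (if range f \<subseteq> J then 1 else 0)))"
    unfolding det_def prod_eq sum_distrib_left by (intro sum.cong refl) (simp add: mult_ac)
  also have "\<dots> = (\<Sum>\<sigma>\<in>?P. \<Sum>f\<in>?F. \<Sum>J\<in>Pow UNIV. of_int (sign \<sigma>) * T f \<sigma> *
          ((- 1) ^ (CARD('n) - card J) * (if range f \<subseteq> J then 1 else 0)))"
    by (subst sum.swap, intro sum.cong refl, subst sum.swap, rule refl)
  also have "\<dots> = (\<Sum>\<sigma>\<in>?P. \<Sum>f\<in>?F. of_int (sign \<sigma>) * T f \<sigma> * (if range f = UNIV then 1 else 0))"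
    unfolding sum_distrib_left[symmetric] alternating_sum_supersets ..
  also have "\<dots> = (\<Sum>\<sigma>\<in>?P. \<Sum>f\<in>?P. of_int (sign \<sigma>) * T f \<sigma>)"
    unfolding surj_finite_permutes[symmetric]
    by (intro sum.cong refl sum.mono_neutral_cong_right) auto
  also have "\<dots> = (\<Sum>f\<in>?P. \<Sum>\<sigma>\<in>?P. of_int (sign \<sigma>) * T f \<sigma>)" by (rule sum.swap)
  \<comment> \<open>\<open>f\<close> assigns a matrix to every row; its inverse \<open>\<pi>\<close>
    assigns a row to every matrix, which lets the product run over the matrices.\<close>
  also have "\<dots> = (\<Sum>\<pi>\<in>?P. \<Sum>\<sigma>\<in>?P. of_int (sign \<sigma>) * T (inv \<pi>) \<sigma>)"
    by (rule sum.reindex_bij_witness[of _ inv inv]) (auto simp: permutes_inv permutes_inv_inv)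
  also have "\<dots> = (\<Sum>\<pi>\<in>?P. \<Sum>\<tau>\<in>?P. of_int (sign \<pi>) * of_int (sign \<tau>) * (\<Prod>j\<in>UNIV. H j $ \<pi> j $ \<tau> j))"
  proof (rule sum.cong[OF refl])
    fix \<pi> assume "\<pi> \<in> ?P"
    then have \<pi>: "\<pi> permutes UNIV" by simp
    show "(\<Sum>\<sigma>\<in>?P. of_int (sign \<sigma>) * T (inv \<pi>) \<sigma>)
        = (\<Sum>\<tau>\<in>?P. of_int (sign \<pi>) * of_int (sign \<tau>) * (\<Prod>j\<in>UNIV. H j $ \<pi> j $ \<tau> j))"
    proof (rule sum.reindex_bij_witness[of _ "\<lambda>\<tau>. \<tau> \<circ> inv \<pi>" "\<lambda>\<sigma>. \<sigma> \<circ> \<pi>"])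
      fix \<sigma> assume "\<sigma> \<in> ?P"
      then have \<sigma>: "\<sigma> permutes UNIV" by simp
      show "(\<sigma> \<circ> \<pi>) \<circ> inv \<pi> = \<sigma>" using \<pi> by (auto simp: fun_eq_iff permutes_inverses)
      show "\<sigma> \<circ> \<pi> \<in> ?P" using \<pi> \<sigma> by (simp add: permutes_compose)
      have perm: "permutation \<sigma>" "permutation \<pi>"
        using \<pi> \<sigma> by (auto intro: permutes_imp_permutation[OF finite])
      have "(\<Prod>j\<in>UNIV. H j $ \<pi> j $ (\<sigma> \<circ> \<pi>) j) = T (inv \<pi>) \<sigma>"
        using prod.reindex_bij_betw[OF permutes_bij[OF \<pi>], of "\<lambda>a. H (inv \<pi> a) $ a $ \<sigma> a"] \<pi>
        by (simp add: T_def permutes_inverses)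
      then show "of_int (sign \<pi>) * of_int (sign (\<sigma> \<circ> \<pi>)) * (\<Prod>j\<in>UNIV. H j $ \<pi> j $ (\<sigma> \<circ> \<pi>) j)
          = of_int (sign \<sigma>) * T (inv \<pi>) \<sigma>"
        unfolding sign_compose[OF perm]
        using sign_compose[OF perm] sign_idempotent[of \<pi>]
        by (simp flip: of_int_mult add: mult_ac)
    next
      fix \<tau> assume "\<tau> \<in> ?P"
      then have \<tau>: "\<tau> permutes UNIV" by simp
      show "(\<tau> \<circ> inv \<pi>) \<circ> \<pi> = \<tau>" using \<pi> by (auto simp: fun_eq_iff permutes_inverses)
      show "\<tau> \<circ> inv \<pi> \<in> ?P" using \<pi> \<tau> by (simp add: permutes_compose permutes_inv)
    qed
  qed
  finally show ?thesis .
qed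

text \<open>This is the double sum of the polarized determinant for the rank one matrices with
  entries \<open>Y $ j $ a * Y $ j $ c\<close>. Hence, for independent rows, the mixed discriminant
  of expected rank one matrices becomes the expectation of a squared determinant.\<close>

lemma det_square_expand:
  fixes Y :: "real ^ 'n::finite ^ 'n"
  shows "(det Y)\<^sup>2 = (\<Sum>\<pi> | \<pi> permutes UNIV. \<Sum>\<tau> | \<tau> permutes UNIV.
      of_int (sign \<pi>) * of_int (sign \<tau>) * (\<Prod>j\<in>UNIV. Y $ j $ \<pi> j * Y $ j $ \<tau> j))"
  unfolding det_def power2_eq_square sum_product prod.distrib
  by (intro sum.cong refl) (simp add: mult_ac)

text \<open>On the segment from the identity to \<open>A\<close> the form stays positive definite up
  to, but not including, the end \<open>t = 1\<close>, so the determinant does not vanish before it;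
  a negative value at the end would force a zero by the intermediate value theorem.\<close>

lemma det_nonneg_of_psd:
  fixes A :: "real ^ 'n::finite ^ 'n"
  assumes psd: "\<And>h. h \<bullet> (A *v h) \<ge> 0"
  shows "det A \<ge> 0"
proof (rule ccontr)
  assume "\<not> ?thesis"
  then have neg: "det A < 0" by simp
  define f where "f t = det (\<chi> i j. (1 - t) * mat 1 $ i $ j + t * A $ i $ j)" for t
  have "continuous_on {0..1} f"
    unfolding f_def det_def by (intro continuous_intros)
  moreover have "f 1 < 0"
    using neg by (simp add: f_def)
  moreover have "f 0 = 1"
  proof -
    have "(\<chi> i j. (mat 1 :: real ^ 'n ^ 'n) $ i $ j) = mat 1" by (simp add: vec_eq_iff)
    then show ?thesis by (simp add: f_def)
  qed
  ultimately obtain t where t: "0 \<le> t" "t \<le> 1" "f t = 0"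
    using IVT2'[of f 1 0 0] by auto
  with \<open>f 1 < 0\<close> have "t < 1" by (metis less_eq_real_def less_irrefl)
  let ?B = "\<chi> i j. (1 - t) * (mat 1 :: real ^ 'n ^ 'n) $ i $ j + t * A $ i $ j"
  have "det ?B = 0" using t by (simp add: f_def)
  then have "\<not> invertible ?B" by (simp add: invertible_det_nz)
  then obtain h where h: "h \<noteq> 0" "?B *v h = 0"
    by (meson invertible_left_inverse matrix_left_invertible_ker)
  have "?B *v h = (1 - t) *\<^sub>R h + t *\<^sub>R (A *v h)"
  proof -
    have "?B = (1 - t) *\<^sub>R mat 1 + t *\<^sub>R A" by (simp add: vec_eq_iff)
    then show ?thesis by (simp add: matrix_vector_mult_add_rdistrib scaleR_matrix_vector_assoc[symmetric])
  qed
  then have "0 = h \<bullet> ((1 - t) *\<^sub>R h + t *\<^sub>R (A *v h))" using h by simp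
  also have "\<dots> = (1 - t) * (h \<bullet> h) + t * (h \<bullet> (A *v h))" by (simp add: inner_add_right)
  also have "\<dots> > 0" using h \<open>t < 1\<close> t psd[of h] by (intro add_pos_nonneg) auto
  finally show False by simp
qed

text \<open>The discriminant argument: the vector \<open>c x - b y\<close> has the value
  \<open>c (a c - b^2)\<close>. If \<open>c = 0\<close>, the form is affine in \<open>t\<close>
  along \<open>x + t y\<close> and bounded below, so its slope vanishes.\<close>

lemma psd_Cauchy_Schwarz:
  fixes Q :: "real ^ 'n::finite ^ 'n"
  assumes sym: "transpose Q = Q" and psd: "\<And>h. h \<bullet> (Q *v h) \<ge> 0"
  shows "(x \<bullet> (Q *v y))\<^sup>2 \<le> (x \<bullet> (Q *v x)) * (y \<bullet> (Q *v y))"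
proof -
  define a b c where "a = x \<bullet> (Q *v x)" and "b = x \<bullet> (Q *v y)" and "c = y \<bullet> (Q *v y)"
  have b': "y \<bullet> (Q *v x) = b"
    unfolding b_def by (metis sym dot_lmul_matrix inner_commute transpose_matrix_vector)
  have pos: "s\<^sup>2 * a + 2 * s * t * b + t\<^sup>2 * c \<ge> 0" for s t
    using psd[of "s *\<^sub>R x + t *\<^sub>R y"] b'
    by (simp add: a_def[symmetric] b_def[symmetric] c_def[symmetric] matrix_vector_right_distrib matrix_vector_mult_scaleR
      inner_add_left inner_add_right power2_eq_square algebra_simps)
  have "b\<^sup>2 \<le> a * c"
  proof (cases "c = 0")
    case True
    have "b = 0"
    proof (rule ccontr)
      assume "b \<noteq> 0"
      \<comment> \<open>With this \<open>t\<close> the value \<open>a + 2 * t * b\<close> is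
        -1.\<close>
      then show False using pos[of 1 "- (a + 1) / (2 * b)"] True by (simp add: field_simps)
    qed
    then show ?thesis using True by simp
  next
    case False
    then have "c > 0" using psd[of y] by (simp add: c_def)
    moreover have "c * (a * c - b\<^sup>2) \<ge> 0"
      using pos[of c "- b"] by (simp add: power2_eq_square algebra_simps)
    ultimately have "a * c - b\<^sup>2 \<ge> 0" by (simp add: zero_le_mult_iff)
    then show ?thesis by simp
  qed
  then show ?thesis by (simp add: a_def b_def c_def)
qed

section \<open>The smoothed support function of an ellipsoid\<close>

definition sqrt1 :: "real ^ 'n::finite ^ 'n \<Rightarrow> real ^ 'n \<Rightarrow> real" where
  "sqrt1 Q x = sqrt (1 + x \<bullet> (Q *v x))"

definition sqrt1_hess :: "real ^ 'n::finite ^ 'n \<Rightarrow> real ^ 'n \<Rightarrow> real ^ 'n ^ 'n" where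
  "sqrt1_hess Q x = (\<chi> a b. Q $ a $ b / sqrt1 Q x - (Q *v x) $ a * (Q *v x) $ b / sqrt1 Q x ^ 3)"

lemma sqrt1_hess_mult:
  fixes Q :: "real ^ 'n::finite ^ 'n"
  shows "sqrt1_hess Q x *v h = (1 / sqrt1 Q x) *\<^sub>R (Q *v h) - ((h \<bullet> (Q *v x)) / sqrt1 Q x ^ 3) *\<^sub>R (Q *v x)"
proof -
  have *: "(\<Sum>j\<in>UNIV. (Q $ i $ j / r - u $ i * u $ j / r ^ 3) * h $ j)
      = (\<Sum>j\<in>UNIV. Q $ i $ j * h $ j) / r - (\<Sum>j\<in>UNIV. h $ j * u $ j) / r ^ 3 * u $ i"
    for i r and u :: "real ^ 'n"
    by (simp add: sum_subtractf left_diff_distrib right_diff_distrib sum_divide_distrib sum_distrib_left sum_distrib_right mult_ac)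
  define u where "u = Q *v x"
  show ?thesis
    unfolding sqrt1_hess_def u_def[symmetric] using *
    by (simp add: matrix_vector_mult_def vec_eq_iff inner_vec_def)
qed

context
  fixes Q :: "real ^ 'n::finite ^ 'n"
  assumes sym: "transpose Q = Q" and psd: "\<And>h. h \<bullet> (Q *v h) \<ge> 0"
begin

lemma sqrt1_ge_1: "sqrt1 Q x \<ge> 1"
  using psd[of x] by (simp add: sqrt1_def)

lemma psd_inner_commute: "x \<bullet> (Q *v y) = y \<bullet> (Q *v x)"
  by (metis sym dot_lmul_matrix inner_commute transpose_matrix_vector)

lemma sqrt1_has_derivative:
  "(sqrt1 Q has_derivative (\<lambda>h. h \<bullet> ((1 / sqrt1 Q x) *\<^sub>R (Q *v x)))) (at x)"
proof -
  have pos: "1 + x \<bullet> (Q *v x) > 0" using psd[of x] by (simp add: add_pos_nonneg)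
  have lin: "((\<lambda>x. Q *v x) has_derivative (\<lambda>h. Q *v h)) (at x)"
    by (simp add: bounded_linear_imp_has_derivative)
  have qd: "((\<lambda>x. 1 + x \<bullet> (Q *v x)) has_derivative (\<lambda>h. 0 + (x \<bullet> (Q *v h) + h \<bullet> (Q *v x)))) (at x)"
    by (intro has_derivative_add has_derivative_const has_derivative_inner has_derivative_ident lin)
  have sd: "(sqrt has_derivative (*) (inverse (sqrt1 Q x) / 2)) (at (1 + x \<bullet> (Q *v x)))"
    using DERIV_real_sqrt[OF pos] unfolding has_field_derivative_def sqrt1_def by simp
  have "((\<lambda>x. sqrt (1 + x \<bullet> (Q *v x))) has_derivative (\<lambda>h. h \<bullet> ((1 / sqrt1 Q x) *\<^sub>R (Q *v x)))) (at x)"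
    by (rule has_derivative_eq_rhs[OF has_derivative_compose[OF qd sd]])
      (simp add: fun_eq_iff psd_inner_commute[of x] field_simps)
  then show ?thesis unfolding sqrt1_def[abs_def] by simp
qed

lemma sqrt1_grad_has_derivative:
  "((\<lambda>x. (1 / sqrt1 Q x) *\<^sub>R (Q *v x)) has_derivative (\<lambda>h. sqrt1_hess Q x *v h)) (at x)"
proof -
  have pos: "sqrt1 Q x > 0" using sqrt1_ge_1[of x] by simp
  have lin: "((\<lambda>x. Q *v x) has_derivative (\<lambda>h. Q *v h)) (at x)"
    by (simp add: bounded_linear_imp_has_derivative)
  have "((\<lambda>x. (inverse (sqrt1 Q x)) *\<^sub>R (Q *v x)) has_derivative (\<lambda>h. sqrt1_hess Q x *v h)) (at x)"
    by (rule has_derivative_eq_rhs[OF has_derivative_scaleR[OF Deriv.has_derivative_inverse[OF _ sqrt1_has_derivative] lin]])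
      (use pos in \<open>simp_all add: fun_eq_iff sqrt1_hess_mult divide_inverse power3_eq_cube mult_ac\<close>)
  then show ?thesis by (simp add: divide_inverse)
qed

text \<open>With \<open>r = sqrt1 Q x\<close>, Cauchy-Schwarz bounds
  \<open>(h \<bullet> (Q *v x))\<^sup>2\<close> by
  \<open>(r\<^sup>2 - 1) * (h \<bullet> (Q *v h))\<close>, and the 1 that remains is the lower
  bound. It makes the Hessian positive in every direction in which \<open>Q\<close> is.\<close>

lemma sqrt1_hess_psd: "h \<bullet> (sqrt1_hess Q x *v h) \<ge> (h \<bullet> (Q *v h)) / sqrt1 Q x ^ 3"
proof -
  have r: "sqrt1 Q x > 0" and r2: "(sqrt1 Q x)\<^sup>2 = 1 + x \<bullet> (Q *v x)"
    using sqrt1_ge_1[of x] psd[of x] by (auto simp: sqrt1_def)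
  have "h \<bullet> (sqrt1_hess Q x *v h)
      = ((sqrt1 Q x)\<^sup>2 * (h \<bullet> (Q *v h)) - (h \<bullet> (Q *v x))\<^sup>2) / sqrt1 Q x ^ 3"
    using r by (simp add: sqrt1_hess_mult inner_diff_right power2_eq_square power3_eq_cube field_simps)
  also have "\<dots> \<ge> (h \<bullet> (Q *v h)) / sqrt1 Q x ^ 3"
    using r psd_Cauchy_Schwarz[OF sym psd, of h x]
    by (intro divide_right_mono) (auto simp: r2 algebra_simps)
  finally show ?thesis .
qed

text \<open>Cauchy-Schwarz together with \<open>sqrt (x \<bullet> (Q *v x)) \<le> sqrt1 Q x\<close>.
  It places the gradient of \<open>sqrt1 Q\<close> in the ellipsoid that belongs to
  \<open>Q\<close>.\<close>

lemma sqrt1_grad_inner_le: "((1 / sqrt1 Q x) *\<^sub>R (Q *v x)) \<bullet> y \<le> sqrt (y \<bullet> (Q *v y))"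
proof -
  have r: "sqrt1 Q x > 0" using sqrt1_ge_1[of x] by simp
  have "y \<bullet> (Q *v x) \<le> sqrt (y \<bullet> (Q *v y)) * sqrt (x \<bullet> (Q *v x))"
    using psd_Cauchy_Schwarz[OF sym psd, of y x] psd
    by (metis abs_le_D1 real_sqrt_abs real_sqrt_le_iff real_sqrt_mult)
  also have "\<dots> \<le> sqrt (y \<bullet> (Q *v y)) * sqrt1 Q x"
    using psd by (intro mult_left_mono) (auto simp: sqrt1_def)
  finally show ?thesis using r by (simp add: inner_commute field_simps)
qed

end

section \<open>Minkowski sums of ellipsoids as images of gradients\<close>

lemma minkowski_sum_insert:
  fixes A :: "'i \<Rightarrow> 'a::real_vector set"
  assumes "finite J" "j \<notin> J"
  shows "minkowski_sum (insert j J) A = {x + y |x y. x \<in> A j \<and> y \<in> minkowski_sum J A}"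
proof (intro set_eqI iffI)
  fix z assume "z \<in> minkowski_sum (insert j J) A"
  then obtain a where "z = (\<Sum>i\<in>insert j J. a i)" "\<forall>i\<in>insert j J. a i \<in> A i"
    by (auto simp: minkowski_sum_def)
  then show "z \<in> {x + y |x y. x \<in> A j \<and> y \<in> minkowski_sum J A}"
    using assms by (auto simp: minkowski_sum_def)
next
  fix z assume "z \<in> {x + y |x y. x \<in> A j \<and> y \<in> minkowski_sum J A}"
  then obtain x a where z: "z = x + (\<Sum>i\<in>J. a i)" "x \<in> A j" "\<forall>i\<in>J. a i \<in> A i"
    by (auto simp: minkowski_sum_def)
  have "(\<Sum>i\<in>J. (a(j := x)) i) = (\<Sum>i\<in>J. a i)"
    using assms by (intro sum.cong) auto
  then show "z \<in> minkowski_sum (insert j J) A"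
    unfolding minkowski_sum_def using z assms by (auto intro!: exI[of _ "a(j := x)"])
qed

lemma set_sum_eq: "(\<Union>x\<in>S. \<Union>y\<in>T. {x + y}) = {x + y |x y. x \<in> S \<and> y \<in> T}"
  by auto

lemma compact_convex_minkowski_sum:
  fixes A :: "'i \<Rightarrow> 'a::euclidean_space set"
  assumes "finite J" "\<And>j. j \<in> J \<Longrightarrow> compact (A j)" "\<And>j. j \<in> J \<Longrightarrow> convex (A j)"
  shows "compact (minkowski_sum J A) \<and> convex (minkowski_sum J A)"
  using assms
proof (induction J)
  case empty
  then show ?case by (simp add: minkowski_sum_def)
next
  case (insert j J)
  then have "compact (minkowski_sum J A)" "convex (minkowski_sum J A)" "compact (A j)" "convex (A j)" by auto
  then show ?case
    unfolding minkowski_sum_insert[OF insert(1,2)]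
    using compact_sums[of "A j" "minkowski_sum J A"] convex_sums[of "A j" "minkowski_sum J A"]
    by (simp add: set_sum_eq)
qed

definition gradsum :: "('i \<Rightarrow> real ^ 'n::finite ^ 'n) \<Rightarrow> 'i set \<Rightarrow> real ^ 'n \<Rightarrow> real ^ 'n" where
  "gradsum Q J x = (\<Sum>j\<in>J. (1 / sqrt1 (Q j) x) *\<^sub>R (Q j *v x))"

definition hesssum :: "('i \<Rightarrow> real ^ 'n::finite ^ 'n) \<Rightarrow> 'i set \<Rightarrow> real ^ 'n \<Rightarrow> real ^ 'n ^ 'n" where
  "hesssum Q J x = (\<Sum>j\<in>J. sqrt1_hess (Q j) x)"

context
  fixes Q :: "'n::finite \<Rightarrow> real ^ 'n ^ 'n" and E :: "'n \<Rightarrow> (real ^ 'n) set"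
  assumes sym: "\<And>j. transpose (Q j) = Q j" and psd: "\<And>j h. h \<bullet> (Q j *v h) \<ge> 0"
    and E: "\<And>j a. a \<in> E j \<longleftrightarrow> (\<forall>x. a \<bullet> x \<le> sqrt (x \<bullet> (Q j *v x)))"
begin

lemma compact_ellipsoid: "compact (E j)" and convex_ellipsoid: "convex (E j)"
proof -
  have Eq: "E j = (\<Inter>x. {a. x \<bullet> a \<le> sqrt (x \<bullet> (Q j *v x))})" by (auto simp: E inner_commute)
  have "closed (E j)" unfolding Eq by (intro closed_INT ballI closed_halfspace_le)
  moreover have "bounded (E j)"
  proof -
    obtain B where B: "\<And>x. norm (Q j *v x) \<le> norm x * B" "B > 0"
      using bounded_linear.pos_bounded[OF matrix_vector_mul_bounded_linear[of "Q j"]] by blast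
    show ?thesis
    proof (rule boundedI)
      fix a assume "a \<in> E j"
      \<comment> \<open>The defining inequality is tested in the direction \<open>a\<close> itself;
        the right side grows only linearly in the norm of \<open>a\<close>.\<close>
      then have "(norm a)\<^sup>2 \<le> sqrt (a \<bullet> (Q j *v a))" by (auto simp: E power2_norm_eq_inner)
      also have "\<dots> \<le> sqrt (B * (norm a)\<^sup>2)"
        using Cauchy_Schwarz_ineq2[of a "Q j *v a"] mult_left_mono[OF B(1)[of a], of "norm a"]
        by (intro real_sqrt_le_mono) (simp add: power2_eq_square mult_ac)
      also have "\<dots> = sqrt B * norm a" using B by (simp add: real_sqrt_mult)
      finally show "norm a \<le> sqrt B"
        using B by (cases "a = 0") (auto simp: power2_eq_square)
    qed
  qed
  ultimately show "compact (E j)" by (simp add: compact_eq_bounded_closed)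
  show "convex (E j)" unfolding Eq by (intro convex_INT convex_halfspace_le)
qed

lemma sum_matrix_vector_mult: "(\<Sum>j\<in>J. A j) *v h = (\<Sum>j\<in>J. A j *v h)"
  for A :: "'b \<Rightarrow> real ^ 'c::finite ^ 'd::finite"
  by (induction J rule: infinite_finite_induct) (auto simp: matrix_vector_mult_add_rdistrib)

lemma gradsum_has_derivative: "(gradsum Q J has_derivative (\<lambda>h. hesssum Q J x *v h)) (at x within S)"
  unfolding gradsum_def[abs_def] hesssum_def sum_matrix_vector_mult
  by (rule has_derivative_sum, rule has_derivative_at_withinI, rule sqrt1_grad_has_derivative[OF sym psd])

lemma hesssum_psd: "h \<bullet> (hesssum Q J x *v h) \<ge> (\<Sum>j\<in>J. (h \<bullet> (Q j *v h)) / sqrt1 (Q j) x ^ 3)"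
  unfolding hesssum_def sum_matrix_vector_mult inner_sum_right
  by (rule sum_mono, rule sqrt1_hess_psd[OF sym psd])

lemma det_hesssum_nonneg: "det (hesssum Q J x) \<ge> 0"
proof (rule det_nonneg_of_psd)
  fix h
  have "0 \<le> (\<Sum>j\<in>J. (h \<bullet> (Q j *v h)) / sqrt1 (Q j) x ^ 3)"
    using psd by (intro sum_nonneg divide_nonneg_nonneg) (auto simp: sqrt1_def)
  with hesssum_psd[of h x J] show "0 \<le> h \<bullet> (hesssum Q J x *v h)" by linarith
qed

lemma gradsum_in_minkowski_sum: "gradsum Q J x \<in> minkowski_sum J E"
  unfolding gradsum_def minkowski_sum_def
  using sqrt1_grad_inner_le[OF sym psd] by (auto simp: E)

lemma minkowski_sum_inner_le:
  assumes "a \<in> minkowski_sum J E"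
  shows "a \<bullet> x \<le> (\<Sum>j\<in>J. sqrt (x \<bullet> (Q j *v x)))"
  using assms E by (auto simp: minkowski_sum_def inner_sum_left intro!: sum_mono)

text \<open>The gradient of a strictly convex function is injective: along the segment from
  \<open>x\<close> to \<open>y\<close> the component of \<open>gradsum\<close> in the direction
  \<open>h\<close> has the positive derivative \<open>h \<bullet> (hesssum Q J z *v h)\<close>, so
  its values at the two ends differ.\<close>

lemma inj_gradsum:
  assumes pd: "\<And>h. h \<noteq> 0 \<Longrightarrow> (\<Sum>j\<in>J. h \<bullet> (Q j *v h)) > 0"
  shows "inj (gradsum Q J)"
proof (rule injI, rule ccontr)
  fix x y assume eq: "gradsum Q J x = gradsum Q J y" and "x \<noteq> y"
  define h where "h = y - x"
  define f where "f t = gradsum Q J (x + t *\<^sub>R h) \<bullet> h" for t :: real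
  have der: "(f has_real_derivative (h \<bullet> (hesssum Q J (x + t *\<^sub>R h) *v h))) (at t)" for t
  proof -
    have "((\<lambda>t. x + t *\<^sub>R h) has_derivative (\<lambda>s. s *\<^sub>R h)) (at t)"
      by (auto intro!: derivative_eq_intros)
    from has_derivative_compose[OF this gradsum_has_derivative[of J "x + t *\<^sub>R h" UNIV]]
    have "(f has_derivative (\<lambda>s. (hesssum Q J (x + t *\<^sub>R h) *v (s *\<^sub>R h)) \<bullet> h)) (at t)"
      unfolding f_def by (rule has_derivative_inner_left)
    moreover have "(\<lambda>s. (hesssum Q J (x + t *\<^sub>R h) *v (s *\<^sub>R h)) \<bullet> h) = (*) (h \<bullet> (hesssum Q J (x + t *\<^sub>R h) *v h))"
      by (simp add: fun_eq_iff matrix_vector_mult_scaleR inner_commute)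
    ultimately show ?thesis by (simp add: has_field_derivative_def)
  qed
  obtain t where t: "f 1 - f 0 = (1 - 0) * (h \<bullet> (hesssum Q J (x + t *\<^sub>R h) *v h))"
    using MVT2[of 0 1 f "\<lambda>t. h \<bullet> (hesssum Q J (x + t *\<^sub>R h) *v h)"] der by auto
  have "h \<noteq> 0" using \<open>x \<noteq> y\<close> by (simp add: h_def)
  then have "(\<Sum>j\<in>J. h \<bullet> (Q j *v h)) > 0" by (rule pd)
  then obtain j where j: "j \<in> J" "h \<bullet> (Q j *v h) > 0"
    by (meson not_le sum_nonpos)
  let ?z = "x + t *\<^sub>R h"
  have r: "sqrt1 (Q j) ?z > 0" for j
    using sqrt1_ge_1[OF sym psd, of j ?z] by simp
  have "0 < (\<Sum>j\<in>J. (h \<bullet> (Q j *v h)) / sqrt1 (Q j) ?z ^ 3)"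
    using j psd r by (intro sum_pos2[of J j]) (auto intro!: divide_nonneg_nonneg simp: less_imp_le)
  then have "h \<bullet> (hesssum Q J ?z *v h) > 0" using hesssum_psd[of h ?z J] by linarith
  then show False using t eq by (simp add: f_def h_def)
qed

text \<open>For an interior point \<open>p\<close> the function \<open>\<Phi>\<close>, a potential
  of \<open>gradsum\<close> minus the linear form of \<open>p\<close>, grows at least like
  \<open>e * norm x\<close> and so attains a minimum; there \<open>gradsum\<close> equals
  \<open>p\<close>.\<close>

lemma interior_subset_range_gradsum: "interior (minkowski_sum J E) \<subseteq> range (gradsum Q J)"
proof
  fix p assume "p \<in> interior (minkowski_sum J E)"
  then obtain e where e: "e > 0" "cball p e \<subseteq> minkowski_sum J E"
    by (meson mem_interior_cball)
  define \<Phi> where "\<Phi> x = (\<Sum>j\<in>J. sqrt1 (Q j) x) - p \<bullet> x" for x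
  have der: "(\<Phi> has_derivative (\<lambda>h. h \<bullet> (gradsum Q J x - p))) (at x)" for x
  proof -
    have "(\<Phi> has_derivative (\<lambda>h. (\<Sum>j\<in>J. h \<bullet> ((1 / sqrt1 (Q j) x) *\<^sub>R (Q j *v x))) - p \<bullet> h)) (at x)"
      unfolding \<Phi>_def
      by (rule has_derivative_diff, rule has_derivative_sum, rule sqrt1_has_derivative[OF sym psd])
        (rule bounded_linear_imp_has_derivative[OF bounded_linear_inner_right])
    then show ?thesis
      by (rule has_derivative_eq_rhs)
        (simp add: fun_eq_iff gradsum_def inner_diff_right inner_sum_right inner_commute)
  qed
  have coer: "\<Phi> x \<ge> e * norm x" for x
  proof (cases "x = 0")
    case True
    then show ?thesis by (simp add: \<Phi>_def sqrt1_def sum_nonneg)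
  next
    case False
    \<comment> \<open>The point of the ball that lies furthest in the direction \<open>x\<close>;
      testing it against the support function of the sum yields the surplus
      \<open>e * norm x\<close>.\<close>
    have "p + (e / norm x) *\<^sub>R x \<in> cball p e"
      using e False by (simp add: dist_norm)
    then have "(p + (e / norm x) *\<^sub>R x) \<bullet> x \<le> (\<Sum>j\<in>J. sqrt (x \<bullet> (Q j *v x)))"
      using e minkowski_sum_inner_le by blast
    moreover have "(p + (e / norm x) *\<^sub>R x) \<bullet> x = p \<bullet> x + e * norm x"
      using False by (simp add: inner_add_left dot_square_norm power2_eq_square)
    moreover have "(\<Sum>j\<in>J. sqrt (x \<bullet> (Q j *v x))) \<le> (\<Sum>j\<in>J. sqrt1 (Q j) x)"
      by (intro sum_mono) (simp add: sqrt1_def)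
    ultimately show ?thesis by (simp add: \<Phi>_def)
  qed
  \<comment> \<open>Outside this radius \<open>e * norm y\<close> is at least
    \<open>\<Phi> 0\<close>, so a minimum over the ball is a global one.\<close>
  define R where "R = \<Phi> 0 / e + 1"
  have \<Phi>0: "\<Phi> 0 \<ge> 0" using coer[of 0] by simp
  have cont: "continuous_on S \<Phi>" for S
    using der by (meson continuous_at_imp_continuous_on has_derivative_continuous)
  have "cball 0 R \<noteq> {}" using e \<Phi>0 by (simp add: R_def not_less)
  then obtain x where x: "x \<in> cball 0 R" "\<And>y. y \<in> cball 0 R \<Longrightarrow> \<Phi> x \<le> \<Phi> y"
    using continuous_attains_inf[OF compact_cball _ cont] by blast
  have min: "\<Phi> x \<le> \<Phi> y" for y
  proof (cases "y \<in> cball 0 R")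
    case False
    then have "norm y \<ge> R" by simp
    then have "e * norm y \<ge> e * R" using e by simp
    moreover have "e * R \<ge> \<Phi> 0" using e by (simp add: R_def field_simps)
    moreover have "\<Phi> x \<le> \<Phi> 0" using x(2)[of 0] e \<Phi>0 by (simp add: R_def)
    ultimately show ?thesis using coer[of y] by linarith
  qed (use x in auto)
  have "(\<lambda>h. h \<bullet> (gradsum Q J x - p)) = (\<lambda>h. 0)"
    by (rule differential_zero_maxmin[OF _ open_UNIV der]) (use min in auto)
  then have "(gradsum Q J x - p) \<bullet> (gradsum Q J x - p) = 0" by meson
  then have "gradsum Q J x = p" by simp
  then show "p \<in> range (gradsum Q J)" by blast
qed

text \<open>If the quadratic forms have no common null direction, \<open>gradsum\<close> maps the
  space injectively onto a set between the interior of the compact convex sum and the sum itself,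
  and the frontier is negligible. A common null direction puts the sum into a hyperplane and lies in
  the kernel of every Hessian, so both sides vanish.\<close>

lemma emeasure_minkowski_sum_ellipsoids:
  "ennreal (measure lebesgue (minkowski_sum J E)) = (\<integral>\<^sup>+ x. ennreal (det (hesssum Q J x)) \<partial>lborel)"
proof -
  let ?K = "minkowski_sum J E"
  have K: "compact ?K" "convex ?K"
    using compact_convex_minkowski_sum[of J E] compact_ellipsoid convex_ellipsoid by auto
  have KB: "?K \<in> sets borel" using K by (simp add: borel_compact)
  have mK: "ennreal (measure lebesgue ?K) = emeasure lborel ?K"
    using K KB emeasure_compact_finite[of ?K] by (simp add: measure_completion emeasure_eq_ennreal_measure emeasure_lborel_cbox_finite top.not_eq_extremum)
  show ?thesis
  proof (cases "\<exists>h. h \<noteq> 0 \<and> (\<Sum>j\<in>J. h \<bullet> (Q j *v h)) = 0")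
    case False
    then have pd: "(\<Sum>j\<in>J. h \<bullet> (Q j *v h)) > 0" if "h \<noteq> 0" for h
      using that psd by (metis less_eq_real_def sum_nonneg)
    have cpt: "compact (cball (0 :: real ^ 'n) (real n))" for n by simp
    have UN: "(UNIV :: (real ^ 'n) set) = (\<Union>n. cball 0 (real n))"
      by (auto simp: real_arch_simple)
    \<comment> \<open>The change of variables needs an integrable weight, so the constant 1 is
      replaced by the indicator of the sum, which is 1 on the whole range of
      \<open>gradsum\<close>.\<close>
    have int: "integrable lborel (indicator ?K :: real ^ 'n \<Rightarrow> real)"
      using K KB emeasure_compact_finite by (intro integrable_real_indicator) auto
    note cv = nn_integral_change_of_variables[OF cpt UN gradsum_has_derivative inj_gradsum[OF pd] int]
    have rng: "range (gradsum Q J) \<subseteq> ?K" using gradsum_in_minkowski_sum by blast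
    have "(\<integral>\<^sup>+ x. ennreal (det (hesssum Q J x)) \<partial>lborel) = (\<integral>\<^sup>+ y\<in>range (gradsum Q J). ennreal (indicator ?K y) \<partial>lborel)"
      using cv(1) gradsum_in_minkowski_sum det_hesssum_nonneg by simp
    also have "\<dots> = (\<integral>\<^sup>+ y. indicator (range (gradsum Q J)) y \<partial>lborel)"
      using rng by (intro nn_integral_cong) (auto simp: indicator_def)
    also have "\<dots> = emeasure lborel (range (gradsum Q J))"
      using cv(2) by simp
    also have "\<dots> = emeasure lborel ?K"
    proof (rule emeasure_eq_AE)
      have "?K - interior ?K \<subseteq> frontier ?K" by (auto simp: frontier_def closure_subset[THEN subsetD])
      then have "negligible (?K - interior ?K)"
        using negligible_convex_frontier[OF K(2)] negligible_subset by blast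
      then have "?K - interior ?K \<in> null_sets lborel"
        using KB by (auto simp: negligible_iff_null_sets null_sets_completion_iff)
      from AE_not_in[OF this]
      show "AE x in lborel. (x \<in> range (gradsum Q J)) = (x \<in> ?K)"
        by eventually_elim (use rng interior_subset_range_gradsum[of J] in blast)
    qed (use cv(2) KB in auto)
    finally show ?thesis using mK by simp
  next
    case True
    then obtain h where h: "h \<noteq> 0" "(\<Sum>j\<in>J. h \<bullet> (Q j *v h)) = 0" by blast
    then have h0: "h \<bullet> (Q j *v h) = 0" if "j \<in> J" for j
      using that psd by (subst (asm) sum_nonneg_eq_0_iff) auto
    have "?K \<subseteq> {a. h \<bullet> a = 0}"
    proof
      fix a assume a: "a \<in> ?K"
      have "(- h) \<bullet> (Q j *v (- h)) = h \<bullet> (Q j *v h)" for j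
        using matrix_vector_mult_scaleR[of "Q j" "- 1" h] by simp
      then have "a \<bullet> h \<le> 0" "a \<bullet> (- h) \<le> 0"
        using minkowski_sum_inner_le[OF a, of h] minkowski_sum_inner_le[OF a, of "- h"] h0 by simp_all
      then show "a \<in> {a. h \<bullet> a = 0}" by (simp add: inner_commute)
    qed
    moreover have "negligible {a. h \<bullet> a = 0}" using h by (intro negligible_hyperplane) auto
    ultimately have "negligible ?K" using negligible_subset by blast
    then have "measure lebesgue ?K = 0" by (simp add: negligible_imp_measure0)
    moreover have "det (hesssum Q J x) = 0" for x
    proof -
      have "Q j *v h = 0" if "j \<in> J" for j
      proof -
        \<comment> \<open>A null vector of a semidefinite form lies in the kernel of its matrix:
          Cauchy-Schwarz for \<open>Q j *v h\<close> and \<open>h\<close>.\<close>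
        have "((Q j *v h) \<bullet> (Q j *v h))\<^sup>2 \<le> 0"
          using psd_Cauchy_Schwarz[where Q="Q j" and x="Q j *v h" and y=h, OF sym psd] h0[OF that] by simp
        then show ?thesis by simp
      qed
      then have "sqrt1_hess (Q j) x *v h = 0" if "j \<in> J" for j
        using that psd_inner_commute[where Q="Q j" and x=h and y=x, OF sym psd] by (simp add: sqrt1_hess_mult)
      then have "hesssum Q J x *v h = 0" by (simp add: hesssum_def sum_matrix_vector_mult)
      then show ?thesis using h(1)
        by (metis invertible_det_nz invertible_left_inverse matrix_left_invertible_ker)
    qed
    ultimately show ?thesis by simp
  qed
qed

end

section \<open>Gaussian integrals and the mixed discriminant\<close>

lemma continuous_on_sqrt1:
  fixes Q :: "real ^ 'n::finite ^ 'n"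
  shows "continuous_on S (sqrt1 Q)"
  unfolding sqrt1_def[abs_def]
  by (intro continuous_intros linear_continuous_on matrix_vector_mul_bounded_linear)

lemma borel_measurable_sqrt1_hess_entry:
  fixes Q :: "real ^ 'n::finite ^ 'n"
  assumes psd: "\<And>h. h \<bullet> (Q *v h) \<ge> 0"
  shows "(\<lambda>x. sqrt1_hess Q x $ a $ b) \<in> borel_measurable borel"
proof (rule borel_measurable_continuous_onI)
  have "sqrt1 Q x \<noteq> 0" for x using psd[of x] by (simp add: sqrt1_def)
  moreover have "continuous_on UNIV (\<lambda>x. (Q *v x) $ k)" for k
    by (intro continuous_intros linear_continuous_on matrix_vector_mul_bounded_linear)
  ultimately show "continuous_on UNIV (\<lambda>x. sqrt1_hess Q x $ a $ b)"
    unfolding sqrt1_hess_def by (simp, intro continuous_intros continuous_on_sqrt1) auto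
qed

lemma nn_integral_exp_square: "(\<integral>\<^sup>+ x. ennreal (exp (- x\<^sup>2 / 2)) \<partial>lborel) = ennreal (sqrt (2 * pi))"
proof -
  have "(\<integral>\<^sup>+ x. ennreal (exp (- x\<^sup>2 / 2)) \<partial>lborel)
      = (\<integral>\<^sup>+ x. ennreal (sqrt (2 * pi)) * ennreal (std_normal_density x) \<partial>lborel)"
    by (intro nn_integral_cong) (simp add: std_normal_density_def flip: ennreal_mult)
  also have "\<dots> = ennreal (sqrt (2 * pi)) * (\<integral>\<^sup>+ x. ennreal (std_normal_density x) \<partial>lborel)"
    by (rule nn_integral_cmult) simp
  also have "(\<integral>\<^sup>+ x. ennreal (std_normal_density x) \<partial>lborel) = 1"
    by (subst nn_integral_eq_integral) auto
  finally show ?thesis by simp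
qed

lemma nn_integral_gauss_vec:
  "(\<integral>\<^sup>+ x. ennreal (\<Prod>k\<in>UNIV. exp (- (x $ k)\<^sup>2 / 2)) \<partial>(lborel :: (real ^ 'n::finite) measure))
    = ennreal (sqrt (2 * pi) ^ CARD('n))"
proof -
  have "(\<integral>\<^sup>+ x. ennreal (\<Prod>k\<in>UNIV. exp (- (x $ k)\<^sup>2 / 2)) \<partial>(lborel :: (real ^ 'n) measure))
      = (\<integral>\<^sup>+ x. (\<Prod>b\<in>Basis. ennreal (exp (- (x \<bullet> b)\<^sup>2 / 2))) \<partial>(lborel :: (real ^ 'n) measure))"
    by (intro nn_integral_cong)
      (simp add: prod_ennreal prod_Basis_cart[of "\<lambda>t. exp (- (t\<^sup>2 / 2))"])
  also have "\<dots> = (\<Prod>b\<in>(Basis :: (real ^ 'n) set). \<integral>\<^sup>+ x. ennreal (exp (- x\<^sup>2 / 2)) \<partial>lborel)"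
    by (rule nn_integral_lborel_prod) auto
  finally show ?thesis
    using nn_integral_exp_square by (simp add: ennreal_power)
qed

text \<open>For invertible \<open>Y\<close> the substitution \<open>y = Y *v x\<close> leads to the
  standard Gaussian integral. For singular \<open>Y\<close> the exponential alone is not integrable,
  and it is the weight \<open>(det Y)\<^sup>2\<close> that makes both sides 0.\<close>

lemma nn_integral_gauss_linear:
  fixes Y :: "real ^ 'n::finite ^ 'n"
  shows "(\<integral>\<^sup>+ x. ennreal ((\<Prod>j\<in>UNIV. exp (- (Y $ j \<bullet> x)\<^sup>2 / 2)) * (det Y)\<^sup>2) \<partial>lborel)
    = ennreal (sqrt (2 * pi) ^ CARD('n)) * ennreal \<bar>det Y\<bar>"
proof (cases "det Y = 0")
  case False
  define f where "f x = (\<Prod>k\<in>UNIV. exp (- (x $ k)\<^sup>2 / 2))" for x :: "real ^ 'n"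
  have f0: "f x \<ge> 0" for x by (simp add: f_def prod_nonneg)
  have fm: "f \<in> borel_measurable borel"
    unfolding f_def by (intro borel_measurable_continuous_onI continuous_intros) auto
  have f: "integrable lborel f"
    using fm f0 nn_integral_gauss_vec[where 'n='n] by (intro integrableI_nonneg) (auto simp: f_def)
  have cpt: "compact (cball (0 :: real ^ 'n) (real n))" for n by simp
  have UN: "(UNIV :: (real ^ 'n) set) = (\<Union>n. cball 0 (real n))"
    by (auto simp: real_arch_simple)
  have inv: "invertible Y" using False by (simp add: invertible_det_nz)
  then have inj: "inj ((*v) Y)" and surj: "range ((*v) Y) = UNIV"
    using invertible_eq_bij by (auto simp: bij_def)
  have der: "((*v) Y has_derivative (\<lambda>h. Y *v h)) (at x within UNIV)" for x
    by (simp add: bounded_linear_imp_has_derivative)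
  have "(\<integral>\<^sup>+ y. ennreal (f y) \<partial>lborel) = (\<integral>\<^sup>+ x. ennreal (\<bar>det Y\<bar> * f (Y *v x)) \<partial>lborel)"
    using nn_integral_change_of_variables(1)[OF cpt UN der inj f f0] surj by simp
  then have 1: "ennreal (sqrt (2 * pi) ^ CARD('n)) = (\<integral>\<^sup>+ x. ennreal (\<bar>det Y\<bar> * f (Y *v x)) \<partial>lborel)"
    using nn_integral_gauss_vec[where 'n='n] by (simp add: f_def)
  have [measurable]: "(\<lambda>x. f (Y *v x)) \<in> borel_measurable borel"
    by (intro measurable_compose[OF _ fm] borel_measurable_continuous_onI linear_continuous_on
        matrix_vector_mul_bounded_linear)
  have "(\<integral>\<^sup>+ x. ennreal ((\<Prod>j\<in>UNIV. exp (- (Y $ j \<bullet> x)\<^sup>2 / 2)) * (det Y)\<^sup>2) \<partial>lborel)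
      = (\<integral>\<^sup>+ x. ennreal \<bar>det Y\<bar> * ennreal (\<bar>det Y\<bar> * f (Y *v x)) \<partial>lborel)"
  proof (rule nn_integral_cong)
    fix x
    have "(\<Prod>j\<in>UNIV. exp (- (Y $ j \<bullet> x)\<^sup>2 / 2)) * (det Y)\<^sup>2 = \<bar>det Y\<bar> * \<bar>det Y\<bar> * f (Y *v x)"
      by (simp add: f_def matrix_vector_mul_component power2_eq_square)
    also have "\<dots> = \<bar>det Y\<bar> * (\<bar>det Y\<bar> * f (Y *v x))" by (rule mult.assoc)
    finally show "ennreal ((\<Prod>j\<in>UNIV. exp (- (Y $ j \<bullet> x)\<^sup>2 / 2)) * (det Y)\<^sup>2)
        = ennreal \<bar>det Y\<bar> * ennreal (\<bar>det Y\<bar> * f (Y *v x))"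
      using f0 by (simp add: ennreal_mult)
  qed
  also have "\<dots> = ennreal \<bar>det Y\<bar> * (\<integral>\<^sup>+ x. ennreal (\<bar>det Y\<bar> * f (Y *v x)) \<partial>lborel)"
    by (rule nn_integral_cmult) simp
  finally show ?thesis using 1 by (simp add: mult.commute)
qed simp

text \<open>The law of the random matrix enters through \<open>Yint\<close>, which asks that the
  expectation of a product over the rows be the product of Hessian entries; independent centred
  Gaussian rows with covariances \<open>Q j\<close> satisfy it. The factorial cancels the division
  in the definition of \<open>mixed_volume\<close>.\<close>

theorem mixed_volume_ellipsoids:
  fixes Q :: "'n::finite \<Rightarrow> real ^ 'n ^ 'n" and E :: "'n \<Rightarrow> (real ^ 'n) set"
    and Y :: "'r \<Rightarrow> real ^ 'n ^ 'n"
  assumes sym: "\<And>j. transpose (Q j) = Q j" and psd: "\<And>j h. h \<bullet> (Q j *v h) \<ge> 0"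
    and E: "\<And>j a. a \<in> E j \<longleftrightarrow> (\<forall>x. a \<bullet> x \<le> sqrt (x \<bullet> (Q j *v x)))"
    and R: "sigma_finite_measure R"
    and Ym: "\<And>i j. (\<lambda>r. Y r $ i $ j) \<in> borel_measurable R"
    and Yint: "\<And>\<pi> \<tau> x. has_bochner_integral R
        (\<lambda>r. \<Prod>j\<in>UNIV. exp (- (Y r $ j \<bullet> x)\<^sup>2 / 2) * (Y r $ j $ \<pi> j * Y r $ j $ \<tau> j))
        (\<Prod>j\<in>UNIV. sqrt1_hess (Q j) x $ \<pi> j $ \<tau> j)"
  shows "ennreal (fact CARD('n) * mixed_volume E)
    = ennreal (sqrt (2 * pi) ^ CARD('n)) * (\<integral>\<^sup>+ r. ennreal \<bar>det (Y r)\<bar> \<partial>R)"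
proof -
  interpret R: sigma_finite_measure R by (rule R)
  interpret pair_sigma_finite "lborel :: (real ^ 'n) measure" R
    by (intro pair_sigma_finite.intro R sigma_finite_lborel)
  note vol = emeasure_minkowski_sum_ellipsoids[OF sym psd E]
  have dm: "(\<lambda>x. det (hesssum Q J x)) \<in> borel_measurable borel" for J
    unfolding det_def hesssum_def sum_component
    by (intro borel_measurable_sum borel_measurable_times borel_measurable_prod borel_measurable_const
        borel_measurable_sqrt1_hess_entry psd)
  have nn: "det (hesssum Q J x) \<ge> 0" for J x
    by (rule det_hesssum_nonneg[OF sym psd E])
  have hbi: "has_bochner_integral lborel (\<lambda>x. det (hesssum Q J x)) (measure lebesgue (minkowski_sum J E))" for J
  proof (rule has_bochner_integral_nn_integral)
    show "(\<integral>\<^sup>+ x. ennreal (det (hesssum Q J x)) \<partial>lborel) = ennreal (measure lebesgue (minkowski_sum J E))"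
      by (rule vol[symmetric])
  qed (use dm nn in simp_all)
  \<comment> \<open>\<open>n!\<close> times the mixed discriminant of the Hessians at
    \<open>x\<close>. Written as an alternating sum of determinants it integrates to
    \<open>n!\<close> times the mixed volume; written as a double sum over permutations it is the
    expectation of \<open>g x\<close>.\<close>
  define P where "P x = (\<Sum>\<pi> | \<pi> permutes UNIV. \<Sum>\<tau> | \<tau> permutes UNIV.
      of_int (sign \<pi>) * of_int (sign \<tau>) * (\<Prod>j\<in>UNIV. sqrt1_hess (Q j) x $ \<pi> j $ \<tau> j))" for x
  have P1: "P x = (\<Sum>J\<in>Pow UNIV. (- 1) ^ (CARD('n) - card J) * det (hesssum Q J x))" for x
    unfolding P_def hesssum_def det_sum_polarization ..
  have hP: "has_bochner_integral lborel P
      (\<Sum>J\<in>Pow UNIV. (- 1) ^ (CARD('n) - card J) * measure lebesgue (minkowski_sum J E))"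
    unfolding P1 by (intro has_bochner_integral_sum has_bochner_integral_mult_right hbi)
  define g where "g x r = (\<Prod>j\<in>UNIV. exp (- (Y r $ j \<bullet> x)\<^sup>2 / 2)) * (det (Y r))\<^sup>2" for x r
  have g0: "g x r \<ge> 0" for x r by (simp add: g_def prod_nonneg)
  have hg: "has_bochner_integral R (g x) (P x)" for x
  proof -
    have "g x = (\<lambda>r. \<Sum>\<pi> | \<pi> permutes UNIV. \<Sum>\<tau> | \<tau> permutes UNIV. of_int (sign \<pi>) * of_int (sign \<tau>) *
        (\<Prod>j\<in>UNIV. exp (- (Y r $ j \<bullet> x)\<^sup>2 / 2) * (Y r $ j $ \<pi> j * Y r $ j $ \<tau> j)))"
      unfolding g_def det_square_expand sum_distrib_left
      by (intro ext sum.cong refl) (simp add: prod.distrib mult_ac)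
    then show ?thesis
      unfolding P_def by (simp only:) (intro has_bochner_integral_sum has_bochner_integral_mult_right Yint)
  qed
  have P_nn: "ennreal (P x) = (\<integral>\<^sup>+ r. ennreal (g x r) \<partial>R)" for x
    using hg[of x] g0 by (simp add: nn_integral_eq_integral has_bochner_integral_iff)
  \<comment> \<open>The alternating sum does not show its sign; nonnegativity comes from the
    expectation of \<open>g\<close> and permits the passage to \<open>ennreal\<close>
    integrals.\<close>
  have P0: "P x \<ge> 0" for x
    unfolding has_bochner_integral_integral_eq[OF hg[of x], symmetric]
    by (rule Bochner_Integration.integral_nonneg) (rule g0)
  have Ym': "(\<lambda>r. Y r $ i $ j) \<in> borel_measurable R" for i j by (rule Ym)
  have gm: "(\<lambda>(x, r). ennreal (g x r)) \<in> borel_measurable (lborel \<Otimes>\<^sub>M R)"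
  proof -
    have [measurable]: "(\<lambda>p. Y (snd p) $ i $ j) \<in> borel_measurable (lborel \<Otimes>\<^sub>M R)" for i j
      by (rule measurable_compose[OF measurable_snd Ym])
    have [measurable]: "(\<lambda>p. fst p $ i) \<in> borel_measurable ((lborel :: (real ^ 'n) measure) \<Otimes>\<^sub>M R)" for i
      by (rule measurable_compose[OF measurable_fst]) (auto intro!: borel_measurable_continuous_onI continuous_intros)
    show ?thesis
      unfolding g_def split_beta inner_vec_def det_def by measurable
  qed
  have fm: "fact CARD('n) * mixed_volume E
      = (\<Sum>J\<in>Pow UNIV. (- 1) ^ (CARD('n) - card J) * measure lebesgue (minkowski_sum J E))"
    by (simp add: mixed_volume_def)
  have "ennreal (fact CARD('n) * mixed_volume E) = (\<integral>\<^sup>+ x. ennreal (P x) \<partial>lborel)"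
    unfolding fm using hP P0 by (simp add: nn_integral_eq_integral has_bochner_integral_iff)
  also have "\<dots> = (\<integral>\<^sup>+ x. (\<integral>\<^sup>+ r. ennreal (g x r) \<partial>R) \<partial>lborel)" by (simp add: P_nn)
  also have "\<dots> = (\<integral>\<^sup>+ r. (\<integral>\<^sup>+ x. ennreal (g x r) \<partial>lborel) \<partial>R)"
    using Fubini'[OF gm] by simp
  also have "\<dots> = (\<integral>\<^sup>+ r. ennreal (sqrt (2 * pi) ^ CARD('n)) * ennreal \<bar>det (Y r)\<bar> \<partial>R)"
    unfolding g_def nn_integral_gauss_linear ..
  also have "\<dots> = ennreal (sqrt (2 * pi) ^ CARD('n)) * (\<integral>\<^sup>+ r. ennreal \<bar>det (Y r)\<bar> \<partial>R)"
    unfolding det_def by (intro nn_integral_cmult) (use Ym in measurable)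
  finally show ?thesis .
qed

section \<open>The area formula\<close>

text \<open>Turns continuity of the matrix entries into continuity in the operator norm, the form in
  which local injectivity takes it.\<close>

lemma onorm_matrix_diff_small:
  fixes J :: "'x::metric_space \<Rightarrow> real ^ 'n::finite ^ 'm::finite"
  assumes U: "open U" "a \<in> U" and cont: "\<And>i j. continuous_on U (\<lambda>x. J x $ i $ j)" and e: "e > 0"
  shows "\<exists>\<delta>>0. \<forall>x. dist a x < \<delta> \<longrightarrow> onorm (\<lambda>v. J x *v v - J a *v v) < e"
proof -
  \<comment> \<open>Entries below \<open>B\<close> give an operator norm of at most
    \<open>e / 2\<close>; the factor 2 leaves room for the strict inequality.\<close>
  define B where "B = e / (2 * (real CARD('m) * real CARD('n)))"
  have B: "B > 0" using e by (simp add: B_def)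
  have "eventually (\<lambda>x. \<bar>J x $ i $ j - J a $ i $ j\<bar> < B) (at a)" for i j
  proof -
    have "isCont (\<lambda>x. J x $ i $ j) a"
      using cont U continuous_on_eq_continuous_at by blast
    then have "((\<lambda>x. J x $ i $ j) \<longlongrightarrow> J a $ i $ j) (at a)" by (simp add: isCont_def)
    then show ?thesis using B by (auto simp: tendsto_iff dist_real_def)
  qed
  then have "eventually (\<lambda>x. \<forall>i j. \<bar>J x $ i $ j - J a $ i $ j\<bar> < B) (at a)"
    by (simp add: eventually_all_finite)
  then obtain \<delta> where \<delta>: "\<delta> > 0" "\<And>x. x \<noteq> a \<Longrightarrow> dist x a < \<delta> \<Longrightarrow> \<forall>i j. \<bar>J x $ i $ j - J a $ i $ j\<bar> < B"
    by (auto simp: eventually_at)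
  have "onorm (\<lambda>v. J x *v v - J a *v v) < e" if "dist a x < \<delta>" for x
  proof -
    have "\<bar>(J x - J a) $ i $ j\<bar> \<le> B" for i j
      using \<delta>(2)[of x] that B by (cases "x = a") (auto simp: dist_commute less_imp_le)
    then have "onorm ((*v) (J x - J a)) \<le> real CARD('m) * real CARD('n) * B"
      by (rule onorm_le_matrix_component)
    also have "\<dots> = e / 2" by (simp add: B_def)
    finally have "onorm ((*v) (J x - J a)) < e" using e by simp
    moreover have "(\<lambda>v. J x *v v - J a *v v) = (*v) (J x - J a)"
      by (simp add: fun_eq_iff matrix_vector_mult_diff_rdistrib)
    ultimately show ?thesis by simp
  qed
  then show ?thesis using \<delta>(1) by blast
qed

lemma locally_injective:
  fixes G :: "real ^ 'n::finite \<Rightarrow> real ^ 'n"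
  assumes U: "open U" "a \<in> U" and der: "\<And>x. x \<in> U \<Longrightarrow> (G has_derivative (\<lambda>h. J x *v h)) (at x)"
    and cont: "\<And>i j. continuous_on U (\<lambda>x. J x $ i $ j)" and det: "det (J a) \<noteq> 0"
  obtains r where "r > 0" "ball a r \<subseteq> U" "inj_on G (ball a r)"
proof -
  have "invertible (J a)" using det by (simp add: invertible_det_nz)
  then obtain A' where inv: "A' ** J a = mat 1" by (auto simp: invertible_def)
  show ?thesis
  proof (rule has_derivative_locally_injective[of a U "(*v) A'" "\<lambda>x h. J x *v h" G])
    show "(*v) A' \<circ> (*v) (J a) = id"
      by (simp add: fun_eq_iff matrix_vector_mul_assoc inv)
    show "\<exists>d>0. \<forall>x. dist a x < d \<longrightarrow> onorm (\<lambda>v. J x *v v - J a *v v) < e" if "e > 0" for e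
      by (rule onorm_matrix_diff_small[OF U cont that])
  qed (use U der that in auto)
qed

lemma emeasure_count_space_inj_preimage:
  assumes "inj_on G P"
  shows "emeasure (count_space UNIV) {x \<in> P. G x = y} = indicator (G ` P) y"
proof (cases "y \<in> G ` P")
  case True
  then obtain x where x: "x \<in> P" "G x = y" by blast
  then have "{x \<in> P. G x = y} = {x}" using assms by (auto simp: inj_on_def)
  then show ?thesis using True by simp
next
  case False
  then have e: "{x \<in> P. G x = y} = {}" by blast
  show ?thesis unfolding e using False by simp
qed

text \<open>The regular part of the domain is cut into countably many pieces on which the
  map is injective.\<close>

theorem nn_integral_card_preimage:
  fixes G :: "real ^ 'n::finite \<Rightarrow> real ^ 'n" and g :: "real ^ 'n \<Rightarrow> real"
  assumes U: "open U" and der: "\<And>x. x \<in> U \<Longrightarrow> (G has_derivative (\<lambda>h. J x *v h)) (at x)"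
    and cont: "\<And>i j. continuous_on U (\<lambda>x. J x $ i $ j)"
    and BC: "\<And>l::nat. compact (C l)" "B = (\<Union>l. C l)" and B: "B \<subseteq> U"
    and g: "integrable lborel g" "\<And>x. g x \<ge> 0" "continuous_on UNIV g"
  shows "(\<integral>\<^sup>+ y. ennreal (g y) * emeasure (count_space UNIV) {x \<in> B. G x = y \<and> det (J x) \<noteq> 0} \<partial>lborel)
    = (\<integral>\<^sup>+ x\<in>B. ennreal (\<bar>det (J x)\<bar> * g (G x)) \<partial>lborel)"
proof -
  have detc: "continuous_on U (\<lambda>x. det (J x))"
    unfolding det_def by (intro continuous_intros cont)
  define R where "R = {x \<in> U. det (J x) \<noteq> 0}"
  have "R = U \<inter> (\<lambda>x. det (J x)) -` (- {0})" by (auto simp: R_def)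
  then have Ro: "open R" using continuous_open_preimage[OF detc U, of "- {0}"] by (simp add: open_Compl)
  have contR: "continuous_on R (\<lambda>x. J x $ i $ j)" for i j
    by (rule continuous_on_subset[OF cont]) (auto simp: R_def)
  have derR: "(G has_derivative (\<lambda>h. J x *v h)) (at x)" and detR: "det (J x) \<noteq> 0" if "x \<in> R" for x
    using that der by (auto simp: R_def)
  \<comment> \<open>Balls of injectivity around the regular points; by Lindelof countably many of
    them cover the regular set.\<close>
  define \<F> where "\<F> = {ball a r |a r. a \<in> R \<and> r > 0 \<and> ball a r \<subseteq> R \<and> inj_on G (ball a r)}"
  have cover: "\<Union>\<F> = R"
  proof
    show "\<Union>\<F> \<subseteq> R" by (auto simp: \<F>_def)
    show "R \<subseteq> \<Union>\<F>"
    proof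
      fix a assume a: "a \<in> R"
      obtain r where "r > 0" "ball a r \<subseteq> R" "inj_on G (ball a r)"
        by (rule locally_injective[OF Ro a derR contR detR[OF a]])
      then have "ball a r \<in> \<F>" "a \<in> ball a r" using a by (auto simp: \<F>_def)
      then show "a \<in> \<Union>\<F>" by blast
    qed
  qed
  obtain \<F>' where F': "\<F>' \<subseteq> \<F>" "countable \<F>'" "\<Union>\<F>' = \<Union>\<F>"
    by (rule Lindelof[of \<F>]) (auto simp: \<F>_def)
  \<comment> \<open>The empty set is added because an enumeration by all natural numbers needs a
    nonempty range.\<close>
  define W where "W = from_nat_into (insert {} \<F>')"
  have rW: "range W = insert {} \<F>'" using F'(2) by (simp add: W_def range_from_nat_into)
  have Wopen: "open (W k)" and Winj: "inj_on G (W k)" and WR: "W k \<subseteq> R" for k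
  proof -
    have "W k \<in> range W" by (rule rangeI)
    then have "W k \<in> insert {} \<F>'" unfolding rW .
    then have "W k \<in> insert {} \<F>" using F'(1) by blast
    then show "open (W k)" "inj_on G (W k)" "W k \<subseteq> R" by (auto simp: \<F>_def)
  qed
  have WU: "(\<Union>k. W k) = R" using rW F'(3) cover by simp
  define P where "P k = B \<inter> W k \<inter> (- (\<Union>l<k. W l))" for k
  have Pinj: "inj_on G (P k)" for k using Winj[of k] by (rule inj_on_subset) (auto simp: P_def)
  have PU: "P k \<subseteq> U" "P k \<subseteq> R" for k using WR[of k] by (auto simp: P_def R_def)
  have Pd: "disjoint_family P"
    unfolding disjoint_family_on_def
  proof (intro ballI impI)
    fix k l :: nat assume "k \<noteq> l"
    then show "P k \<inter> P l = {}" by (cases "k < l") (auto simp: P_def not_less le_less)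
  qed
  have PB: "(\<Union>k. P k) = B \<inter> R"
  proof
    show "(\<Union>k. P k) \<subseteq> B \<inter> R" using WU by (auto simp: P_def)
    show "B \<inter> R \<subseteq> (\<Union>k. P k)"
    proof
      fix x assume x: "x \<in> B \<inter> R"
      then have ex: "\<exists>k. x \<in> W k" using WU by blast
      define k where "k = (LEAST k. x \<in> W k)"
      have "x \<in> W k" unfolding k_def using ex by (rule LeastI_ex)
      moreover have "x \<notin> W l" if "l < k" for l using not_less_Least[of l] that by (auto simp: k_def)
      ultimately show "x \<in> (\<Union>k. P k)" using x by (auto simp: P_def)
    qed
  qed
  \<comment> \<open>Each piece is a countable union of compact sets, as the change of variables
    requires: \<open>B\<close> and the open \<open>W k\<close> are such unions, and removing the
    earlier balls intersects with a closed set.\<close>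
  have Pf: "\<exists>F :: nat \<Rightarrow> (real ^ 'n) set. (\<forall>n. compact (F n)) \<and> P k = (\<Union>n. F n)" for k
  proof -
    obtain D where D: "\<And>n::nat. compact (D n)" "(\<Union>n. D n) = W k"
      using open_Union_compact_subsets[OF Wopen[of k]] by metis
    have cl: "closed (- (\<Union>l<k. W l))" using Wopen by (intro closed_Compl open_UN) auto
    define F where "F n = C (fst (prod_decode n)) \<inter> D (snd (prod_decode n)) \<inter> (- (\<Union>l<k. W l))" for n
    have "P k = (\<Union>p. C (fst p) \<inter> D (snd p) \<inter> (- (\<Union>l<k. W l)))"
      unfolding P_def BC(2) D(2)[symmetric] by auto
    also have "\<dots> = (\<Union>n. F n)"
      unfolding F_def by (metis (mono_tags, lifting) SUP_cong image_image surj_prod_decode)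
    finally have "P k = (\<Union>n. F n)" .
    moreover have "compact (F n)" for n
      unfolding F_def by (intro compact_Int_closed[OF _ cl] compact_Int BC(1) D(1))
    ultimately show ?thesis by blast
  qed
  have cv: "(\<integral>\<^sup>+ y\<in>G ` P k. ennreal (g y) \<partial>lborel) = (\<integral>\<^sup>+ x\<in>P k. ennreal (\<bar>det (J x)\<bar> * g (G x)) \<partial>lborel)"
    and GP: "G ` P k \<in> sets borel" and PS: "P k \<in> sets borel" for k
  proof -
    obtain F :: "nat \<Rightarrow> (real ^ 'n) set" where F: "\<And>n. compact (F n)" "P k = (\<Union>n. F n)"
      using Pf[of k] by auto
    have d: "(G has_derivative (\<lambda>h. J x *v h)) (at x within P k)" if "x \<in> P k" for x
      using der[of x] PU(1)[of k] that by (auto intro: has_derivative_at_withinI)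
    show "(\<integral>\<^sup>+ y\<in>G ` P k. ennreal (g y) \<partial>lborel) = (\<integral>\<^sup>+ x\<in>P k. ennreal (\<bar>det (J x)\<bar> * g (G x)) \<partial>lborel)"
      by (rule nn_integral_change_of_variables(1)[OF F d Pinj g(1,2)])
    show "G ` P k \<in> sets borel" by (rule nn_integral_change_of_variables(2)[OF F d Pinj g(1,2)])
    show "P k \<in> sets borel"
      unfolding F(2) by (rule sets.countable_UN) (use F(1) in \<open>auto intro: borel_closed compact_imp_closed\<close>)
  qed
  have gm: "g \<in> borel_measurable borel" using g(1) by simp
  have Gc: "continuous_on U G"
    by (meson continuous_at_imp_continuous_on der has_derivative_continuous)
  define h where "h x = ennreal (\<bar>det (J x)\<bar> * g (G x))" for x
  \<comment> \<open>Measurability is obtained on the pieces, where the Jacobian and \<open>G\<close>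
    are continuous; outside \<open>U\<close> nothing is known about them.\<close>
  have hm: "(\<lambda>x. h x * indicator (P k) x) \<in> borel_measurable borel" for k
  proof -
    have "continuous_on (P k) (\<lambda>x. \<bar>det (J x)\<bar> * g (G x))"
      by (intro continuous_intros continuous_on_subset[OF detc PU(1)]
          continuous_on_compose2[OF g(3) continuous_on_subset[OF Gc PU(1)]]) auto
    then have "(\<lambda>x. indicator (P k) x *\<^sub>R (\<bar>det (J x)\<bar> * g (G x))) \<in> borel_measurable borel"
      using PS by (intro borel_measurable_continuous_on_indicator)
    then have "(\<lambda>x. ennreal (indicator (P k) x *\<^sub>R (\<bar>det (J x)\<bar> * g (G x)))) \<in> borel_measurable borel" by measurable
    also have "(\<lambda>x. ennreal (indicator (P k) x *\<^sub>R (\<bar>det (J x)\<bar> * g (G x)))) = (\<lambda>x. h x * indicator (P k) x)"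
      by (auto simp: h_def indicator_def fun_eq_iff)
    finally show ?thesis .
  qed
  have count: "emeasure (count_space UNIV) {x \<in> B. G x = y \<and> det (J x) \<noteq> 0} = (\<Sum>k. indicator (G ` P k) y)" for y
  proof -
    have "{x \<in> B. G x = y \<and> det (J x) \<noteq> 0} = (\<Union>k. {x \<in> P k. G x = y})"
      using PB B by (auto simp: R_def set_eq_iff)
    also have "emeasure (count_space UNIV) \<dots> = (\<Sum>k. emeasure (count_space UNIV) {x \<in> P k. G x = y})"
      using Pd by (intro suminf_emeasure[symmetric]) (auto simp: disjoint_family_on_def)
    also have "\<dots> = (\<Sum>k. indicator (G ` P k) y)"
      by (simp add: emeasure_count_space_inj_preimage[OF Pinj])
    finally show ?thesis .
  qed
  have "(\<integral>\<^sup>+ y. ennreal (g y) * emeasure (count_space UNIV) {x \<in> B. G x = y \<and> det (J x) \<noteq> 0} \<partial>lborel)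
      = (\<integral>\<^sup>+ y. (\<Sum>k. ennreal (g y) * indicator (G ` P k) y) \<partial>lborel)"
    unfolding count by (simp add: ennreal_suminf_cmult)
  also have "\<dots> = (\<Sum>k. \<integral>\<^sup>+ y\<in>G ` P k. ennreal (g y) \<partial>lborel)"
    using GP gm by (intro nn_integral_suminf borel_measurable_times_ennreal borel_measurable_indicator) auto
  also have "\<dots> = (\<Sum>k. \<integral>\<^sup>+ x\<in>P k. h x \<partial>lborel)" unfolding cv h_def ..
  also have "\<dots> = (\<integral>\<^sup>+ x. (\<Sum>k. h x * indicator (P k) x) \<partial>lborel)"
    using hm by (intro nn_integral_suminf[symmetric]) simp
  also have "\<dots> = (\<integral>\<^sup>+ x. h x * indicator B x \<partial>lborel)"
  proof (rule nn_integral_cong)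
    fix x
    have "(\<Sum>k. h x * indicator (P k) x) = h x * indicator (B \<inter> R) x"
      using suminf_indicator[OF Pd, of x] by (simp add: ennreal_suminf_cmult PB)
    \<comment> \<open>On the rest of \<open>B\<close> the Jacobian determinant is 0, and so is
      \<open>h\<close>.\<close>
    also have "\<dots> = h x * indicator B x"
      using B by (auto simp: h_def R_def indicator_def)
    finally show "(\<Sum>k. h x * indicator (P k) x) = h x * indicator B x" .
  qed
  finally show ?thesis by (simp add: h_def)
qed

section \<open>Measurability of counting functions\<close>

lemma sets_ex_compact:
  fixes u :: "'c \<Rightarrow> 'x::{metric_space, second_countable_topology} \<Rightarrow> real"
  assumes K: "compact K" and um: "\<And>\<theta>. (\<lambda>c. u c \<theta>) \<in> borel_measurable M"
    and uc: "\<And>c. c \<in> space M \<Longrightarrow> continuous_on K (u c)"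
  shows "{c \<in> space M. \<exists>\<theta>\<in>K. u c \<theta> \<le> 0} \<in> sets M"
proof -
  obtain D where D: "countable D" "D \<subseteq> K" "K \<subseteq> closure D" by (rule separable)
  \<comment> \<open>On a compact set a continuous function has a value at most 0 as soon as it takes
    values below every \<open>1 / Suc p\<close>, and by continuity these can be looked for on a
    countable dense subset.\<close>
  have "{c \<in> space M. \<exists>\<theta>\<in>K. u c \<theta> \<le> 0}
      = (\<Inter>p::nat. \<Union>\<theta>\<in>D. {c \<in> space M. u c \<theta> < 1 / real (Suc p)}) \<inter> space M"
  proof (intro set_eqI iffI)
    fix c assume "c \<in> {c \<in> space M. \<exists>\<theta>\<in>K. u c \<theta> \<le> 0}"
    then obtain \<theta> where c: "c \<in> space M" and \<theta>: "\<theta> \<in> K" "u c \<theta> \<le> 0" by blast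
    have "\<exists>\<theta>'\<in>D. u c \<theta>' < 1 / real (Suc p)" for p
    proof -
      obtain \<delta> where \<delta>: "\<delta> > 0" "\<And>x. x \<in> K \<Longrightarrow> dist x \<theta> < \<delta> \<Longrightarrow> dist (u c x) (u c \<theta>) < 1 / real (Suc p)"
        using uc[OF c] \<theta>(1) unfolding continuous_on_iff by (metis of_nat_0_less_iff zero_less_Suc zero_less_divide_1_iff)
      obtain \<theta>' where \<theta>': "\<theta>' \<in> D" "dist \<theta>' \<theta> < \<delta>"
        using D(3) \<theta>(1) \<delta>(1) by (meson closure_approachable subsetD)
      then have "dist (u c \<theta>') (u c \<theta>) < 1 / real (Suc p)" using \<delta>(2) D(2) by blast
      then have "u c \<theta>' < 1 / real (Suc p)" using \<theta>(2) by (simp add: dist_real_def)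
      then show ?thesis using \<theta>'(1) by blast
    qed
    then show "c \<in> (\<Inter>p::nat. \<Union>\<theta>\<in>D. {c \<in> space M. u c \<theta> < 1 / real (Suc p)}) \<inter> space M"
      using c by auto
  next
    fix c assume c': "c \<in> (\<Inter>p::nat. \<Union>\<theta>\<in>D. {c \<in> space M. u c \<theta> < 1 / real (Suc p)}) \<inter> space M"
    then have c: "c \<in> space M" and ex: "\<And>p::nat. \<exists>\<theta>\<in>D. u c \<theta> < 1 / real (Suc p)" by auto
    have "K \<noteq> {}" using ex[of 0] D(2) by blast
    then obtain \<theta> where \<theta>: "\<theta> \<in> K" "\<And>x. x \<in> K \<Longrightarrow> u c \<theta> \<le> u c x"
      using continuous_attains_inf[OF K _ uc[OF c]] by blast
    have "u c \<theta> < 1 / real (Suc p)" for p using ex[of p] D(2) \<theta>(2) by (meson le_less_trans subsetD)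
    then have "u c \<theta> \<le> 0" by (meson nat_approx_posE not_le less_asym)
    then show "c \<in> {c \<in> space M. \<exists>\<theta>\<in>K. u c \<theta> \<le> 0}" using c \<theta>(1) by blast
  qed
  also have "\<dots> \<in> sets M"
    using D(1) um by (intro sets.Int sets.countable_INT sets.countable_UN' ballI) (auto intro!: borel_measurable_less)
  finally show ?thesis .
qed

definition dyadic_cell :: "nat \<Rightarrow> int ^ 'n::finite \<Rightarrow> (real ^ 'n) set" where
  "dyadic_cell k q = {x. \<forall>j. of_int (q $ j) \<le> 2 ^ k * x $ j \<and> 2 ^ k * x $ j < of_int (q $ j) + 1}"

lemma dyadic_cell_iff: "x \<in> dyadic_cell k q \<longleftrightarrow> q = (\<chi> j. \<lfloor>2 ^ k * x $ j\<rfloor>)"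
proof -
  have "of_int m \<le> t \<and> t < of_int m + 1 \<longleftrightarrow> m = \<lfloor>t\<rfloor>" for m :: int and t :: real
    using floor_eq_iff[of t m] by auto
  then show ?thesis by (simp add: dyadic_cell_def vec_eq_iff)
qed

text \<open>Half-open boxes can tile the space and are nevertheless countable unions of compact
  sets, the kind of domain that the area formula and the measurability lemmas accept.\<close>

lemma halfopen_box_compact_union:
  "{x :: real ^ 'n::finite. \<forall>j. a $ j \<le> x $ j \<and> x $ j < b $ j} = (\<Union>l::nat. cbox a (\<chi> j. b $ j - 1 / real (Suc l)))"
proof (intro set_eqI iffI)
  fix x assume "x \<in> {x. \<forall>j. a $ j \<le> x $ j \<and> x $ j < b $ j}"
  then have x: "\<And>j. a $ j \<le> x $ j" "\<And>j. x $ j < b $ j" by auto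
  have "\<exists>l. 1 / real (Suc l) < b $ j - x $ j" for j
    using x(2)[of j] by (metis diff_gt_0_iff_gt nat_approx_posE)
  then obtain l where l: "\<And>j. 1 / real (Suc (l j)) < b $ j - x $ j" by metis
  define m where "m = Max (range l)"
  have "x $ j \<le> b $ j - 1 / real (Suc m)" for j
  proof -
    have "l j \<le> m" by (simp add: m_def)
    then have "1 / real (Suc m) \<le> 1 / real (Suc (l j))" by (intro divide_left_mono) auto
    then show ?thesis using l[of j] by linarith
  qed
  then have "x \<in> cbox a (\<chi> j. b $ j - 1 / real (Suc m))" using x by (simp add: mem_box_cart)
  then show "x \<in> (\<Union>l::nat. cbox a (\<chi> j. b $ j - 1 / real (Suc l)))" by blast
next
  fix x assume "x \<in> (\<Union>l::nat. cbox a (\<chi> j. b $ j - 1 / real (Suc l)))"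
  then obtain l :: nat where l: "x \<in> cbox a (\<chi> j. b $ j - 1 / real (Suc l))" by blast
  have "x $ j < b $ j" for j
  proof -
    have "x $ j \<le> b $ j - 1 / real (Suc l)" using l by (simp add: mem_box_cart)
    moreover have "1 / real (Suc l) > 0" by simp
    ultimately show ?thesis by linarith
  qed
  then show "x \<in> {x. \<forall>j. a $ j \<le> x $ j \<and> x $ j < b $ j}" using l by (simp add: mem_box_cart)
qed

lemma dyadic_cell_compact_union: "\<exists>C. (\<forall>l::nat. compact (C l)) \<and> dyadic_cell k q = (\<Union>l. C l)"
proof -
  have "dyadic_cell k q = {x. \<forall>j. (\<chi> j. of_int (q $ j) / 2 ^ k) $ j \<le> x $ j \<and> x $ j < (\<chi> j. (of_int (q $ j) + 1) / 2 ^ k) $ j}"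
    by (simp add: dyadic_cell_def field_simps)
  then show ?thesis unfolding halfopen_box_compact_union by (intro exI conjI allI) auto
qed

text \<open>For each \<open>k\<close> the dyadic cells partition the space. Finitely many points
  fall into different cells once \<open>k\<close> is large, and points from different cells are
  different.\<close>

lemma count_ge_iff_cells:
  fixes A :: "(real ^ 'n::finite) set"
  shows "of_nat p \<le> emeasure (count_space UNIV) A \<longleftrightarrow>
    (\<exists>k F. finite F \<and> card F = p \<and> (\<forall>q\<in>F. A \<inter> dyadic_cell k q \<noteq> {}))"
proof
  assume ge: "of_nat p \<le> emeasure (count_space UNIV) A"
  obtain P where P: "P \<subseteq> A" "finite P" "card P = p"
  proof (cases "finite A")
    case True
    then have "p \<le> card A" using ge by simp
    then show ?thesis using that obtain_subset_with_card_n[of p A] True finite_subset by blast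
  next
    case False
    then show ?thesis using that infinite_arbitrarily_large[of A p] by blast
  qed
  define fl where "fl k x = (\<chi> j. \<lfloor>2 ^ k * x $ j\<rfloor>)" for k :: nat and x :: "real ^ 'n"
  have ev: "eventually (\<lambda>k. fl k x \<noteq> fl k y) sequentially" if "x \<noteq> y" for x y
  proof -
    obtain j where j: "x $ j \<noteq> y $ j" using \<open>x \<noteq> y\<close> unfolding vec_eq_iff by blast
    \<comment> \<open>From this level on the cells are narrower than the distance of
      \<open>x\<close> and \<open>y\<close> in the coordinate \<open>j\<close>.\<close>
    obtain K :: nat where K: "1 / \<bar>x $ j - y $ j\<bar> < 2 ^ K"
      using real_arch_pow[of 2 "1 / \<bar>x $ j - y $ j\<bar>"] by auto
    have "fl k x \<noteq> fl k y" if "k \<ge> K" for k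
    proof
      assume "fl k x = fl k y"
      then have "\<lfloor>2 ^ k * x $ j\<rfloor> = \<lfloor>2 ^ k * y $ j\<rfloor>" by (simp add: fl_def vec_eq_iff)
      then have "\<bar>2 ^ k * x $ j - 2 ^ k * y $ j\<bar> < 1" by linarith
      then have "2 ^ k * \<bar>x $ j - y $ j\<bar> < 1" by (simp add: abs_mult flip: right_diff_distrib)
      moreover have "1 < 2 ^ k * \<bar>x $ j - y $ j\<bar>"
      proof -
        have "(2::real) ^ K \<le> 2 ^ k" using that by (intro power_increasing) auto
        then have "1 / \<bar>x $ j - y $ j\<bar> < 2 ^ k" using K by linarith
        then show ?thesis using j by (simp add: divide_less_eq)
      qed
      ultimately show False by simp
    qed
    then show ?thesis by (auto simp: eventually_sequentially)
  qed
  have "eventually (\<lambda>k. \<forall>x\<in>P. \<forall>y\<in>P. x \<noteq> y \<longrightarrow> fl k x \<noteq> fl k y) sequentially"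
    using P(2) ev by (intro eventually_ball_finite ballI) (auto intro: always_eventually)
  then obtain k where k: "\<forall>x\<in>P. \<forall>y\<in>P. x \<noteq> y \<longrightarrow> fl k x \<noteq> fl k y"
    by (auto simp: eventually_sequentially)
  then have "inj_on (fl k) P" by (auto simp: inj_on_def)
  then have "card (fl k ` P) = p" using P by (simp add: card_image)
  moreover have "A \<inter> dyadic_cell k q \<noteq> {}" if "q \<in> fl k ` P" for q
    using that P(1) by (auto simp: dyadic_cell_iff fl_def)
  ultimately show "\<exists>k F. finite F \<and> card F = p \<and> (\<forall>q\<in>F. A \<inter> dyadic_cell k q \<noteq> {})"
    using P(2) by blast
next
  assume "\<exists>k F. finite F \<and> card F = p \<and> (\<forall>q\<in>F. A \<inter> dyadic_cell k q \<noteq> {})"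
  then obtain k F where F: "finite F" "card F = p" "\<And>q. q \<in> F \<Longrightarrow> A \<inter> dyadic_cell k q \<noteq> {}" by blast
  define s where "s q = (SOME x. x \<in> A \<inter> dyadic_cell k q)" for q
  have s: "s q \<in> A \<inter> dyadic_cell k q" if "q \<in> F" for q
    unfolding s_def by (rule someI_ex) (use F(3)[OF that] in blast)
  have "inj_on s F"
  proof (rule inj_onI)
    fix q r assume "q \<in> F" "r \<in> F" "s q = s r"
    then show "q = r" using s[of q] s[of r] by (simp add: dyadic_cell_iff)
  qed
  then have "card (s ` F) = p" using F by (simp add: card_image)
  then have "of_nat p = emeasure (count_space UNIV) (s ` F)" using F by simp
  also have "\<dots> \<le> emeasure (count_space UNIV) A" using s by (intro emeasure_mono) auto
  finally show "of_nat p \<le> emeasure (count_space UNIV) A" .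
qed

text \<open>Having at least \<open>p\<close> points is a countable union, over levels and finite
  sets of cells, of finite intersections of hitting events; each cell is a countable union of
  compact sets.\<close>

lemma measurable_count:
  fixes A :: "'c \<Rightarrow> (real ^ 'n::finite) set"
  assumes hit: "\<And>K. compact K \<Longrightarrow> {c \<in> space M. A c \<inter> K \<noteq> {}} \<in> sets M"
  shows "(\<lambda>c. emeasure (count_space UNIV) (A c)) \<in> borel_measurable M"
proof -
  have cell: "{c \<in> space M. A c \<inter> dyadic_cell k q \<noteq> {}} \<in> sets M" for k q
  proof -
    obtain C where C: "\<forall>l::nat. compact (C l)" "dyadic_cell k q = (\<Union>l. C l)"
      using dyadic_cell_compact_union by blast
    have "{c \<in> space M. A c \<inter> dyadic_cell k q \<noteq> {}} = (\<Union>l. {c \<in> space M. A c \<inter> C l \<noteq> {}})"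
      unfolding C(2) by blast
    also have "\<dots> \<in> sets M" using C(1) hit by (intro sets.countable_UN) auto
    finally show ?thesis .
  qed
  have ge: "{c \<in> space M. of_nat p \<le> emeasure (count_space UNIV) (A c)} \<in> sets M" for p
  proof -
    have "{c \<in> space M. of_nat p \<le> emeasure (count_space UNIV) (A c)}
        = (\<Union>k. \<Union>F\<in>{F. finite F \<and> card F = p}. {c \<in> space M. \<forall>q\<in>F. A c \<inter> dyadic_cell k q \<noteq> {}})"
      unfolding count_ge_iff_cells by blast
    also have "\<dots> \<in> sets M"
    proof (rule sets.countable_UN, rule image_subsetI)
      fix k :: nat
      have "countable {F :: (int ^ 'n) set. finite F \<and> card F = p}"
        by (rule countable_subset[OF _ countable_Collect_finite]) auto
      then show "(\<Union>F\<in>{F. finite F \<and> card F = p}. {c \<in> space M. \<forall>q\<in>F. A c \<inter> dyadic_cell k q \<noteq> {}}) \<in> sets M"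
      proof (rule sets.countable_UN'')
        fix F :: "(int ^ 'n) set" assume "F \<in> {F. finite F \<and> card F = p}"
        then show "{c \<in> space M. \<forall>q\<in>F. A c \<inter> dyadic_cell k q \<noteq> {}} \<in> sets M"
          using cell by (intro sets.sets_Collect_finite_All) auto
      qed
    qed
    finally show ?thesis .
  qed
  \<comment> \<open>The count is recovered from its superlevel sets; the supremum also yields the
    value \<open>\<infinity>\<close> for infinite sets.\<close>
  have "emeasure (count_space UNIV) (A c)
      = (SUP p. of_nat p * indicator {c \<in> space M. of_nat p \<le> emeasure (count_space UNIV) (A c)} c)"
    if "c \<in> space M" for c
  proof (rule antisym)
    show "(SUP p. of_nat p * indicator {c \<in> space M. of_nat p \<le> emeasure (count_space UNIV) (A c)} c)
        \<le> emeasure (count_space UNIV) (A c)"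
      by (rule SUP_least) (auto simp: indicator_def)
    show "emeasure (count_space UNIV) (A c)
        \<le> (SUP p. of_nat p * indicator {c \<in> space M. of_nat p \<le> emeasure (count_space UNIV) (A c)} c)"
    proof (cases "finite (A c)")
      case True
      then show ?thesis using that by (intro SUP_upper2[of "card (A c)"]) auto
    next
      case False
      then show ?thesis using that by (simp add: ennreal_SUP_of_nat_eq_top)
    qed
  qed
  moreover have "(\<lambda>c. SUP p. of_nat p * indicator {c \<in> space M. of_nat p \<le> emeasure (count_space UNIV) (A c)} c :: ennreal)
      \<in> borel_measurable M"
    using ge by (intro borel_measurable_SUP borel_measurable_times_ennreal borel_measurable_indicator) auto
  ultimately show ?thesis by (subst measurable_cong)
qed

section \<open>Trigonometric polynomials\<close>

definition pairing :: "int ^ 'n::finite \<Rightarrow> real ^ 'n \<Rightarrow> real" where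
  "pairing \<mu> \<theta> = (\<Sum>j\<in>UNIV. real_of_int (\<mu> $ j) * \<theta> $ j)"

definition expt :: "real ^ 'n::finite \<Rightarrow> complex ^ 'n" where
  "expt \<theta> = (\<chi> j. cis (\<theta> $ j))"

lemma expt_in_torus[simp]: "expt \<theta> \<in> torus"
  by (simp add: expt_def torus_def)

lemma torus_imp_expt:
  assumes "z \<in> torus"
  shows "\<exists>\<theta>. z = expt \<theta>"
proof
  show "z = expt (\<chi> j. Arg (z $ j))"
    using assms by (simp add: expt_def torus_def vec_eq_iff cis_Arg sgn_eq)
      (metis cis_Arg div_by_1 norm_zero of_real_1 sgn_eq zero_neq_one)
qed

lemma cis_sum: "finite A \<Longrightarrow> cis (\<Sum>x\<in>A. f x) = (\<Prod>x\<in>A. cis (f x))"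
  by (induction A rule: finite_induct) (simp_all add: cis_mult[symmetric])

lemma laurent_monomial_expt: "laurent_monomial \<mu> (expt \<theta>) = cis (pairing \<mu> \<theta>)"
proof -
  have "cis t powi k = cis (of_int k * t)" for t k
    by (rule cis_power_int)
  then show ?thesis
    by (simp add: laurent_monomial_def expt_def pairing_def cis_sum)
qed

lemma pairing_diff_left: "pairing (\<mu> - \<nu>) x = pairing \<mu> x - pairing \<nu> x"
  by (simp add: pairing_def sum_subtractf algebra_simps)

lemma pairing_uminus_left: "pairing (- \<mu>) x = - pairing \<mu> x"
  by (simp add: pairing_def sum_negf)

lemma pairing_zero[simp]: "pairing 0 x = 0" "pairing \<mu> 0 = 0"
  by (simp_all add: pairing_def)

lemma pairing_add_right: "pairing \<mu> (x + y) = pairing \<mu> x + pairing \<mu> y"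
  by (simp add: pairing_def sum.distrib algebra_simps)

lemma continuous_on_pairing: "continuous_on S (pairing \<mu>)"
  unfolding pairing_def[abs_def] by (intro continuous_intros)

lemma continuous_on_expt: "continuous_on S expt"
  unfolding expt_def[abs_def] by (intro continuous_intros)

lemma measurable_expt[measurable]: "expt \<in> borel_measurable borel"
  by (intro borel_measurable_continuous_onI continuous_on_expt)

definition unif_box :: "(real ^ 'n::finite) measure" where
  "unif_box = uniform_measure lborel (cbox 0 (\<chi> j. 2 * pi))"

lemma haar_torus_expt: "haar_torus = distr unif_box borel expt"
  unfolding haar_torus_def unif_box_def expt_def[abs_def] ..

lemma sets_unif_box[simp, measurable_cong]: "sets unif_box = sets borel"
  and space_unif_box[simp]: "space unif_box = UNIV"
  by (simp_all add: unif_box_def)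

lemma emeasure_box_2pi: "emeasure lborel (cbox (0 :: real ^ 'n::finite) (\<chi> j. 2 * pi)) = ennreal ((2 * pi) ^ CARD('n))"
proof -
  have "(\<chi> j. 2 * pi :: real ^ 'n) \<bullet> b = 2 * pi" if "b \<in> Basis" for b
    using that by (auto simp: Basis_vec_def inner_axis)
  then show ?thesis by (simp add: emeasure_lborel_cbox)
qed

lemma prob_space_unif_box: "prob_space (unif_box :: (real ^ 'n::finite) measure)"
  unfolding unif_box_def by (rule prob_space_uniform_measure) (simp_all add: emeasure_box_2pi)

interpretation unif_box: prob_space unif_box by (rule prob_space_unif_box)

lemma integral_haar_torus:
  fixes f :: "complex ^ 'n::finite \<Rightarrow> 'b::{banach, second_countable_topology}"
  assumes "(\<lambda>\<theta>. f (expt \<theta>)) \<in> borel_measurable borel" "f \<in> borel_measurable borel"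
  shows "(\<integral>z. f z \<partial>haar_torus) = (\<integral>\<theta>. f (expt \<theta>) \<partial>unif_box)"
  unfolding haar_torus_expt using assms by (intro integral_distr) auto

section \<open>Orthogonality of the characters\<close>

lemma integral_cis_period:
  fixes k :: int
  shows "(LINT t:{0..2 * pi}|lborel. cis (of_int k * t)) = (if k = 0 then 2 * pi else 0)"
proof (cases "k = 0")
  case True
  then show ?thesis by (simp add: set_lebesgue_integral_def cis_zero) (simp add: scaleR_conv_of_real)
next
  case False
  define c where "c = 1 / (\<i> * of_int k)"
  have c: "of_int k * (\<i> * w) * c = w" for w using False by (simp add: c_def field_simps)
  let ?F = "\<lambda>t. cis (of_int k * t) * c"
  have "(?F has_vector_derivative cis (of_int k * t)) (at t within {0..2 * pi})" for t
  proof -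
    have "((\<lambda>t. cis (of_int k * t)) has_vector_derivative (of_int k * (\<i> * cis (of_int k * t)))) (at t within {0..2 * pi})"
      unfolding cis_conv_exp
      by (rule has_vector_derivative_eq_rhs)
        (rule has_vector_derivative_real_field derivative_eq_intros refl | simp)+
    from has_vector_derivative_mult_left[OF this, of c] show ?thesis by (simp only: c)
  qed
  then have "has_bochner_integral lborel (\<lambda>t. indicator {0..2 * pi} t *\<^sub>R cis (of_int k * t)) (?F (2 * pi) - ?F 0)"
    by (intro has_bochner_integral_FTC_Icc) (auto intro!: continuous_intros)
  moreover have "cis (of_int k * (2 * pi)) = 1"
    using cis_multiple_2pi[of "of_int k"] by (simp add: mult_ac)
  ultimately show ?thesis using False
    by (simp add: has_bochner_integral_iff set_lebesgue_integral_def)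
qed

lemma integral_cis_pairing:
  fixes \<mu> :: "int ^ 'n::finite"
  shows "integrable unif_box (\<lambda>\<theta>. cis (pairing \<mu> \<theta>))"
    and "(\<integral>\<theta>. cis (pairing \<mu> \<theta>) \<partial>unif_box) = (if \<mu> = 0 then 1 else 0)"
proof -
  have m: "(\<lambda>\<theta>. cis (pairing \<mu> \<theta>)) \<in> borel_measurable borel"
    by (intro borel_measurable_continuous_onI continuous_intros continuous_on_pairing)
  then show "integrable unif_box (\<lambda>\<theta>. cis (pairing \<mu> \<theta>))"
    by (intro unif_box.integrable_const_bound[of _ 1]) auto
  let ?B = "cbox (0 :: real ^ 'n) (\<chi> j. 2 * pi)"
  \<comment> \<open>Lebesgue measure factorizes over the vectors of \<open>Basis\<close>;
    \<open>?e\<close> recovers the coordinate that belongs to such a vector.\<close>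
  let ?e = "\<lambda>b :: real ^ 'n. THE k. b = axis k (1::real)"
  have axis[simp]: "(THE k'. axis k (1::real) = axis k' 1) = k" for k :: 'n
    by (rule the_equality) (auto simp: axis_eq_axis)
  define g where "g b t = indicator {0..2 * pi} t *\<^sub>R cis (of_int (\<mu> $ (?e b)) * t)" for b t
  interpret L: product_sigma_finite "\<lambda>_ :: real ^ 'n. lborel :: real measure" by standard
  have gm[measurable]: "g b \<in> borel_measurable borel" for b
    unfolding g_def by (intro borel_measurable_scaleR borel_measurable_indicator
        borel_measurable_continuous_onI continuous_intros) auto
  have gi: "integrable lborel (g b)" for b
  proof (rule Bochner_Integration.integrable_bound)
    show "integrable lborel (\<lambda>t. indicator {0..2 * pi} t :: real)" by simp
    show "AE t in lborel. norm (g b t) \<le> norm (indicator {0..2 * pi} t :: real)"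
      by (simp add: g_def)
  qed simp
  have basis_prod: "(\<Prod>b\<in>Basis. h b) = (\<Prod>k\<in>UNIV. h (axis k 1))" for h :: "real ^ 'n \<Rightarrow> complex"
  proof -
    have "Basis = (\<lambda>k. axis k (1::real)) ` (UNIV :: 'n set)" by (auto simp: Basis_vec_def)
    moreover have "inj (\<lambda>k::'n. axis k (1::real))" by (auto simp: inj_on_def axis_eq_axis)
    ultimately show ?thesis using prod.reindex[of "\<lambda>k. axis k 1" UNIV h] by (simp add: o_def)
  qed
  have ind: "indicator ?B \<theta> *\<^sub>R cis (pairing \<mu> \<theta>) = (\<Prod>b\<in>Basis. g b (\<theta> \<bullet> b))" for \<theta>
  proof -
    have "(\<Prod>b\<in>Basis. g b (\<theta> \<bullet> b)) = (\<Prod>k\<in>UNIV. indicator {0..2 * pi} (\<theta> $ k) *\<^sub>R cis (of_int (\<mu> $ k) * \<theta> $ k))"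
      by (simp add: basis_prod g_def inner_axis)
    also have "\<dots> = (\<Prod>k\<in>UNIV. complex_of_real (indicator {0..2 * pi} (\<theta> $ k))) * cis (pairing \<mu> \<theta>)"
      by (simp add: scaleR_conv_of_real prod.distrib pairing_def cis_sum)
    also have "(\<Prod>k\<in>UNIV. complex_of_real (indicator {0..2 * pi} (\<theta> $ k))) = complex_of_real (indicator ?B \<theta>)"
      by (auto simp: indicator_def mem_box_cart intro!: prod.neutral)
    finally show ?thesis by (simp add: scaleR_conv_of_real)
  qed
  have "(\<integral>\<theta>. indicator ?B \<theta> *\<^sub>R cis (pairing \<mu> \<theta>) \<partial>lborel)
      = (\<integral>f. (\<Prod>b\<in>Basis. g b ((\<Sum>b\<in>Basis. f b *\<^sub>R b) \<bullet> b)) \<partial>PiM (Basis :: (real ^ 'n) set) (\<lambda>_. lborel))"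
    unfolding ind by (subst lborel_eq, subst integral_distr) auto
  also have "\<dots> = (\<integral>f. (\<Prod>b\<in>Basis. g b (f b)) \<partial>PiM (Basis :: (real ^ 'n) set) (\<lambda>_. lborel))"
    by (intro Bochner_Integration.integral_cong prod.cong refl) simp
  also have "\<dots> = (\<Prod>b\<in>(Basis :: (real ^ 'n) set). \<integral>t. g b t \<partial>lborel)"
    by (rule L.product_integral_prod) (auto intro: gi)
  also have "\<dots> = (\<Prod>k\<in>(UNIV :: 'n set). if \<mu> $ k = 0 then 2 * pi else 0)"
  proof -
    have "(\<integral>t. g (axis k 1) t \<partial>lborel) = (if \<mu> $ k = 0 then 2 * pi else 0)" for k
      unfolding integral_cis_period[of "\<mu> $ k", symmetric] by (simp add: g_def set_lebesgue_integral_def)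
    note ig = this
    show ?thesis unfolding basis_prod of_real_prod by (rule prod.cong[OF refl]) (use ig in \<open>auto split: if_splits\<close>)
  qed
  also have "\<dots> = (if \<mu> = 0 then (2 * pi) ^ CARD('n) else 0)"
    by (auto simp: vec_eq_iff)
  finally have I: "(\<integral>\<theta>. indicator ?B \<theta> *\<^sub>R cis (pairing \<mu> \<theta>) \<partial>lborel) = (if \<mu> = 0 then (2 * pi) ^ CARD('n) else 0)" .
  have "(\<integral>\<theta>. cis (pairing \<mu> \<theta>) \<partial>unif_box)
      = (\<integral>\<theta>. indicator ?B \<theta> *\<^sub>R cis (pairing \<mu> \<theta>) \<partial>lborel) /\<^sub>R ((2 * pi) ^ CARD('n))"
  proof -
    have "unif_box = density lborel (\<lambda>\<theta>. ennreal (indicator ?B \<theta> / (2 * pi) ^ CARD('n)))"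
      unfolding unif_box_def uniform_measure_def emeasure_box_2pi
    proof (intro density_cong AE_I2)
      fix \<theta>
      have "ennreal (indicator ?B \<theta> / (2 * pi) ^ CARD('n)) = ennreal (indicator ?B \<theta>) / ennreal ((2 * pi) ^ CARD('n))"
        by (rule divide_ennreal[symmetric]) simp_all
      then show "indicator ?B \<theta> / ennreal ((2 * pi) ^ CARD('n)) = ennreal (indicator ?B \<theta> / (2 * pi) ^ CARD('n))"
        by (simp only: ennreal_indicator)
    qed simp_all
    then have "(\<integral>\<theta>. cis (pairing \<mu> \<theta>) \<partial>unif_box)
        = (\<integral>\<theta>. cis (pairing \<mu> \<theta>) \<partial>density lborel (\<lambda>\<theta>. ennreal (indicator ?B \<theta> / (2 * pi) ^ CARD('n))))"
      by (simp only:)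
    also have "\<dots> = (\<integral>\<theta>. (indicator ?B \<theta> / (2 * pi) ^ CARD('n)) *\<^sub>R cis (pairing \<mu> \<theta>) \<partial>lborel)"
      by (rule integral_density) (use m in simp_all)
    also have "\<dots> = (\<integral>\<theta>. (1 / (2 * pi) ^ CARD('n)) *\<^sub>R (indicator ?B \<theta> *\<^sub>R cis (pairing \<mu> \<theta>)) \<partial>lborel)"
      by (intro Bochner_Integration.integral_cong) auto
    also have "\<dots> = (1 / (2 * pi) ^ CARD('n)) *\<^sub>R (\<integral>\<theta>. indicator ?B \<theta> *\<^sub>R cis (pairing \<mu> \<theta>) \<partial>lborel)"
      by (rule integral_scaleR_right)
    finally show ?thesis by (simp only: inverse_eq_divide)
  qed
  moreover have "complex_of_real ((2 * pi) ^ CARD('n)) /\<^sub>R ((2 * pi) ^ CARD('n)) = 1"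
  proof -
    have "complex_of_real c /\<^sub>R c = 1" if "c \<noteq> 0" for c
      using that by (simp add: scaleR_conv_of_real flip: of_real_mult)
    from this[of "(2 * pi) ^ CARD('n)"] show ?thesis by simp
  qed
  ultimately show "(\<integral>\<theta>. cis (pairing \<mu> \<theta>) \<partial>unif_box) = (if \<mu> = 0 then 1 else 0)"
    unfolding I by (simp del: of_real_power power_mult_distrib of_real_mult)
qed

section \<open>Real trigonometric polynomials and their coefficients\<close>

lemma laurent_monomial_continuous: "continuous_on torus (laurent_monomial \<mu>)"
proof -
  have "z $ j \<noteq> 0" if "z \<in> torus" for z :: "complex ^ 'a" and j
    using that by (auto simp: torus_def dest: spec[of _ j])
  then show ?thesis
    unfolding laurent_monomial_def[abs_def] by (intro continuous_intros) auto
qed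

lemma closed_torus: "closed (torus :: (complex ^ 'n::finite) set)"
proof -
  have "torus = (\<Inter>j. {z :: complex ^ 'n. cmod (z $ j) = 1})" by (auto simp: torus_def)
  moreover have "closed (\<Inter>j. {z :: complex ^ 'n. cmod (z $ j) = 1})"
    by (intro closed_INT ballI closed_Collect_eq continuous_intros)
  ultimately show ?thesis by simp
qed

text \<open>A coefficient family of \<open>f\<close>, read in the angles. It is constrained only on
  \<open>\<Lambda>\<close> and its negatives, so that simple global formulas such as the constant 1
  may serve as coefficients.\<close>

definition coef_of :: "(int ^ 'n::finite) set \<Rightarrow> (complex ^ 'n \<Rightarrow> real) \<Rightarrow> (int ^ 'n \<Rightarrow> complex) \<Rightarrow> bool" where
  "coef_of \<Lambda> f a \<longleftrightarrow> (\<forall>\<mu>\<in>\<Lambda>. a (- \<mu>) = cnj (a \<mu>)) \<and>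
      (\<forall>\<theta>. complex_of_real (f (expt \<theta>)) = (\<Sum>\<mu>\<in>\<Lambda>. a \<mu> * cis (pairing \<mu> \<theta>))) \<and>
      (\<forall>z. z \<notin> torus \<longrightarrow> f z = 0)"

lemma trig_polys_coef: "f \<in> trig_polys \<Lambda> \<longleftrightarrow> (\<exists>a. coef_of \<Lambda> f a)"
proof -
  have "(\<forall>z\<in>torus. complex_of_real (f z) = (\<Sum>\<mu>\<in>\<Lambda>. a \<mu> * laurent_monomial \<mu> z))
      \<longleftrightarrow> (\<forall>\<theta>. complex_of_real (f (expt \<theta>)) = (\<Sum>\<mu>\<in>\<Lambda>. a \<mu> * cis (pairing \<mu> \<theta>)))" for a
    using torus_imp_expt expt_in_torus by (auto simp flip: laurent_monomial_expt)
  note * = this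
  show ?thesis by (simp only: trig_polys_def coef_of_def mem_Collect_eq *) blast
qed

lemma coef_of_lincomb:
  assumes "coef_of \<Lambda> f a" "coef_of \<Lambda> g b"
  shows "coef_of \<Lambda> (\<lambda>z. c * f z + d * g z) (\<lambda>\<mu>. of_real c * a \<mu> + of_real d * b \<mu>)"
  using assms by (auto simp: coef_of_def sum.distrib sum_distrib_left algebra_simps)

lemma trig_polys_lincomb:
  "f \<in> trig_polys \<Lambda> \<Longrightarrow> g \<in> trig_polys \<Lambda> \<Longrightarrow> (\<lambda>z. c * f z + d * g z) \<in> trig_polys \<Lambda>"
  unfolding trig_polys_coef using coef_of_lincomb by blast

lemma trig_polys_zero: "(\<lambda>z. 0) \<in> trig_polys \<Lambda>"
  unfolding trig_polys_coef by (rule exI[of _ "\<lambda>_. 0"]) (simp add: coef_of_def)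

lemma trig_polys_sum:
  assumes "finite K" "\<And>k. k \<in> K \<Longrightarrow> f k \<in> trig_polys \<Lambda>"
  shows "(\<lambda>z. \<Sum>k\<in>K. c k * f k z) \<in> trig_polys \<Lambda>"
  using assms
proof (induction K)
  case (insert k K)
  then show ?case
    using trig_polys_lincomb[of "f k" \<Lambda> "\<lambda>z. \<Sum>k\<in>K. c k * f k z" "c k" 1] by simp
qed (simp add: trig_polys_zero)

lemma trig_polys_eqI:
  assumes "f \<in> trig_polys \<Lambda>" "g \<in> trig_polys \<Lambda>" "\<And>\<theta>. f (expt \<theta>) = g (expt \<theta>)"
  shows "f = g"
proof
  fix z
  show "f z = g z"
  proof (cases "z \<in> torus")
    case True
    then show ?thesis using assms(3) torus_imp_expt by blast
  next
    case False
    then show ?thesis using assms(1,2) by (simp add: trig_polys_def)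
  qed
qed

lemma trig_poly_measurable:
  assumes "f \<in> trig_polys \<Lambda>"
  shows "f \<in> borel_measurable borel"
proof -
  obtain a where a: "\<forall>z\<in>torus. complex_of_real (f z) = (\<Sum>\<mu>\<in>\<Lambda>. a \<mu> * laurent_monomial \<mu> z)"
    and 0: "\<forall>z. z \<notin> torus \<longrightarrow> f z = 0"
    using assms by (auto simp: trig_polys_def)
  have "continuous_on torus (\<lambda>z. Re (\<Sum>\<mu>\<in>\<Lambda>. a \<mu> * laurent_monomial \<mu> z))"
    by (intro continuous_intros laurent_monomial_continuous)
  then have "(\<lambda>z. indicator torus z *\<^sub>R Re (\<Sum>\<mu>\<in>\<Lambda>. a \<mu> * laurent_monomial \<mu> z)) \<in> borel_measurable borel"
    by (intro borel_measurable_continuous_on_indicator) (simp_all add: closed_torus)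
  moreover have "(\<lambda>z. indicator torus z *\<^sub>R Re (\<Sum>\<mu>\<in>\<Lambda>. a \<mu> * laurent_monomial \<mu> z)) = f"
  proof
    fix z
    show "indicator torus z *\<^sub>R Re (\<Sum>\<mu>\<in>\<Lambda>. a \<mu> * laurent_monomial \<mu> z) = f z"
      using a[rule_format, of z, symmetric] 0 by (cases "z \<in> torus") simp_all
  qed
  ultimately show ?thesis by simp
qed

lemma trig_poly_continuous:
  assumes "f \<in> trig_polys \<Lambda>"
  shows "continuous_on S (\<lambda>\<theta>. f (expt \<theta>))"
proof -
  obtain a where "coef_of \<Lambda> f a" using assms by (auto simp: trig_polys_coef)
  then have "f (expt \<theta>) = Re (\<Sum>\<mu>\<in>\<Lambda>. a \<mu> * cis (pairing \<mu> \<theta>))" for \<theta>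
    by (metis Re_complex_of_real coef_of_def)
  then show ?thesis by (simp only:) (intro continuous_intros continuous_on_pairing)
qed

lemma L2_inner_expt:
  assumes "f \<in> trig_polys \<Lambda>" "g \<in> trig_polys \<Lambda>"
  shows "L2_inner f g = (\<integral>\<theta>. f (expt \<theta>) * g (expt \<theta>) \<partial>unif_box)"
proof -
  note [measurable] = trig_poly_measurable[OF assms(1)] trig_poly_measurable[OF assms(2)]
  show ?thesis unfolding L2_inner_def by (intro integral_haar_torus) measurable
qed

lemma L2_inner_commute: "L2_inner f g = L2_inner g f"
  by (simp add: L2_inner_def mult.commute)

text \<open>\<open>Re\<close> gives the value the type \<open>real\<close>; the sum is real when
  \<open>w\<close> is conjugate-symmetric and \<open>\<Lambda>\<close> symmetric.\<close>

definition mkpoly :: "(int ^ 'n::finite) set \<Rightarrow> (int ^ 'n \<Rightarrow> complex) \<Rightarrow> complex ^ 'n \<Rightarrow> real" where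
  "mkpoly \<Lambda> w z = (if z \<in> torus then Re (\<Sum>\<mu>\<in>\<Lambda>. w \<mu> * laurent_monomial \<mu> z) else 0)"

text \<open>Translation on the torus by the point with angles \<open>\<phi>\<close>. Multiplication
  by unit numbers also preserves the complement of the torus, where the representatives
  vanish.\<close>

definition tshift :: "real ^ 'n::finite \<Rightarrow> (complex ^ 'n \<Rightarrow> real) \<Rightarrow> complex ^ 'n \<Rightarrow> real" where
  "tshift \<phi> f z = f (\<chi> j. cis (\<phi> $ j) * z $ j)"

lemma tshift_expt: "tshift \<phi> f (expt \<theta>) = f (expt (\<phi> + \<theta>))"
  by (simp add: tshift_def expt_def cis_mult)

lemma tshift_tshift: "tshift \<phi> (tshift \<psi> f) = tshift (\<phi> + \<psi>) f"
  by (simp add: tshift_def fun_eq_iff cis_mult[symmetric] mult_ac)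

lemma tshift_0: "tshift 0 f = f"
  by (simp add: tshift_def fun_eq_iff cis_zero)

section \<open>Inner product, reproducing kernels and gradients\<close>

context
  fixes \<Lambda> :: "(int ^ 'n::finite) set"
  assumes fin: "finite \<Lambda>" and ne: "\<Lambda> \<noteq> {}" and sym: "uminus ` \<Lambda> = \<Lambda>"
begin

lemma uminus_mem_iff: "- \<mu> \<in> \<Lambda> \<longleftrightarrow> \<mu> \<in> \<Lambda>"
  using sym by (metis imageI minus_minus)

lemma sum_uminus: "(\<Sum>\<mu>\<in>\<Lambda>. h (- \<mu>)) = (\<Sum>\<mu>\<in>\<Lambda>. h \<mu>)"
  by (rule sum.reindex_bij_witness[of _ uminus uminus]) (auto simp: uminus_mem_iff)

text \<open>Exchanging \<open>\<mu>\<close> and \<open>- \<mu>\<close> shows that the sum is its own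
  conjugate.\<close>

lemma mkpoly_coef:
  assumes w: "\<And>\<mu>. \<mu> \<in> \<Lambda> \<Longrightarrow> w (- \<mu>) = cnj (w \<mu>)"
  shows "coef_of \<Lambda> (mkpoly \<Lambda> w) w"
proof -
  have "complex_of_real (Re (\<Sum>\<mu>\<in>\<Lambda>. w \<mu> * cis (pairing \<mu> \<theta>))) = (\<Sum>\<mu>\<in>\<Lambda>. w \<mu> * cis (pairing \<mu> \<theta>))" for \<theta>
  proof -
    have "cnj (\<Sum>\<mu>\<in>\<Lambda>. w \<mu> * cis (pairing \<mu> \<theta>)) = (\<Sum>\<mu>\<in>\<Lambda>. w (- \<mu>) * cis (pairing (- \<mu>) \<theta>))"
      using w by (simp add: cis_cnj pairing_uminus_left)
    also have "\<dots> = (\<Sum>\<mu>\<in>\<Lambda>. w \<mu> * cis (pairing \<mu> \<theta>))"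
      by (rule sum_uminus[of "\<lambda>\<mu>. w \<mu> * cis (pairing \<mu> \<theta>)"])
    finally have "(\<Sum>\<mu>\<in>\<Lambda>. w \<mu> * cis (pairing \<mu> \<theta>)) \<in> \<real>" by (rule Reals_cnj_iff[THEN iffD2])
    then show ?thesis by (rule of_real_Re)
  qed
  then show ?thesis
    using w by (simp add: coef_of_def mkpoly_def laurent_monomial_expt)
qed

lemma coef_of_real:
  assumes "coef_of \<Lambda> f a"
  shows "f (expt \<theta>) = (\<Sum>\<mu>\<in>\<Lambda>. Re (a \<mu>) * cos (pairing \<mu> \<theta>) - Im (a \<mu>) * sin (pairing \<mu> \<theta>))"
proof -
  have "f (expt \<theta>) = Re (\<Sum>\<mu>\<in>\<Lambda>. a \<mu> * cis (pairing \<mu> \<theta>))"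
    using assms by (metis Re_complex_of_real coef_of_def)
  then show ?thesis by simp
qed

text \<open>Parseval for characters. Linearity, positivity and the values of the kernels below are
  read off the coefficients, without separate integrability arguments.\<close>

lemma L2_inner_coef:
  assumes a: "coef_of \<Lambda> f a" and b: "coef_of \<Lambda> g b"
  shows "complex_of_real (L2_inner f g) = (\<Sum>\<mu>\<in>\<Lambda>. a \<mu> * cnj (b \<mu>))"
proof -
  have V: "f \<in> trig_polys \<Lambda>" "g \<in> trig_polys \<Lambda>" using a b by (auto simp: trig_polys_coef)
  have eq: "complex_of_real (f (expt \<theta>) * g (expt \<theta>))
      = (\<Sum>\<mu>\<in>\<Lambda>. \<Sum>\<nu>\<in>\<Lambda>. a \<mu> * cnj (b \<nu>) * cis (pairing (\<mu> - \<nu>) \<theta>))" for \<theta>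
  proof -
    have "complex_of_real (g (expt \<theta>)) = cnj (complex_of_real (g (expt \<theta>)))" by simp
    also have "\<dots> = (\<Sum>\<nu>\<in>\<Lambda>. cnj (b \<nu>) * cis (- pairing \<nu> \<theta>))"
      using b by (simp add: coef_of_def cis_cnj)
    finally have g: "complex_of_real (g (expt \<theta>)) = (\<Sum>\<nu>\<in>\<Lambda>. cnj (b \<nu>) * cis (- pairing \<nu> \<theta>))" .
    have f: "complex_of_real (f (expt \<theta>)) = (\<Sum>\<mu>\<in>\<Lambda>. a \<mu> * cis (pairing \<mu> \<theta>))"
      using a by (simp add: coef_of_def)
    have c: "cis (pairing (\<mu> - \<nu>) \<theta>) = cis (pairing \<mu> \<theta>) * cis (- pairing \<nu> \<theta>)" for \<mu> \<nu>
      by (simp add: cis_mult pairing_diff_left)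
    show ?thesis
      unfolding of_real_mult f g sum_product c by (intro sum.cong refl) (simp add: mult_ac)
  qed
  have "complex_of_real (L2_inner f g) = (\<integral>\<theta>. complex_of_real (f (expt \<theta>) * g (expt \<theta>)) \<partial>unif_box)"
    unfolding L2_inner_expt[OF V] by (rule integral_complex_of_real[symmetric])
  also have "\<dots> = (\<integral>\<theta>. (\<Sum>\<mu>\<in>\<Lambda>. \<Sum>\<nu>\<in>\<Lambda>. a \<mu> * cnj (b \<nu>) * cis (pairing (\<mu> - \<nu>) \<theta>)) \<partial>unif_box)"
    unfolding eq ..
  also have "\<dots> = (\<Sum>\<mu>\<in>\<Lambda>. \<Sum>\<nu>\<in>\<Lambda>. a \<mu> * cnj (b \<nu>) * (\<integral>\<theta>. cis (pairing (\<mu> - \<nu>) \<theta>) \<partial>unif_box))"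
    by (simp add: Bochner_Integration.integral_sum integral_cis_pairing(1) integrable_mult_right)
  also have "\<dots> = (\<Sum>\<mu>\<in>\<Lambda>. \<Sum>\<nu>\<in>\<Lambda>. if \<nu> = \<mu> then a \<mu> * cnj (b \<mu>) else 0)"
    unfolding integral_cis_pairing(2) by (intro sum.cong refl) auto
  also have "\<dots> = (\<Sum>\<mu>\<in>\<Lambda>. a \<mu> * cnj (b \<mu>))"
    using fin by simp
  finally show ?thesis .
qed

lemma L2_inner_lincomb:
  assumes "f \<in> trig_polys \<Lambda>" "g \<in> trig_polys \<Lambda>" "h \<in> trig_polys \<Lambda>"
  shows "L2_inner (\<lambda>z. c * f z + d * g z) h = c * L2_inner f h + d * L2_inner g h"
proof -
  obtain a b e where *: "coef_of \<Lambda> f a" "coef_of \<Lambda> g b" "coef_of \<Lambda> h e"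
    using assms by (auto simp: trig_polys_coef)
  have "complex_of_real (L2_inner (\<lambda>z. c * f z + d * g z) h) = complex_of_real (c * L2_inner f h + d * L2_inner g h)"
    unfolding of_real_add of_real_mult L2_inner_coef[OF *(1,3)] L2_inner_coef[OF *(2,3)]
      L2_inner_coef[OF coef_of_lincomb[OF *(1,2)] *(3)]
    by (simp add: sum_distrib_left sum.distrib algebra_simps)
  then show ?thesis by (simp only: of_real_eq_iff)
qed

lemma L2_inner_sum:
  assumes "finite K" "\<And>k. k \<in> K \<Longrightarrow> f k \<in> trig_polys \<Lambda>" "h \<in> trig_polys \<Lambda>"
  shows "L2_inner (\<lambda>z. \<Sum>k\<in>K. c k * f k z) h = (\<Sum>k\<in>K. c k * L2_inner (f k) h)"
  using assms
proof (induction K)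
  case empty
  then show ?case using L2_inner_lincomb[OF trig_polys_zero trig_polys_zero, of h 0 0] by simp
next
  case (insert k K)
  have "(\<lambda>z. \<Sum>k\<in>K. c k * f k z) \<in> trig_polys \<Lambda>" using insert by (intro trig_polys_sum) auto
  then show ?case
    using insert L2_inner_lincomb[where f="f k" and g="\<lambda>z. \<Sum>k\<in>K. c k * f k z" and h=h and c="c k" and d=1]
    by simp
qed

lemma L2_inner_self:
  assumes "f \<in> trig_polys \<Lambda>"
  shows "L2_inner f f \<ge> 0" and "L2_inner f f = 0 \<longleftrightarrow> f = (\<lambda>z. 0)"
proof -
  obtain a where a: "coef_of \<Lambda> f a" using assms by (auto simp: trig_polys_coef)
  have "complex_of_real (L2_inner f f) = complex_of_real (\<Sum>\<mu>\<in>\<Lambda>. (cmod (a \<mu>))\<^sup>2)"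
    unfolding L2_inner_coef[OF a a] of_real_sum by (simp add: complex_norm_square del: of_real_power)
  then have eq: "L2_inner f f = (\<Sum>\<mu>\<in>\<Lambda>. (cmod (a \<mu>))\<^sup>2)" by (simp only: of_real_eq_iff)
  show "L2_inner f f \<ge> 0" unfolding eq by (intro sum_nonneg) simp
  show "L2_inner f f = 0 \<longleftrightarrow> f = (\<lambda>z. 0)"
  proof
    assume "L2_inner f f = 0"
    then have "a \<mu> = 0" if "\<mu> \<in> \<Lambda>" for \<mu>
      using that fin unfolding eq by (subst (asm) sum_nonneg_eq_0_iff) auto
    then have "f (expt \<theta>) = 0" for \<theta> using coef_of_real[OF a, of \<theta>] by simp
    then show "f = (\<lambda>z. 0)" using trig_polys_eqI[OF assms trig_polys_zero] by blast
  qed (simp add: L2_inner_def)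
qed

text \<open>The reproducing kernel at the identity of the torus: pairing with it evaluates
  there.\<close>

definition kern :: "complex ^ 'n \<Rightarrow> real" where "kern = mkpoly \<Lambda> (\<lambda>_. 1)"

text \<open>Represents the \<open>j\<close>-th partial derivative at the identity in the angles; the
  sign of the factor comes from the conjugate in the inner product.\<close>

definition dkern :: "'n \<Rightarrow> complex ^ 'n \<Rightarrow> real" where
  "dkern j = mkpoly \<Lambda> (\<lambda>\<mu>. - \<i> * of_int (\<mu> $ j))"

lemma kern_coef: "coef_of \<Lambda> kern (\<lambda>_. 1)" and dkern_coef: "coef_of \<Lambda> (dkern j) (\<lambda>\<mu>. - \<i> * of_int (\<mu> $ j))"
  unfolding kern_def dkern_def by (rule mkpoly_coef; simp)+

lemma L2_inner_kern:
  assumes "f \<in> trig_polys \<Lambda>"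
  shows "L2_inner f kern = f (expt 0)"
proof -
  obtain a where a: "coef_of \<Lambda> f a" using assms by (auto simp: trig_polys_coef)
  have "complex_of_real (L2_inner f kern) = complex_of_real (f (expt 0))"
    unfolding L2_inner_coef[OF a kern_coef] using a by (simp add: coef_of_def cis_zero)
  then show ?thesis by (simp only: of_real_eq_iff)
qed

lemma L2_inner_kern_kern: "L2_inner kern kern = real (card \<Lambda>)"
proof -
  have "complex_of_real (L2_inner kern kern) = complex_of_real (real (card \<Lambda>))"
    unfolding L2_inner_coef[OF kern_coef kern_coef] by simp
  then show ?thesis by (simp only: of_real_eq_iff)
qed

text \<open>The coefficient sum is purely imaginary and has to be real. As a consequence the value
  and the gradient at the identity of a Gaussian combination of an orthonormal basis are
  uncorrelated.\<close>

lemma L2_inner_kern_dkern: "L2_inner kern (dkern j) = 0"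
proof -
  have "complex_of_real (L2_inner kern (dkern j)) = \<i> * of_real (\<Sum>\<mu>\<in>\<Lambda>. of_int (\<mu> $ j))"
    unfolding L2_inner_coef[OF kern_coef dkern_coef] by (simp add: sum_distrib_left)
  then show ?thesis by (auto simp: complex_eq_iff)
qed

lemma L2_inner_dkern_dkern: "L2_inner (dkern i) (dkern j) = (\<Sum>\<mu>\<in>\<Lambda>. of_int (\<mu> $ i) * of_int (\<mu> $ j))"
proof -
  have "complex_of_real (L2_inner (dkern i) (dkern j)) = complex_of_real (\<Sum>\<mu>\<in>\<Lambda>. of_int (\<mu> $ i) * of_int (\<mu> $ j))"
    unfolding L2_inner_coef[OF dkern_coef dkern_coef] of_real_sum
    by (intro sum.cong refl) (simp add: complex_eq_iff)
  then show ?thesis by (simp only: of_real_eq_iff)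
qed

text \<open>The gradient in the angles, through a chosen coefficient family. The explicit formula
  makes continuity immediate; that the choice is immaterial for a trigonometric polynomial follows
  from uniqueness of the derivative.\<close>

definition tgrad :: "(complex ^ 'n \<Rightarrow> real) \<Rightarrow> real ^ 'n \<Rightarrow> real ^ 'n" where
  "tgrad f \<theta> = (\<chi> j. \<Sum>\<mu>\<in>\<Lambda>. - (Re ((SOME a. coef_of \<Lambda> f a) \<mu>) * sin (pairing \<mu> \<theta>)
      + Im ((SOME a. coef_of \<Lambda> f a) \<mu>) * cos (pairing \<mu> \<theta>)) * of_int (\<mu> $ j))"

lemma tgrad_has_derivative:
  assumes "f \<in> trig_polys \<Lambda>"
  shows "((\<lambda>\<theta>. f (expt \<theta>)) has_derivative (\<lambda>h. tgrad f \<theta> \<bullet> h)) (at \<theta>)"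
proof -
  define a where "a = (SOME a. coef_of \<Lambda> f a)"
  have a: "coef_of \<Lambda> f a" unfolding a_def using assms unfolding trig_polys_coef by (rule someI_ex)
  have p: "(pairing \<mu> has_derivative pairing \<mu>) (at \<theta>)" for \<mu>
    unfolding pairing_def[abs_def] by (intro bounded_linear_imp_has_derivative bounded_linear_sum
        bounded_linear_const_mult bounded_linear_vec_nth)
  have c: "((\<lambda>\<theta>. cos (pairing \<mu> \<theta>)) has_derivative (\<lambda>h. - sin (pairing \<mu> \<theta>) * pairing \<mu> h)) (at \<theta>)"
    and s: "((\<lambda>\<theta>. sin (pairing \<mu> \<theta>)) has_derivative (\<lambda>h. cos (pairing \<mu> \<theta>) * pairing \<mu> h)) (at \<theta>)" for \<mu>
    using has_derivative_compose[OF p DERIV_cos[of "pairing \<mu> \<theta>", unfolded has_field_derivative_def]]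
      has_derivative_compose[OF p DERIV_sin[of "pairing \<mu> \<theta>", unfolded has_field_derivative_def]]
    by simp_all
  have "((\<lambda>\<theta>. \<Sum>\<mu>\<in>\<Lambda>. Re (a \<mu>) * cos (pairing \<mu> \<theta>) - Im (a \<mu>) * sin (pairing \<mu> \<theta>)) has_derivative
      (\<lambda>h. \<Sum>\<mu>\<in>\<Lambda>. Re (a \<mu>) * (- sin (pairing \<mu> \<theta>) * pairing \<mu> h) - Im (a \<mu>) * (cos (pairing \<mu> \<theta>) * pairing \<mu> h))) (at \<theta>)"
    by (rule has_derivative_sum, rule has_derivative_diff)
      (rule bounded_linear.has_derivative[OF bounded_linear_mult_right], rule c s)+
  also have "(\<lambda>\<theta>. \<Sum>\<mu>\<in>\<Lambda>. Re (a \<mu>) * cos (pairing \<mu> \<theta>) - Im (a \<mu>) * sin (pairing \<mu> \<theta>)) = (\<lambda>\<theta>. f (expt \<theta>))"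
    using coef_of_real[OF a] by simp
  also have "(\<lambda>h. \<Sum>\<mu>\<in>\<Lambda>. Re (a \<mu>) * (- sin (pairing \<mu> \<theta>) * pairing \<mu> h) - Im (a \<mu>) * (cos (pairing \<mu> \<theta>) * pairing \<mu> h))
      = (\<lambda>h. tgrad f \<theta> \<bullet> h)"
  proof
    fix h :: "real ^ 'n"
    have "tgrad f \<theta> \<bullet> h = (\<Sum>j\<in>UNIV. \<Sum>\<mu>\<in>\<Lambda>. - (Re (a \<mu>) * sin (pairing \<mu> \<theta>) + Im (a \<mu>) * cos (pairing \<mu> \<theta>)) * of_int (\<mu> $ j) * h $ j)"
      by (simp add: tgrad_def inner_vec_def sum_distrib_right a_def)
    also have "\<dots> = (\<Sum>\<mu>\<in>\<Lambda>. - (Re (a \<mu>) * sin (pairing \<mu> \<theta>) + Im (a \<mu>) * cos (pairing \<mu> \<theta>)) * pairing \<mu> h)"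
      by (subst sum.swap) (simp add: pairing_def[of _ h] sum_distrib_left sum_distrib_right mult_ac)
    also have "\<dots> = (\<Sum>\<mu>\<in>\<Lambda>. Re (a \<mu>) * (- sin (pairing \<mu> \<theta>) * pairing \<mu> h) - Im (a \<mu>) * (cos (pairing \<mu> \<theta>) * pairing \<mu> h))"
      by (intro sum.cong refl) (simp add: algebra_simps)
    finally show "(\<Sum>\<mu>\<in>\<Lambda>. Re (a \<mu>) * (- sin (pairing \<mu> \<theta>) * pairing \<mu> h) - Im (a \<mu>) * (cos (pairing \<mu> \<theta>) * pairing \<mu> h))
        = tgrad f \<theta> \<bullet> h" by simp
  qed
  finally show ?thesis .
qed

lemma continuous_on_tgrad: "continuous_on S (tgrad f)"
  unfolding tgrad_def[abs_def] by (intro continuous_intros continuous_on_pairing)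

lemma tgrad_0:
  assumes "f \<in> trig_polys \<Lambda>"
  shows "tgrad f 0 $ j = L2_inner f (dkern j)"
proof -
  define a where "a = (SOME a. coef_of \<Lambda> f a)"
  have a: "coef_of \<Lambda> f a" unfolding a_def using assms unfolding trig_polys_coef by (rule someI_ex)
  have "L2_inner f (dkern j) = Re (\<Sum>\<mu>\<in>\<Lambda>. a \<mu> * cnj (- \<i> * of_int (\<mu> $ j)))"
    unfolding L2_inner_coef[OF a dkern_coef, symmetric] by simp
  then show ?thesis by (simp add: tgrad_def a_def[symmetric] sum_negf)
qed

lemma tshift_coef:
  assumes "coef_of \<Lambda> f a"
  shows "coef_of \<Lambda> (tshift \<phi> f) (\<lambda>\<mu>. a \<mu> * cis (pairing \<mu> \<phi>))"
proof -
  have "tshift \<phi> f z = 0" if "z \<notin> torus" for z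
  proof -
    have "(\<chi> j. cis (\<phi> $ j) * z $ j) \<notin> torus" using that by (simp add: torus_def norm_mult)
    then show ?thesis using assms by (simp add: tshift_def coef_of_def)
  qed
  then show ?thesis
    using assms by (auto simp: coef_of_def tshift_expt pairing_add_right cis_mult[symmetric] mult_ac
        pairing_uminus_left cis_cnj)
qed

lemma tshift_trig_polys: "f \<in> trig_polys \<Lambda> \<Longrightarrow> tshift \<phi> f \<in> trig_polys \<Lambda>"
  unfolding trig_polys_coef using tshift_coef by blast

lemma L2_inner_tshift:
  assumes "f \<in> trig_polys \<Lambda>" "g \<in> trig_polys \<Lambda>"
  shows "L2_inner (tshift \<phi> f) (tshift \<phi> g) = L2_inner f g"
proof -
  obtain a b where *: "coef_of \<Lambda> f a" "coef_of \<Lambda> g b"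
    using assms by (auto simp: trig_polys_coef)
  have "a \<mu> * cis (pairing \<mu> \<phi>) * cnj (b \<mu> * cis (pairing \<mu> \<phi>)) = a \<mu> * cnj (b \<mu>)" for \<mu>
  proof -
    have "a \<mu> * cis (pairing \<mu> \<phi>) * cnj (b \<mu> * cis (pairing \<mu> \<phi>))
        = a \<mu> * cnj (b \<mu>) * (cis (pairing \<mu> \<phi>) * cis (- pairing \<mu> \<phi>))"
      by (simp add: cis_cnj mult_ac)
    then show ?thesis by (simp add: cis_mult)
  qed
  note key = this
  have "complex_of_real (L2_inner (tshift \<phi> f) (tshift \<phi> g)) = complex_of_real (L2_inner f g)"
    unfolding L2_inner_coef[OF *] L2_inner_coef[OF tshift_coef[OF *(1)] tshift_coef[OF *(2)]] key ..
  then show ?thesis by (simp only: of_real_eq_iff)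
qed

lemma orthogonal_trans_tshift: "orthogonal_trans \<Lambda> (tshift \<phi>)"
proof -
  have "bij_betw (tshift \<phi>) (trig_polys \<Lambda>) (trig_polys \<Lambda>)"
    by (rule bij_betw_byWitness[of _ "tshift (- \<phi>)"])
      (auto simp: tshift_tshift tshift_0 tshift_trig_polys)
  then show ?thesis
    using L2_inner_tshift by (auto simp: orthogonal_trans_def tshift_def[abs_def])
qed

section \<open>Orthonormal bases\<close>

lemma gram_schmidt:
  assumes e: "e \<in> trig_polys \<Lambda>" "L2_inner e e = 1" and S: "finite S" "S \<subseteq> trig_polys \<Lambda>"
  shows "\<exists>d b. 0 < d \<and> b 0 = e \<and> (\<forall>k<d. b k \<in> trig_polys \<Lambda>) \<and>
    (\<forall>k<d. \<forall>l<d. L2_inner (b k) (b l) = (if k = l then 1 else 0)) \<and>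
    (\<forall>s\<in>S. s = (\<lambda>z. \<Sum>k<(d::nat). L2_inner s (b k) * b k z))"
  using S
proof (induction S)
  case empty
  show ?case using e by (intro exI[of _ "1::nat"] exI[of _ "\<lambda>_. e"]) simp
next
  case (insert s S)
  then obtain d :: nat and b where d: "0 < d" "b 0 = e" and bV: "\<And>k. k < d \<Longrightarrow> b k \<in> trig_polys \<Lambda>"
    and on: "\<And>k l. k < d \<Longrightarrow> l < d \<Longrightarrow> L2_inner (b k) (b l) = (if k = l then 1 else 0)"
    and sp: "\<And>s. s \<in> S \<Longrightarrow> s = (\<lambda>z. \<Sum>k<d. L2_inner s (b k) * b k z)"
    by auto
  have sV: "s \<in> trig_polys \<Lambda>" and SV: "S \<subseteq> trig_polys \<Lambda>" using insert.prems by auto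
  define p where "p = (\<lambda>z. \<Sum>k<d. L2_inner s (b k) * b k z)"
  have pV: "p \<in> trig_polys \<Lambda>" unfolding p_def by (intro trig_polys_sum) (auto intro: bV)
  \<comment> \<open>The component of \<open>s\<close> orthogonal to the vectors found so far. If it
    vanishes nothing is added, otherwise its normalization is appended; so the prescribed
    \<open>e\<close> stays the first member.\<close>
  define r where "r = (\<lambda>z. 1 * s z + (- 1) * p z)"
  have rV: "r \<in> trig_polys \<Lambda>" unfolding r_def by (intro trig_polys_lincomb sV pV)
  have p_b: "L2_inner p (b l) = L2_inner s (b l)" if "l < d" for l
    unfolding p_def using that bV on
    by (subst L2_inner_sum) (auto simp: if_distrib[of "\<lambda>x. _ * x"] cong: if_cong)
  have r_b: "L2_inner r (b l) = 0" if "l < d" for l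
    unfolding r_def L2_inner_lincomb[OF sV pV bV[OF that]] using p_b[OF that] by simp
  show ?case
  proof (cases "r = (\<lambda>z. 0)")
    case True
    then have "s = p" by (auto simp: r_def fun_eq_iff)
    then have "\<forall>s\<in>insert s S. s = (\<lambda>z. \<Sum>k<d. L2_inner s (b k) * b k z)"
      using sp by (auto simp: p_def)
    then show ?thesis using d bV on by (intro exI[of _ d] exI[of _ b]) blast
  next
    case False
    define n where "n = sqrt (L2_inner r r)"
    have n: "n > 0" "n * n = L2_inner r r"
      using False L2_inner_self[OF rV] by (auto simp: n_def less_le)
    define q where "q = (\<lambda>z. (1 / n) * r z + 0 * r z)"
    have qV: "q \<in> trig_polys \<Lambda>" unfolding q_def by (intro trig_polys_lincomb rV)
    have q_f: "L2_inner q f = L2_inner r f / n" if "f \<in> trig_polys \<Lambda>" for f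
      unfolding q_def L2_inner_lincomb[OF rV rV that] by simp
    have q_b: "L2_inner q (b l) = 0" if "l < d" for l using q_f[OF bV[OF that]] r_b[OF that] by simp
    have qq: "L2_inner q q = 1"
      using q_f[OF qV] L2_inner_commute[of r q] q_f[OF rV] n mult_pos_pos[OF n(1) n(1)] by (simp add: field_simps)
    define b' where "b' = b(d := q)"
    have b'[simp]: "k < d \<Longrightarrow> b' k = b k" "b' d = q" for k by (auto simp: b'_def)
    have "s = (\<lambda>z. \<Sum>k<Suc d. L2_inner s (b' k) * b' k z)"
    proof
      fix z
      have rp: "L2_inner p r = 0"
        unfolding p_def using r_b L2_inner_commute[of r]
        by (subst L2_inner_sum) (auto intro!: sum.neutral bV rV)
      have sr: "s = (\<lambda>z. 1 * r z + 1 * p z)" by (simp add: r_def)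
      have "L2_inner s r = L2_inner r r"
        using L2_inner_lincomb[OF rV pV rV, of 1 1] rp sr by simp
      moreover have "L2_inner s r = L2_inner r r \<Longrightarrow> L2_inner s q = n"
      proof -
        assume "L2_inner s r = L2_inner r r"
        then have "n * L2_inner s q = n * n"
          using q_f[OF sV] n by (simp add: L2_inner_commute[of s])
        then show "L2_inner s q = n" using n(1) by simp
      qed
      ultimately have "L2_inner s q = n" by blast
      then have "L2_inner s q * q z = r z" using n by (simp add: q_def)
      then show "s z = (\<Sum>k<Suc d. L2_inner s (b' k) * b' k z)"
        by (simp add: r_def p_def)
    qed
    moreover have "t = (\<lambda>z. \<Sum>k<Suc d. L2_inner t (b' k) * b' k z)" if t: "t \<in> S" for t
    proof
      fix z
      have "L2_inner t q = L2_inner (\<lambda>z. \<Sum>k<d. L2_inner t (b k) * b k z) q" using sp[OF t] by simp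
      also have "\<dots> = 0"
        using q_b L2_inner_commute[of q]
        by (subst L2_inner_sum) (auto intro!: sum.neutral bV qV)
      finally have "L2_inner t q = 0" .
      then show "t z = (\<Sum>k<Suc d. L2_inner t (b' k) * b' k z)"
        using fun_cong[OF sp[OF t], of z] by simp
    qed
    moreover have "L2_inner (b' k) (b' l) = (if k = l then 1 else 0)" if "k < Suc d" "l < Suc d" for k l
    proof -
      have bq: "L2_inner (b l) q = 0" if "l < d" for l using q_b[OF that] L2_inner_commute[of "b l" q] by simp
      show ?thesis using that by (cases "k = d"; cases "l = d") (simp_all add: on q_b bq qq)
    qed
    moreover have "b' k \<in> trig_polys \<Lambda>" if "k < Suc d" for k
      using that bV qV by (auto simp: less_Suc_eq)
    ultimately show ?thesis
      using d by (intro exI[of _ "Suc d"] exI[of _ b']) auto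
  qed
qed

definition onb :: "nat \<Rightarrow> (nat \<Rightarrow> complex ^ 'n \<Rightarrow> real) \<Rightarrow> bool" where
  "onb d b \<longleftrightarrow> 0 < d \<and> (\<forall>k<d. b k \<in> trig_polys \<Lambda>) \<and>
    (\<forall>k<d. \<forall>l<d. L2_inner (b k) (b l) = (if k = l then 1 else 0)) \<and>
    (\<forall>f\<in>trig_polys \<Lambda>. f = (\<lambda>z. \<Sum>k<d. L2_inner f (b k) * b k z))"

text \<open>Gram-Schmidt, started with the normalized kernel and fed with the cosines and sines of
  \<open>pairing \<mu>\<close>, which span \<open>trig_polys \<Lambda>\<close>.\<close>

lemma onb_exists: "\<exists>d b. onb d b \<and> b 0 = (\<lambda>z. kern z / sqrt (real (card \<Lambda>)))"
proof -
  define m where "m = real (card \<Lambda>)"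
  have m: "m > 0" using fin ne by (simp add: m_def card_gt_0_iff)
  define e where "e = (\<lambda>z. (1 / sqrt m) * kern z + 0 * kern z)"
  have kV: "kern \<in> trig_polys \<Lambda>" using kern_coef trig_polys_coef by blast
  have eV: "e \<in> trig_polys \<Lambda>" unfolding e_def by (intro trig_polys_lincomb kV)
  have ee: "L2_inner e e = 1"
  proof -
    have ef: "L2_inner e f = L2_inner kern f / sqrt m" if "f \<in> trig_polys \<Lambda>" for f
      unfolding e_def L2_inner_lincomb[OF kV kV that] by simp
    have "L2_inner e e = m / (sqrt m * sqrt m)"
      unfolding ef[OF eV] L2_inner_commute[of kern e] ef[OF kV] L2_inner_kern_kern m_def[symmetric] by simp
    then show ?thesis using m by simp
  qed
  have neg: "- \<nu> = \<mu> \<longleftrightarrow> \<nu> = - \<mu>" for \<nu> \<mu> :: "int ^ 'n" by auto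
  \<comment> \<open>Cosine and sine of \<open>pairing \<mu>\<close>. The two conditionals are added,
    not nested, so that for \<open>\<mu> = 0\<close> the cosine gets the coefficient 1 and the sine
    0.\<close>
  let ?C = "\<lambda>\<mu>. mkpoly \<Lambda> (\<lambda>\<nu>. (if \<nu> = \<mu> then 1 / 2 else 0) + (if \<nu> = - \<mu> then 1 / 2 else 0))"
  let ?S = "\<lambda>\<mu>. mkpoly \<Lambda> (\<lambda>\<nu>. (if \<nu> = \<mu> then - \<i> / 2 else 0) + (if \<nu> = - \<mu> then \<i> / 2 else 0))"
  have C: "coef_of \<Lambda> (?C \<mu>) (\<lambda>\<nu>. (if \<nu> = \<mu> then 1 / 2 else 0) + (if \<nu> = - \<mu> then 1 / 2 else 0))" for \<mu>
    by (rule mkpoly_coef) (simp add: neg)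
  have S: "coef_of \<Lambda> (?S \<mu>) (\<lambda>\<nu>. (if \<nu> = \<mu> then - \<i> / 2 else 0) + (if \<nu> = - \<mu> then \<i> / 2 else 0))" for \<mu>
    by (rule mkpoly_coef) (simp add: neg)
  have Cv: "?C \<mu> (expt \<theta>) = cos (pairing \<mu> \<theta>)" and Sv: "?S \<mu> (expt \<theta>) = sin (pairing \<mu> \<theta>)" if "\<mu> \<in> \<Lambda>" for \<mu> \<theta>
  proof -
    have mm: "- \<mu> \<in> \<Lambda>" using that uminus_mem_iff by simp
    have sum_if: "(\<Sum>\<nu>\<in>\<Lambda>. ((if \<nu> = \<mu> then u else 0) + (if \<nu> = - \<mu> then v else 0)) * cis (pairing \<nu> \<theta>))
        = u * cis (pairing \<mu> \<theta>) + v * cis (- pairing \<mu> \<theta>)" for u v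
    proof -
      have delta: "(\<Sum>\<nu>\<in>\<Lambda>. (if \<nu> = \<kappa> then u else 0) * h \<nu>) = u * h \<kappa>"
        if "\<kappa> \<in> \<Lambda>" for \<kappa> u and h :: "int ^ 'n \<Rightarrow> complex"
        using fin that by (subst sum.remove[of _ \<kappa>]) (auto intro!: sum.neutral)
      show ?thesis
        by (simp add: distrib_right sum.distrib delta[OF that] delta[OF mm] pairing_uminus_left)
    qed
    show "?C \<mu> (expt \<theta>) = cos (pairing \<mu> \<theta>)"
      by (simp add: mkpoly_def laurent_monomial_expt sum_if)
    show "?S \<mu> (expt \<theta>) = sin (pairing \<mu> \<theta>)"
      by (simp add: mkpoly_def laurent_monomial_expt sum_if)
  qed
  define G where "G = ?C ` \<Lambda> \<union> ?S ` \<Lambda>"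
  have coefV: "coef_of \<Lambda> f a \<Longrightarrow> f \<in> trig_polys \<Lambda>" for f a
    using trig_polys_coef by blast
  have GV: "G \<subseteq> trig_polys \<Lambda>" using coefV[OF C] coefV[OF S] by (auto simp: G_def)
  have "finite G" using fin by (simp add: G_def)
  from gram_schmidt[OF eV ee this GV] obtain d :: nat and b where d: "0 < d" "b 0 = e"
    and bV: "\<And>k. k < d \<Longrightarrow> b k \<in> trig_polys \<Lambda>"
    and on: "\<And>k l. k < d \<Longrightarrow> l < d \<Longrightarrow> L2_inner (b k) (b l) = (if k = l then 1 else 0)"
    and sp: "\<And>s. s \<in> G \<Longrightarrow> s = (\<lambda>z. \<Sum>k<d. L2_inner s (b k) * b k z)" by blast
  have "f = (\<lambda>z. \<Sum>k<d. L2_inner f (b k) * b k z)" if fV: "f \<in> trig_polys \<Lambda>" for f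
  proof -
    obtain a where a: "coef_of \<Lambda> f a" using fV by (auto simp: trig_polys_coef)
    define p where "p = (\<lambda>z. 1 * (\<Sum>\<mu>\<in>\<Lambda>. Re (a \<mu>) * ?C \<mu> z) + (- 1) * (\<Sum>\<mu>\<in>\<Lambda>. Im (a \<mu>) * ?S \<mu> z))"
    have V1: "(\<lambda>z. \<Sum>\<mu>\<in>\<Lambda>. Re (a \<mu>) * ?C \<mu> z) \<in> trig_polys \<Lambda>" "(\<lambda>z. \<Sum>\<mu>\<in>\<Lambda>. Im (a \<mu>) * ?S \<mu> z) \<in> trig_polys \<Lambda>"
      using GV by (intro trig_polys_sum[OF fin]; auto simp: G_def)+
    have fp: "f = p"
    proof (rule trig_polys_eqI[OF fV])
      show "p \<in> trig_polys \<Lambda>" unfolding p_def by (intro trig_polys_lincomb V1)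
      show "f (expt \<theta>) = p (expt \<theta>)" for \<theta>
        unfolding coef_of_real[OF a] p_def by (simp add: Cv Sv sum_subtractf)
    qed
    have lin: "L2_inner p (b k) = 1 * (\<Sum>\<mu>\<in>\<Lambda>. Re (a \<mu>) * L2_inner (?C \<mu>) (b k)) + (- 1) * (\<Sum>\<mu>\<in>\<Lambda>. Im (a \<mu>) * L2_inner (?S \<mu>) (b k))"
      if "k < d" for k
    proof -
      have "L2_inner (\<lambda>z. \<Sum>\<mu>\<in>\<Lambda>. Re (a \<mu>) * ?C \<mu> z) (b k) = (\<Sum>\<mu>\<in>\<Lambda>. Re (a \<mu>) * L2_inner (?C \<mu>) (b k))"
        using GV bV[OF that] by (intro L2_inner_sum[OF fin]) (auto simp: G_def)
      moreover have "L2_inner (\<lambda>z. \<Sum>\<mu>\<in>\<Lambda>. Im (a \<mu>) * ?S \<mu> z) (b k) = (\<Sum>\<mu>\<in>\<Lambda>. Im (a \<mu>) * L2_inner (?S \<mu>) (b k))"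
        using GV bV[OF that] by (intro L2_inner_sum[OF fin]) (auto simp: G_def)
      ultimately show ?thesis unfolding p_def L2_inner_lincomb[OF V1 bV[OF that]] by simp
    qed
    have exp: "(\<Sum>\<mu>\<in>\<Lambda>. w \<mu> * g \<mu> z) = (\<Sum>k<d. (\<Sum>\<mu>\<in>\<Lambda>. w \<mu> * L2_inner (g \<mu>) (b k)) * b k z)"
      if "\<And>\<mu>. \<mu> \<in> \<Lambda> \<Longrightarrow> g \<mu> \<in> G" for w :: "int ^ 'n \<Rightarrow> real" and g z
    proof -
      have "(\<Sum>\<mu>\<in>\<Lambda>. w \<mu> * g \<mu> z) = (\<Sum>\<mu>\<in>\<Lambda>. w \<mu> * (\<Sum>k<d. L2_inner (g \<mu>) (b k) * b k z))"
        by (rule sum.cong[OF refl], rule arg_cong[where f="(*) _"], rule fun_cong[OF sp[OF that]])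
      also have "\<dots> = (\<Sum>k<d. (\<Sum>\<mu>\<in>\<Lambda>. w \<mu> * L2_inner (g \<mu>) (b k)) * b k z)"
        unfolding sum_distrib_left sum_distrib_right by (subst sum.swap) (simp add: mult_ac)
      finally show ?thesis .
    qed
    have "p = (\<lambda>z. \<Sum>k<d. L2_inner p (b k) * b k z)"
    proof
      fix z
      have "p z = (\<Sum>k<d. (\<Sum>\<mu>\<in>\<Lambda>. Re (a \<mu>) * L2_inner (?C \<mu>) (b k)) * b k z)
          - (\<Sum>k<d. (\<Sum>\<mu>\<in>\<Lambda>. Im (a \<mu>) * L2_inner (?S \<mu>) (b k)) * b k z)"
        unfolding p_def using exp[of ?C "\<lambda>\<mu>. Re (a \<mu>)" z] exp[of ?S "\<lambda>\<mu>. Im (a \<mu>)" z]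
        by (simp add: G_def)
      also have "\<dots> = (\<Sum>k<d. L2_inner p (b k) * b k z)"
        unfolding sum_subtractf[symmetric] by (intro sum.cong refl) (simp add: lin left_diff_distrib)
      finally show "p z = (\<Sum>k<d. L2_inner p (b k) * b k z)" .
    qed
    then show ?thesis using fp by simp
  qed
  then have "onb d b" using d bV on by (simp add: onb_def)
  moreover have "b 0 = (\<lambda>z. kern z / sqrt (real (card \<Lambda>)))" by (simp add: d e_def m_def)
  ultimately show ?thesis by blast
qed

lemma onb_Parseval:
  assumes "onb d b" "f \<in> trig_polys \<Lambda>" "g \<in> trig_polys \<Lambda>"
  shows "L2_inner f g = (\<Sum>k<d. L2_inner f (b k) * L2_inner g (b k))"
proof -
  have "L2_inner f g = L2_inner (\<lambda>z. \<Sum>k<d. L2_inner f (b k) * b k z) g"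
    using assms by (simp add: onb_def)
  also have "\<dots> = (\<Sum>k<d. L2_inner f (b k) * L2_inner (b k) g)"
    using assms by (intro L2_inner_sum) (auto simp: onb_def)
  finally show ?thesis by (simp add: L2_inner_commute)
qed

text \<open>All four facts come from the kernels: \<open>b 0\<close> is a multiple of
  \<open>kern\<close>, which is orthogonal to every \<open>dkern j\<close>; the other members are
  orthogonal to \<open>kern\<close>, hence vanish at the identity; and Parseval for
  \<open>dkern i\<close> and \<open>dkern j\<close> gives the last sum, with a zero term for
  \<open>k = 0\<close>.\<close>

lemma onb_at_0:
  assumes b: "onb d b" and b0: "b 0 = (\<lambda>z. kern z / sqrt (real (card \<Lambda>)))"
  shows "b 0 (expt 0) = sqrt (real (card \<Lambda>))"
    and "tgrad (b 0) 0 = 0"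
    and "0 < k \<Longrightarrow> k < d \<Longrightarrow> b k (expt 0) = 0"
    and "(\<Sum>k\<in>{1..<d}. tgrad (b k) 0 $ i * tgrad (b k) 0 $ j) = (\<Sum>\<mu>\<in>\<Lambda>. of_int (\<mu> $ i) * of_int (\<mu> $ j))"
proof -
  define m where "m = real (card \<Lambda>)"
  have m: "m > 0" using fin ne by (simp add: m_def card_gt_0_iff)
  have kV: "kern \<in> trig_polys \<Lambda>" using kern_coef trig_polys_coef by blast
  have dV: "dkern j \<in> trig_polys \<Lambda>" for j using dkern_coef trig_polys_coef by blast
  have bV: "k < d \<Longrightarrow> b k \<in> trig_polys \<Lambda>" for k using b by (simp add: onb_def)
  have d: "d > 0" using b by (simp add: onb_def)
  have b0': "b 0 = (\<lambda>z. (1 / sqrt m) * kern z + 0 * kern z)" by (simp add: b0 m_def)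
  have b0f: "L2_inner (b 0) f = L2_inner kern f / sqrt m" if "f \<in> trig_polys \<Lambda>" for f
    unfolding b0' L2_inner_lincomb[OF kV kV that] by simp
  have "kern (expt 0) = m" using L2_inner_kern[OF kV] L2_inner_kern_kern by (simp add: m_def)
  then show "b 0 (expt 0) = sqrt (real (card \<Lambda>))"
    using m by (simp add: b0 m_def[symmetric] real_div_sqrt)
  have t0: "tgrad (b 0) 0 $ j = 0" for j
    using tgrad_0[OF bV[OF d]] b0f[OF dV] L2_inner_kern_dkern by simp
  then show "tgrad (b 0) 0 = 0" by (simp add: vec_eq_iff)
  show "b k (expt 0) = 0" if "0 < k" "k < d"
  proof -
    have "L2_inner kern (b k) / sqrt m = L2_inner (b 0) (b k)" using b0f[OF bV[OF that(2)]] by simp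
    also have "\<dots> = 0" using b that d by (simp add: onb_def)
    finally have "L2_inner (b k) kern = 0" using m by (simp add: L2_inner_commute)
    then show ?thesis using L2_inner_kern[OF bV[OF that(2)]] by simp
  qed
  have "(\<Sum>\<mu>\<in>\<Lambda>. of_int (\<mu> $ i) * of_int (\<mu> $ j)) = (\<Sum>k<d. L2_inner (dkern i) (b k) * L2_inner (dkern j) (b k))"
    unfolding L2_inner_dkern_dkern[symmetric] by (rule onb_Parseval[OF b dV dV])
  also have "\<dots> = (\<Sum>k<d. tgrad (b k) 0 $ i * tgrad (b k) 0 $ j)"
    using bV by (intro sum.cong refl) (simp add: tgrad_0 L2_inner_commute)
  also have "\<dots> = (\<Sum>k\<in>{1..<d}. tgrad (b k) 0 $ i * tgrad (b k) 0 $ j)"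
    using t0 by (intro sum.mono_neutral_right) (auto simp: not_less_eq_eq less_Suc_eq_0_disj)
  finally show "(\<Sum>k\<in>{1..<d}. tgrad (b k) 0 $ i * tgrad (b k) 0 $ j) = (\<Sum>\<mu>\<in>\<Lambda>. of_int (\<mu> $ i) * of_int (\<mu> $ j))" by simp
qed

end

section \<open>Uniform measures on the sphere\<close>

text \<open>Finite linear combinations of point evaluations. They are measurable for the topology of
  pointwise convergence, whereas coordinates in an orthonormal basis are defined by integrals; the
  combinations serve to express the latter.\<close>

inductive evaluation_comb :: "(('z \<Rightarrow> real) \<Rightarrow> real) \<Rightarrow> bool" where
  eval: "evaluation_comb (\<lambda>f. f z)"
| comb: "evaluation_comb A \<Longrightarrow> evaluation_comb B \<Longrightarrow> evaluation_comb (\<lambda>f. c * A f + d * B f)"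

lemma evaluation_comb_sum:
  assumes "finite K" "\<And>k. k \<in> K \<Longrightarrow> evaluation_comb (A k)"
  shows "evaluation_comb (\<lambda>f. \<Sum>k\<in>K. c k * A k f)"
  using assms
proof (induction K)
  case empty
  show ?case using evaluation_comb.comb[OF evaluation_comb.eval evaluation_comb.eval, of 0 undefined 0 undefined] by simp
next
  case (insert k K)
  then show ?case
    using evaluation_comb.comb[of "A k" "\<lambda>f. \<Sum>k\<in>K. c k * A k f" "c k" 1] by simp
qed

lemma evaluation_comb_linear:
  "evaluation_comb A \<Longrightarrow> A (\<lambda>z. c * f z + d * g z) = c * A f + d * A g"
  by (induction rule: evaluation_comb.induct) (simp_all add: algebra_simps)

lemma evaluation_comb_linear_sum:
  assumes "evaluation_comb A" "finite K"
  shows "A (\<lambda>z. \<Sum>k\<in>K. c k * f k z) = (\<Sum>k\<in>K. c k * A (f k))"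
  using assms(2)
proof (induction K)
  case empty
  then show ?case using evaluation_comb_linear[OF assms(1), of 0 "\<lambda>_. 0" 0 "\<lambda>_. 0"] by simp
next
  case (insert k K)
  then show ?case
    using evaluation_comb_linear[OF assms(1), of "c k" "f k" 1 "\<lambda>z. \<Sum>k\<in>K. c k * f k z"] by simp
qed

lemma evaluation_comb_measurable:
  "evaluation_comb A \<Longrightarrow> A \<in> borel_measurable borel"
proof (induction rule: evaluation_comb.induct)
  case (eval z)
  show ?case by (intro borel_measurable_continuous_onI continuous_on_product_coordinates)
next
  case (comb A B c d)
  then show ?case by (intro borel_measurable_add borel_measurable_times borel_measurable_const)
qed

text \<open>Linear independence yields a point where \<open>b m\<close> differs from the combination
  of earlier members with the coefficients \<open>E k (b m)\<close>. Evaluating the difference there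
  gives, up to the scalar \<open>s\<close>, a functional \<open>F\<close> that vanishes on the
  earlier members; subtracting multiples of \<open>F\<close> corrects the earlier functionals at
  \<open>b m\<close>.\<close>

lemma dual_evaluations:
  fixes b :: "nat \<Rightarrow> 'z \<Rightarrow> real"
  assumes indep: "\<And>m c. m < d \<Longrightarrow> b m \<noteq> (\<lambda>z. \<Sum>k<m. c k * b k z)" and "m \<le> d"
  shows "\<exists>E. \<forall>k<m. evaluation_comb (E k) \<and> (\<forall>l<m. E k (b l) = (if k = l then 1 else 0))"
  using \<open>m \<le> d\<close>
proof (induction m)
  case (Suc m)
  then obtain E where E: "\<And>k. k < m \<Longrightarrow> evaluation_comb (E k)"
    and Eb: "\<And>k l. k < m \<Longrightarrow> l < m \<Longrightarrow> E k (b l) = (if k = l then 1 else 0)" by auto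
  obtain z where z: "b m z \<noteq> (\<Sum>k<m. E k (b m) * b k z)"
    using indep[of m "\<lambda>k. E k (b m)"] Suc.prems by auto
  define s where "s = b m z - (\<Sum>k<m. E k (b m) * b k z)"
  have s: "s \<noteq> 0" using z by (simp add: s_def)
  define F where "F = (\<lambda>f. (1 / s) * f z + (- 1 / s) * (\<Sum>k<m. b k z * E k f))"
  have F: "evaluation_comb F"
    unfolding F_def by (intro evaluation_comb.intros evaluation_comb_sum) (auto intro: E)
  have Fl: "F (b l) = 0" if "l < m" for l
  proof -
    have "(\<Sum>k<m. b k z * E k (b l)) = (\<Sum>k<m. if k = l then b k z else 0)"
      using that Eb by (intro sum.cong) auto
    also have "\<dots> = b l z" using that by simp
    finally show ?thesis by (simp add: F_def)
  qed
  have Fm: "F (b m) = 1"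
    using s by (simp add: F_def s_def mult.commute flip: diff_divide_distrib)
  define E' where "E' = (\<lambda>k. if k = m then F else (\<lambda>f. 1 * E k f + (- E k (b m)) * F f))"
  have "evaluation_comb (E' k)" if "k < Suc m" for k
    using that E F evaluation_comb.comb[of "E k" F 1 "- E k (b m)"] by (auto simp: E'_def less_Suc_eq)
  moreover have "E' k (b l) = (if k = l then 1 else 0)" if "k < Suc m" "l < Suc m" for k l
    using that Eb Fl Fm by (auto simp: E'_def less_Suc_eq)
  ultimately show ?case by blast
qed simp

lemma measurable_lincomb_fun:
  fixes b :: "nat \<Rightarrow> 'z \<Rightarrow> real"
  assumes "\<And>k. k < d \<Longrightarrow> (\<lambda>x. c x k) \<in> borel_measurable M"
  shows "(\<lambda>x z. \<Sum>k<d. c x k * b k z) \<in> measurable M borel"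
proof -
  \<comment> \<open>Coefficients from \<open>d\<close> on are set to 0 to obtain a measurable map
    into sequences, on which the linear combination depends continuously.\<close>
  have "(\<lambda>x k. if k < d then c x k else 0) \<in> measurable M (borel :: (nat \<Rightarrow> real) measure)"
  proof (rule measurable_coordinatewise_then_product)
    show "(\<lambda>x. if i < d then c x i else 0) \<in> borel_measurable M" for i
      using assms by (cases "i < d") simp_all
  qed
  moreover have "(\<lambda>c z. \<Sum>k<d. c k * b k z) \<in> measurable (borel :: (nat \<Rightarrow> real) measure) borel"
    by (intro borel_measurable_continuous_onI continuous_on_coordinatewise_then_product continuous_intros
        continuous_on_product_coordinates)
  ultimately have "(\<lambda>x. (\<lambda>c z. \<Sum>k<d. c k * b k z) (\<lambda>k. if k < d then c x k else 0)) \<in> measurable M borel"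
    by (rule measurable_compose)
  then show ?thesis by simp
qed

section \<open>Coordinates and caps of the sphere\<close>

context
  fixes \<Lambda> :: "(int ^ 'n::finite) set" and d :: nat and b :: "nat \<Rightarrow> complex ^ 'n \<Rightarrow> real"
  assumes fin: "finite \<Lambda>" and ne: "\<Lambda> \<noteq> {}" and sym: "uminus ` \<Lambda> = \<Lambda>" and onb: "onb \<Lambda> d b"
begin

lemma onb_pos: "d > 0" and onb_V: "k < d \<Longrightarrow> b k \<in> trig_polys \<Lambda>"
  and onb_orth: "k < d \<Longrightarrow> l < d \<Longrightarrow> L2_inner (b k) (b l) = (if k = l then 1 else 0)"
  and onb_expand: "f \<in> trig_polys \<Lambda> \<Longrightarrow> f = (\<lambda>z. \<Sum>k<d. L2_inner f (b k) * b k z)"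
  using onb by (auto simp: onb_def[OF fin ne sym])

lemmas lincomb = L2_inner_lincomb[OF fin ne sym] and inner_sum = L2_inner_sum[OF fin ne sym]
  and inner_self = L2_inner_self[OF fin ne sym] and Parseval = onb_Parseval[OF fin ne sym onb]

lemma sphere_V: "f \<in> unit_sphere \<Lambda> \<Longrightarrow> f \<in> trig_polys \<Lambda>" and sphere_1: "f \<in> unit_sphere \<Lambda> \<Longrightarrow> L2_inner f f = 1"
  by (auto simp: unit_sphere_def)

lemma comb_V: "(\<lambda>z. \<Sum>k<d. c k * b k z) \<in> trig_polys \<Lambda>"
  by (intro trig_polys_sum) (auto intro: onb_V)

lemma comb_inner: "l < d \<Longrightarrow> L2_inner (\<lambda>z. \<Sum>k<d. c k * b k z) (b l) = c l"
  by (subst inner_sum) (auto simp: onb_V onb_orth if_distrib[of "\<lambda>x. _ * x"] cong: if_cong)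

abbreviation "sphere_borel \<equiv> restrict_space (borel :: (complex ^ 'n \<Rightarrow> real) measure) (unit_sphere \<Lambda>)"

text \<open>On the sphere the coordinate agrees with a combination of point evaluations that is dual
  to the basis.\<close>

lemma measurable_coordinate: "k < d \<Longrightarrow> (\<lambda>f. L2_inner f (b k)) \<in> borel_measurable sphere_borel"
proof -
  assume k: "k < d"
  have "b m \<noteq> (\<lambda>z. \<Sum>k<m. c k * b k z)" if "m < d" for m c
  proof
    assume eq: "b m = (\<lambda>z. \<Sum>k<m. c k * b k z)"
    have "L2_inner (b m) (b m) = L2_inner (\<lambda>z. \<Sum>k<m. c k * b k z) (b m)" using eq by simp
    also have "\<dots> = (\<Sum>k<m. c k * L2_inner (b k) (b m))"
      using that by (intro inner_sum) (auto intro: onb_V)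
    also have "\<dots> = 0" using that by (intro sum.neutral) (auto simp: onb_orth)
    finally show False using onb_orth[OF that that] by simp
  qed
  from dual_evaluations[OF this order.refl, of d] obtain E where
    E: "evaluation_comb (E k)" "\<And>l. l < d \<Longrightarrow> E k (b l) = (if k = l then 1 else 0)"
    using k by blast
  have "E k f = L2_inner f (b k)" if "f \<in> unit_sphere \<Lambda>" for f
  proof -
    have "E k f = E k (\<lambda>z. \<Sum>k<d. L2_inner f (b k) * b k z)"
      using onb_expand[OF sphere_V[OF that]] by simp
    also have "\<dots> = (\<Sum>l<d. L2_inner f (b l) * E k (b l))" by (rule evaluation_comb_linear_sum[OF E(1)]) simp
    also have "\<dots> = L2_inner f (b k)"
      using k E(2) by (simp add: if_distrib[of "\<lambda>x. _ * x"] cong: if_cong)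
    finally show ?thesis .
  qed
  moreover have "E k \<in> borel_measurable sphere_borel"
    by (rule measurable_restrict_space1[OF evaluation_comb_measurable[OF E(1)]])
  ultimately show ?thesis by (subst measurable_cong[of _ _ "E k"]) (auto simp: space_restrict_space)
qed

lemma measurable_inner_pair:
  "(\<lambda>(f, g). L2_inner f g) \<in> borel_measurable (sphere_borel \<Otimes>\<^sub>M sphere_borel)"
proof -
  have "(\<lambda>p. \<Sum>k<d. L2_inner (fst p) (b k) * L2_inner (snd p) (b k)) \<in> borel_measurable (sphere_borel \<Otimes>\<^sub>M sphere_borel)"
    by (intro borel_measurable_sum borel_measurable_times
        measurable_compose[OF measurable_fst measurable_coordinate] measurable_compose[OF measurable_snd measurable_coordinate]) auto
  then show ?thesis
    by (subst measurable_cong[of _ _ "\<lambda>p. \<Sum>k<d. L2_inner (fst p) (b k) * L2_inner (snd p) (b k)"])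
      (auto simp: space_pair_measure space_restrict_space split_beta intro!: Parseval sphere_V)
qed

definition cap :: "(complex ^ 'n \<Rightarrow> real) \<Rightarrow> real \<Rightarrow> (complex ^ 'n \<Rightarrow> real) set" where
  "cap x a = {z \<in> unit_sphere \<Lambda>. L2_inner z x > a}"

lemma measurable_cap_pair:
  "{p \<in> space (sphere_borel \<Otimes>\<^sub>M sphere_borel). L2_inner (fst p) (snd p) > a} \<in> sets (sphere_borel \<Otimes>\<^sub>M sphere_borel)"
  using measurable_inner_pair by (simp add: split_beta) measurable

lemma measurable_cap:
  assumes "x \<in> unit_sphere \<Lambda>"
  shows "cap x a \<in> sets sphere_borel"
proof -
  have eq: "cap x a = (\<lambda>z. (z, x)) -` {p \<in> space (sphere_borel \<Otimes>\<^sub>M sphere_borel). L2_inner (fst p) (snd p) > a} \<inter> space sphere_borel"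
    using assms by (auto simp: cap_def space_pair_measure space_restrict_space)
  have m: "(\<lambda>z. (z, x)) \<in> measurable sphere_borel (sphere_borel \<Otimes>\<^sub>M sphere_borel)"
    by (rule measurable_Pair[OF measurable_ident measurable_const, unfolded id_def])
      (use assms in \<open>simp add: space_restrict_space\<close>)
  show ?thesis unfolding eq by (rule measurable_sets[OF m measurable_cap_pair])
qed

lemma inner_difference:
  assumes V: "x \<in> trig_polys \<Lambda>" "y \<in> trig_polys \<Lambda>"
  defines "D \<equiv> \<lambda>z. 1 * y z + (- 1) * x z"
  shows "D \<in> trig_polys \<Lambda>" "L2_inner D D = L2_inner y y - 2 * L2_inner y x + L2_inner x x"
proof -
  show DV: "D \<in> trig_polys \<Lambda>" unfolding D_def by (intro trig_polys_lincomb V)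
  have 1: "L2_inner D f = L2_inner y f - L2_inner x f" if "f \<in> trig_polys \<Lambda>" for f
    unfolding D_def lincomb[OF V(2,1) that] by simp
  have "L2_inner y D = L2_inner y y - L2_inner x y" "L2_inner x D = L2_inner y x - L2_inner x x"
    using 1[OF V(2)] 1[OF V(1)] by (simp_all add: L2_inner_commute[of _ D])
  then show "L2_inner D D = L2_inner y y - 2 * L2_inner y x + L2_inner x x"
    using 1[OF DV] L2_inner_commute[of x y] by simp
qed

text \<open>On the sphere the squared distance of \<open>y n\<close> and \<open>x\<close> is
  \<open>2 - 2 * L2_inner (y n) x\<close>, so all coordinates converge, and with them the values at
  every point.\<close>

lemma sphere_inner_near:
  assumes x: "x \<in> unit_sphere \<Lambda>" and y: "\<And>n::nat. y n \<in> unit_sphere \<Lambda>"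
    and lim: "(\<lambda>n. L2_inner (y n) x) \<longlonglongrightarrow> 1"
  shows "(\<lambda>n. y n z) \<longlonglongrightarrow> x z"
proof -
  have V: "x \<in> trig_polys \<Lambda>" "\<And>n. y n \<in> trig_polys \<Lambda>" using x y by (auto intro: sphere_V)
  have diffV: "(\<lambda>z. 1 * y n z + (- 1) * x z) \<in> trig_polys \<Lambda>" for n by (intro trig_polys_lincomb V)
  have c: "(\<lambda>n. L2_inner (y n) (b k)) \<longlonglongrightarrow> L2_inner x (b k)" if k: "k < d" for k
  proof -
    let ?D = "\<lambda>n. (\<lambda>z. 1 * y n z + (- 1) * x z)"
    have n2: "L2_inner (?D n) (?D n) = 2 - 2 * L2_inner (y n) x" for n
      unfolding inner_difference(2)[OF V(1,2)] using sphere_1[OF x] sphere_1[OF y] by simp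
    have le: "(L2_inner (y n) (b k) - L2_inner x (b k))\<^sup>2 \<le> 2 - 2 * L2_inner (y n) x" for n
    proof -
      have "L2_inner (y n) (b k) - L2_inner x (b k) = L2_inner (?D n) (b k)"
        unfolding lincomb[OF V(2,1) onb_V[OF k]] by simp
      then have "(L2_inner (y n) (b k) - L2_inner x (b k))\<^sup>2 = (L2_inner (?D n) (b k))\<^sup>2" by simp
      also have "\<dots> \<le> (\<Sum>k<d. (L2_inner (?D n) (b k))\<^sup>2)"
        using k by (intro member_le_sum) auto
      also have "\<dots> = L2_inner (?D n) (?D n)" using Parseval[OF diffV diffV] by (simp add: power2_eq_square)
      finally show ?thesis using n2 by simp
    qed
    have "(\<lambda>n. 2 - 2 * L2_inner (y n) x) \<longlonglongrightarrow> 2 - 2 * 1" by (intro tendsto_intros lim)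
    then have lim0: "(\<lambda>n. 2 - 2 * L2_inner (y n) x) \<longlonglongrightarrow> 0" by simp
    have "(\<lambda>n. (L2_inner (y n) (b k) - L2_inner x (b k))\<^sup>2) \<longlonglongrightarrow> 0"
      by (rule tendsto_sandwich[OF _ _ tendsto_const lim0]) (simp_all add: le)
    from tendsto_real_sqrt[OF this]
    have "(\<lambda>n. L2_inner (y n) (b k) - L2_inner x (b k)) \<longlonglongrightarrow> 0"
    proof -
      assume "(\<lambda>n. sqrt ((L2_inner (y n) (b k) - L2_inner x (b k))\<^sup>2)) \<longlonglongrightarrow> sqrt 0"
      then have "(\<lambda>n. \<bar>L2_inner (y n) (b k) - L2_inner x (b k)\<bar>) \<longlonglongrightarrow> 0" by simp
      then show ?thesis by (rule tendsto_rabs_zero_cancel)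
    qed
    then show ?thesis by (simp add: LIM_zero_iff)
  qed
  have "(\<lambda>n. \<Sum>k<d. L2_inner (y n) (b k) * b k z) \<longlonglongrightarrow> (\<Sum>k<d. L2_inner x (b k) * b k z)"
    by (intro tendsto_sum tendsto_mult c tendsto_const) simp
  moreover have "y n z = (\<Sum>k<d. L2_inner (y n) (b k) * b k z)" for n
    using fun_cong[OF onb_expand[OF V(2)[of n]], of z] .
  ultimately show ?thesis
    using fun_cong[OF onb_expand[OF V(1)], of z] by simp
qed

text \<open>Links the caps, which are defined by the inner product, with the topology of pointwise
  convergence: points of ever smaller caps converge to the centre, so they cannot stay outside
  \<open>U\<close>.\<close>

lemma open_contains_cap:
  assumes U: "open U" and x: "x \<in> U" "x \<in> unit_sphere \<Lambda>" and a: "a \<longlonglongrightarrow> (1::real)"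
  shows "eventually (\<lambda>n. cap x (a n) \<subseteq> U) sequentially"
proof (rule ccontr)
  assume "\<not> ?thesis"
  then have fr: "frequently (\<lambda>n. \<exists>y. y \<in> cap x (a n) \<and> y \<notin> U) sequentially"
    by (simp add: frequently_def subset_eq Ball_def)
  define A where "A = {n. \<exists>y. y \<in> cap x (a n) \<and> y \<notin> U}"
  have "infinite A" using fr by (simp add: A_def frequently_cofinite[symmetric] cofinite_eq_sequentially)
  then obtain r :: "nat \<Rightarrow> nat" where r: "strict_mono r" "\<And>n. r n \<in> A"
    using infinite_enumerate by blast
  then have "\<forall>n. \<exists>y. y \<in> cap x (a (r n)) \<and> y \<notin> U" by (simp add: A_def)
  from choice[OF this] obtain y where y: "\<And>n. y n \<in> cap x (a (r n))" "\<And>n. y n \<notin> U" by blast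
  have yS: "y n \<in> unit_sphere \<Lambda>" and ya: "a (r n) < L2_inner (y n) x" for n using y by (auto simp: cap_def)
  have "L2_inner (y n) x \<le> 1" for n
  proof -
    have V: "y n \<in> trig_polys \<Lambda>" "x \<in> trig_polys \<Lambda>" using yS x by (auto intro: sphere_V)
    have "0 \<le> L2_inner (\<lambda>z. 1 * y n z + (- 1) * x z) (\<lambda>z. 1 * y n z + (- 1) * x z)"
      by (rule inner_self(1)[OF inner_difference(1)[OF V(2,1)]])
    also have "\<dots> = 2 - 2 * L2_inner (y n) x"
      unfolding inner_difference(2)[OF V(2,1)] using sphere_1[OF x(2)] sphere_1[OF yS] by simp
    finally show ?thesis by simp
  qed
  note le1 = this
  have ar: "(\<lambda>n. a (r n)) \<longlonglongrightarrow> 1" using LIMSEQ_subseq_LIMSEQ[OF a r(1)] by (simp add: o_def)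
  have lim: "(\<lambda>n. L2_inner (y n) x) \<longlonglongrightarrow> 1"
    by (rule tendsto_sandwich[OF _ _ ar tendsto_const]) (simp_all add: le1 less_imp_le[OF ya])
  have "y \<longlonglongrightarrow> x"
  proof -
    have "limitin (product_topology (\<lambda>_. euclidean) UNIV) y x sequentially"
      unfolding limitin_componentwise
      using sphere_inner_near[OF x(2) yS lim] by (simp add: extensional_def)
    then show ?thesis by (simp add: euclidean_product_topology)
  qed
  then have "eventually (\<lambda>n. y n \<in> U) sequentially" using U x(1) by (rule topological_tendstoD)
  then show False using y(2) by simp
qed

section \<open>Probability measures that agree on congruent caps\<close>

definition cap_uniform :: "(complex ^ 'n \<Rightarrow> real) measure \<Rightarrow> bool" where
  "cap_uniform \<sigma> \<longleftrightarrow> prob_space \<sigma> \<and> sets \<sigma> = sets sphere_borel \<and>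
    (\<forall>x\<in>unit_sphere \<Lambda>. \<forall>y\<in>unit_sphere \<Lambda>. \<forall>a. emeasure \<sigma> (cap x a) = emeasure \<sigma> (cap y a))"

lemma cap_uniform_space: "cap_uniform \<sigma> \<Longrightarrow> space \<sigma> = unit_sphere \<Lambda>"
  unfolding cap_uniform_def using sets_eq_imp_space_eq[of \<sigma> sphere_borel] by (simp add: space_restrict_space)

lemma cap_uniformD:
  "cap_uniform \<sigma> \<Longrightarrow> x \<in> unit_sphere \<Lambda> \<Longrightarrow> y \<in> unit_sphere \<Lambda> \<Longrightarrow> emeasure \<sigma> (cap x a) = emeasure \<sigma> (cap y a)"
  unfolding cap_uniform_def by blast

text \<open>Tonelli for the pairs with \<open>L2_inner y z > a\<close> and \<open>z \<in> U\<close>: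
  for fixed \<open>z\<close> the points \<open>y\<close> form a cap around \<open>z\<close>, whose
  mass does not depend on \<open>z\<close>.\<close>

lemma cap_double_integral:
  assumes \<sigma>: "cap_uniform \<sigma>" and \<tau>: "cap_uniform \<tau>" and U: "U \<in> sets sphere_borel" and x: "x \<in> unit_sphere \<Lambda>"
  shows "(\<integral>\<^sup>+ y. emeasure \<tau> (U \<inter> cap y a) \<partial>\<sigma>) = emeasure \<sigma> (cap x a) * emeasure \<tau> U"
proof -
  interpret S: prob_space \<sigma> using \<sigma> by (simp add: cap_uniform_def)
  interpret T: prob_space \<tau> using \<tau> by (simp add: cap_uniform_def)
  interpret pair_sigma_finite \<sigma> \<tau> by standard
  have sets[measurable_cong]: "sets \<sigma> = sets sphere_borel" "sets \<tau> = sets sphere_borel"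
    using \<sigma> \<tau> by (simp_all add: cap_uniform_def)
  note space = cap_uniform_space[OF \<sigma>] cap_uniform_space[OF \<tau>]
  have sp: "sets (\<sigma> \<Otimes>\<^sub>M \<tau>) = sets (sphere_borel \<Otimes>\<^sub>M sphere_borel)"
    by (rule sets_pair_measure_cong[OF sets])
  define A where "A = {p \<in> space (sphere_borel \<Otimes>\<^sub>M sphere_borel). L2_inner (fst p) (snd p) > a}"
  have Am: "A \<in> sets (\<sigma> \<Otimes>\<^sub>M \<tau>)" unfolding sp A_def by (rule measurable_cap_pair)
  have Um: "U \<in> sets \<tau>" using U sets by simp
  have Us: "U \<subseteq> unit_sphere \<Lambda>" using sets.sets_into_space[OF U] by (simp add: space_restrict_space)
  define h where "h p = indicator A p * (indicator U (snd p) :: ennreal)" for p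
  have hm: "(\<lambda>(y, z). h (y, z)) \<in> borel_measurable (\<sigma> \<Otimes>\<^sub>M \<tau>)"
    unfolding h_def split_beta using Am Um by measurable
  have Aiff: "(y, z) \<in> A \<longleftrightarrow> y \<in> unit_sphere \<Lambda> \<and> z \<in> unit_sphere \<Lambda> \<and> L2_inner y z > a" for y z
    by (simp add: A_def space_pair_measure space_restrict_space)
  have 1: "(\<integral>\<^sup>+ z. h (y, z) \<partial>\<tau>) = emeasure \<tau> (U \<inter> cap y a)" if "y \<in> space \<sigma>" for y
  proof -
    have y: "y \<in> unit_sphere \<Lambda>" using that space by simp
    have "(\<integral>\<^sup>+ z. h (y, z) \<partial>\<tau>) = (\<integral>\<^sup>+ z. indicator (U \<inter> cap y a) z \<partial>\<tau>)"
    proof (rule nn_integral_cong)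
      fix z
      show "h (y, z) = indicator (U \<inter> cap y a) z"
        using y Us L2_inner_commute[of y z]
        by (cases "z \<in> U"; cases "L2_inner y z > a") (auto simp: h_def Aiff cap_def)
    qed
    also have "\<dots> = emeasure \<tau> (U \<inter> cap y a)"
      using Um measurable_cap[OF y, of a] sets by (intro nn_integral_indicator) auto
    finally show ?thesis .
  qed
  have 2: "(\<integral>\<^sup>+ y. h (y, z) \<partial>\<sigma>) = emeasure \<sigma> (cap x a) * indicator U z" if "z \<in> space \<tau>" for z
  proof -
    have z: "z \<in> unit_sphere \<Lambda>" using that space by simp
    have "(\<integral>\<^sup>+ y. h (y, z) \<partial>\<sigma>) = (\<integral>\<^sup>+ y. indicator U z * indicator (cap z a) y \<partial>\<sigma>)"
    proof (rule nn_integral_cong)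
      fix y
      show "h (y, z) = indicator U z * indicator (cap z a) y"
        using z by (cases "z \<in> U"; cases "y \<in> cap z a") (simp_all add: h_def Aiff cap_def)
    qed
    also have "\<dots> = indicator U z * emeasure \<sigma> (cap z a)"
      using measurable_cap[OF z, of a] sets by (subst nn_integral_cmult_indicator) auto
    also have "emeasure \<sigma> (cap z a) = emeasure \<sigma> (cap x a)"
      by (rule cap_uniformD[OF \<sigma> z x])
    finally show ?thesis by (simp add: mult.commute)
  qed
  have "(\<integral>\<^sup>+ y. emeasure \<tau> (U \<inter> cap y a) \<partial>\<sigma>) = (\<integral>\<^sup>+ y. \<integral>\<^sup>+ z. h (y, z) \<partial>\<tau> \<partial>\<sigma>)"
    by (rule nn_integral_cong) (simp add: 1)
  also have "\<dots> = (\<integral>\<^sup>+ z. \<integral>\<^sup>+ y. h (y, z) \<partial>\<sigma> \<partial>\<tau>)"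
    using Fubini'[OF hm] by simp
  also have "\<dots> = (\<integral>\<^sup>+ z. emeasure \<sigma> (cap x a) * indicator U z \<partial>\<tau>)"
    by (rule nn_integral_cong) (simp add: 2)
  also have "\<dots> = emeasure \<sigma> (cap x a) * emeasure \<tau> U"
    using Um by (rule nn_integral_cmult_indicator)
  finally show ?thesis .
qed

text \<open>The double integral for the whole sphere: its left side is the constant mass that
  \<open>\<tau>\<close> gives to a cap, its right side the mass that \<open>\<sigma>\<close> gives
  to it.\<close>

lemma cap_emeasure_eq:
  assumes \<sigma>: "cap_uniform \<sigma>" and \<tau>: "cap_uniform \<tau>" and x: "x \<in> unit_sphere \<Lambda>"
  shows "emeasure \<sigma> (cap x a) = emeasure \<tau> (cap x a)"
proof -
  have ps: "prob_space \<sigma>" "prob_space \<tau>" using \<sigma> \<tau> by (simp_all add: cap_uniform_def)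
  have S: "unit_sphere \<Lambda> \<in> sets sphere_borel"
    using sets.top[of sphere_borel] by (simp add: space_restrict_space)
  have capS: "unit_sphere \<Lambda> \<inter> cap y a = cap y a" for y by (auto simp: cap_def)
  have "(\<integral>\<^sup>+ y. emeasure \<tau> (cap y a) \<partial>\<sigma>) = emeasure \<sigma> (cap x a)"
    using cap_double_integral[OF \<sigma> \<tau> S x, of a] prob_space.emeasure_space_1[OF ps(2)] cap_uniform_space[OF \<tau>]
    by (simp add: capS)
  moreover have "(\<integral>\<^sup>+ y. emeasure \<tau> (cap y a) \<partial>\<sigma>) = (\<integral>\<^sup>+ y. emeasure \<tau> (cap x a) \<partial>\<sigma>)"
  proof (rule nn_integral_cong)
    fix y assume "y \<in> space \<sigma>"
    then have "y \<in> unit_sphere \<Lambda>" using cap_uniform_space[OF \<sigma>] by simp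
    then show "emeasure \<tau> (cap y a) = emeasure \<tau> (cap x a)"
      using cap_uniformD[OF \<tau> _ x] by blast
  qed
  moreover have "\<dots> = emeasure \<tau> (cap x a)"
    using prob_space.emeasure_space_1[OF ps(1)] by simp
  ultimately show ?thesis by simp
qed

text \<open>Christensen's argument: by Fubini, \<open>\<sigma>\<close> and \<open>\<tau>\<close> give the same value to every cap, and shrinking caps
  detect membership in an open set.\<close>

lemma cap_uniform_le:
  assumes \<sigma>: "cap_uniform \<sigma>" and \<tau>: "cap_uniform \<tau>" and U: "open U"
    and pos: "\<And>x a. x \<in> unit_sphere \<Lambda> \<Longrightarrow> a < 1 \<Longrightarrow> emeasure \<tau> (cap x a) > 0"
  shows "emeasure \<sigma> (U \<inter> unit_sphere \<Lambda>) \<le> emeasure \<tau> (U \<inter> unit_sphere \<Lambda>)"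
proof (cases "unit_sphere \<Lambda> = {}")
  case False
  then obtain x0 where x0: "x0 \<in> unit_sphere \<Lambda>" by blast
  interpret S: prob_space \<sigma> using \<sigma> by (simp add: cap_uniform_def)
  interpret T: prob_space \<tau> using \<tau> by (simp add: cap_uniform_def)
  interpret pair_sigma_finite \<sigma> \<tau> by standard
  have sets: "sets \<sigma> = sets sphere_borel" "sets \<tau> = sets sphere_borel"
    using \<sigma> \<tau> by (simp_all add: cap_uniform_def)
  note space = cap_uniform_space[OF \<sigma>] cap_uniform_space[OF \<tau>]
  let ?V = "U \<inter> unit_sphere \<Lambda>"
  have V: "?V \<in> sets sphere_borel"
    unfolding sets_restrict_space by (rule image_eqI[of _ _ U]) (use U in auto)
  define a :: "nat \<Rightarrow> real" where "a n = 1 - 1 / real (Suc n)" for n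
  have a: "a \<longlonglongrightarrow> 1" and a1: "a n < 1" for n
  proof -
    have "a \<longlonglongrightarrow> 1 - 0" unfolding a_def
      by (intro tendsto_diff tendsto_const LIMSEQ_inverse_real_of_nat[unfolded inverse_eq_divide])
    then show "a \<longlonglongrightarrow> 1" by simp
    show "a n < 1" by (simp add: a_def)
  qed
  define t where "t n = emeasure \<tau> (cap x0 (a n))" for n
  have t0: "t n \<noteq> 0" for n using pos[OF x0 a1[of n]] by (simp add: t_def)
  have t1: "t n \<noteq> \<infinity>" for n by (simp add: t_def)
  define f where "f n y = emeasure \<tau> (?V \<inter> cap y (a n))" for n y
  have fm: "f n \<in> borel_measurable \<sigma>" for n
  proof -
    define A where "A = {p \<in> space (sphere_borel \<Otimes>\<^sub>M sphere_borel). L2_inner (fst p) (snd p) > a n} \<inter> (unit_sphere \<Lambda> \<times> ?V)"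
    have "unit_sphere \<Lambda> \<times> ?V \<in> sets (sphere_borel \<Otimes>\<^sub>M sphere_borel)"
      using V sets.top[of sphere_borel] by (intro pair_measureI) (simp_all add: space_restrict_space)
    then have "A \<in> sets (\<sigma> \<Otimes>\<^sub>M \<tau>)"
      unfolding A_def sets_pair_measure_cong[OF sets] by (intro sets.Int measurable_cap_pair)
    from T.measurable_emeasure_Pair[OF this]
    have "(\<lambda>y. emeasure \<tau> (Pair y -` A)) \<in> borel_measurable \<sigma>" .
    moreover have "Pair y -` A = ?V \<inter> cap y (a n)" if "y \<in> space \<sigma>" for y
      using that unfolding space
      by (auto simp: A_def cap_def space_pair_measure space_restrict_space L2_inner_commute[of y])
    ultimately show ?thesis unfolding f_def by (subst measurable_cong[of _ _ "\<lambda>y. emeasure \<tau> (Pair y -` A)"]) auto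
  qed
  \<comment> \<open>The averages of the indicator over caps have the same integral for every
    \<open>n\<close>, because both measures give a cap the mass \<open>t n\<close>; positivity of
    that mass permits the division.\<close>
  have int: "(\<integral>\<^sup>+ y. f n y / t n \<partial>\<sigma>) = emeasure \<tau> ?V" for n
  proof -
    have "(\<integral>\<^sup>+ y. f n y / t n \<partial>\<sigma>) = (\<integral>\<^sup>+ y. f n y \<partial>\<sigma>) / t n"
      using fm by (rule nn_integral_divide)
    also have "\<dots> = t n * emeasure \<tau> ?V / t n"
      unfolding f_def cap_double_integral[OF \<sigma> \<tau> V x0] cap_emeasure_eq[OF \<sigma> \<tau> x0] t_def ..
    also have "\<dots> = emeasure \<tau> ?V"
      using t0[of n] t1[of n] by (simp add: ennreal_mult_divide_eq mult.commute[of "t n"])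
    finally show ?thesis .
  qed
  have "emeasure \<sigma> ?V = (\<integral>\<^sup>+ y. indicator ?V y \<partial>\<sigma>)"
    using V sets by (intro nn_integral_indicator[symmetric]) simp
  \<comment> \<open>At a point of the open set small caps lie inside it, so the averages are
    eventually 1; Fatou's lemma then takes the lower limit out of the integral.\<close>
  also have "\<dots> \<le> (\<integral>\<^sup>+ y. liminf (\<lambda>n. f n y / t n) \<partial>\<sigma>)"
  proof (rule nn_integral_mono)
    fix y assume "y \<in> space \<sigma>"
    then have y: "y \<in> unit_sphere \<Lambda>" using space by simp
    show "indicator ?V y \<le> liminf (\<lambda>n. f n y / t n)"
    proof (cases "y \<in> U")
      case True
      have "eventually (\<lambda>n. 1 \<le> f n y / t n) sequentially"
        using open_contains_cap[OF U True y a]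
      proof eventually_elim
        case (elim n)
        then have "?V \<inter> cap y (a n) = cap y (a n)" by (auto simp: cap_def)
        then have "f n y = t n"
          using cap_uniformD[OF \<tau> y x0] by (simp add: f_def t_def)
        then show ?case using ennreal_divide_self[OF t0[of n]] t1[of n] by (simp add: less_top)
      qed
      then have "1 \<le> liminf (\<lambda>n. f n y / t n)" by (rule Liminf_bounded)
      then show ?thesis using True y by simp
    qed simp
  qed
  also have "\<dots> \<le> liminf (\<lambda>n. \<integral>\<^sup>+ y. f n y / t n \<partial>\<sigma>)"
    using fm by (intro nn_integral_liminf borel_measurable_divide_ennreal) auto
  also have "\<dots> = emeasure \<tau> ?V" by (simp add: int Liminf_const)
  finally show ?thesis .
qed simp

text \<open>The traces of open sets generate the Borel sets of the sphere and are stable under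
  intersection, so the inequality in both directions suffices.\<close>

lemma cap_uniform_unique:
  assumes \<sigma>: "cap_uniform \<sigma>" and \<tau>: "cap_uniform \<tau>"
    and pos: "\<And>x a. x \<in> unit_sphere \<Lambda> \<Longrightarrow> a < 1 \<Longrightarrow> emeasure \<tau> (cap x a) > 0"
  shows "\<sigma> = \<tau>"
proof -
  interpret S: prob_space \<sigma> using \<sigma> by (simp add: cap_uniform_def)
  interpret T: prob_space \<tau> using \<tau> by (simp add: cap_uniform_def)
  have sets: "sets \<sigma> = sets sphere_borel" "sets \<tau> = sets sphere_borel"
    using \<sigma> \<tau> by (simp_all add: cap_uniform_def)
  note space = cap_uniform_space[OF \<sigma>] cap_uniform_space[OF \<tau>]
  \<comment> \<open>Positivity passes to \<open>\<sigma>\<close>, since the two measures agree on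
    caps; this makes the situation symmetric.\<close>
  have pos': "emeasure \<sigma> (cap x a) > 0" if "x \<in> unit_sphere \<Lambda>" "a < 1" for x a
    using pos[OF that] cap_emeasure_eq[OF \<sigma> \<tau> that(1)] by simp
  have eq: "emeasure \<sigma> (U \<inter> unit_sphere \<Lambda>) = emeasure \<tau> (U \<inter> unit_sphere \<Lambda>)" if "open U" for U
    using cap_uniform_le[OF \<sigma> \<tau> that pos] cap_uniform_le[OF \<tau> \<sigma> that pos'] by (rule antisym)
  let ?E = "(\<lambda>U. U \<inter> unit_sphere \<Lambda>) ` {U :: (complex ^ 'n \<Rightarrow> real) set. open U}"
  have gen: "sets sphere_borel = sigma_sets (unit_sphere \<Lambda>) ?E"
  proof -
    have E: "{(\<lambda>x. x) -` A \<inter> unit_sphere \<Lambda> |A. open A} = ?E" by auto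
    have "sets sphere_borel = {(\<lambda>x. x) -` A \<inter> unit_sphere \<Lambda> |A. A \<in> sigma_sets UNIV {U. open U}}"
      by (auto simp: sets_restrict_space borel_def)
    also have "\<dots> = sigma_sets (unit_sphere \<Lambda>) {(\<lambda>x. x) -` A \<inter> unit_sphere \<Lambda> |A. A \<in> {U. open U}}"
      by (rule sigma_sets_vimage_commute) simp
    finally show ?thesis using E by simp
  qed
  show ?thesis
  proof (rule measure_eqI_generator_eq[of ?E "unit_sphere \<Lambda>" \<sigma> \<tau> "\<lambda>_. unit_sphere \<Lambda>"])
    show "Int_stable ?E"
    proof (rule Int_stableI_image)
      fix U V :: "(complex ^ 'n \<Rightarrow> real) set" assume "U \<in> {U. open U}" "V \<in> {U. open U}"
      then show "\<exists>W\<in>{U. open U}. U \<inter> unit_sphere \<Lambda> \<inter> (V \<inter> unit_sphere \<Lambda>) = W \<inter> unit_sphere \<Lambda>"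
        by (intro bexI[of _ "U \<inter> V"]) auto
    qed
  qed (use eq gen sets in \<open>auto intro!: image_eqI[of _ _ UNIV]\<close>)
qed

end

section \<open>Gaussian measures\<close>

definition stdn :: "real measure" where
  "stdn = density lborel (\<lambda>x. ennreal (std_normal_density x))"

definition gauss :: "'k set \<Rightarrow> ('k \<Rightarrow> real) measure" where
  "gauss I = PiM I (\<lambda>_. stdn)"

lemma sets_stdn[simp, measurable_cong]: "sets stdn = sets borel"
  and space_stdn[simp]: "space stdn = UNIV"
  by (simp_all add: stdn_def)

lemma prob_space_stdn: "prob_space stdn"
  unfolding stdn_def by (rule prob_space_normal_density) simp

interpretation stdn: prob_space stdn by (rule prob_space_stdn)

interpretation stdn_prod: product_sigma_finite "\<lambda>_. stdn"
  by standard

lemma prob_space_gauss: "prob_space (gauss I)"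
  unfolding gauss_def by (intro prob_space_PiM prob_space_stdn)

lemma sets_gauss[measurable_cong]: "sets (gauss I) = sets (PiM I (\<lambda>_. borel))"
  unfolding gauss_def by (intro sets_PiM_cong) auto

lemma space_gauss: "space (gauss I) = PiE I (\<lambda>_. UNIV)"
  by (simp add: gauss_def space_PiM)

lemma measurable_gauss_component[measurable]: "k \<in> I \<Longrightarrow> (\<lambda>c. c k) \<in> borel_measurable (gauss I)"
  unfolding measurable_cong_sets[OF sets_gauss refl] by (rule measurable_component_singleton)

lemma nn_integral_stdn:
  assumes [measurable]: "f \<in> borel_measurable borel"
  shows "(\<integral>\<^sup>+ x. f x \<partial>stdn) = (\<integral>\<^sup>+ x. ennreal (std_normal_density x) * f x \<partial>lborel)"
  unfolding stdn_def by (subst nn_integral_density) auto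

section \<open>Rotation invariance of Gaussian measures\<close>

lemma nn_integral_translate:
  fixes f :: "real \<Rightarrow> ennreal"
  assumes [measurable]: "f \<in> borel_measurable borel"
  shows "(\<integral>\<^sup>+ s. f (s + a) \<partial>lborel) = (\<integral>\<^sup>+ s. f s \<partial>lborel)"
  using nn_integral_real_affine[of f 1 a] by (simp add: add.commute)

lemma nn_integral_shear:
  fixes g :: "real \<times> real \<Rightarrow> ennreal"
  assumes [measurable]: "g \<in> borel_measurable (borel \<Otimes>\<^sub>M borel)"
  shows "(\<integral>\<^sup>+ t. \<integral>\<^sup>+ s. g (s + a * t, t) \<partial>lborel \<partial>lborel) = (\<integral>\<^sup>+ t. \<integral>\<^sup>+ s. g (s, t) \<partial>lborel \<partial>lborel)"
    and "(\<integral>\<^sup>+ t. \<integral>\<^sup>+ s. g (s, t + a * s) \<partial>lborel \<partial>lborel) = (\<integral>\<^sup>+ t. \<integral>\<^sup>+ s. g (s, t) \<partial>lborel \<partial>lborel)"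
proof -
  show "(\<integral>\<^sup>+ t. \<integral>\<^sup>+ s. g (s + a * t, t) \<partial>lborel \<partial>lborel) = (\<integral>\<^sup>+ t. \<integral>\<^sup>+ s. g (s, t) \<partial>lborel \<partial>lborel)"
    by (intro nn_integral_cong nn_integral_translate[of "\<lambda>s. g (s, t)" for t]) measurable
  have "(\<integral>\<^sup>+ t. \<integral>\<^sup>+ s. g (s, t + a * s) \<partial>lborel \<partial>lborel) = (\<integral>\<^sup>+ s. \<integral>\<^sup>+ t. g (s, t + a * s) \<partial>lborel \<partial>lborel)"
    using lborel_pair.Fubini'[of "\<lambda>t s. g (s, t + a * s)"] by simp
  also have "\<dots> = (\<integral>\<^sup>+ s. \<integral>\<^sup>+ t. g (s, t) \<partial>lborel \<partial>lborel)"
    by (intro nn_integral_cong nn_integral_translate[of "\<lambda>t. g (s, t)" for s]) measurable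
  also have "\<dots> = (\<integral>\<^sup>+ t. \<integral>\<^sup>+ s. g (s, t) \<partial>lborel \<partial>lborel)"
    using lborel_pair.Fubini'[of "\<lambda>t s. g (s, t)"] by simp
  finally show "(\<integral>\<^sup>+ t. \<integral>\<^sup>+ s. g (s, t + a * s) \<partial>lborel \<partial>lborel) = (\<integral>\<^sup>+ t. \<integral>\<^sup>+ s. g (s, t) \<partial>lborel \<partial>lborel)" .
qed

text \<open>A rotation is a product of three shears.\<close>

lemma nn_integral_rotation:
  fixes g :: "real \<times> real \<Rightarrow> ennreal"
  assumes [measurable]: "g \<in> borel_measurable (borel \<Otimes>\<^sub>M borel)" and ab: "a\<^sup>2 + b\<^sup>2 = 1"
  shows "(\<integral>\<^sup>+ t. \<integral>\<^sup>+ s. g (a * s - b * t, b * s + a * t) \<partial>lborel \<partial>lborel)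
    = (\<integral>\<^sup>+ t. \<integral>\<^sup>+ s. g (s, t) \<partial>lborel \<partial>lborel)"
proof (cases "b = 0")
  case False
  \<comment> \<open>For the angle with cosine \<open>a\<close> and sine \<open>b\<close> this is
    minus the tangent of half the angle; shears by \<open>p\<close>, \<open>b\<close> and
    \<open>p\<close> compose to the rotation.\<close>
  define p where "p = (a - 1) / b"
  have pb: "1 + p * b = a" using False by (simp add: p_def)
  have pa: "p * (1 + a) = - b"
    using ab False by (simp add: p_def field_simps power2_eq_square)
  define g1 where "g1 = (\<lambda>(s, t). g (s + p * t, t))"
  define g2 where "g2 = (\<lambda>(s, t). g1 (s, t + b * s))"
  have [measurable]: "g1 \<in> borel_measurable (borel \<Otimes>\<^sub>M borel)" unfolding g1_def by measurable
  have [measurable]: "g2 \<in> borel_measurable (borel \<Otimes>\<^sub>M borel)" unfolding g2_def by measurable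
  have "g (a * s - b * t, b * s + a * t) = g2 (s + p * t, t)" for s t
  proof -
    have e1: "t + b * (s + p * t) = b * s + a * t"
      using pb by (simp add: algebra_simps) (metis distrib_right mult.commute mult.left_commute mult_1)
    have "s + p * t + p * (b * s + a * t) = (1 + p * b) * s + (p * (1 + a)) * t"
      by (simp add: algebra_simps)
    then have "s + p * t + p * (b * s + a * t) = a * s - b * t" by (simp add: pa pb)
    then show ?thesis by (simp add: g2_def g1_def e1)
  qed
  then have "(\<integral>\<^sup>+ t. \<integral>\<^sup>+ s. g (a * s - b * t, b * s + a * t) \<partial>lborel \<partial>lborel)
      = (\<integral>\<^sup>+ t. \<integral>\<^sup>+ s. g2 (s + p * t, t) \<partial>lborel \<partial>lborel)" by simp
  also have "\<dots> = (\<integral>\<^sup>+ t. \<integral>\<^sup>+ s. g2 (s, t) \<partial>lborel \<partial>lborel)" by (rule nn_integral_shear) simp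
  also have "\<dots> = (\<integral>\<^sup>+ t. \<integral>\<^sup>+ s. g1 (s, t + b * s) \<partial>lborel \<partial>lborel)" by (simp add: g2_def)
  also have "\<dots> = (\<integral>\<^sup>+ t. \<integral>\<^sup>+ s. g1 (s, t) \<partial>lborel \<partial>lborel)" by (rule nn_integral_shear) simp
  also have "\<dots> = (\<integral>\<^sup>+ t. \<integral>\<^sup>+ s. g (s + p * t, t) \<partial>lborel \<partial>lborel)" by (simp add: g1_def)
  also have "\<dots> = (\<integral>\<^sup>+ t. \<integral>\<^sup>+ s. g (s, t) \<partial>lborel \<partial>lborel)" by (rule nn_integral_shear) simp
  finally show ?thesis .
next
  case True
  then consider "a = 1" | "a = - 1" using ab by (auto simp: power2_eq_1_iff)
  then show ?thesis
  proof cases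
    case 1
    then show ?thesis using True by simp
  next
    case 2
    have neg: "(\<integral>\<^sup>+ x. f (- x) \<partial>lborel) = (\<integral>\<^sup>+ x. f x \<partial>lborel)"
      if [measurable]: "f \<in> borel_measurable borel" for f :: "real \<Rightarrow> ennreal"
      using nn_integral_real_affine[of f "- 1" 0] by simp
    have "(\<integral>\<^sup>+ t. \<integral>\<^sup>+ s. g (- s, - t) \<partial>lborel \<partial>lborel) = (\<integral>\<^sup>+ t. \<integral>\<^sup>+ s. g (s, - t) \<partial>lborel \<partial>lborel)"
      by (intro nn_integral_cong neg[of "\<lambda>s. g (s, - t)" for t]) measurable
    also have "\<dots> = (\<integral>\<^sup>+ t. \<integral>\<^sup>+ s. g (s, t) \<partial>lborel \<partial>lborel)"
      by (rule neg[of "\<lambda>t. \<integral>\<^sup>+ s. g (s, t) \<partial>lborel"]) measurable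
    finally show ?thesis using True 2 by simp
  qed
qed

text \<open>Lebesgue measure is invariant, and the product density depends only on
  \<open>s\<^sup>2 + t\<^sup>2\<close>.\<close>

lemma stdn_rotation:
  fixes g :: "real \<times> real \<Rightarrow> ennreal"
  assumes [measurable]: "g \<in> borel_measurable (borel \<Otimes>\<^sub>M borel)" and ab: "a\<^sup>2 + b\<^sup>2 = 1"
  shows "(\<integral>\<^sup>+ t. \<integral>\<^sup>+ s. g (a * s - b * t, b * s + a * t) \<partial>stdn \<partial>stdn) = (\<integral>\<^sup>+ t. \<integral>\<^sup>+ s. g (s, t) \<partial>stdn \<partial>stdn)"
proof -
  let ?d = "\<lambda>x. ennreal (std_normal_density x)"
  have *: "(\<integral>\<^sup>+ t. \<integral>\<^sup>+ s. h (s, t) \<partial>stdn \<partial>stdn) = (\<integral>\<^sup>+ t. \<integral>\<^sup>+ s. ?d t * (?d s * h (s, t)) \<partial>lborel \<partial>lborel)"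
    if [measurable]: "h \<in> borel_measurable (borel \<Otimes>\<^sub>M borel)" for h :: "real \<times> real \<Rightarrow> ennreal"
    by (simp add: nn_integral_stdn nn_integral_cmult)
  define f where "f = (\<lambda>(s, t). ?d t * (?d s * g (s, t)))"
  have [measurable]: "f \<in> borel_measurable (borel \<Otimes>\<^sub>M borel)" unfolding f_def by measurable
  have sq: "(a * s - b * t)\<^sup>2 + (b * s + a * t)\<^sup>2 = s\<^sup>2 + t\<^sup>2" for s t
  proof -
    have "(a * s - b * t)\<^sup>2 + (b * s + a * t)\<^sup>2 = (a\<^sup>2 + b\<^sup>2) * (s\<^sup>2 + t\<^sup>2)"
      by (simp add: power2_eq_square algebra_simps)
    then show ?thesis using ab by simp
  qed
  have dd: "?d y * ?d x = ennreal (1 / (2 * pi) * exp (- (x\<^sup>2 + y\<^sup>2) / 2))" for x y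
    by (simp add: std_normal_density_def field_simps flip: ennreal_mult exp_add)
  have "?d t * (?d s * g (a * s - b * t, b * s + a * t)) = f (a * s - b * t, b * s + a * t)" for s t
    by (simp only: f_def prod.case mult.assoc[symmetric] dd sq)
  then have "(\<integral>\<^sup>+ t. \<integral>\<^sup>+ s. g (a * s - b * t, b * s + a * t) \<partial>stdn \<partial>stdn)
      = (\<integral>\<^sup>+ t. \<integral>\<^sup>+ s. f (a * s - b * t, b * s + a * t) \<partial>lborel \<partial>lborel)"
    using *[of "\<lambda>(s, t). g (a * s - b * t, b * s + a * t)"] by simp
  also have "\<dots> = (\<integral>\<^sup>+ t. \<integral>\<^sup>+ s. f (s, t) \<partial>lborel \<partial>lborel)" by (rule nn_integral_rotation[OF _ ab]) simp
  also have "\<dots> = (\<integral>\<^sup>+ t. \<integral>\<^sup>+ s. g (s, t) \<partial>stdn \<partial>stdn)" by (simp add: * f_def)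
  finally show ?thesis .
qed

text \<open>The two coordinates of the plane are integrated innermost, where the planar statement
  applies.\<close>

lemma gauss_rotation:
  assumes fin: "finite I" and ij: "i \<in> I" "j \<in> I" "i \<noteq> j" and ab: "a\<^sup>2 + b\<^sup>2 = 1"
    and f[measurable]: "f \<in> borel_measurable (PiM I (\<lambda>_. borel))"
  shows "(\<integral>\<^sup>+ c. f (c(i := a * c i - b * c j, j := b * c i + a * c j)) \<partial>gauss I) = (\<integral>\<^sup>+ c. f c \<partial>gauss I)"
proof -
  define K where "K = I - {i, j}"
  have I: "I = insert i (insert j K)" and K: "finite K" "j \<notin> K" "i \<notin> insert j K"
    using ij fin by (auto simp: K_def)
  have exp: "(\<integral>\<^sup>+ c. h c \<partial>gauss I) = (\<integral>\<^sup>+ x. \<integral>\<^sup>+ t. \<integral>\<^sup>+ s. h (x(j := t, i := s)) \<partial>stdn \<partial>stdn \<partial>gauss K)"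
    if [measurable]: "h \<in> borel_measurable (PiM I (\<lambda>_. borel))" for h :: "_ \<Rightarrow> ennreal"
  proof -
    have hm: "h \<in> borel_measurable (PiM (insert i (insert j K)) (\<lambda>_. stdn))"
      unfolding I[symmetric] using sets_gauss[of I] by (simp add: gauss_def cong: measurable_cong_sets)
    have "(\<integral>\<^sup>+ c. h c \<partial>gauss I) = (\<integral>\<^sup>+ x. \<integral>\<^sup>+ s. h (x(i := s)) \<partial>stdn \<partial>PiM (insert j K) (\<lambda>_. stdn))"
      unfolding gauss_def I using K hm by (intro stdn_prod.product_nn_integral_insert) auto
    also have "\<dots> = (\<integral>\<^sup>+ x. \<integral>\<^sup>+ t. \<integral>\<^sup>+ s. h (x(j := t, i := s)) \<partial>stdn \<partial>stdn \<partial>gauss K)"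
      unfolding gauss_def using K(1,2)
    proof (intro stdn_prod.product_nn_integral_insert)
      have "(\<lambda>(x, s). h (x(i := s))) \<in> borel_measurable (PiM (insert j K) (\<lambda>_. stdn) \<Otimes>\<^sub>M stdn)"
        using measurable_compose[OF measurable_add_dim hm] by (simp add: split_beta)
      then show "(\<lambda>x. \<integral>\<^sup>+ s. h (x(i := s)) \<partial>stdn) \<in> borel_measurable (PiM (insert j K) (\<lambda>_. stdn))"
        by (rule stdn.borel_measurable_nn_integral)
    qed auto
    finally show ?thesis .
  qed
  have rm: "(\<lambda>c. c(i := a * c i - b * c j, j := b * c i + a * c j)) \<in> measurable (PiM I (\<lambda>_. borel)) (PiM I (\<lambda>_. borel))"
  proof (rule measurable_PiM_single')
    fix k assume "k \<in> I"
    then show "(\<lambda>c. (c(i := a * c i - b * c j, j := b * c i + a * c j)) k) \<in> borel_measurable (PiM I (\<lambda>_. borel))"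
      using ij by (cases "k = j"; cases "k = i") auto
  qed (use ij in \<open>auto simp: space_PiM PiE_iff extensional_def\<close>)
  have "(\<integral>\<^sup>+ c. f (c(i := a * c i - b * c j, j := b * c i + a * c j)) \<partial>gauss I)
      = (\<integral>\<^sup>+ x. \<integral>\<^sup>+ t. \<integral>\<^sup>+ s. f (x(j := b * s + a * t, i := a * s - b * t)) \<partial>stdn \<partial>stdn \<partial>gauss K)"
  proof -
    have "(x(j := t, i := s))(i := a * (x(j := t, i := s)) i - b * (x(j := t, i := s)) j,
        j := b * (x(j := t, i := s)) i + a * (x(j := t, i := s)) j)
      = x(j := b * s + a * t, i := a * s - b * t)" for x s t
      using ij by (auto simp: fun_eq_iff)
    then show ?thesis using exp[OF measurable_compose[OF rm f]] by simp
  qed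
  also have "\<dots> = (\<integral>\<^sup>+ x. \<integral>\<^sup>+ t. \<integral>\<^sup>+ s. f (x(j := t, i := s)) \<partial>stdn \<partial>stdn \<partial>gauss K)"
  proof (rule nn_integral_cong)
    fix x assume x: "x \<in> space (gauss K)"
    have "(\<lambda>(s, t). x(j := t, i := s)) \<in> measurable (borel \<Otimes>\<^sub>M borel) (PiM I (\<lambda>_. borel))"
    proof (rule measurable_PiM_single')
      fix k assume "k \<in> I"
      show "(\<lambda>w. (case w of (s, t) \<Rightarrow> x(j := t, i := s)) k) \<in> borel_measurable (borel \<Otimes>\<^sub>M borel)"
        using ij by (cases "k = j"; cases "k = i") (simp_all add: split_beta)
    next
      have "x k = undefined" if "k \<notin> I" for k
        using x that I by (auto simp: space_gauss PiE_iff extensional_def)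
      then show "(\<lambda>(s, t). x(j := t, i := s)) \<in> space (borel \<Otimes>\<^sub>M borel) \<rightarrow> (\<Pi>\<^sub>E i\<in>I. space borel)"
        using ij by (auto simp: PiE_iff extensional_def)
    qed
    from measurable_compose[OF this f]
    have "(\<lambda>(s, t). f (x(j := t, i := s))) \<in> borel_measurable (borel \<Otimes>\<^sub>M borel)" by (simp add: split_beta)
    from stdn_rotation[OF this ab]
    show "(\<integral>\<^sup>+ t. \<integral>\<^sup>+ s. f (x(j := b * s + a * t, i := a * s - b * t)) \<partial>stdn \<partial>stdn)
        = (\<integral>\<^sup>+ t. \<integral>\<^sup>+ s. f (x(j := t, i := s)) \<partial>stdn \<partial>stdn)" by simp
  qed
  also have "\<dots> = (\<integral>\<^sup>+ c. f c \<partial>gauss I)" by (rule exp[symmetric]) simp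
  finally show ?thesis .
qed

lemma gauss_reflection:
  assumes fin: "finite I" and i: "i \<in> I" and f[measurable]: "f \<in> borel_measurable (PiM I (\<lambda>_. borel))"
  shows "(\<integral>\<^sup>+ c. f (c(i := - c i)) \<partial>gauss I) = (\<integral>\<^sup>+ c. f c \<partial>gauss I)"
proof -
  define K where "K = I - {i}"
  have I: "I = insert i K" and K: "finite K" "i \<notin> K" using i fin by (auto simp: K_def)
  have exp: "(\<integral>\<^sup>+ c. h c \<partial>gauss I) = (\<integral>\<^sup>+ x. \<integral>\<^sup>+ s. h (x(i := s)) \<partial>stdn \<partial>gauss K)"
    if [measurable]: "h \<in> borel_measurable (PiM I (\<lambda>_. borel))" for h :: "_ \<Rightarrow> ennreal"
  proof -
    have hm: "h \<in> borel_measurable (PiM (insert i K) (\<lambda>_. stdn))"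
      unfolding I[symmetric] using sets_gauss[of I] by (simp add: gauss_def cong: measurable_cong_sets)
    show ?thesis
      unfolding gauss_def I using K hm by (intro stdn_prod.product_nn_integral_insert) auto
  qed
  have rm: "(\<lambda>c. c(i := - c i :: real)) \<in> measurable (PiM I (\<lambda>_. borel)) (PiM I (\<lambda>_. borel))"
  proof (rule measurable_PiM_single')
    fix k assume "k \<in> I"
    then show "(\<lambda>c. (c(i := - c i :: real)) k) \<in> borel_measurable (PiM I (\<lambda>_. borel))"
      using i by (cases "k = i") simp_all
  qed (use i in \<open>auto simp: space_PiM PiE_iff extensional_def\<close>)
  have "(\<integral>\<^sup>+ c. f (c(i := - c i)) \<partial>gauss I) = (\<integral>\<^sup>+ x. \<integral>\<^sup>+ s. f (x(i := - s)) \<partial>stdn \<partial>gauss K)"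
    using exp[OF measurable_compose[OF rm f]] by simp
  also have "\<dots> = (\<integral>\<^sup>+ x. \<integral>\<^sup>+ s. f (x(i := s)) \<partial>stdn \<partial>gauss K)"
  proof (rule nn_integral_cong)
    fix x assume x: "x \<in> space (gauss K)"
    have "(\<lambda>s. x(i := s)) \<in> measurable borel (PiM I (\<lambda>_. borel))"
    proof (rule measurable_PiM_single')
      fix k assume "k \<in> I"
      show "(\<lambda>s. (x(i := s)) k) \<in> borel_measurable borel"
        by (cases "k = i") simp_all
    next
      have "x k = undefined" if "k \<notin> I" for k
        using x that I by (auto simp: space_gauss PiE_iff extensional_def)
      then show "(\<lambda>s. x(i := s)) \<in> space borel \<rightarrow> (\<Pi>\<^sub>E i\<in>I. space borel)"
        using i by (auto simp: PiE_iff extensional_def)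
    qed
    from measurable_compose[OF this f]
    have [measurable]: "(\<lambda>s. f (x(i := s))) \<in> borel_measurable borel" .
    show "(\<integral>\<^sup>+ s. f (x(i := - s)) \<partial>stdn) = (\<integral>\<^sup>+ s. f (x(i := s)) \<partial>stdn)"
      using nn_integral_real_affine[of "\<lambda>s. ennreal (std_normal_density s) * f (x(i := s))" "- 1" 0]
      by (simp add: nn_integral_stdn std_normal_density_def)
  qed
  also have "\<dots> = (\<integral>\<^sup>+ c. f c \<partial>gauss I)" by (rule exp[symmetric]) simp
  finally show ?thesis .
qed

text \<open>Rotating one coordinate plane after another turns the linear form into a multiple of a coordinate.\<close>

lemma gauss_linear_form:
  fixes g :: "real \<times> real \<Rightarrow> ennreal"
  assumes fin: "finite I" and i0: "i0 \<in> I" and g[measurable]: "g \<in> borel_measurable (borel \<Otimes>\<^sub>M borel)"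
  shows "(\<integral>\<^sup>+ c. g (\<Sum>k\<in>I. x k * c k, \<Sum>k\<in>I. (c k)\<^sup>2) \<partial>gauss I)
    = (\<integral>\<^sup>+ c. g (sqrt (\<Sum>k\<in>I. (x k)\<^sup>2) * c i0, \<Sum>k\<in>I. (c k)\<^sup>2) \<partial>gauss I)"
proof -
  have gm: "(\<lambda>c. g (\<Sum>k\<in>I. y k * c k, \<Sum>k\<in>I. (c k)\<^sup>2)) \<in> borel_measurable (PiM I (\<lambda>_. borel))" for y
    by measurable
  have *: "(\<integral>\<^sup>+ c. g (\<Sum>k\<in>I. x k * c k, \<Sum>k\<in>I. (c k)\<^sup>2) \<partial>gauss I)
    = (\<integral>\<^sup>+ c. g (sqrt (\<Sum>k\<in>I. (x k)\<^sup>2) * c i0, \<Sum>k\<in>I. (c k)\<^sup>2) \<partial>gauss I)"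
    if "finite J" "J \<subseteq> I - {i0}" "\<And>k. k \<in> I \<Longrightarrow> k \<notin> insert i0 J \<Longrightarrow> x k = 0" for J x
    using that
  \<comment> \<open>\<open>J\<close> contains the coordinates other than \<open>i0\<close> in which
    the form may still have a nonzero coefficient; \<open>x\<close> varies because each rotation
    changes the form.\<close>
  proof (induction J arbitrary: x)
    case empty
    have s1: "(\<Sum>k\<in>I. x k * c k) = x i0 * c i0" for c :: "'a \<Rightarrow> real"
      using empty.prems fin i0 by (subst sum.remove[of I i0]) (auto intro!: sum.neutral)
    have s2: "(\<Sum>k\<in>I. (x k)\<^sup>2) = (x i0)\<^sup>2"
      using empty.prems fin i0 by (subst sum.remove[of I i0]) (auto intro!: sum.neutral)
    show ?case
    proof (cases "x i0 \<ge> 0")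
      case True
      then show ?thesis by (simp add: s1 s2)
    next
      case False
      have sq: "(\<Sum>k\<in>I. ((c(i0 := - c i0)) k)\<^sup>2) = (\<Sum>k\<in>I. (c k)\<^sup>2)" for c :: "'a \<Rightarrow> real"
        by (intro sum.cong) auto
      have "(\<integral>\<^sup>+ c. g (\<Sum>k\<in>I. x k * c k, \<Sum>k\<in>I. (c k)\<^sup>2) \<partial>gauss I)
          = (\<integral>\<^sup>+ c. g (- x i0 * c i0, \<Sum>k\<in>I. (c k)\<^sup>2) \<partial>gauss I)"
        by (subst gauss_reflection[OF fin i0 gm, symmetric], unfold sq) (simp add: s1)
      then show ?thesis using False by (simp add: s2)
    qed
  next
    case (insert j J)
    \<comment> \<open>The rotation by the angle of the pair \<open>(x i0, x j)\<close> gathers both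
      coefficients into the single coefficient \<open>r\<close> at \<open>i0\<close>.\<close>
    define r where "r = sqrt ((x i0)\<^sup>2 + (x j)\<^sup>2)"
    have j: "j \<in> I" "j \<noteq> i0" "i0 \<in> I" using insert.prems i0 by auto
    show ?case
    proof (cases "r = 0")
      case True
      then have "x i0 = 0" "x j = 0" by (auto simp: r_def sum_power2_eq_zero_iff)
      then show ?thesis using insert by (intro insert.IH) auto
    next
      case False
      then have r: "r > 0" by (simp add: r_def less_le)
      have r2: "r\<^sup>2 = (x i0)\<^sup>2 + (x j)\<^sup>2" by (simp add: r_def)
      define a b where "a = x i0 / r" and "b = x j / r"
      have xr: "x i0 = r * a" "x j = r * b" using r by (auto simp: a_def b_def)
      have ab: "a\<^sup>2 + b\<^sup>2 = 1"
      proof -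
        have "a\<^sup>2 + b\<^sup>2 = r\<^sup>2 / r\<^sup>2" unfolding a_def b_def power_divide r2 add_divide_distrib ..
        then show ?thesis using r by simp
      qed
      define x' where "x' = x(i0 := r, j := 0)"
      let ?R = "\<lambda>c. c(i0 := a * c i0 - b * c j, j := b * c i0 + a * c j)"
      have split: "(\<Sum>k\<in>I. h k) = h i0 + (h j + (\<Sum>k\<in>I - {i0} - {j}. h k))" for h :: "'a \<Rightarrow> real"
        using fin j by (subst sum.remove[of I i0], simp, simp, subst sum.remove[of "I - {i0}" j]) auto
      have lin: "(\<Sum>k\<in>I. x k * ?R c k) = (\<Sum>k\<in>I. x' k * c k)" for c :: "'a \<Rightarrow> real"
      proof -
        have "x i0 * (a * c i0 - b * c j) + x j * (b * c i0 + a * c j) = (a\<^sup>2 + b\<^sup>2) * (r * c i0)"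
          unfolding xr by (simp add: algebra_simps power2_eq_square)
        moreover have "(\<Sum>k\<in>I - {i0} - {j}. x k * ?R c k) = (\<Sum>k\<in>I - {i0} - {j}. x' k * c k)"
          by (intro sum.cong) (auto simp: x'_def)
        ultimately show ?thesis
          unfolding split using j by (simp add: x'_def ab)
      qed
      have sq: "(\<Sum>k\<in>I. (?R c k)\<^sup>2) = (\<Sum>k\<in>I. (c k)\<^sup>2)" for c :: "'a \<Rightarrow> real"
      proof -
        have "(a * c i0 - b * c j)\<^sup>2 + (b * c i0 + a * c j)\<^sup>2 = (a\<^sup>2 + b\<^sup>2) * ((c i0)\<^sup>2 + (c j)\<^sup>2)"
          by (simp add: algebra_simps power2_eq_square)
        moreover have "(\<Sum>k\<in>I - {i0} - {j}. (?R c k)\<^sup>2) = (\<Sum>k\<in>I - {i0} - {j}. (c k)\<^sup>2)"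
          by (intro sum.cong) auto
        ultimately show ?thesis unfolding split using j by (simp add: ab)
      qed
      have x'2: "(\<Sum>k\<in>I. (x' k)\<^sup>2) = (\<Sum>k\<in>I. (x k)\<^sup>2)"
      proof -
        have "(\<Sum>k\<in>I - {i0} - {j}. (x' k)\<^sup>2) = (\<Sum>k\<in>I - {i0} - {j}. (x k)\<^sup>2)"
          by (intro sum.cong) (auto simp: x'_def)
        then show ?thesis unfolding split using j r2 by (simp add: x'_def)
      qed
      have "(\<integral>\<^sup>+ c. g (\<Sum>k\<in>I. x k * c k, \<Sum>k\<in>I. (c k)\<^sup>2) \<partial>gauss I)
          = (\<integral>\<^sup>+ c. g (\<Sum>k\<in>I. x' k * c k, \<Sum>k\<in>I. (c k)\<^sup>2) \<partial>gauss I)"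
        by (subst gauss_rotation[OF fin j(3,1) j(2)[symmetric] ab gm, symmetric], unfold lin sq) (rule refl)
      also have "\<dots> = (\<integral>\<^sup>+ c. g (sqrt (\<Sum>k\<in>I. (x' k)\<^sup>2) * c i0, \<Sum>k\<in>I. (c k)\<^sup>2) \<partial>gauss I)"
        using insert.prems insert.hyps by (intro insert.IH) (auto simp: x'_def)
      finally show ?thesis by (simp add: x'2)
    qed
  qed
  show ?thesis using fin by (intro *[of "I - {i0}"]) auto
qed

section \<open>Gaussian moments with an exponential weight\<close>

lemma has_bochner_integral_stdn_iff:
  assumes [measurable]: "f \<in> borel_measurable borel"
  shows "has_bochner_integral stdn f v \<longleftrightarrow> has_bochner_integral lborel (\<lambda>x. std_normal_density x * f x) v"
  unfolding stdn_def has_bochner_integral_iff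
  using integrable_density[of f lborel std_normal_density] integral_density[of f lborel std_normal_density]
  by simp

text \<open>Completing the square: \<open>exp (- (x t + z)\<^sup>2 / 2)\<close> turns the standard normal density into a multiple
  of another normal density.\<close>

lemma stdn_exp_quadratic:
  fixes x z :: real
  defines "v \<equiv> 1 / (1 + x\<^sup>2)" and "m \<equiv> - x * z / (1 + x\<^sup>2)"
  defines "C \<equiv> sqrt v * exp (- z\<^sup>2 * v / 2)"
  shows "has_bochner_integral stdn (\<lambda>t. exp (- (x * t + z)\<^sup>2 / 2) * (p * t\<^sup>2 + q * t + r))
    (C * (p * (m\<^sup>2 + v) + q * m + r))"
proof -
  have pos: "1 + x\<^sup>2 > 0" by (simp add: add_pos_nonneg)
  have v: "v > 0" using pos by (simp add: v_def)
  have xv: "(1 + x\<^sup>2) * v = 1" and mv: "m = - x * z * v" using pos by (auto simp: v_def m_def)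
  have dens: "std_normal_density t * exp (- (x * t + z)\<^sup>2 / 2) = C * normal_density m (sqrt v) t" for t
  proof -
    have "v * (t\<^sup>2 + (x * t + z)\<^sup>2) = (t - m)\<^sup>2 + z\<^sup>2 * v * v"
    proof -
      have "v * (t\<^sup>2 + (x * t + z)\<^sup>2) = ((1 + x\<^sup>2) * v) * t\<^sup>2 + 2 * x * z * v * t + z\<^sup>2 * v"
        by (simp add: power2_eq_square algebra_simps)
      also have "\<dots> = t\<^sup>2 - 2 * m * t + z\<^sup>2 * v" by (simp add: xv mv)
      also have "z\<^sup>2 * v = z\<^sup>2 * v * ((1 + x\<^sup>2) * v)" by (simp add: xv)
      also have "\<dots> = m\<^sup>2 + z\<^sup>2 * v * v" by (simp add: mv power2_eq_square algebra_simps)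
      finally show ?thesis by (simp add: power2_eq_square algebra_simps)
    qed
    then have "t\<^sup>2 + (x * t + z)\<^sup>2 = (t - m)\<^sup>2 / v + z\<^sup>2 * v"
      using v by (simp add: field_simps)
    then have *: "- t\<^sup>2 / 2 + - (x * t + z)\<^sup>2 / 2 = - (t - m)\<^sup>2 / (2 * v) + - z\<^sup>2 * v / 2"
      by (simp add: field_simps)
    have "std_normal_density t * exp (- (x * t + z)\<^sup>2 / 2)
        = 1 / sqrt (2 * pi) * exp (- t\<^sup>2 / 2 + - (x * t + z)\<^sup>2 / 2)"
      by (simp add: std_normal_density_def exp_add[symmetric] del: exp_add)
    also have "\<dots> = 1 / sqrt (2 * pi) * (exp (- (t - m)\<^sup>2 / (2 * v)) * exp (- z\<^sup>2 * v / 2))"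
      unfolding * exp_add ..
    also have "\<dots> = C * normal_density m (sqrt v) t"
      using v by (simp add: C_def normal_density_def real_sqrt_mult)
    finally show ?thesis .
  qed
  let ?D = "normal_density m (sqrt v)"
  have m0: "has_bochner_integral lborel ?D 1"
    using v by (simp add: has_bochner_integral_iff)
  have m1: "has_bochner_integral lborel (\<lambda>t. ?D t * t) m"
    using v by (intro normal_moment_nz_1) simp
  have m2': "has_bochner_integral lborel (\<lambda>t. ?D t * (t - m)\<^sup>2) v"
    using normal_moment_even[of "sqrt v" m 1] v by simp
  \<comment> \<open>The quadratic is expanded around \<open>m\<close>, since the moments at hand are
    the mean and the central second moment.\<close>
  have "has_bochner_integral lborel (\<lambda>t. p * (?D t * (t - m)\<^sup>2) + (2 * p * m + q) * (?D t * t) + (r - p * m\<^sup>2) * ?D t)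
      (p * v + (2 * p * m + q) * m + (r - p * m\<^sup>2) * 1)"
    by (intro has_bochner_integral_add has_bochner_integral_mult_right m0 m1 m2')
  then have "has_bochner_integral lborel (\<lambda>t. C * (p * (?D t * (t - m)\<^sup>2) + (2 * p * m + q) * (?D t * t) + (r - p * m\<^sup>2) * ?D t))
      (C * (p * v + (2 * p * m + q) * m + (r - p * m\<^sup>2) * 1))"
    by (rule has_bochner_integral_mult_right)
  also have "(\<lambda>t. C * (p * (?D t * (t - m)\<^sup>2) + (2 * p * m + q) * (?D t * t) + (r - p * m\<^sup>2) * ?D t))
      = (\<lambda>t. std_normal_density t * (exp (- (x * t + z)\<^sup>2 / 2) * (p * t\<^sup>2 + q * t + r)))"
  proof
    fix t
    have "C * (p * (?D t * (t - m)\<^sup>2) + (2 * p * m + q) * (?D t * t) + (r - p * m\<^sup>2) * ?D t)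
        = (C * ?D t) * (p * t\<^sup>2 + q * t + r)"
      by (simp add: power2_eq_square algebra_simps)
    then show "C * (p * (?D t * (t - m)\<^sup>2) + (2 * p * m + q) * (?D t * t) + (r - p * m\<^sup>2) * ?D t)
        = std_normal_density t * (exp (- (x * t + z)\<^sup>2 / 2) * (p * t\<^sup>2 + q * t + r))"
      by (simp only: dens[symmetric] mult.assoc)
  qed
  also have "C * (p * v + (2 * p * m + q) * m + (r - p * m\<^sup>2) * 1) = C * (p * (m\<^sup>2 + v) + q * m + r)"
    by (simp add: power2_eq_square algebra_simps)
  finally show ?thesis
    by (subst has_bochner_integral_stdn_iff) auto
qed

lemma integrable_stdn_square: "integrable stdn (\<lambda>t. t\<^sup>2)"
proof -
  have "has_bochner_integral stdn (\<lambda>t. exp (- (0 * t + 0)\<^sup>2 / 2) * (1 * t\<^sup>2 + 0 * t + 0))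
    (sqrt (1 / (1 + 0\<^sup>2)) * exp (- 0\<^sup>2 * (1 / (1 + 0\<^sup>2)) / 2) * (1 * ((- 0 * 0 / (1 + 0\<^sup>2))\<^sup>2 + 1 / (1 + 0\<^sup>2)) + 0 * (- 0 * 0 / (1 + 0\<^sup>2)) + 0))"
    by (rule stdn_exp_quadratic)
  then show ?thesis by (simp add: has_bochner_integral_iff)
qed

lemma distr_gauss_component: "i \<in> I \<Longrightarrow> distr (gauss I) stdn (\<lambda>c. c i) = stdn"
  unfolding gauss_def using distr_PiM_component[of I "\<lambda>_. stdn" i] prob_space_stdn by simp

lemma integrable_gauss_square:
  assumes "i \<in> I"
  shows "integrable (gauss I) (\<lambda>c. (c i)\<^sup>2)"
proof -
  have "integrable (distr (gauss I) stdn (\<lambda>c. c i)) (\<lambda>t. t\<^sup>2)"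
    using integrable_stdn_square distr_gauss_component[OF assms] by simp
  then show ?thesis
    by (subst (asm) integrable_distr_eq) (use assms in \<open>auto cong: measurable_cong_sets\<close>)
qed

lemma integrable_gauss_quadratic:
  fixes h :: "('k \<Rightarrow> real) \<Rightarrow> real"
  assumes fin: "finite I" and h[measurable]: "h \<in> borel_measurable (gauss I)" and h1: "\<And>c. \<bar>h c\<bar> \<le> 1"
  shows "integrable (gauss I) (\<lambda>c. h c * ((\<Sum>k\<in>I. \<alpha> k * c k) * (\<Sum>k\<in>I. \<beta> k * c k)))"
proof -
  have "integrable (gauss I) (\<lambda>c. h c * (c k * c l))" if kl: "k \<in> I" "l \<in> I" for k l
  proof (rule Bochner_Integration.integrable_bound)
    show "integrable (gauss I) (\<lambda>c. (c k)\<^sup>2 + (c l)\<^sup>2)"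
      using kl by (intro Bochner_Integration.integrable_add integrable_gauss_square)
    show "(\<lambda>c. h c * (c k * c l)) \<in> borel_measurable (gauss I)"
      by (intro borel_measurable_times h measurable_gauss_component kl)
    show "AE c in gauss I. norm (h c * (c k * c l)) \<le> norm ((c k)\<^sup>2 + (c l)\<^sup>2)"
    proof (rule AE_I2)
      fix c
      have "\<bar>h c\<bar> * \<bar>c k * c l\<bar> \<le> 1 * \<bar>c k * c l\<bar>" by (intro mult_right_mono h1) simp
      also have "\<dots> \<le> (c k)\<^sup>2 + (c l)\<^sup>2"
      proof -
        have "2 * \<bar>c k\<bar> * \<bar>c l\<bar> \<le> (c k)\<^sup>2 + (c l)\<^sup>2" "0 \<le> \<bar>c k\<bar> * \<bar>c l\<bar>"
          using sum_squares_bound[of "\<bar>c k\<bar>" "\<bar>c l\<bar>"] by simp_all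
        then show ?thesis unfolding abs_mult by linarith
      qed
      finally show "norm (h c * (c k * c l)) \<le> norm ((c k)\<^sup>2 + (c l)\<^sup>2)" by (simp add: abs_mult)
    qed
  qed
  then have "integrable (gauss I) (\<lambda>c. \<Sum>k\<in>I. \<Sum>l\<in>I. \<alpha> k * \<beta> l * (h c * (c k * c l)))"
    by (intro Bochner_Integration.integrable_sum integrable_mult_right) auto
  also have "(\<lambda>c. \<Sum>k\<in>I. \<Sum>l\<in>I. \<alpha> k * \<beta> l * (h c * (c k * c l)))
      = (\<lambda>c. h c * ((\<Sum>k\<in>I. \<alpha> k * c k) * (\<Sum>k\<in>I. \<beta> k * c k)))"
    unfolding sum_product unfolding sum_distrib_left by (intro ext sum.cong refl) (simp add: mult_ac)
  finally show ?thesis .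
qed

lemma sum_indicator_mult:
  fixes c :: "'k \<Rightarrow> real"
  assumes "finite I" "k \<in> I"
  shows "(\<Sum>l\<in>I. (if l = k then 1 else 0) * c l) = c k"
  using assms by (subst sum.remove[of _ k]) (auto intro!: sum.neutral)

abbreviation expsq :: "real \<Rightarrow> real" where "expsq z \<equiv> exp (- z\<^sup>2 / 2)"

text \<open>Gaussian integration by parts: the expectation of \<open>c k * f c\<close> is that of
  the partial derivative of \<open>f\<close>, here for \<open>f = expsq Z * B\<close>. It is
  verified by integrating over the coordinate \<open>k\<close> alone with the explicit formula for
  quadratic factors.\<close>

lemma gauss_Stein:
  fixes x \<beta> :: "'k \<Rightarrow> real"
  defines "Z c I \<equiv> \<Sum>k\<in>I. x k * c k" and "B c I \<equiv> \<Sum>k\<in>I. \<beta> k * c k"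
  assumes fin: "finite I" and k: "k \<in> I"
  shows "(\<integral>c. expsq (Z c I) * (c k * B c I) \<partial>gauss I)
    = \<beta> k * (\<integral>c. expsq (Z c I) \<partial>gauss I) - x k * (\<integral>c. expsq (Z c I) * (B c I * Z c I) \<partial>gauss I)"
proof -
  interpret G: prob_space "gauss I" by (rule prob_space_gauss)
  define K where "K = I - {k}"
  have I: "I = insert k K" and K: "finite K" "k \<notin> K" using k fin by (auto simp: K_def)
  have m[measurable]: "(\<lambda>c. expsq (Z c I)) \<in> borel_measurable (gauss I)"
    unfolding Z_def by measurable
  have e1: "\<bar>expsq z\<bar> \<le> 1" for z by simp
  have ck: "c k = (\<Sum>l\<in>I. (if l = k then 1 else 0) * c l)" for c :: "'k \<Rightarrow> real"
    by (rule sum_indicator_mult[OF fin k, symmetric])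
  have i1: "integrable (gauss I) (\<lambda>c. expsq (Z c I) * (c k * B c I))"
    unfolding B_def by (subst ck) (intro integrable_gauss_quadratic fin m e1)
  have i2: "integrable (gauss I) (\<lambda>c. expsq (Z c I) * (B c I * Z c I))"
    using integrable_gauss_quadratic[OF fin m e1, of \<beta> x] by (simp add: B_def Z_def)
  have i3: "integrable (gauss I) (\<lambda>c. expsq (Z c I))"
    by (rule G.integrable_const_bound[of _ 1]) (simp, rule m)
  let ?F = "\<lambda>c. expsq (Z c I) * (c k * B c I) - \<beta> k * expsq (Z c I) + x k * (expsq (Z c I) * (B c I * Z c I))"
  have iF: "integrable (gauss I) ?F"
    by (intro Bochner_Integration.integrable_add Bochner_Integration.integrable_diff integrable_mult_right i1 i2 i3)
  have "(\<integral>c. ?F c \<partial>gauss I) = (\<integral>y. (\<integral>t. ?F (y(k := t)) \<partial>stdn) \<partial>PiM K (\<lambda>_. stdn))"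
    using iF K unfolding gauss_def I by (intro stdn_prod.product_integral_insert) auto
  also have "\<dots> = (\<integral>y. 0 \<partial>PiM K (\<lambda>_. stdn))"
  proof (rule Bochner_Integration.integral_cong[OF refl])
    fix y :: "'k \<Rightarrow> real"
    define z where "z = (\<Sum>l\<in>K. x l * y l)"
    define L where "L = (\<Sum>l\<in>K. \<beta> l * y l)"
    have Zt: "Z (y(k := t)) I = x k * t + z" for t
      unfolding Z_def I z_def using K by (simp add: sum.insert) (intro sum.cong, auto)
    have Bt: "B (y(k := t)) I = \<beta> k * t + L" for t
      unfolding B_def I L_def using K by (simp add: sum.insert) (intro sum.cong, auto)
    let ?x = "x k" and ?b = "\<beta> k"
    define v m C where "v = 1 / (1 + ?x\<^sup>2)" and "m = - ?x * z / (1 + ?x\<^sup>2)" and "C = sqrt v * exp (- z\<^sup>2 * v / 2)"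
    \<comment> \<open>The coefficients of the difference of both sides as a quadratic polynomial in
      the coordinate \<open>t\<close>, with the exponential factored out.\<close>
    define p q r where "p = ?b + ?x * ?x * ?b" and "q = L + ?x * (?b * z + ?x * L)" and "r = ?x * L * z - ?b"
    have pos: "1 + ?x\<^sup>2 > 0" by (simp add: add_pos_nonneg)
    have eq: "?F (y(k := t)) = expsq (?x * t + z) * (p * t\<^sup>2 + q * t + r)" for t
      unfolding Zt Bt by (simp add: p_def q_def r_def power2_eq_square algebra_simps)
    have "has_bochner_integral stdn (\<lambda>t. ?F (y(k := t))) (C * (p * (m\<^sup>2 + v) + q * m + r))"
      unfolding eq C_def m_def v_def by (rule stdn_exp_quadratic)
    moreover have "p * (m\<^sup>2 + v) + q * m + r = 0"
    proof -
      have xv: "(1 + ?x\<^sup>2) * v = 1" and xm: "(1 + ?x\<^sup>2) * m = - ?x * z" using pos by (auto simp: v_def m_def)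
      have "p * (m\<^sup>2 + v) + q * m + r
          = ?b * m * ((1 + ?x\<^sup>2) * m) + ?b * ((1 + ?x\<^sup>2) * v) + L * ((1 + ?x\<^sup>2) * m) + ?x * ?b * z * m + ?x * L * z - ?b"
        by (simp add: p_def q_def r_def power2_eq_square algebra_simps)
      also have "\<dots> = 0" unfolding xv xm by (simp add: algebra_simps)
      finally show ?thesis .
    qed
    ultimately show "(\<integral>t. ?F (y(k := t)) \<partial>stdn) = 0"
      by (simp add: has_bochner_integral_iff)
  qed
  finally have "(\<integral>c. ?F c \<partial>gauss I) = 0" by simp
  moreover have "(\<integral>c. ?F c \<partial>gauss I) = (\<integral>c. expsq (Z c I) * (c k * B c I) \<partial>gauss I)
      - \<beta> k * (\<integral>c. expsq (Z c I) \<partial>gauss I) + x k * (\<integral>c. expsq (Z c I) * (B c I * Z c I) \<partial>gauss I)"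
    by (subst Bochner_Integration.integral_add Bochner_Integration.integral_diff integral_mult_right_zero;
        (intro Bochner_Integration.integrable_diff integrable_mult_right i1 i2 i3)?)+ simp
  ultimately show ?thesis by simp
qed

text \<open>By rotation invariance only the length of \<open>x\<close> matters, which leaves a
  one-dimensional integral.\<close>

lemma gauss_expsq:
  assumes fin: "finite I"
  shows "(\<integral>c. expsq (\<Sum>k\<in>I. x k * c k) \<partial>gauss I) = 1 / sqrt (1 + (\<Sum>k\<in>I. (x k)\<^sup>2))"
proof (cases "I = {}")
  case True
  interpret prob_space "gauss I" by (rule prob_space_gauss)
  show ?thesis using True prob_space by simp
next
  case False
  then obtain i0 where i0: "i0 \<in> I" by blast
  interpret G: prob_space "gauss I" by (rule prob_space_gauss)
  define s where "s = sqrt (\<Sum>k\<in>I. (x k)\<^sup>2)"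
  have "(\<integral>\<^sup>+ c. ennreal (expsq (\<Sum>k\<in>I. x k * c k)) \<partial>gauss I) = (\<integral>\<^sup>+ c. ennreal (expsq (s * c i0)) \<partial>gauss I)"
    using gauss_linear_form[OF fin i0, of "\<lambda>(a, b). ennreal (expsq a)" x] by (simp add: s_def)
  also have "\<dots> = (\<integral>\<^sup>+ t. ennreal (expsq (s * t)) \<partial>distr (gauss I) stdn (\<lambda>c. c i0))"
    using i0 by (subst nn_integral_distr) (auto cong: measurable_cong_sets)
  also have "\<dots> = (\<integral>\<^sup>+ t. ennreal (expsq (s * t)) \<partial>stdn)" by (simp add: distr_gauss_component[OF i0])
  also have "\<dots> = ennreal (1 / sqrt (1 + s\<^sup>2))"
  proof -
    have "has_bochner_integral stdn (\<lambda>t. expsq (s * t)) (sqrt (1 / (1 + s\<^sup>2)))"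
      using stdn_exp_quadratic[of s 0 0 0 1] by simp
    then show ?thesis by (simp add: has_bochner_integral_iff nn_integral_eq_integral real_sqrt_divide)
  qed
  finally have "(\<integral>\<^sup>+ c. ennreal (expsq (\<Sum>k\<in>I. x k * c k)) \<partial>gauss I) = ennreal (1 / sqrt (1 + s\<^sup>2))" .
  then have "has_bochner_integral (gauss I) (\<lambda>c. expsq (\<Sum>k\<in>I. x k * c k)) (1 / sqrt (1 + s\<^sup>2))"
    by (intro has_bochner_integral_nn_integral) auto
  moreover have "s\<^sup>2 = (\<Sum>k\<in>I. (x k)\<^sup>2)" by (simp add: s_def sum_nonneg)
  ultimately show ?thesis by (simp add: has_bochner_integral_iff)
qed

text \<open>The value has the form of an entry of \<open>sqrt1_hess Q\<close>: when the linear forms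
  are coordinates of a Gaussian vector with covariance \<open>Q\<close>, and the exponent is its
  product with a point, the sums are entries of \<open>Q\<close> and of \<open>Q\<close> applied to
  that point. Integration by parts reduces every moment to those that contain the exponent.\<close>

lemma gauss_expsq_quadratic:
  fixes x \<alpha> \<beta> :: "'k \<Rightarrow> real"
  assumes fin: "finite I"
  defines "r \<equiv> sqrt (1 + (\<Sum>k\<in>I. (x k)\<^sup>2))"
  shows "has_bochner_integral (gauss I)
    (\<lambda>c. expsq (\<Sum>k\<in>I. x k * c k) * ((\<Sum>k\<in>I. \<alpha> k * c k) * (\<Sum>k\<in>I. \<beta> k * c k)))
    ((\<Sum>k\<in>I. \<alpha> k * \<beta> k) / r - (\<Sum>k\<in>I. \<alpha> k * x k) * (\<Sum>k\<in>I. \<beta> k * x k) / r ^ 3)"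
proof -
  define Z where "Z c = (\<Sum>k\<in>I. x k * c k)" for c
  define l where "l \<gamma> c = (\<Sum>k\<in>I. \<gamma> k * c k)" for \<gamma> c :: "'k \<Rightarrow> real"
  define s where "s = (\<Sum>k\<in>I. (x k)\<^sup>2)"
  define e0 where "e0 = (\<integral>c. expsq (Z c) \<partial>gauss I)"
  have s0: "s \<ge> 0" by (simp add: s_def sum_nonneg)
  have r: "r > 0" and r2: "r\<^sup>2 = 1 + s" using s0 by (auto simp: r_def s_def)
  have e0: "e0 = 1 / r" unfolding e0_def Z_def r_def by (rule gauss_expsq[OF fin])
  have m[measurable]: "(\<lambda>c. expsq (Z c)) \<in> borel_measurable (gauss I)"
    unfolding Z_def by measurable
  have e1: "\<bar>expsq z\<bar> \<le> 1" for z by simp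
  note int = integrable_gauss_quadratic[OF fin m e1, folded l_def]
  have lx: "Z c = l x c" for c by (simp add: Z_def l_def)
  have S: "(\<integral>c. expsq (Z c) * (l a c * l b c) \<partial>gauss I)
      = (\<Sum>k\<in>I. a k * b k) * e0 - (\<Sum>k\<in>I. a k * x k) * (\<integral>c. expsq (Z c) * (l b c * Z c) \<partial>gauss I)" for a b
  proof -
    have ik: "integrable (gauss I) (\<lambda>c. expsq (Z c) * (c k * l b c))" if "k \<in> I" for k
    proof -
      have ck: "c k = l (\<lambda>l. if l = k then 1 else 0) c" for c :: "'k \<Rightarrow> real"
        unfolding l_def by (rule sum_indicator_mult[OF fin that, symmetric])
      show ?thesis by (subst ck) (rule int)
    qed
    have "(\<integral>c. expsq (Z c) * (l a c * l b c) \<partial>gauss I) = (\<integral>c. (\<Sum>k\<in>I. a k * (expsq (Z c) * (c k * l b c))) \<partial>gauss I)"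
      by (intro Bochner_Integration.integral_cong refl)
        (simp add: l_def[of a] sum_distrib_left sum_distrib_right mult_ac)
    also have "\<dots> = (\<Sum>k\<in>I. a k * (\<integral>c. expsq (Z c) * (c k * l b c) \<partial>gauss I))"
    proof -
      have "integrable (gauss I) (\<lambda>c. a k * (expsq (Z c) * (c k * l b c)))" if "k \<in> I" for k
        by (rule integrable_mult_right, rule ik[OF that])
      then show ?thesis by (subst Bochner_Integration.integral_sum) simp_all
    qed
    also have "\<dots> = (\<Sum>k\<in>I. a k * (b k * e0 - x k * (\<integral>c. expsq (Z c) * (l b c * Z c) \<partial>gauss I)))"
      unfolding e0_def Z_def l_def by (intro sum.cong refl) (simp only: gauss_Stein[OF fin])
    also have "\<dots> = (\<Sum>k\<in>I. a k * b k) * e0 - (\<Sum>k\<in>I. a k * x k) * (\<integral>c. expsq (Z c) * (l b c * Z c) \<partial>gauss I)"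
      by (simp add: right_diff_distrib sum_subtractf sum_distrib_right sum_distrib_left mult_ac)
    finally show ?thesis .
  qed
  define u where "u = (\<integral>c. expsq (Z c) * (l x c * Z c) \<partial>gauss I)"
  \<comment> \<open>Integration by parts with both forms equal to the exponent returns the unknown
    itself, so the equation can be solved for it.\<close>
  have "u = s * e0 - s * u"
    using S[of x x] by (simp add: u_def s_def lx power2_eq_square)
  then have u: "u * r\<^sup>2 = s * e0" by (simp add: r2 algebra_simps)
  have b: "(\<integral>c. expsq (Z c) * (l \<beta> c * Z c) \<partial>gauss I) = (\<Sum>k\<in>I. \<beta> k * x k) / r ^ 3"
  proof -
    have "(\<integral>c. expsq (Z c) * (l \<beta> c * Z c) \<partial>gauss I) = (\<Sum>k\<in>I. \<beta> k * x k) * (e0 - u)"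
      using S[of \<beta> x] by (simp add: lx u_def algebra_simps)
    moreover have "e0 - u = 1 / r ^ 3"
    proof -
      have "(e0 - u) * r\<^sup>2 = e0" using u by (simp add: r2 algebra_simps)
      then have "e0 - u = e0 / r\<^sup>2" using r by (simp add: eq_divide_eq)
      then show ?thesis using e0 by (simp add: power2_eq_square power3_eq_cube)
    qed
    ultimately show ?thesis by simp
  qed
  show ?thesis
    unfolding has_bochner_integral_iff Z_def[symmetric] l_def[symmetric]
    using int S[of \<alpha> \<beta>] b e0 by simp (simp_all add: l_def)
qed

section \<open>Independent blocks and densities\<close>

lemma gauss_indep_blocks:
  fixes B :: "'j \<Rightarrow> 'k set"
  assumes B: "\<And>j. B j \<subseteq> I" "disjoint_family B"
  shows "prob_space.indep_vars (gauss I) (\<lambda>j. gauss (B j)) (\<lambda>j c. restrict c (B j)) UNIV"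
proof -
  interpret G: prob_space "gauss I" by (rule prob_space_gauss)
  have "G.indep_vars (\<lambda>_. stdn) (\<lambda>i c. c i) I"
  proof (cases "I = {}")
    case True
    show ?thesis unfolding G.indep_vars_def G.indep_sets_def unfolding True by simp
  next
    case False
    show ?thesis
    proof (subst G.indep_vars_iff_distr_eq_PiM'[OF False])
      show "(\<lambda>c. c i) \<in> measurable (gauss I) stdn" if "i \<in> I" for i
        unfolding measurable_cong_sets[OF refl sets_stdn] by (rule measurable_gauss_component[OF that])
      have "distr (gauss I) (PiM I (\<lambda>_. stdn)) (\<lambda>c. \<lambda>i\<in>I. c i) = distr (gauss I) (gauss I) (\<lambda>c. c)"
      proof (rule distr_cong)
      fix c assume "c \<in> space (gauss I)"
      then show "(\<lambda>i\<in>I. c i) = c" by (simp add: space_gauss PiE_iff extensional_restrict)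
    qed (simp_all add: gauss_def)
      also have "\<dots> = gauss I" by (simp add: distr_id)
      also have "\<dots> = PiM I (\<lambda>i. distr (gauss I) stdn (\<lambda>c. c i))"
        unfolding gauss_def[of I] by (intro PiM_cong refl) (simp add: distr_gauss_component flip: gauss_def)
      finally show "distr (gauss I) (PiM I (\<lambda>_. stdn)) (\<lambda>c. \<lambda>i\<in>I. c i) = PiM I (\<lambda>i. distr (gauss I) stdn (\<lambda>c. c i))" .
    qed
  qed
  from G.indep_vars_restrict[OF this B(1) B(2)]
  show ?thesis by (simp add: gauss_def[of "B _"])
qed

lemma gauss_density:
  assumes fin: "finite I"
  shows "gauss I = density (PiM I (\<lambda>_. lborel)) (\<lambda>c. \<Prod>i\<in>I. ennreal (std_normal_density (c i)))"
proof -
  interpret L: product_sigma_finite "\<lambda>_::'a. lborel :: real measure" by standard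
  have "density (PiM I (\<lambda>_. lborel)) (\<lambda>c. \<Prod>i\<in>I. ennreal (std_normal_density (c i))) = PiM I (\<lambda>_. stdn)"
  proof (rule stdn_prod.PiM_eqI[OF fin])
    show "sets (density (PiM I (\<lambda>_. lborel)) (\<lambda>c. \<Prod>i\<in>I. ennreal (std_normal_density (c i)))) = sets (PiM I (\<lambda>_. stdn))"
      by (simp, intro sets_PiM_cong) auto
    fix A assume A: "\<And>i. i \<in> I \<Longrightarrow> A i \<in> sets stdn"
    have "emeasure (density (PiM I (\<lambda>_. lborel)) (\<lambda>c. \<Prod>i\<in>I. ennreal (std_normal_density (c i)))) (Pi\<^sub>E I A)
        = (\<integral>\<^sup>+ c. (\<Prod>i\<in>I. ennreal (std_normal_density (c i))) * indicator (Pi\<^sub>E I A) c \<partial>PiM I (\<lambda>_. lborel))"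
      using A fin by (intro emeasure_density) (auto intro!: sets_PiM_I_finite)
    also have "\<dots> = (\<integral>\<^sup>+ c. (\<Prod>i\<in>I. ennreal (std_normal_density (c i)) * indicator (A i) (c i)) \<partial>PiM I (\<lambda>_. lborel))"
    proof (rule nn_integral_cong)
      fix c :: "'a \<Rightarrow> real" assume "c \<in> space (PiM I (\<lambda>_. lborel))"
      then have "indicator (Pi\<^sub>E I A) c = (\<Prod>i\<in>I. indicator (A i) (c i) :: ennreal)"
        using fin by (auto simp: indicator_def space_PiM PiE_iff intro!: prod.neutral[symmetric])
      then show "(\<Prod>i\<in>I. ennreal (std_normal_density (c i))) * indicator (Pi\<^sub>E I A) c
          = (\<Prod>i\<in>I. ennreal (std_normal_density (c i)) * indicator (A i) (c i))"
        by (simp add: prod.distrib)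
    qed
    also have "\<dots> = (\<Prod>i\<in>I. \<integral>\<^sup>+ t. ennreal (std_normal_density t) * indicator (A i) t \<partial>lborel)"
      using A fin by (intro L.product_nn_integral_prod) auto
    also have "\<dots> = (\<Prod>i\<in>I. emeasure stdn (A i))"
      using A by (intro prod.cong refl) (simp add: stdn_def emeasure_density)
    finally show "emeasure (density (PiM I (\<lambda>_. lborel)) (\<lambda>c. \<Prod>i\<in>I. ennreal (std_normal_density (c i)))) (Pi\<^sub>E I A)
        = (\<Prod>i\<in>I. emeasure stdn (A i))" .
  qed
  then show ?thesis unfolding gauss_def by (rule sym)
qed

text \<open>The index set consists of pairs with second component 0 because these will index the
  first coefficients of a system, one for each equation.\<close>

lemma distr_PiM_lborel_vec:
  "distr (PiM ((UNIV :: 'n::finite set) \<times> {0::nat}) (\<lambda>_. lborel)) borel (\<lambda>c. \<chi> i. c (i, 0))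
    = (lborel :: (real ^ 'n) measure)"
proof (rule lborel_eqI[symmetric])
  let ?I = "(UNIV :: 'n set) \<times> {0::nat}"
  interpret L: product_sigma_finite "\<lambda>_::'n \<times> nat. lborel :: real measure" by standard
  interpret L: finite_product_sigma_finite "\<lambda>_::'n \<times> nat. lborel :: real measure" ?I by standard auto
  fix l u :: "real ^ 'n"
  assume le: "\<And>b. b \<in> Basis \<Longrightarrow> l \<bullet> b \<le> u \<bullet> b"
  then have le': "l $ k \<le> u $ k" for k
  proof -
    have "axis k (1::real) \<in> (Basis :: (real ^ 'n) set)" by (auto simp: Basis_vec_def)
    from le[OF this] show ?thesis by (simp add: inner_axis)
  qed
  have m: "(\<lambda>c. \<chi> i. c (i, 0)) \<in> measurable (PiM ?I (\<lambda>_. lborel)) (borel :: (real ^ 'n) measure)"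
  proof (subst borel_measurable_euclidean_space, rule ballI)
    fix b :: "real ^ 'n" assume "b \<in> Basis"
    then obtain k where b: "b = axis k 1" by (auto simp: Basis_vec_def)
    have "(\<lambda>c. c (k, 0)) \<in> measurable (PiM ?I (\<lambda>_. lborel :: real measure)) lborel"
      by (rule measurable_component_singleton) blast
    then show "(\<lambda>c. (\<chi> i. c (i, 0)) \<bullet> b) \<in> borel_measurable (PiM ?I (\<lambda>_. lborel))"
      by (simp only: measurable_lborel1 b inner_axis vec_lambda_beta inner_real_def mult_1_right)
  qed
  have vim: "(\<lambda>c. \<chi> i. c (i, 0)) -` box l u \<inter> space (PiM ?I (\<lambda>_. lborel)) = (\<Pi>\<^sub>E p\<in>?I. {l $ fst p <..< u $ fst p})"
    unfolding space_PiM PiE_def by (intro set_eqI) (simp add: mem_box_cart PiE_def Pi_iff)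
  have "emeasure (distr (PiM ?I (\<lambda>_. lborel)) borel (\<lambda>c. \<chi> i. c (i, 0))) (box l u)
      = (\<Prod>p\<in>?I. emeasure lborel {l $ fst p <..< u $ fst p})"
    using m by (simp add: emeasure_distr vim[simplified] L.measure_times)
  also have "\<dots> = (\<Prod>p\<in>?I. ennreal ((u - l) $ fst p))"
    using le' by simp
  also have "\<dots> = ennreal (\<Prod>p\<in>?I. (u - l) $ fst p)"
    using le' by (subst prod_ennreal) auto
  also have "(\<Prod>p\<in>?I. (u - l) $ fst p) = (\<Prod>b\<in>Basis. (u - l) \<bullet> b)"
  proof -
    have "(\<Prod>p\<in>?I. (u - l) $ fst p) = (\<Prod>k\<in>UNIV. (u - l) $ k)"
      by (rule prod.reindex_bij_witness[of _ "\<lambda>k. (k, 0)" fst]) auto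
    then show ?thesis using prod_Basis_cart[of "\<lambda>x. x" "u - l"] by simp
  qed
  finally show "emeasure (distr (PiM ?I (\<lambda>_. lborel)) borel (\<lambda>c. \<chi> i. c (i, 0))) (box l u) = (\<Prod>b\<in>Basis. (u - l) \<bullet> b)" .
qed simp

section \<open>The invariant measure of the sphere\<close>

lemma emeasure_stdn_Ioo_pos:
  assumes "l < u"
  shows "emeasure stdn {l<..<u} > 0"
proof (rule ccontr)
  assume "\<not> ?thesis"
  then have "(\<integral>\<^sup>+ x. ennreal (std_normal_density x) * indicator {l<..<u} x \<partial>lborel) = 0"
    by (simp add: stdn_def emeasure_density not_less)
  then have "AE x in lborel. ennreal (std_normal_density x) * indicator {l<..<u} x = 0"
    by (subst (asm) nn_integral_0_iff_AE) auto
  then have "AE x in lborel. x \<notin> {l<..<u}"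
  proof eventually_elim
    case (elim x)
    have "ennreal (std_normal_density x) \<noteq> 0" using normal_density_pos[of 1 0 x] by (simp add: not_le)
    then show ?case using elim by (auto simp: indicator_def split: if_splits)
  qed
  then have "{l<..<u} \<in> null_sets lborel" by (subst (asm) AE_iff_null_sets[symmetric]) auto
  then have "emeasure lborel {l<..<u} = 0" by (rule null_setsD1)
  then show False using assms by simp
qed

lemma AE_gauss_nonzero:
  assumes "i \<in> I"
  shows "AE c in gauss I. c i \<noteq> 0"
proof -
  have "AE t in stdn. t \<noteq> 0"
    unfolding stdn_def using AE_lborel_singleton[of "0::real"] by (subst AE_density) auto
  then have "AE t in distr (gauss I) stdn (\<lambda>c. c i). t \<noteq> 0"
    unfolding distr_gauss_component[OF assms] .
  moreover have "(\<lambda>c. c i) \<in> measurable (gauss I) stdn"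
    unfolding measurable_cong_sets[OF refl sets_stdn] by (rule measurable_gauss_component[OF assms])
  ultimately show ?thesis by (rule AE_distrD[rotated])
qed

text \<open>An open box with first coordinate in (1, 2) and all others in (-e, e) has positive
  Gaussian mass and lies in the cone around the first axis. It yields the positive cap masses that
  the uniqueness argument divides by.\<close>

lemma gauss_cone_pos:
  assumes d: "0 < d" and a: "a < 1"
  shows "(\<integral>\<^sup>+ c. indicator {p. fst p > a * sqrt (snd p)} (c 0, \<Sum>k<d. (c k)\<^sup>2) \<partial>gauss {..<d::nat}) > 0"
proof -
  interpret G: finite_product_sigma_finite "\<lambda>_. stdn" "{..<d}" by standard simp
  \<comment> \<open>For \<open>a > 0\<close> the choice ensures
    \<open>a\<^sup>2 * ((c 0)\<^sup>2 + d * e\<^sup>2) < (c 0)\<^sup>2\<close> whenever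
    \<open>c 0 \<ge> 1\<close>; for \<open>a \<le> 0\<close> any width works.\<close>
  obtain e :: real where e: "e > 0" "a > 0 \<Longrightarrow> a\<^sup>2 * (real d * e\<^sup>2) < 1 - a\<^sup>2"
  proof (cases "a > 0")
    case True
    have a2: "a\<^sup>2 < 1" using True a by (simp add: power_less_one_iff)
    define e where "e = sqrt ((1 - a\<^sup>2) / (2 * real d))"
    have "e > 0" using a2 d by (simp add: e_def)
    moreover have "a\<^sup>2 * (real d * e\<^sup>2) < 1 - a\<^sup>2"
    proof -
      have "real d * e\<^sup>2 = (1 - a\<^sup>2) / 2" using a2 d by (simp add: e_def)
      then have "a\<^sup>2 * (real d * e\<^sup>2) \<le> 1 * ((1 - a\<^sup>2) / 2)" using a2 by (intro mult_mono) auto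
      also have "\<dots> < 1 - a\<^sup>2" using a2 by simp
      finally show ?thesis .
    qed
    ultimately show ?thesis using that by blast
  next
    case False
    then show ?thesis using that[of 1] by simp
  qed
  define B where "B k = (if k = 0 then {1<..<2} else {-e<..<e})" for k :: nat
  have B: "B k \<in> sets stdn" "emeasure stdn (B k) > 0" for k
    using e(1) by (auto simp: B_def intro: emeasure_stdn_Ioo_pos)
  have "0 < (\<Prod>k\<in>K. emeasure stdn (B k))" if "finite K" for K
    using that by (induction K) (simp_all add: B(2) ennreal_zero_less_mult_iff)
  then have "0 < (\<Prod>k<d. emeasure stdn (B k))" by simp
  also have "\<dots> = emeasure (gauss {..<d}) (PiE {..<d} B)"
    unfolding gauss_def using B(1) by (intro G.measure_times[symmetric]) auto
  also have "\<dots> = (\<integral>\<^sup>+ c. indicator (PiE {..<d} B) c \<partial>gauss {..<d})"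
    unfolding gauss_def using B(1) by (intro nn_integral_indicator[symmetric] sets_PiM_I_finite) auto
  also have "\<dots> \<le> (\<integral>\<^sup>+ c. indicator {p. fst p > a * sqrt (snd p)} (c 0, \<Sum>k<d. (c k)\<^sup>2) \<partial>gauss {..<d})"
  proof (rule nn_integral_mono)
    fix c :: "nat \<Rightarrow> real"
    show "indicator (PiE {..<d} B) c \<le> (indicator {p. fst p > a * sqrt (snd p)} (c 0, \<Sum>k<d. (c k)\<^sup>2) :: ennreal)"
    proof (cases "c \<in> PiE {..<d} B")
      case True
      have c0: "1 < c 0" using True d by (auto simp: PiE_iff B_def dest: bspec[of _ _ 0])
      have ck: "(c k)\<^sup>2 \<le> e\<^sup>2" if "k \<in> {1..<d}" for k
      proof -
        have "c k \<in> B k" using True that by (auto simp: PiE_iff)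
        then have "\<bar>c k\<bar> \<le> \<bar>e\<bar>" using that by (auto simp: B_def)
        then show ?thesis by (rule abs_le_square_iff[THEN iffD1])
      qed
      have "a * sqrt (\<Sum>k<d. (c k)\<^sup>2) < c 0"
      proof (cases "a > 0")
        case False
        then have "a * sqrt (\<Sum>k<d. (c k)\<^sup>2) \<le> 0" by (intro mult_nonpos_nonneg) (auto intro: sum_nonneg)
        then show ?thesis using c0 by simp
      next
        case True
        have "{..<d} = insert 0 {1..<d}" using d by auto
        then have "(\<Sum>k<d. (c k)\<^sup>2) = (c 0)\<^sup>2 + (\<Sum>k\<in>{1..<d}. (c k)\<^sup>2)" by simp
        also have "\<dots> \<le> (c 0)\<^sup>2 + (\<Sum>k\<in>{1..<d}. e\<^sup>2)" using ck by (intro add_left_mono sum_mono) auto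
        also have "\<dots> \<le> (c 0)\<^sup>2 + real d * e\<^sup>2" by (simp add: mult_right_mono)
        finally have "a\<^sup>2 * (\<Sum>k<d. (c k)\<^sup>2) \<le> a\<^sup>2 * ((c 0)\<^sup>2 + real d * e\<^sup>2)" by (intro mult_left_mono) auto
        also have "\<dots> < a\<^sup>2 * (c 0)\<^sup>2 + (1 - a\<^sup>2)" using e(2)[OF True] by (simp add: distrib_left)
        also have "\<dots> \<le> a\<^sup>2 * (c 0)\<^sup>2 + (1 - a\<^sup>2) * (c 0)\<^sup>2"
        proof -
          have "1 - a\<^sup>2 > 0" using True a by (simp add: power_less_one_iff)
          moreover have "1 \<le> (c 0)\<^sup>2" using c0 by (simp add: one_le_power)
          ultimately show ?thesis by (simp add: mult_le_cancel_left1)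
        qed
        also have "\<dots> = (c 0)\<^sup>2" by (simp add: algebra_simps)
        finally have "sqrt (a\<^sup>2 * (\<Sum>k<d. (c k)\<^sup>2)) < sqrt ((c 0)\<^sup>2)" by (rule real_sqrt_less_mono)
        then show ?thesis using True c0 by (simp add: real_sqrt_mult)
      qed
      then show ?thesis by (simp add: indicator_def)
    qed simp
  qed
  finally show ?thesis .
qed

section \<open>The law of a normalized Gaussian vector\<close>

context
  fixes \<Lambda> :: "(int ^ 'n::finite) set" and d :: nat and b :: "nat \<Rightarrow> complex ^ 'n \<Rightarrow> real"
  assumes fin: "finite \<Lambda>" and ne: "\<Lambda> \<noteq> {}" and sym: "uminus ` \<Lambda> = \<Lambda>" and onb: "onb \<Lambda> d b"
begin

interpretation dummy: prob_space "gauss {..<d}" by (rule prob_space_gauss)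

lemmas lincomb' = L2_inner_lincomb[OF fin ne sym] and onb_V' = onb_V[OF fin ne sym onb]
  and onb_pos' = onb_pos[OF fin ne sym onb] and onb_expand' = onb_expand[OF fin ne sym onb]
  and comb_inner' = comb_inner[OF fin ne sym onb] and comb_V' = comb_V[OF fin ne sym onb]
  and Parseval' = onb_Parseval[OF fin ne sym onb]
  and measurable_coordinate' = measurable_coordinate[OF fin ne sym onb]
  and measurable_cap' = measurable_cap[OF fin ne sym onb]
  and cap_uniform_unique' = cap_uniform_unique[OF fin ne sym onb]

abbreviation "SB \<equiv> restrict_space (borel :: (complex ^ 'n \<Rightarrow> real) measure) (unit_sphere \<Lambda>)"

lemma orthogonal_trans_sphere:
  assumes U: "orthogonal_trans \<Lambda> U" and f: "f \<in> unit_sphere \<Lambda>"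
  shows "U f \<in> unit_sphere \<Lambda>"
  using assms by (auto simp: orthogonal_trans_def unit_sphere_def bij_betw_def)

lemma orthogonal_trans_cap:
  assumes U: "orthogonal_trans \<Lambda> U" and x: "x \<in> unit_sphere \<Lambda>"
  shows "U ` cap \<Lambda> x a = cap \<Lambda> (U x) a"
proof -
  have xV: "x \<in> trig_polys \<Lambda>" using x by (simp add: unit_sphere_def)
  have inner: "L2_inner (U f) (U g) = L2_inner f g" if "f \<in> trig_polys \<Lambda>" "g \<in> trig_polys \<Lambda>" for f g
    using U that by (simp add: orthogonal_trans_def)
  have bij: "bij_betw U (trig_polys \<Lambda>) (trig_polys \<Lambda>)" using U by (simp add: orthogonal_trans_def)
  show ?thesis
  proof
    show "U ` cap \<Lambda> x a \<subseteq> cap \<Lambda> (U x) a"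
      using orthogonal_trans_sphere[OF U] inner[OF _ xV]
      by (auto simp: cap_def[OF fin ne sym onb] unit_sphere_def)
    show "cap \<Lambda> (U x) a \<subseteq> U ` cap \<Lambda> x a"
    proof
      fix z assume z: "z \<in> cap \<Lambda> (U x) a"
      then have "z \<in> trig_polys \<Lambda>" by (simp add: cap_def[OF fin ne sym onb] unit_sphere_def)
      then obtain f where f: "f \<in> trig_polys \<Lambda>" "z = U f" using bij by (auto simp: bij_betw_def)
      then have "f \<in> cap \<Lambda> x a"
        using z inner[OF f(1) f(1)] inner[OF f(1) xV] by (simp add: cap_def[OF fin ne sym onb] unit_sphere_def)
      then show "z \<in> U ` cap \<Lambda> x a" using f by blast
    qed
  qed
qed

text \<open>The Householder reflection along \<open>w = x - y\<close>. As both vectors have norm 1,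
  \<open>L2_inner x w\<close> is half of \<open>L2_inner w w\<close>, and the reflection takes
  \<open>x\<close> to \<open>x - w = y\<close>.\<close>

lemma reflection_exists:
  assumes x: "x \<in> unit_sphere \<Lambda>" and y: "y \<in> unit_sphere \<Lambda>" and "x \<noteq> y"
  shows "\<exists>U. orthogonal_trans \<Lambda> U \<and> U x = y"
proof -
  have V: "x \<in> trig_polys \<Lambda>" "y \<in> trig_polys \<Lambda>" and n1: "L2_inner x x = 1" "L2_inner y y = 1"
    using x y by (auto simp: unit_sphere_def)
  define w where "w = (\<lambda>z. 1 * x z + (- 1) * y z)"
  note D = inner_difference[OF fin ne sym onb V(2,1), folded w_def]
  have wV: "w \<in> trig_polys \<Lambda>" and ww: "L2_inner w w = 2 - 2 * L2_inner x y" using D n1 by auto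
  have "w \<noteq> (\<lambda>z. 0)" using \<open>x \<noteq> y\<close> by (auto simp: w_def fun_eq_iff)
  then have w0: "L2_inner w w \<noteq> 0" using L2_inner_self[OF fin ne sym wV] by simp
  define U where "U f = (\<lambda>z. 1 * f z + (- (2 * L2_inner f w / L2_inner w w)) * w z)" for f
  have UV: "U f \<in> trig_polys \<Lambda>" if "f \<in> trig_polys \<Lambda>" for f
    unfolding U_def by (intro trig_polys_lincomb that wV)
  have Ui: "L2_inner (U f) g = L2_inner f g - 2 * L2_inner f w * L2_inner w g / L2_inner w w"
    if "f \<in> trig_polys \<Lambda>" "g \<in> trig_polys \<Lambda>" for f g
    unfolding U_def lincomb'[OF that(1) wV that(2)] by simp
  have Uw: "L2_inner (U f) w = - L2_inner f w" if "f \<in> trig_polys \<Lambda>" for f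
    using Ui[OF that wV] w0 by simp
  have UU: "U (U f) = f" if "f \<in> trig_polys \<Lambda>" for f
    unfolding U_def[of "U f"] Uw[OF that] by (simp add: U_def)
  have "bij_betw U (trig_polys \<Lambda>) (trig_polys \<Lambda>)"
    by (rule bij_betw_byWitness[of _ U]) (auto simp: UU UV)
  moreover have "U (\<lambda>z. c * f z + e * g z) = (\<lambda>z. c * U f z + e * U g z)"
    if "f \<in> trig_polys \<Lambda>" "g \<in> trig_polys \<Lambda>" for f g c e
    unfolding U_def lincomb'[OF that wV] by (simp add: fun_eq_iff algebra_simps add_divide_distrib)
  moreover have "L2_inner (U f) (U g) = L2_inner f g" if "f \<in> trig_polys \<Lambda>" "g \<in> trig_polys \<Lambda>" for f g
  proof -
    have "L2_inner (U f) (U g) = L2_inner f (U g) - 2 * L2_inner f w * L2_inner w (U g) / L2_inner w w"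
      by (rule Ui[OF that(1) UV[OF that(2)]])
    also have "L2_inner w (U g) = - L2_inner g w"
      unfolding L2_inner_commute[of w "U g"] by (rule Uw[OF that(2)])
    also have "L2_inner f (U g) = L2_inner g f - 2 * L2_inner g w * L2_inner w f / L2_inner w w"
      unfolding L2_inner_commute[of f "U g"] by (rule Ui[OF that(2,1)])
    finally show ?thesis by (simp add: L2_inner_commute[of w f] L2_inner_commute[of g f])
  qed
  ultimately have "orthogonal_trans \<Lambda> U" by (simp add: orthogonal_trans_def)
  moreover have "U x = y"
  proof -
    have "L2_inner x w = 1 - L2_inner x y"
    proof -
      have "L2_inner w x = 1 * L2_inner x x + (- 1) * L2_inner y x"
        unfolding w_def by (rule lincomb'[OF V V(1)])
      then show ?thesis using n1 by (simp add: L2_inner_commute[of x w] L2_inner_commute[of y x])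
    qed
    then have "2 * L2_inner x w / L2_inner w w = 1" using w0 ww by simp
    then show ?thesis unfolding U_def by (simp add: w_def)
  qed
  ultimately show ?thesis by blast
qed

text \<open>Reflections already move any cap onto any other of the same size, so invariance under
  them gives equal masses.\<close>

lemma invariant_imp_cap_uniform:
  assumes sp: "space \<sigma> = unit_sphere \<Lambda>" and sets: "sets \<sigma> = sets SB" and 1: "emeasure \<sigma> (unit_sphere \<Lambda>) = 1"
    and inv: "\<And>U A. orthogonal_trans \<Lambda> U \<Longrightarrow> A \<in> sets \<sigma> \<Longrightarrow> emeasure \<sigma> (U ` A) = emeasure \<sigma> A"
  shows "cap_uniform \<Lambda> \<sigma>"
  unfolding cap_uniform_def[OF fin ne sym onb]
proof (intro conjI ballI allI)
  show "prob_space \<sigma>" using sp 1 by (intro prob_spaceI) simp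
  show "sets \<sigma> = sets SB" by (rule sets)
  fix x y a assume x: "x \<in> unit_sphere \<Lambda>" and y: "y \<in> unit_sphere \<Lambda>"
  show "emeasure \<sigma> (cap \<Lambda> x a) = emeasure \<sigma> (cap \<Lambda> y a)"
  proof (cases "x = y")
    case False
    from reflection_exists[OF x y this] obtain U where U: "orthogonal_trans \<Lambda> U" "U x = y" by blast
    have "cap \<Lambda> x a \<in> sets \<sigma>" using measurable_cap'[OF x] sets by simp
    from inv[OF U(1) this] show ?thesis using orthogonal_trans_cap[OF U(1) x, of a] U(2) by simp
  qed simp
qed

text \<open>The zero vector has no direction; it is sent to the first member of the basis.\<close>

definition gcoef :: "(nat \<Rightarrow> real) \<Rightarrow> nat \<Rightarrow> real" where
  "gcoef c k = (if (\<Sum>l<d. (c l)\<^sup>2) = 0 then (if k = 0 then 1 else 0) else c k / sqrt (\<Sum>l<d. (c l)\<^sup>2))"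

definition gpoly :: "(nat \<Rightarrow> real) \<Rightarrow> complex ^ 'n \<Rightarrow> real" where
  "gpoly c = (\<lambda>z. \<Sum>k<d. gcoef c k * b k z)"

lemma gpoly_V: "gpoly c \<in> trig_polys \<Lambda>"
  unfolding gpoly_def by (rule comb_V')

lemma gpoly_inner:
  assumes "x \<in> trig_polys \<Lambda>"
  shows "L2_inner (gpoly c) x = (\<Sum>k<d. gcoef c k * L2_inner x (b k))"
  unfolding Parseval'[OF gpoly_V assms] unfolding gpoly_def by (intro sum.cong refl) (simp add: comb_inner')

lemma gpoly_sphere: "gpoly c \<in> unit_sphere \<Lambda>"
proof -
  have "L2_inner (gpoly c) (gpoly c) = (\<Sum>k<d. (gcoef c k)\<^sup>2)"
    unfolding Parseval'[OF gpoly_V gpoly_V] unfolding gpoly_def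
    by (intro sum.cong refl) (simp add: comb_inner' power2_eq_square)
  also have "\<dots> = 1"
  proof (cases "(\<Sum>l<d. (c l)\<^sup>2) = 0")
    case True
    have "(\<Sum>k<d. (gcoef c k)\<^sup>2) = (\<Sum>k<d. if k = 0 then 1 else 0)"
      using True by (intro sum.cong) (auto simp: gcoef_def)
    then show ?thesis using onb_pos' by simp
  next
    case False
    have nn: "0 \<le> (\<Sum>l<d. (c l)\<^sup>2)" by (intro sum_nonneg) simp
    have "(\<Sum>k<d. (gcoef c k)\<^sup>2) = (\<Sum>k<d. (c k)\<^sup>2 / (\<Sum>l<d. (c l)\<^sup>2))"
      using False nn by (intro sum.cong) (auto simp: gcoef_def power_divide)
    then show ?thesis using False by (simp add: sum_divide_distrib[symmetric])
  qed
  finally show ?thesis using gpoly_V by (simp add: unit_sphere_def)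
qed

lemma measurable_gpoly: "gpoly \<in> measurable (gauss {..<d}) SB"
proof (rule measurable_restrict_space2)
  have gm: "(\<lambda>c. gcoef c k) \<in> borel_measurable (gauss {..<d})" if "k < d" for k
  proof -
    have ck: "(\<lambda>c. c l) \<in> borel_measurable (gauss {..<d})" if "l < d" for l
      using that by (intro measurable_gauss_component) simp
    have s: "(\<lambda>c. \<Sum>l<d. (c l)\<^sup>2) \<in> borel_measurable (gauss {..<d})"
      by (intro borel_measurable_sum borel_measurable_power ck) simp
    have "{c \<in> space (gauss {..<d}). (\<Sum>l<d. (c l)\<^sup>2) = 0} \<in> sets (gauss {..<d})"
      using s by measurable
    then show ?thesis
      unfolding gcoef_def
      by (intro measurable_If borel_measurable_divide borel_measurable_sqrt ck that s borel_measurable_const) simp_all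
  qed
  show "gpoly \<in> measurable (gauss {..<d}) borel"
    unfolding gpoly_def[abs_def] by (rule measurable_lincomb_fun) (rule gm)
qed (simp add: gpoly_sphere)

definition gsphere :: "(complex ^ 'n \<Rightarrow> real) measure" where
  "gsphere = distr (gauss {..<d}) SB gpoly"

text \<open>Almost surely, \<open>gpoly c\<close> lies in the cap exactly if a linear form in
  \<open>c\<close> exceeds \<open>a\<close> times the norm of \<open>c\<close>. The coefficient
  vector of the form has norm 1, so rotation invariance replaces the form by the first coordinate
  and \<open>x\<close> disappears.\<close>

lemma emeasure_gsphere_cap:
  assumes x: "x \<in> unit_sphere \<Lambda>"
  shows "emeasure gsphere (cap \<Lambda> x a)
    = (\<integral>\<^sup>+ c. indicator {p. fst p > a * sqrt (snd p)} (c 0, \<Sum>k<d. (c k)\<^sup>2) \<partial>gauss {..<d})"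
proof -
  have xV: "x \<in> trig_polys \<Lambda>" and x1: "L2_inner x x = 1" using x by (auto simp: unit_sphere_def)
  have capm: "cap \<Lambda> x a \<in> sets SB" by (rule measurable_cap'[OF x])
  define g :: "real \<times> real \<Rightarrow> ennreal" where "g = indicator {p. fst p > a * sqrt (snd p)}"
  have gm: "g \<in> borel_measurable (borel \<Otimes>\<^sub>M borel)"
    unfolding g_def borel_prod
    by (intro borel_measurable_indicator borel_open open_Collect_less continuous_intros)
  have "emeasure gsphere (cap \<Lambda> x a) = (\<integral>\<^sup>+ f. indicator (cap \<Lambda> x a) f \<partial>gsphere)"
    using capm by (intro nn_integral_indicator[symmetric]) (simp add: gsphere_def)
  also have "\<dots> = (\<integral>\<^sup>+ c. indicator (cap \<Lambda> x a) (gpoly c) \<partial>gauss {..<d})"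
    unfolding gsphere_def using measurable_gpoly capm by (intro nn_integral_distr) auto
  also have "\<dots> = (\<integral>\<^sup>+ c. g (\<Sum>k<d. L2_inner x (b k) * c k, \<Sum>k<d. (c k)\<^sup>2) \<partial>gauss {..<d})"
  proof (rule nn_integral_cong_AE)
    \<comment> \<open>Excludes the zero vector, whose normalization is a mere convention.\<close>
    have "AE c in gauss {..<d}. c 0 \<noteq> 0" using onb_pos' by (intro AE_gauss_nonzero) simp
    then show "AE c in gauss {..<d}. indicator (cap \<Lambda> x a) (gpoly c) = g (\<Sum>k<d. L2_inner x (b k) * c k, \<Sum>k<d. (c k)\<^sup>2)"
    proof eventually_elim
      case (elim c)
      have "(c 0)\<^sup>2 \<le> (\<Sum>k<d. (c k)\<^sup>2)" using onb_pos' by (intro member_le_sum) auto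
      then have s: "(\<Sum>k<d. (c k)\<^sup>2) > 0" using elim by (meson less_le_trans zero_less_power2)
      have "L2_inner (gpoly c) x = (\<Sum>k<d. L2_inner x (b k) * c k) / sqrt (\<Sum>k<d. (c k)\<^sup>2)"
        unfolding gpoly_inner[OF xV] using s by (simp add: gcoef_def sum_divide_distrib mult.commute)
      then have "gpoly c \<in> cap \<Lambda> x a \<longleftrightarrow> (\<Sum>k<d. L2_inner x (b k) * c k) > a * sqrt (\<Sum>k<d. (c k)\<^sup>2)"
        using s gpoly_sphere by (simp add: cap_def[OF fin ne sym onb] pos_less_divide_eq)
      then show ?case by (simp add: g_def indicator_def)
    qed
  qed
  also have "\<dots> = (\<integral>\<^sup>+ c. g (sqrt (\<Sum>k<d. (L2_inner x (b k))\<^sup>2) * c 0, \<Sum>k<d. (c k)\<^sup>2) \<partial>gauss {..<d})"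
    using onb_pos' by (intro gauss_linear_form gm) auto
  also have "(\<Sum>k<d. (L2_inner x (b k))\<^sup>2) = 1"
    using Parseval'[OF xV xV] x1 by (simp add: power2_eq_square)
  finally show ?thesis by (simp add: g_def)
qed

lemma cap_uniform_gsphere: "cap_uniform \<Lambda> gsphere"
  unfolding cap_uniform_def[OF fin ne sym onb]
proof (intro conjI ballI allI)
  show "prob_space gsphere" unfolding gsphere_def by (rule dummy.prob_space_distr[OF measurable_gpoly])
  show "sets gsphere = sets SB" by (simp add: gsphere_def)
  show "emeasure gsphere (cap \<Lambda> x a) = emeasure gsphere (cap \<Lambda> y a)"
    if "x \<in> unit_sphere \<Lambda>" "y \<in> unit_sphere \<Lambda>" for x y a
    by (simp only: emeasure_gsphere_cap[OF that(1)] emeasure_gsphere_cap[OF that(2)])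
qed

lemma gsphere_cap_pos: "x \<in> unit_sphere \<Lambda> \<Longrightarrow> a < 1 \<Longrightarrow> emeasure gsphere (cap \<Lambda> x a) > 0"
  unfolding emeasure_gsphere_cap using onb_pos' by (rule gauss_cone_pos)

text \<open>The image of \<open>gsphere\<close> under the inverse of \<open>U\<close> again gives
  congruent caps equal mass, so by uniqueness it is \<open>gsphere\<close>.\<close>

lemma gsphere_invariant:
  assumes U: "orthogonal_trans \<Lambda> U" and A: "A \<in> sets SB"
  shows "emeasure gsphere (U ` A) = emeasure gsphere A"
proof -
  let ?V = "trig_polys \<Lambda>"
  define W where "W = inv_into ?V U"
  have bij: "bij_betw U ?V ?V" and inner: "\<And>f g. f \<in> ?V \<Longrightarrow> g \<in> ?V \<Longrightarrow> L2_inner (U f) (U g) = L2_inner f g"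
    and lin: "\<And>f g c e. f \<in> ?V \<Longrightarrow> g \<in> ?V \<Longrightarrow> U (\<lambda>z. c * f z + e * g z) = (\<lambda>z. c * U f z + e * U g z)"
    using U by (auto simp: orthogonal_trans_def)
  have WV: "W f \<in> ?V" and UW: "U (W f) = f" if "f \<in> ?V" for f
    unfolding W_def using bij that by (auto simp: bij_betw_def inv_into_into f_inv_into_f)
  have WU: "W (U f) = f" if "f \<in> ?V" for f
    unfolding W_def using bij that by (simp add: bij_betw_def)
  have U_sum: "U (\<lambda>z. \<Sum>k\<in>K. c k * f k z) = (\<lambda>z. \<Sum>k\<in>K. c k * U (f k) z)"
    if "finite K" "\<And>k. k \<in> K \<Longrightarrow> f k \<in> ?V" for K :: "nat set" and c f
    using that
  proof (induction K)
    case empty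
    show ?case using lin[OF trig_polys_zero trig_polys_zero, of 0 0] by simp
  next
    case (insert k K)
    have "(\<lambda>z. \<Sum>k\<in>K. c k * f k z) \<in> ?V" using insert by (intro trig_polys_sum) auto
    then show ?case
      using insert lin[of "f k" "\<lambda>z. \<Sum>k\<in>K. c k * f k z" "c k" 1] by simp
  qed
  \<comment> \<open>\<open>U\<close> is an abstract map; the expansion in coordinates is what makes
    its inverse measurable on the sphere.\<close>
  have W_exp: "W f = (\<lambda>z. \<Sum>k<d. L2_inner f (b k) * W (b k) z)" if f: "f \<in> ?V" for f
  proof -
    have "U (\<lambda>z. \<Sum>k<d. L2_inner f (b k) * W (b k) z) = (\<lambda>z. \<Sum>k<d. L2_inner f (b k) * U (W (b k)) z)"
      by (intro U_sum) (auto intro: WV onb_V')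
    also have "\<dots> = (\<lambda>z. \<Sum>k<d. L2_inner f (b k) * b k z)" by (intro ext sum.cong refl) (simp add: UW onb_V')
    also have "\<dots> = f" by (rule onb_expand'[OF f, symmetric])
    finally have "W (U (\<lambda>z. \<Sum>k<d. L2_inner f (b k) * W (b k) z)) = W f" by simp
    moreover have "(\<lambda>z. \<Sum>k<d. L2_inner f (b k) * W (b k) z) \<in> ?V"
      by (intro trig_polys_sum) (auto intro: WV onb_V')
    ultimately show ?thesis using WU by simp
  qed
  have WS: "W f \<in> unit_sphere \<Lambda>" if "f \<in> unit_sphere \<Lambda>" for f
    using that WV inner[OF WV WV, of f f] UW by (auto simp: unit_sphere_def)
  have Wm: "W \<in> measurable SB SB"
  proof (rule measurable_restrict_space2)
    show "W \<in> space SB \<rightarrow> unit_sphere \<Lambda>" using WS by (auto simp: space_restrict_space)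
    have "(\<lambda>f z. \<Sum>k<d. L2_inner f (b k) * W (b k) z) \<in> measurable SB borel"
      by (intro measurable_lincomb_fun measurable_coordinate')
    then show "W \<in> measurable SB borel"
      by (rule measurable_cong[THEN iffD1, rotated])
        (simp add: W_exp[symmetric] space_restrict_space unit_sphere_def)
  qed
  have setsg: "sets gsphere = sets SB" and spg: "space gsphere = unit_sphere \<Lambda>"
    by (simp_all add: gsphere_def space_restrict_space)
  have Wg: "W \<in> measurable gsphere SB" using Wm by (simp add: measurable_cong_sets[OF setsg refl])
  define \<tau> where "\<tau> = distr gsphere SB W"
  have \<tau>: "emeasure \<tau> B = emeasure gsphere (U ` B)" if "B \<in> sets SB" for B
  proof -
    have BS: "B \<subseteq> unit_sphere \<Lambda>" using sets.sets_into_space[OF that] by (simp add: space_restrict_space)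
    have "W -` B \<inter> unit_sphere \<Lambda> = U ` B"
    proof
      show "W -` B \<inter> unit_sphere \<Lambda> \<subseteq> U ` B"
      proof
        fix f assume f: "f \<in> W -` B \<inter> unit_sphere \<Lambda>"
        then have "f = U (W f)" using UW by (simp add: unit_sphere_def)
        then show "f \<in> U ` B" using f by blast
      qed
      show "U ` B \<subseteq> W -` B \<inter> unit_sphere \<Lambda>"
      proof
        fix g assume "g \<in> U ` B"
        then obtain f where f: "f \<in> B" "g = U f" by blast
        then have "f \<in> unit_sphere \<Lambda>" using BS by blast
        then show "g \<in> W -` B \<inter> unit_sphere \<Lambda>"
          using f WU orthogonal_trans_sphere[OF U] by (auto simp: unit_sphere_def)
      qed
    qed
    then show ?thesis unfolding \<tau>_def using Wg that by (simp add: emeasure_distr spg)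
  qed
  have "prob_space gsphere" using cap_uniform_gsphere by (simp add: cap_uniform_def[OF fin ne sym onb])
  then have prob\<tau>: "prob_space \<tau>" unfolding \<tau>_def by (rule prob_space.prob_space_distr[OF _ Wg])
  have "cap_uniform \<Lambda> \<tau>"
    unfolding cap_uniform_def[OF fin ne sym onb]
  proof (intro conjI ballI allI)
    show "prob_space \<tau>" by (rule prob\<tau>)
    show "sets \<tau> = sets SB" by (simp add: \<tau>_def)
    fix x y a assume x: "x \<in> unit_sphere \<Lambda>" and y: "y \<in> unit_sphere \<Lambda>"
    show "emeasure \<tau> (cap \<Lambda> x a) = emeasure \<tau> (cap \<Lambda> y a)"
      unfolding \<tau>[OF measurable_cap'[OF x]] \<tau>[OF measurable_cap'[OF y]] orthogonal_trans_cap[OF U x] orthogonal_trans_cap[OF U y]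
      by (rule cap_uniformD[OF fin ne sym onb cap_uniform_gsphere]) (intro orthogonal_trans_sphere[OF U] x y)+
  qed
  from cap_uniform_unique'[OF this cap_uniform_gsphere gsphere_cap_pos]
  have "\<tau> = gsphere" by blast
  then show ?thesis using \<tau>[OF A] by simp
qed

text \<open>Resolves the definite description: \<open>gsphere\<close> is invariant, and any
  invariant probability measure gives congruent caps equal mass, hence equals it.\<close>

lemma sphere_measure_gauss: "sphere_measure \<Lambda> = gsphere"
  unfolding sphere_measure_def
proof (rule the_equality)
  have "prob_space gsphere" using cap_uniform_gsphere by (simp add: cap_uniform_def[OF fin ne sym onb])
  then have "emeasure gsphere (space gsphere) = 1" by (rule prob_space.emeasure_space_1)
  then show "space gsphere = unit_sphere \<Lambda> \<and> sets gsphere = sets SB \<and> emeasure gsphere (unit_sphere \<Lambda>) = 1 \<and>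
      (\<forall>U. orthogonal_trans \<Lambda> U \<longrightarrow> (\<forall>A\<in>sets gsphere. emeasure gsphere (U ` A) = emeasure gsphere A))"
    using gsphere_invariant by (auto simp: gsphere_def space_restrict_space)
next
  fix \<sigma>
  assume "space \<sigma> = unit_sphere \<Lambda> \<and> sets \<sigma> = sets SB \<and> emeasure \<sigma> (unit_sphere \<Lambda>) = 1 \<and>
      (\<forall>U. orthogonal_trans \<Lambda> U \<longrightarrow> (\<forall>A\<in>sets \<sigma>. emeasure \<sigma> (U ` A) = emeasure \<sigma> A))"
  then have "cap_uniform \<Lambda> \<sigma>" by (intro invariant_imp_cap_uniform) auto
  from cap_uniform_unique'[OF this cap_uniform_gsphere gsphere_cap_pos]
  show "\<sigma> = gsphere" by blast
qed

lemma distr_sphere_tshift: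
  "distr (sphere_measure \<Lambda>) SB (tshift \<phi>) = sphere_measure \<Lambda>"
  "tshift \<phi> \<in> measurable (sphere_measure \<Lambda>) SB"
proof -
  have setsg: "sets gsphere = sets SB" and spg: "space gsphere = unit_sphere \<Lambda>"
    by (simp_all add: gsphere_def space_restrict_space)
  have S: "tshift \<psi> f \<in> unit_sphere \<Lambda>" if "f \<in> unit_sphere \<Lambda>" for f \<psi>
    by (rule orthogonal_trans_sphere[OF orthogonal_trans_tshift[OF fin ne sym] that])
  have m: "tshift \<phi> \<in> measurable gsphere SB"
    unfolding measurable_cong_sets[OF setsg refl]
  proof (rule measurable_restrict_space2)
    show "tshift \<phi> \<in> space SB \<rightarrow> unit_sphere \<Lambda>" using S by (auto simp: space_restrict_space)
    have "tshift \<phi> \<in> measurable (borel :: (complex ^ 'n \<Rightarrow> real) measure) borel"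
      unfolding tshift_def[abs_def]
      by (intro borel_measurable_continuous_onI continuous_on_coordinatewise_then_product
          continuous_on_product_coordinates)
    then show "tshift \<phi> \<in> measurable SB borel" by (rule measurable_restrict_space1)
  qed
  then show "tshift \<phi> \<in> measurable (sphere_measure \<Lambda>) SB" by (simp add: sphere_measure_gauss)
  show "distr (sphere_measure \<Lambda>) SB (tshift \<phi>) = sphere_measure \<Lambda>"
    unfolding sphere_measure_gauss
  proof (rule measure_eqI)
    show "sets (distr gsphere SB (tshift \<phi>)) = sets gsphere" by (simp add: setsg)
    fix A assume "A \<in> sets (distr gsphere SB (tshift \<phi>))"
    then have A: "A \<in> sets SB" by simp
    then have AS: "A \<subseteq> unit_sphere \<Lambda>" using sets.sets_into_space[OF A] by (simp add: space_restrict_space)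
    have "tshift \<phi> -` A \<inter> unit_sphere \<Lambda> = tshift (- \<phi>) ` A"
    proof
      show "tshift \<phi> -` A \<inter> unit_sphere \<Lambda> \<subseteq> tshift (- \<phi>) ` A"
      proof
        fix f assume f: "f \<in> tshift \<phi> -` A \<inter> unit_sphere \<Lambda>"
        have "f = tshift (- \<phi>) (tshift \<phi> f)" by (simp add: tshift_tshift tshift_0)
        then show "f \<in> tshift (- \<phi>) ` A" using f by blast
      qed
      show "tshift (- \<phi>) ` A \<subseteq> tshift \<phi> -` A \<inter> unit_sphere \<Lambda>"
        using AS S by (auto simp: tshift_tshift tshift_0)
    qed
    then show "emeasure (distr gsphere SB (tshift \<phi>)) A = emeasure gsphere A"
      using m A gsphere_invariant[OF orthogonal_trans_tshift[OF fin ne sym] A] by (simp add: emeasure_distr spg)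
  qed
qed

end

section \<open>Zeros of random systems\<close>

text \<open>Packs a system of equations and one inequality into a single condition
  \<open>u \<le> 0\<close>, as the measurability criterion for compact sets expects.\<close>

lemma sum_abs_add_le_0_iff:
  fixes f :: "'i::finite \<Rightarrow> real"
  assumes "t \<ge> 0"
  shows "(\<Sum>i\<in>UNIV. \<bar>f i\<bar>) + t \<le> 0 \<longleftrightarrow> (\<forall>i. f i = 0) \<and> t \<le> 0"
proof -
  have s: "(\<Sum>i\<in>UNIV. \<bar>f i\<bar>) \<ge> 0" by (intro sum_nonneg) simp
  have "(\<Sum>i\<in>UNIV. \<bar>f i\<bar>) + t \<le> 0 \<longleftrightarrow> (\<Sum>i\<in>UNIV. \<bar>f i\<bar>) = 0 \<and> t \<le> 0" using s assms by linarith
  also have "(\<Sum>i\<in>UNIV. \<bar>f i\<bar>) = 0 \<longleftrightarrow> (\<forall>i. f i = 0)" by (subst sum_nonneg_eq_0_iff) auto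
  finally show ?thesis .
qed

section \<open>Gradients and evaluations on the sphere\<close>

context
  fixes \<Lambda> :: "(int ^ 'n::finite) set" and d :: nat and b :: "nat \<Rightarrow> complex ^ 'n \<Rightarrow> real"
  assumes fin: "finite \<Lambda>" and ne: "\<Lambda> \<noteq> {}" and sym: "uminus ` \<Lambda> = \<Lambda>" and onb: "onb \<Lambda> d b"
begin

text \<open>Frees \<open>tgrad\<close> from the coefficient family chosen in its definition.\<close>

lemma tgrad_unique:
  assumes f: "f \<in> trig_polys \<Lambda>" and v: "((\<lambda>\<theta>. f (expt \<theta>)) has_derivative (\<lambda>h. v \<bullet> h)) (at \<theta>)"
  shows "tgrad \<Lambda> f \<theta> = v"
proof -
  have "(\<lambda>h. tgrad \<Lambda> f \<theta> \<bullet> h) = (\<lambda>h. v \<bullet> h)"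
    by (rule has_derivative_unique[OF tgrad_has_derivative[OF fin ne sym f] v])
  then have "\<forall>h. tgrad \<Lambda> f \<theta> \<bullet> h = v \<bullet> h" by (blast dest: fun_cong)
  then show ?thesis by (rule vector_eq_rdot[THEN iffD1])
qed

lemma tgrad_comb:
  "tgrad \<Lambda> (\<lambda>z. \<Sum>k<d. c k * b k z) \<theta> = (\<Sum>k<d. c k *\<^sub>R tgrad \<Lambda> (b k) \<theta>)"
proof (rule tgrad_unique)
  show "(\<lambda>z. \<Sum>k<d. c k * b k z) \<in> trig_polys \<Lambda>" by (rule comb_V[OF fin ne sym onb])
  have "((\<lambda>\<theta>. \<Sum>k<d. c k * b k (expt \<theta>)) has_derivative (\<lambda>h. \<Sum>k<d. c k * (tgrad \<Lambda> (b k) \<theta> \<bullet> h))) (at \<theta>)"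
  proof (rule has_derivative_sum)
    fix k assume "k \<in> {..<d}"
    then have "b k \<in> trig_polys \<Lambda>" using onb_V[OF fin ne sym onb] by simp
    from tgrad_has_derivative[OF fin ne sym this]
    show "((\<lambda>\<theta>. c k * b k (expt \<theta>)) has_derivative (\<lambda>h. c k * (tgrad \<Lambda> (b k) \<theta> \<bullet> h))) (at \<theta>)"
      by (rule bounded_linear.has_derivative[OF bounded_linear_mult_right])
  qed
  then show "((\<lambda>\<theta>. \<Sum>k<d. c k * b k (expt \<theta>)) has_derivative (\<lambda>h. (\<Sum>k<d. c k *\<^sub>R tgrad \<Lambda> (b k) \<theta>) \<bullet> h)) (at \<theta>)"
    by (simp add: inner_sum_left)
qed

lemma tgrad_expand:
  assumes "f \<in> trig_polys \<Lambda>"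
  shows "tgrad \<Lambda> f \<theta> = (\<Sum>k<d. L2_inner f (b k) *\<^sub>R tgrad \<Lambda> (b k) \<theta>)"
  using tgrad_comb[of "\<lambda>k. L2_inner f (b k)" \<theta>] onb_expand[OF fin ne sym onb assms] by simp

lemma tgrad_tshift:
  assumes f: "f \<in> trig_polys \<Lambda>"
  shows "tgrad \<Lambda> (tshift \<phi> f) \<theta> = tgrad \<Lambda> f (\<phi> + \<theta>)"
proof (rule tgrad_unique)
  show "tshift \<phi> f \<in> trig_polys \<Lambda>" by (rule tshift_trig_polys[OF fin ne sym f])
  have "((\<lambda>\<theta>. \<phi> + \<theta>) has_derivative (\<lambda>h. h)) (at \<theta>)" by (auto intro!: derivative_eq_intros)
  from has_derivative_compose[OF this tgrad_has_derivative[OF fin ne sym f]]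
  show "((\<lambda>\<theta>. tshift \<phi> f (expt \<theta>)) has_derivative (\<lambda>h. tgrad \<Lambda> f (\<phi> + \<theta>) \<bullet> h)) (at \<theta>)"
    by (simp add: tshift_expt)
qed

lemma measurable_eval_sphere: "(\<lambda>f. f z) \<in> borel_measurable (SB \<Lambda>)"
  by (intro measurable_restrict_space1 borel_measurable_continuous_onI continuous_on_product_coordinates)

lemma measurable_tgrad_sphere: "(\<lambda>f. tgrad \<Lambda> f \<theta> $ j) \<in> borel_measurable (SB \<Lambda>)"
proof -
  have "(\<lambda>f. \<Sum>k<d. L2_inner f (b k) * tgrad \<Lambda> (b k) \<theta> $ j) \<in> borel_measurable (SB \<Lambda>)"
    by (intro borel_measurable_sum borel_measurable_times borel_measurable_const
        measurable_coordinate[OF fin ne sym onb]) simp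
  then show ?thesis
    by (rule measurable_cong[THEN iffD1, rotated])
      (simp add: tgrad_expand space_restrict_space unit_sphere_def)
qed

lemma sphere_measure_facts:
  "sets (sphere_measure \<Lambda>) = sets (SB \<Lambda>)" "space (sphere_measure \<Lambda>) = unit_sphere \<Lambda>" "prob_space (sphere_measure \<Lambda>)"
proof -
  have eq: "sphere_measure \<Lambda> = gsphere \<Lambda> d b" by (rule sphere_measure_gauss[OF fin ne sym onb])
  show "sets (sphere_measure \<Lambda>) = sets (SB \<Lambda>)" "space (sphere_measure \<Lambda>) = unit_sphere \<Lambda>"
    unfolding eq by (simp_all add: gsphere_def[OF fin ne sym onb] space_restrict_space)
  show "prob_space (sphere_measure \<Lambda>)"
    using cap_uniform_gsphere[OF fin ne sym onb] unfolding eq by (simp add: cap_uniform_def[OF fin ne sym onb])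
qed

end

section \<open>Regular and degenerate zeros of a sample\<close>

locale trig_system =
  fixes \<Lambda> :: "'n::finite \<Rightarrow> (int ^ 'n) set" and d :: "'n \<Rightarrow> nat" and b :: "'n \<Rightarrow> nat \<Rightarrow> complex ^ 'n \<Rightarrow> real"
  assumes fin: "\<And>i. finite (\<Lambda> i)" and ne: "\<And>i. \<Lambda> i \<noteq> {}" and sym: "\<And>i. uminus ` \<Lambda> i = \<Lambda> i"
    and onb: "\<And>i. onb (\<Lambda> i) (d i) (b i)"
    and b0: "\<And>i. b i 0 = (\<lambda>z. kern (\<Lambda> i) z / sqrt (real (card (\<Lambda> i))))"
begin

lemmas facts = fin ne sym onb

definition sphere_prod :: "('n \<Rightarrow> complex ^ 'n \<Rightarrow> real) measure" where
  "sphere_prod = PiM UNIV (\<lambda>i. sphere_measure (\<Lambda> i))"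

lemma space_sphere_prod: "space sphere_prod = {s. \<forall>i. s i \<in> unit_sphere (\<Lambda> i)}"
  by (auto simp: sphere_prod_def space_PiM sphere_measure_facts(2)[OF facts])

lemma prob_space_sphere_prod: "prob_space sphere_prod"
  unfolding sphere_prod_def by (intro prob_space_PiM sphere_measure_facts(3)[OF facts])

sublocale sphere_prod: prob_space sphere_prod by (rule prob_space_sphere_prod)

lemma sphere_prod_V: "s \<in> space sphere_prod \<Longrightarrow> s i \<in> trig_polys (\<Lambda> i)"
  by (simp add: space_sphere_prod unit_sphere_def)

lemma measurable_sphere_prod_component:
  assumes "f \<in> borel_measurable (SB (\<Lambda> i))"
  shows "(\<lambda>s. f (s i)) \<in> borel_measurable sphere_prod"
proof -
  have "(\<lambda>s. s i) \<in> measurable sphere_prod (sphere_measure (\<Lambda> i))"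
    unfolding sphere_prod_def by (rule measurable_component_singleton) simp
  then show ?thesis
    by (rule measurable_compose) (use assms in \<open>simp add: measurable_cong_sets[OF sphere_measure_facts(1)[OF facts] refl]\<close>)
qed

definition Jac :: "('n \<Rightarrow> complex ^ 'n \<Rightarrow> real) \<Rightarrow> real ^ 'n \<Rightarrow> real ^ 'n ^ 'n" where
  "Jac s \<theta> = (\<chi> i j. tgrad (\<Lambda> i) (s i) \<theta> $ j)"

lemma measurable_det_Jac: "(\<lambda>s. det (Jac s \<theta>)) \<in> borel_measurable sphere_prod"
  unfolding det_def Jac_def vec_lambda_beta
  by (intro borel_measurable_sum borel_measurable_times borel_measurable_const borel_measurable_prod
      measurable_sphere_prod_component[OF measurable_tgrad_sphere[OF facts]])

lemma continuous_det_Jac: "continuous_on S (\<lambda>\<theta>. det (Jac s \<theta>))"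
proof -
  have "continuous_on S (\<lambda>\<theta>. tgrad (\<Lambda> i) (s i) \<theta> $ j)" for i j
    by (intro continuous_intros continuous_on_tgrad[OF fin ne sym])
  then show ?thesis unfolding det_def Jac_def vec_lambda_beta by (intro continuous_on_sum continuous_on_mult continuous_on_const continuous_on_prod) auto
qed

lemma measurable_sphere_prod_eval: "(\<lambda>s. s i z) \<in> borel_measurable sphere_prod"
  by (rule measurable_sphere_prod_component[OF measurable_eval_sphere[OF facts]])

definition regular_zeros :: "(real ^ 'n) set \<Rightarrow> ('n \<Rightarrow> complex ^ 'n \<Rightarrow> real) \<Rightarrow> (real ^ 'n) set" where
  "regular_zeros B s = {\<theta>\<in>B. (\<forall>i. s i (expt \<theta>) = 0) \<and> det (Jac s \<theta>) \<noteq> 0}"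

definition degenerate_zeros :: "(real ^ 'n) set \<Rightarrow> ('n \<Rightarrow> complex ^ 'n \<Rightarrow> real) \<Rightarrow> (real ^ 'n) set" where
  "degenerate_zeros B s = {\<theta>\<in>B. (\<forall>i. s i (expt \<theta>) = 0) \<and> det (Jac s \<theta>) = 0}"

text \<open>Only regular zeros enter the count, since the area formula sees no others; degenerate
  zeros will be shown to be almost surely absent.\<close>

definition zero_count :: "(real ^ 'n) set \<Rightarrow> ('n \<Rightarrow> complex ^ 'n \<Rightarrow> real) \<Rightarrow> ennreal" where
  "zero_count B s = emeasure (count_space UNIV) (regular_zeros B s)"

lemma continuous_sphere_prod_eval: "s \<in> space sphere_prod \<Longrightarrow> continuous_on S (\<lambda>\<theta>. s i (expt \<theta>))"
  using trig_poly_continuous[OF sphere_prod_V] .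

lemma measurable_zero_count:
  assumes B: "\<And>l::nat. compact (C l)" "B = (\<Union>l. C l)"
  shows "zero_count B \<in> borel_measurable sphere_prod"
  unfolding zero_count_def[abs_def]
proof (rule measurable_count)
  fix K :: "(real ^ 'n) set" assume K: "compact K"
  \<comment> \<open>A nonzero determinant is not a closed condition. It is exhausted by the closed
    conditions \<open>1 / Suc j \<le> \<bar>det\<bar>\<close>, each written as the vanishing of a
    nonnegative continuous term.\<close>
  define u where "u j s \<theta> = (\<Sum>i\<in>UNIV. \<bar>s i (expt \<theta>)\<bar>) + max 0 (1 / real (Suc j) - \<bar>det (Jac s \<theta>)\<bar>)"
    for j :: nat and s and \<theta> :: "real ^ 'n"
  have u: "u j s \<theta> \<le> 0 \<longleftrightarrow> (\<forall>i. s i (expt \<theta>) = 0) \<and> 1 / real (Suc j) \<le> \<bar>det (Jac s \<theta>)\<bar>" for j s \<theta>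
    unfolding u_def by (subst sum_abs_add_le_0_iff) auto
  have pos: "x \<noteq> 0 \<longleftrightarrow> (\<exists>j::nat. 1 / real (Suc j) \<le> \<bar>x\<bar>)" for x :: real
  proof
    assume "x \<noteq> 0"
    then have "0 < \<bar>x\<bar>" by simp
    then obtain j :: nat where "1 / real (Suc j) < \<bar>x\<bar>" by (rule nat_approx_posE)
    then show "\<exists>j::nat. 1 / real (Suc j) \<le> \<bar>x\<bar>" by (auto intro: less_imp_le)
  next
    assume "\<exists>j::nat. 1 / real (Suc j) \<le> \<bar>x\<bar>"
    then obtain j :: nat where "1 / real (Suc j) \<le> \<bar>x\<bar>" by blast
    moreover have "0 < 1 / real (Suc j)" by simp
    ultimately show "x \<noteq> 0" by auto
  qed
  have "{s \<in> space sphere_prod. regular_zeros B s \<inter> K \<noteq> {}} = (\<Union>l. \<Union>j. {s \<in> space sphere_prod. \<exists>\<theta>\<in>C l \<inter> K. u j s \<theta> \<le> 0})"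
    unfolding regular_zeros_def u pos B(2) by blast
  also have "\<dots> \<in> sets sphere_prod"
  proof (rule sets.countable_UN, rule image_subsetI, rule sets.countable_UN, rule image_subsetI, rule sets_ex_compact)
    fix l j :: nat
    show "compact (C l \<inter> K)" using B(1) K by (intro compact_Int)
    show "(\<lambda>s. u j s \<theta>) \<in> borel_measurable sphere_prod" for \<theta>
      unfolding u_def
      by (intro borel_measurable_add borel_measurable_sum borel_measurable_abs measurable_sphere_prod_eval
          borel_measurable_max borel_measurable_const borel_measurable_diff measurable_det_Jac)
    show "continuous_on (C l \<inter> K) (u j s)" if "s \<in> space sphere_prod" for s
      unfolding u_def[abs_def] by (intro continuous_intros continuous_sphere_prod_eval[OF that] continuous_det_Jac)
  qed
  finally show "{s \<in> space sphere_prod. regular_zeros B s \<inter> K \<noteq> {}} \<in> sets sphere_prod" .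
qed

lemma measurable_degenerate_zeros:
  assumes B: "\<And>l::nat. compact (C l)" "B = (\<Union>l. C l)"
  shows "{s \<in> space sphere_prod. degenerate_zeros B s \<noteq> {}} \<in> sets sphere_prod"
proof -
  define u where "u s \<theta> = (\<Sum>i\<in>UNIV. \<bar>s i (expt \<theta>)\<bar>) + \<bar>det (Jac s \<theta>)\<bar>" for s and \<theta> :: "real ^ 'n"
  have u: "u s \<theta> \<le> 0 \<longleftrightarrow> (\<forall>i. s i (expt \<theta>) = 0) \<and> det (Jac s \<theta>) = 0" for s \<theta>
    unfolding u_def by (subst sum_abs_add_le_0_iff) auto
  have "{s \<in> space sphere_prod. degenerate_zeros B s \<noteq> {}} = (\<Union>l. {s \<in> space sphere_prod. \<exists>\<theta>\<in>C l. u s \<theta> \<le> 0})"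
    unfolding degenerate_zeros_def u B(2) by blast
  also have "\<dots> \<in> sets sphere_prod"
  proof (rule sets.countable_UN, rule image_subsetI, rule sets_ex_compact)
    fix l :: nat
    show "compact (C l)" by (rule B(1))
    show "(\<lambda>s. u s \<theta>) \<in> borel_measurable sphere_prod" for \<theta>
      unfolding u_def by (intro borel_measurable_add borel_measurable_sum borel_measurable_abs measurable_sphere_prod_eval measurable_det_Jac)
    show "continuous_on (C l) (u s)" if "s \<in> space sphere_prod" for s
      unfolding u_def[abs_def] by (intro continuous_intros continuous_sphere_prod_eval[OF that] continuous_det_Jac)
  qed
  finally show ?thesis .
qed

definition shift_sample :: "real ^ 'n \<Rightarrow> ('n \<Rightarrow> complex ^ 'n \<Rightarrow> real) \<Rightarrow> 'n \<Rightarrow> complex ^ 'n \<Rightarrow> real" where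
  "shift_sample \<phi> s = (\<lambda>i. tshift \<phi> (s i))"

text \<open>Every factor is invariant, because translations of the torus act as orthogonal
  maps.\<close>

lemma distr_shift_sample: "distr sphere_prod sphere_prod (shift_sample \<phi>) = sphere_prod" and measurable_shift_sample: "shift_sample \<phi> \<in> measurable sphere_prod sphere_prod"
proof -
  have m: "tshift \<phi> \<in> measurable (sphere_measure (\<Lambda> i)) (sphere_measure (\<Lambda> i))" for i
    using distr_sphere_tshift(2)[OF facts] by (simp add: measurable_cong_sets[OF refl sphere_measure_facts(1)[OF facts]])
  have c: "compose UNIV (tshift \<phi>) = shift_sample \<phi>"
    by (simp add: compose_def shift_sample_def fun_eq_iff)
  have "distr sphere_prod sphere_prod (compose UNIV (tshift \<phi>)) = PiM UNIV (\<lambda>i. distr (sphere_measure (\<Lambda> i)) (sphere_measure (\<Lambda> i)) (tshift \<phi>))"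
    unfolding sphere_prod_def by (intro distr_PiM_finite_prob_space' sphere_measure_facts(3)[OF facts] m) auto
  also have "\<dots> = sphere_prod"
  proof -
    have "distr (sphere_measure (\<Lambda> i)) (sphere_measure (\<Lambda> i)) (tshift \<phi>) = sphere_measure (\<Lambda> i)" for i
    proof -
      have "distr (sphere_measure (\<Lambda> i)) (sphere_measure (\<Lambda> i)) (tshift \<phi>) = distr (sphere_measure (\<Lambda> i)) (SB (\<Lambda> i)) (tshift \<phi>)"
        by (rule distr_cong[OF refl sphere_measure_facts(1)[OF facts] refl])
      also have "\<dots> = sphere_measure (\<Lambda> i)" by (rule distr_sphere_tshift(1)[OF facts])
      finally show ?thesis .
    qed
    then show ?thesis by (simp add: sphere_prod_def)
  qed
  finally show "distr sphere_prod sphere_prod (shift_sample \<phi>) = sphere_prod" by (simp add: c)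
  show "shift_sample \<phi> \<in> measurable sphere_prod sphere_prod"
    unfolding sphere_prod_def
  proof (rule measurable_PiM_single')
    show "(\<lambda>s. shift_sample \<phi> s i) \<in> measurable (PiM UNIV (\<lambda>i. sphere_measure (\<Lambda> i))) (sphere_measure (\<Lambda> i))" for i
      unfolding shift_sample_def by (rule measurable_compose[OF measurable_component_singleton[where M="\<lambda>i. sphere_measure (\<Lambda> i)", OF UNIV_I] m])
    have "tshift \<phi> f \<in> space (sphere_measure (\<Lambda> i))" if "f \<in> space (sphere_measure (\<Lambda> i))" for f i
      using measurable_space[OF m that] .
    then show "shift_sample \<phi> \<in> space (PiM UNIV (\<lambda>i. sphere_measure (\<Lambda> i))) \<rightarrow> (\<Pi>\<^sub>E i\<in>UNIV. space (sphere_measure (\<Lambda> i)))"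
      by (auto simp: space_PiM shift_sample_def PiE_iff)
  qed
qed

lemma Jac_shift_sample: "s \<in> space sphere_prod \<Longrightarrow> Jac (shift_sample \<phi> s) \<theta> = Jac s (\<phi> + \<theta>)"
  unfolding Jac_def shift_sample_def by (simp add: tgrad_tshift[OF facts sphere_prod_V])

lemma regular_zeros_shift: "s \<in> space sphere_prod \<Longrightarrow> regular_zeros ((+) \<phi> ` B) s = (+) \<phi> ` regular_zeros B (shift_sample \<phi> s)"
  and degenerate_zeros_shift: "s \<in> space sphere_prod \<Longrightarrow> degenerate_zeros ((+) \<phi> ` B) s = (+) \<phi> ` degenerate_zeros B (shift_sample \<phi> s)"
  by (auto simp: regular_zeros_def degenerate_zeros_def Jac_shift_sample) (auto simp: shift_sample_def tshift_expt)

lemma zero_count_shift: "s \<in> space sphere_prod \<Longrightarrow> zero_count ((+) \<phi> ` B) s = zero_count B (shift_sample \<phi> s)"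
proof -
  assume s: "s \<in> space sphere_prod"
  have inj: "inj_on ((+) \<phi>) A" for A by simp
  show ?thesis
    unfolding zero_count_def regular_zeros_shift[OF s] emeasure_count_space[OF subset_UNIV]
    by (simp add: finite_image_iff[OF inj] card_image[OF inj])
qed

lemma nn_integral_zero_count_shift:
  assumes B: "\<And>l::nat. compact (C l)" "B = (\<Union>l. C l)"
  shows "(\<integral>\<^sup>+ s. zero_count ((+) \<phi> ` B) s \<partial>sphere_prod) = (\<integral>\<^sup>+ s. zero_count B s \<partial>sphere_prod)"
proof -
  have "(\<integral>\<^sup>+ s. zero_count ((+) \<phi> ` B) s \<partial>sphere_prod) = (\<integral>\<^sup>+ s. zero_count B (shift_sample \<phi> s) \<partial>sphere_prod)"
    by (intro nn_integral_cong zero_count_shift)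
  also have "\<dots> = (\<integral>\<^sup>+ s. zero_count B s \<partial>distr sphere_prod sphere_prod (shift_sample \<phi>))"
    by (rule nn_integral_distr[symmetric, OF measurable_shift_sample]) (use measurable_zero_count[OF B] in \<open>simp add: distr_shift_sample\<close>)
  finally show ?thesis by (simp add: distr_shift_sample)
qed

lemma AE_degenerate_zeros_shift:
  assumes "AE s in sphere_prod. degenerate_zeros B s = {}"
  shows "AE s in sphere_prod. degenerate_zeros ((+) \<phi> ` B) s = {}"
proof -
  have "AE s in distr sphere_prod sphere_prod (shift_sample \<phi>). degenerate_zeros B s = {}" unfolding distr_shift_sample by (rule assms)
  then have "AE s in sphere_prod. degenerate_zeros B (shift_sample \<phi> s) = {}" by (rule AE_distrD[OF measurable_shift_sample])
  with AE_space show ?thesis by eventually_elim (simp add: degenerate_zeros_shift)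
qed

end

section \<open>Gaussian coordinates\<close>

context trig_system
begin

definition rest_index :: "('n \<times> nat) set" where "rest_index = Sigma UNIV (\<lambda>i. {1..<d i})"
definition base_index :: "('n \<times> nat) set" where "base_index = UNIV \<times> {0}"
definition coef_index :: "('n \<times> nat) set" where "coef_index = Sigma UNIV (\<lambda>i. {..<d i})"

definition sample :: "('n \<times> nat \<Rightarrow> real) \<Rightarrow> 'n \<Rightarrow> complex ^ 'n \<Rightarrow> real" where
  "sample c i = gpoly (d i) (b i) (\<lambda>k. c (i, k))"

lemma d_pos: "0 < d i"
  using onb[of i] by (simp add: onb_def[OF fin ne sym])

lemma index_split: "rest_index \<inter> base_index = {}" "finite rest_index" "finite base_index" "coef_index = rest_index \<union> base_index" "finite coef_index"
  using d_pos by (auto simp: rest_index_def base_index_def coef_index_def)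

lemma gpoly_cong: "(\<And>k. k < d i \<Longrightarrow> c k = c' k) \<Longrightarrow> gpoly (d i) (b i) c = gpoly (d i) (b i) c'"
proof -
  assume eq: "\<And>k. k < d i \<Longrightarrow> c k = c' k"
  have "(\<Sum>l<d i. (c l)\<^sup>2) = (\<Sum>l<d i. (c' l)\<^sup>2)" by (intro sum.cong) (simp_all add: eq)
  then have "gcoef (d i) c k = gcoef (d i) c' k" if "k < d i" for k
    using that by (simp add: gcoef_def[OF fin ne sym onb] eq)
  then show ?thesis by (auto simp: gpoly_def[OF fin ne sym onb] intro!: sum.cong)
qed

text \<open>The polynomials of different equations depend on disjoint blocks of coefficients, so
  they are independent, and each has the law of a normalized Gaussian combination.\<close>

lemma sphere_prod_gauss: "sphere_prod = distr (gauss coef_index) sphere_prod sample" and measurable_sample: "sample \<in> measurable (gauss coef_index) sphere_prod"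
proof -
  interpret G: prob_space "gauss coef_index" by (rule prob_space_gauss)
  define B where "B i = {i} \<times> {..<d i}" for i
  define T where "T i c = (\<lambda>k\<in>{..<d i}. c (i, k))" for i and c :: "'n \<times> nat \<Rightarrow> real"
  have T: "T i \<in> measurable (gauss J) (gauss {..<d i})" if "B i \<subseteq> J" for i J
    unfolding T_def gauss_def[of "{..<d i}"]
  proof (rule measurable_restrict)
    fix k assume "k \<in> {..<d i}"
    then have "(i, k) \<in> J" using that by (auto simp: B_def)
    then show "(\<lambda>c. c (i, k)) \<in> measurable (gauss J) stdn"
      unfolding measurable_cong_sets[OF refl sets_stdn] by (rule measurable_gauss_component)
  qed
  have BC: "B i \<subseteq> coef_index" for i by (auto simp: B_def coef_index_def)
  have gp: "gpoly (d i) (b i) \<in> measurable (gauss {..<d i}) (sphere_measure (\<Lambda> i))" for i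
    unfolding measurable_cong_sets[OF refl sphere_measure_facts(1)[OF facts]]
    by (rule measurable_gpoly[OF facts])
  have X: "sample c i = gpoly (d i) (b i) (T i c)" for c i
    unfolding sample_def T_def by (rule gpoly_cong) simp
  have Xm: "(\<lambda>c. sample c i) \<in> measurable (gauss coef_index) (sphere_measure (\<Lambda> i))" for i
    unfolding X by (rule measurable_compose[OF T[OF BC] gp])
  have "G.indep_vars (\<lambda>i. gauss (B i)) (\<lambda>i c. restrict c (B i)) UNIV"
    by (rule gauss_indep_blocks[OF BC]) (auto simp: disjoint_family_on_def B_def)
  from G.indep_vars_compose2[OF this, of "\<lambda>i c. gpoly (d i) (b i) (T i c)" "\<lambda>i. sphere_measure (\<Lambda> i)"]
  have "G.indep_vars (\<lambda>i. sphere_measure (\<Lambda> i)) (\<lambda>i c. gpoly (d i) (b i) (T i (restrict c (B i)))) UNIV"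
    using measurable_compose[OF T[OF subset_refl] gp] by blast
  moreover have "T i (restrict c (B i)) = T i c" for i c by (auto simp: T_def B_def)
  ultimately have "G.indep_vars (\<lambda>i. sphere_measure (\<Lambda> i)) (\<lambda>i c. sample c i) UNIV" by (simp add: X)
  then have "distr (gauss coef_index) (PiM UNIV (\<lambda>i. sphere_measure (\<Lambda> i))) (\<lambda>c. \<lambda>i\<in>UNIV. sample c i)
      = PiM UNIV (\<lambda>i. distr (gauss coef_index) (sphere_measure (\<Lambda> i)) (\<lambda>c. sample c i))"
    by (subst (asm) G.indep_vars_iff_distr_eq_PiM') (use Xm in auto)
  also have "\<dots> = sphere_prod"
    unfolding sphere_prod_def
  proof (rule PiM_cong[OF refl])
    fix i
    have dT: "distr (gauss coef_index) (gauss {..<d i}) (T i) = gauss {..<d i}"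
      unfolding gauss_def T_def
      by (rule distr_PiM_reindex) (auto intro: prob_space_stdn simp: inj_on_def coef_index_def)
    have "distr (gauss coef_index) (sphere_measure (\<Lambda> i)) (\<lambda>c. sample c i)
        = distr (distr (gauss coef_index) (gauss {..<d i}) (T i)) (sphere_measure (\<Lambda> i)) (gpoly (d i) (b i))"
      unfolding X by (subst distr_distr[OF gp T[OF BC]]) (simp add: comp_def)
    also have "\<dots> = distr (gauss {..<d i}) (SB (\<Lambda> i)) (gpoly (d i) (b i))"
      unfolding dT by (rule distr_cong[OF refl sphere_measure_facts(1)[OF facts] refl])
    also have "\<dots> = sphere_measure (\<Lambda> i)"
      unfolding sphere_measure_gauss[OF facts] gsphere_def[OF facts] ..
    finally show "distr (gauss coef_index) (sphere_measure (\<Lambda> i)) (\<lambda>c. sample c i) = sphere_measure (\<Lambda> i)" .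
  qed
  finally have "distr (gauss coef_index) sphere_prod sample = sphere_prod" by (simp add: sphere_prod_def restrict_def)
  then show "sphere_prod = distr (gauss coef_index) sphere_prod sample" by (rule HOL.sym)
  have "(\<lambda>c. \<lambda>i\<in>UNIV. sample c i) \<in> measurable (gauss coef_index) sphere_prod"
    unfolding sphere_prod_def by (rule measurable_restrict) (rule Xm)
  then show "sample \<in> measurable (gauss coef_index) sphere_prod" by (simp add: restrict_def)
qed

text \<open>The coefficients of the base members \<open>b i 0\<close> are \<open>y\<close>, the remaining ones are \<open>r\<close>.\<close>

definition coefs :: "('n \<times> nat \<Rightarrow> real) \<Rightarrow> real ^ 'n \<Rightarrow> 'n \<times> nat \<Rightarrow> real" where
  "coefs r y = (\<lambda>p\<in>coef_index. if snd p = 0 then y $ fst p else r p)"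

definition \<gamma> :: "real ^ 'n \<Rightarrow> real" where "\<gamma> y = (\<Prod>i\<in>UNIV. std_normal_density (y $ i))"

lemma measurable_coefs: "(\<lambda>p. coefs (fst p) (snd p)) \<in> measurable (gauss rest_index \<Otimes>\<^sub>M borel) (gauss coef_index)"
  unfolding gauss_def[of coef_index] coefs_def
proof (rule measurable_restrict)
  fix q assume q: "q \<in> coef_index"
  show "(\<lambda>p. if snd q = 0 then snd p $ fst q else fst p q) \<in> measurable (gauss rest_index \<Otimes>\<^sub>M (borel :: (real ^ 'n) measure)) stdn"
    unfolding measurable_cong_sets[OF refl sets_stdn]
  proof (cases "snd q = 0")
    case True
    have "(\<lambda>y :: real ^ 'n. y $ fst q) \<in> borel_measurable borel"
      by (intro borel_measurable_continuous_onI continuous_intros)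
    show "(\<lambda>p. if snd q = 0 then snd p $ fst q else fst p q) \<in> borel_measurable (gauss rest_index \<Otimes>\<^sub>M (borel :: (real ^ 'n) measure))"
      unfolding if_P[OF True] by (rule measurable_compose[OF measurable_snd]) fact
  next
    case False
    then have "q \<in> rest_index" using q by (auto simp: coef_index_def rest_index_def)
    then show "(\<lambda>p. if snd q = 0 then snd p $ fst q else fst p q) \<in> borel_measurable (gauss rest_index \<Otimes>\<^sub>M (borel :: (real ^ 'n) measure))"
      unfolding if_not_P[OF False] by (intro measurable_compose[OF measurable_fst measurable_gauss_component])
  qed
qed

lemma measurable_sample_coefs:
  assumes "r \<in> space (gauss rest_index)"
  shows "(\<lambda>y. sample (coefs r y)) \<in> measurable borel sphere_prod"
proof -
  have "(\<lambda>y. (r, y)) \<in> measurable (borel :: (real ^ 'n) measure) (gauss rest_index \<Otimes>\<^sub>M borel)"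
    by (rule measurable_Pair1'[OF assms])
  from measurable_compose[OF measurable_compose[OF this measurable_coefs] measurable_sample]
  show ?thesis by simp
qed

text \<open>Tonelli over the split of the coefficients: for fixed \<open>r\<close> the first
  coefficients \<open>y\<close> are integrated against Lebesgue measure with density
  \<open>\<gamma>\<close>, ready for the area formula.\<close>

lemma nn_integral_sphere_prod:
  assumes f: "f \<in> borel_measurable sphere_prod"
  shows "(\<integral>\<^sup>+ s. f s \<partial>sphere_prod) = (\<integral>\<^sup>+ r. (\<integral>\<^sup>+ y. ennreal (\<gamma> y) * f (sample (coefs r y)) \<partial>lborel) \<partial>gauss rest_index)"
proof -
  have fG: "(\<lambda>c. f (sample c)) \<in> borel_measurable (gauss coef_index)"
    by (rule measurable_compose[OF measurable_sample f])
  have "(\<integral>\<^sup>+ s. f s \<partial>sphere_prod) = (\<integral>\<^sup>+ s. f s \<partial>distr (gauss coef_index) sphere_prod sample)" by (simp flip: sphere_prod_gauss)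
  also have "\<dots> = (\<integral>\<^sup>+ c. f (sample c) \<partial>gauss coef_index)" by (rule nn_integral_distr[OF measurable_sample]) (use f in simp)
  also have "\<dots> = (\<integral>\<^sup>+ r. (\<integral>\<^sup>+ t. f (sample (merge rest_index base_index (r, t))) \<partial>gauss base_index) \<partial>gauss rest_index)"
    using stdn_prod.product_nn_integral_fold[OF index_split(1,2,3), of "\<lambda>c. f (sample c)"] fG
    by (simp add: gauss_def index_split(4))
  also have "\<dots> = (\<integral>\<^sup>+ r. (\<integral>\<^sup>+ y. ennreal (\<gamma> y) * f (sample (coefs r y)) \<partial>lborel) \<partial>gauss rest_index)"
  proof (rule nn_integral_cong)
    fix r assume r: "r \<in> space (gauss rest_index)"
    have mm: "sample (merge rest_index base_index (r, t)) = sample (coefs r (\<chi> i. t (i, 0)))" for t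
    proof
      fix i show "sample (merge rest_index base_index (r, t)) i = sample (coefs r (\<chi> i. t (i, 0))) i"
        unfolding sample_def by (rule gpoly_cong) (auto simp: coefs_def merge_def rest_index_def base_index_def coef_index_def)
    qed
    have fy: "(\<lambda>y. f (sample (coefs r y))) \<in> borel_measurable borel"
      by (rule measurable_compose[OF measurable_sample_coefs[OF r] f])
    have \<gamma>m: "(\<lambda>y. ennreal (\<gamma> y)) \<in> borel_measurable borel"
      unfolding \<gamma>_def std_normal_density_def
      by (intro measurable_compose[OF borel_measurable_continuous_onI measurable_ennreal] continuous_intros) auto
    define v where "v t = (\<chi> i. t (i, 0::nat))" for t :: "'n \<times> nat \<Rightarrow> real"
    let ?L = "PiM base_index (\<lambda>_. lborel :: real measure)"
    have vm: "v \<in> measurable ?L borel"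
    proof (subst borel_measurable_euclidean_space, rule ballI)
      fix e :: "real ^ 'n" assume "e \<in> Basis"
      then obtain k where e: "e = axis k 1" by (auto simp: Basis_vec_def)
      have "(\<lambda>c. c (k, 0)) \<in> measurable ?L lborel"
        by (rule measurable_component_singleton) (simp add: base_index_def)
      then show "(\<lambda>c. v c \<bullet> e) \<in> borel_measurable ?L"
        by (simp only: v_def measurable_lborel1 e inner_axis vec_lambda_beta inner_real_def mult_1_right)
    qed
    have dv: "distr ?L borel v = lborel"
      unfolding v_def[abs_def] base_index_def by (rule distr_PiM_lborel_vec)
    have "(\<integral>\<^sup>+ t. f (sample (merge rest_index base_index (r, t))) \<partial>gauss base_index) = (\<integral>\<^sup>+ t. f (sample (coefs r (v t))) \<partial>gauss base_index)"
      unfolding mm v_def ..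
    also have "\<dots> = (\<integral>\<^sup>+ t. (\<Prod>p\<in>base_index. ennreal (std_normal_density (t p))) * f (sample (coefs r (v t))) \<partial>?L)"
      unfolding gauss_density[OF index_split(3)]
    proof (rule nn_integral_density)
      show "(\<lambda>c. \<Prod>i\<in>base_index. ennreal (std_normal_density (c i))) \<in> borel_measurable ?L"
        by measurable
      show "(\<lambda>t. f (sample (coefs r (v t)))) \<in> borel_measurable ?L"
        by (rule measurable_compose[OF vm fy])
    qed
    also have "\<dots> = (\<integral>\<^sup>+ t. ennreal (\<gamma> (v t)) * f (sample (coefs r (v t))) \<partial>?L)"
    proof (rule nn_integral_cong)
      fix t :: "'n \<times> nat \<Rightarrow> real"
      have "(\<Prod>p\<in>base_index. ennreal (std_normal_density (t p))) = (\<Prod>i\<in>UNIV. ennreal (std_normal_density (t (i, 0))))"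
        unfolding base_index_def by (rule prod.reindex_bij_witness[of _ "\<lambda>k. (k, 0)" fst]) auto
      also have "\<dots> = ennreal (\<gamma> (v t))" unfolding \<gamma>_def v_def by (subst prod_ennreal) auto
      finally show "(\<Prod>p\<in>base_index. ennreal (std_normal_density (t p))) * f (sample (coefs r (v t))) = ennreal (\<gamma> (v t)) * f (sample (coefs r (v t)))"
        by simp
    qed
    also have "\<dots> = (\<integral>\<^sup>+ y. ennreal (\<gamma> y) * f (sample (coefs r y)) \<partial>distr ?L borel v)"
      by (rule nn_integral_distr[symmetric, OF vm]) (intro borel_measurable_times_ennreal; simp add: \<gamma>m fy)
    finally show "(\<integral>\<^sup>+ t. f (sample (merge rest_index base_index (r, t))) \<partial>gauss base_index) = (\<integral>\<^sup>+ y. ennreal (\<gamma> y) * f (sample (coefs r y)) \<partial>lborel)"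
      unfolding dv .
  qed
  finally show ?thesis .
qed

end

section \<open>Zeros as preimages under a fibre map\<close>

context trig_system
begin

definition base_val :: "'n \<Rightarrow> real ^ 'n \<Rightarrow> real" where "base_val i \<theta> = b i 0 (expt \<theta>)"
definition ratio :: "'n \<Rightarrow> nat \<Rightarrow> real ^ 'n \<Rightarrow> real" where "ratio i k \<theta> = b i k (expt \<theta>) / base_val i \<theta>"
definition ratio_grad :: "'n \<Rightarrow> nat \<Rightarrow> real ^ 'n \<Rightarrow> real ^ 'n" where
  "ratio_grad i k \<theta> = (1 / base_val i \<theta>) *\<^sub>R tgrad (\<Lambda> i) (b i k) \<theta> - (b i k (expt \<theta>) / (base_val i \<theta>)\<^sup>2) *\<^sub>R tgrad (\<Lambda> i) (b i 0) \<theta>"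
text \<open>Solving \<open>y $ i * b i 0 + (\<Sum>k. r (i, k) * b i k) = 0\<close> for
  \<open>y $ i\<close>, where \<open>b i 0\<close> does not vanish, gives this map; the zeros of the
  sample become the preimages of \<open>y\<close>.\<close>

definition fiber_map :: "('n \<times> nat \<Rightarrow> real) \<Rightarrow> real ^ 'n \<Rightarrow> real ^ 'n" where
  "fiber_map r \<theta> = (\<chi> i. - (\<Sum>k\<in>{1..<d i}. r (i, k) * ratio i k \<theta>))"
definition fiber_jac :: "('n \<times> nat \<Rightarrow> real) \<Rightarrow> real ^ 'n \<Rightarrow> real ^ 'n ^ 'n" where
  "fiber_jac r \<theta> = (\<chi> i j. - (\<Sum>k\<in>{1..<d i}. r (i, k) * ratio_grad i k \<theta> $ j))"
definition base_pos :: "(real ^ 'n) set" where "base_pos = {\<theta>. \<forall>i. base_val i \<theta> > 0}"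

lemma bV: "k < d i \<Longrightarrow> b i k \<in> trig_polys (\<Lambda> i)"
  by (rule onb_V[OF facts])

lemma continuous_base_val: "continuous_on S (base_val i)"
  unfolding base_val_def[abs_def] by (rule trig_poly_continuous[OF bV[OF d_pos]])

lemma open_base_pos: "open base_pos"
proof -
  have "base_pos = (\<Inter>i. {\<theta>. 0 < base_val i \<theta>})" by (auto simp: base_pos_def)
  moreover have "open {\<theta>. 0 < base_val i \<theta>}" for i
    by (rule open_Collect_less[OF continuous_on_const continuous_base_val])
  ultimately show ?thesis by auto
qed

lemma ratio_derivative:
  assumes "base_val i \<theta> \<noteq> 0" "k < d i"
  shows "(ratio i k has_derivative (\<lambda>h. ratio_grad i k \<theta> \<bullet> h)) (at \<theta>)"
proof -
  have 1: "((\<lambda>\<theta>. b i k (expt \<theta>)) has_derivative (\<lambda>h. tgrad (\<Lambda> i) (b i k) \<theta> \<bullet> h)) (at \<theta>)"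
    by (rule tgrad_has_derivative[OF fin ne sym bV[OF assms(2)]])
  have 2: "(base_val i has_derivative (\<lambda>h. tgrad (\<Lambda> i) (b i 0) \<theta> \<bullet> h)) (at \<theta>)"
    unfolding base_val_def[abs_def] by (rule tgrad_has_derivative[OF fin ne sym bV[OF d_pos]])
  have "((\<lambda>\<theta>. b i k (expt \<theta>) / base_val i \<theta>) has_derivative
      (\<lambda>h. - b i k (expt \<theta>) * (inverse (base_val i \<theta>) * (tgrad (\<Lambda> i) (b i 0) \<theta> \<bullet> h) * inverse (base_val i \<theta>))
        + (tgrad (\<Lambda> i) (b i k) \<theta> \<bullet> h) / base_val i \<theta>)) (at \<theta>)"
    by (rule has_derivative_divide[OF 1 2 assms(1)])
  moreover have "(\<lambda>h. - b i k (expt \<theta>) * (inverse (base_val i \<theta>) * (tgrad (\<Lambda> i) (b i 0) \<theta> \<bullet> h) * inverse (base_val i \<theta>))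
        + (tgrad (\<Lambda> i) (b i k) \<theta> \<bullet> h) / base_val i \<theta>) = (\<lambda>h. ratio_grad i k \<theta> \<bullet> h)"
    by (simp add: ratio_grad_def fun_eq_iff inner_diff_left power2_eq_square divide_inverse)
  ultimately show ?thesis by (simp add: ratio_def[abs_def])
qed

lemma fiber_map_derivative:
  assumes "\<theta> \<in> base_pos"
  shows "(fiber_map r has_derivative (\<lambda>h. fiber_jac r \<theta> *v h)) (at \<theta>)"
proof (subst has_derivative_componentwise_within, rule ballI)
  fix e :: "real ^ 'n" assume "e \<in> Basis"
  then obtain i where e: "e = axis i 1" by (auto simp: Basis_vec_def)
  have p: "base_val i \<theta> \<noteq> 0" using assms by (auto simp: base_pos_def dest: spec[of _ i])
  have 1: "((\<lambda>\<theta>. \<Sum>k\<in>{1..<d i}. r (i, k) * ratio i k \<theta>) has_derivative (\<lambda>h. \<Sum>k\<in>{1..<d i}. r (i, k) * (ratio_grad i k \<theta> \<bullet> h))) (at \<theta>)"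
  proof (rule has_derivative_sum)
    fix k assume "k \<in> {1..<d i}"
    then have "k < d i" by simp
    from ratio_derivative[OF p this]
    show "((\<lambda>\<theta>. r (i, k) * ratio i k \<theta>) has_derivative (\<lambda>h. r (i, k) * (ratio_grad i k \<theta> \<bullet> h))) (at \<theta>)"
      by (rule bounded_linear.has_derivative[OF bounded_linear_mult_right])
  qed
  have 2: "(\<lambda>x. fiber_map r x \<bullet> e) = (\<lambda>\<theta>. - (\<Sum>k\<in>{1..<d i}. r (i, k) * ratio i k \<theta>))"
    by (simp add: e inner_axis fiber_map_def)
  have 3: "(\<lambda>h. (fiber_jac r \<theta> *v h) \<bullet> e) = (\<lambda>h. - (\<Sum>k\<in>{1..<d i}. r (i, k) * (ratio_grad i k \<theta> \<bullet> h)))"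
  proof
    fix h
    have "(fiber_jac r \<theta> *v h) \<bullet> e = (\<Sum>j\<in>UNIV. - (\<Sum>k\<in>{1..<d i}. r (i, k) * ratio_grad i k \<theta> $ j) * h $ j)"
      by (simp add: e inner_axis fiber_jac_def matrix_vector_mult_def)
    also have "\<dots> = - (\<Sum>j\<in>UNIV. \<Sum>k\<in>{1..<d i}. r (i, k) * (ratio_grad i k \<theta> $ j * h $ j))"
      by (simp only: sum_distrib_right sum_negf minus_mult_left[symmetric] mult.assoc)
    also have "(\<Sum>j\<in>UNIV. \<Sum>k\<in>{1..<d i}. r (i, k) * (ratio_grad i k \<theta> $ j * h $ j)) = (\<Sum>k\<in>{1..<d i}. r (i, k) * (ratio_grad i k \<theta> \<bullet> h))"
      by (subst sum.swap) (simp add: inner_vec_def sum_distrib_left)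
    finally show "(fiber_jac r \<theta> *v h) \<bullet> e = - (\<Sum>k\<in>{1..<d i}. r (i, k) * (ratio_grad i k \<theta> \<bullet> h))" .
  qed
  show "((\<lambda>x. fiber_map r x \<bullet> e) has_derivative (\<lambda>h. (fiber_jac r \<theta> *v h) \<bullet> e)) (at \<theta>)"
    unfolding 2 3 by (rule has_derivative_minus[OF 1])
qed

lemma continuous_ratio_grad: "k < d i \<Longrightarrow> continuous_on base_pos (\<lambda>\<theta>. ratio_grad i k \<theta> $ j)"
  unfolding ratio_grad_def
  by (intro continuous_intros continuous_base_val continuous_on_tgrad[OF fin ne sym] trig_poly_continuous[OF bV])
    (auto simp: base_pos_def dest: spec[of _ i])

lemma continuous_fiber_jac: "continuous_on base_pos (\<lambda>\<theta>. fiber_jac r \<theta> $ i $ j)"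
  unfolding fiber_jac_def vec_lambda_beta
  by (intro continuous_on_minus continuous_on_sum continuous_on_mult continuous_on_const continuous_ratio_grad) auto

lemma measurable_base_val: "base_val i \<in> borel_measurable borel"
  by (intro borel_measurable_continuous_onI continuous_base_val)

lemma measurable_ratio: "k < d i \<Longrightarrow> ratio i k \<in> borel_measurable borel"
  unfolding ratio_def[abs_def]
  by (intro borel_measurable_divide measurable_base_val borel_measurable_continuous_onI trig_poly_continuous[OF bV])

lemma measurable_ratio_grad: "k < d i \<Longrightarrow> (\<lambda>\<theta>. ratio_grad i k \<theta> $ j) \<in> borel_measurable borel"
  unfolding ratio_grad_def vector_minus_component vector_scaleR_component real_scaleR_def
  by (intro borel_measurable_diff borel_measurable_times borel_measurable_divide borel_measurable_power measurable_base_val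
      borel_measurable_const borel_measurable_continuous_onI[OF trig_poly_continuous[OF bV]]
      borel_measurable_continuous_onI[OF continuous_on_component[OF continuous_on_tgrad[OF fin ne sym]]])

text \<open>\<open>N\<close> is the norm of the coefficient vector of equation \<open>i\<close>; a
  nonzero first coefficient keeps it positive.\<close>

lemma sample_expand:
  assumes y: "y $ i \<noteq> 0"
  obtains N where "N > 0"
    "\<And>z. sample (coefs r y) i z = (y $ i * b i 0 z + (\<Sum>k\<in>{1..<d i}. r (i, k) * b i k z)) / N"
    "\<And>\<theta>. tgrad (\<Lambda> i) (sample (coefs r y) i) \<theta>
      = (1 / N) *\<^sub>R (y $ i *\<^sub>R tgrad (\<Lambda> i) (b i 0) \<theta> + (\<Sum>k\<in>{1..<d i}. r (i, k) *\<^sub>R tgrad (\<Lambda> i) (b i k) \<theta>))"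
proof -
  define c where "c k = coefs r y (i, k)" for k
  have c0: "c 0 = y $ i" and ck: "k \<in> {1..<d i} \<Longrightarrow> c k = r (i, k)" for k
    using d_pos[of i] by (auto simp: c_def coefs_def coef_index_def)
  define N where "N = sqrt (\<Sum>l<d i. (c l)\<^sup>2)"
  have "(c 0)\<^sup>2 \<le> (\<Sum>l<d i. (c l)\<^sup>2)" by (rule member_le_sum) (use d_pos[of i] in auto)
  moreover have "(c 0)\<^sup>2 > 0" using y c0 by simp
  ultimately have S: "(\<Sum>l<d i. (c l)\<^sup>2) > 0" by linarith
  then have N: "N > 0" by (simp add: N_def)
  have g: "gcoef (d i) c k = c k / N" for k
    unfolding gcoef_def[OF facts] N_def using S by simp
  have s: "sample (coefs r y) i = (\<lambda>z. \<Sum>k<d i. (c k / N) * b i k z)"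
    unfolding sample_def c_def[symmetric] gpoly_def[OF facts] g ..
  have split: "{..<d i} = insert 0 {1..<d i}" using d_pos[of i] by auto
  show ?thesis
  proof (rule that[OF N])
    show "sample (coefs r y) i z = (y $ i * b i 0 z + (\<Sum>k\<in>{1..<d i}. r (i, k) * b i k z)) / N" for z
    proof -
      have "(\<Sum>k\<in>{1..<d i}. (c k / N) * b i k z) = (\<Sum>k\<in>{1..<d i}. r (i, k) * b i k z) / N"
        unfolding sum_divide_distrib by (rule sum.cong) (simp_all add: ck)
      then show ?thesis unfolding s split by (simp add: c0 add_divide_distrib)
    qed
    show "tgrad (\<Lambda> i) (sample (coefs r y) i) \<theta>
      = (1 / N) *\<^sub>R (y $ i *\<^sub>R tgrad (\<Lambda> i) (b i 0) \<theta> + (\<Sum>k\<in>{1..<d i}. r (i, k) *\<^sub>R tgrad (\<Lambda> i) (b i k) \<theta>))" for \<theta>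
    proof -
      have "(\<Sum>k\<in>{1..<d i}. (c k / N) *\<^sub>R tgrad (\<Lambda> i) (b i k) \<theta>)
          = (1 / N) *\<^sub>R (\<Sum>k\<in>{1..<d i}. r (i, k) *\<^sub>R tgrad (\<Lambda> i) (b i k) \<theta>)"
        unfolding scaleR_sum_right by (rule sum.cong) (simp_all add: ck)
      moreover have "tgrad (\<Lambda> i) (sample (coefs r y) i) \<theta> = (\<Sum>k<d i. (c k / N) *\<^sub>R tgrad (\<Lambda> i) (b i k) \<theta>)"
        unfolding s by (rule tgrad_comb[OF facts])
      ultimately show ?thesis unfolding split by (simp add: c0 scaleR_add_right)
    qed
  qed
qed

text \<open>Dividing by \<open>b i 0\<close> changes the gradient by a term proportional to the
  value of the polynomial, which is 0 at a zero; there the two gradients agree up to the factor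
  \<open>- (base_val i \<theta> / N)\<close>.\<close>

lemma sample_zero:
  assumes y: "y $ i \<noteq> 0" and \<theta>: "\<theta> \<in> base_pos"
  shows "sample (coefs r y) i (expt \<theta>) = 0 \<longleftrightarrow> fiber_map r \<theta> $ i = y $ i"
    and "fiber_map r \<theta> $ i = y $ i \<Longrightarrow> \<exists>c. c \<noteq> 0 \<and> tgrad (\<Lambda> i) (sample (coefs r y) i) \<theta> = c *s (fiber_jac r \<theta> $ i)"
proof -
  obtain N where N: "N > 0"
    and s: "\<And>z. sample (coefs r y) i z = (y $ i * b i 0 z + (\<Sum>k\<in>{1..<d i}. r (i, k) * b i k z)) / N"
    and t: "\<And>\<theta>. tgrad (\<Lambda> i) (sample (coefs r y) i) \<theta>
      = (1 / N) *\<^sub>R (y $ i *\<^sub>R tgrad (\<Lambda> i) (b i 0) \<theta> + (\<Sum>k\<in>{1..<d i}. r (i, k) *\<^sub>R tgrad (\<Lambda> i) (b i k) \<theta>))"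
    using sample_expand[OF y] by blast
  have p: "base_val i \<theta> > 0" using \<theta> by (simp add: base_pos_def)
  have G: "(\<Sum>k\<in>{1..<d i}. r (i, k) * b i k (expt \<theta>)) = - (base_val i \<theta> * fiber_map r \<theta> $ i)"
    unfolding fiber_map_def ratio_def vec_lambda_beta mult_minus_right minus_minus sum_distrib_left
    using p by (intro sum.cong) auto
  have "sample (coefs r y) i (expt \<theta>) = base_val i \<theta> * (y $ i - fiber_map r \<theta> $ i) / N"
    unfolding s G base_val_def[symmetric] by (simp add: right_diff_distrib mult.commute)
  then show "sample (coefs r y) i (expt \<theta>) = 0 \<longleftrightarrow> fiber_map r \<theta> $ i = y $ i"
    using p N by auto
  assume z: "fiber_map r \<theta> $ i = y $ i"
  have "tgrad (\<Lambda> i) (sample (coefs r y) i) \<theta> = (- (base_val i \<theta> / N)) *s (fiber_jac r \<theta> $ i)"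
  proof (rule vec_eq_iff[THEN iffD2], rule allI)
    fix j
    have "base_val i \<theta> * fiber_jac r \<theta> $ i $ j = - (\<Sum>k\<in>{1..<d i}. r (i, k) * tgrad (\<Lambda> i) (b i k) \<theta> $ j
        - (r (i, k) * b i k (expt \<theta>)) * (tgrad (\<Lambda> i) (b i 0) \<theta> $ j / base_val i \<theta>))"
      unfolding fiber_jac_def ratio_grad_def vec_lambda_beta mult_minus_right sum_distrib_left
      using p by (intro arg_cong[where f=uminus] sum.cong) (simp_all add: field_simps power2_eq_square)
    also have "\<dots> = - (\<Sum>k\<in>{1..<d i}. r (i, k) * tgrad (\<Lambda> i) (b i k) \<theta> $ j)
        + (\<Sum>k\<in>{1..<d i}. r (i, k) * b i k (expt \<theta>)) * (tgrad (\<Lambda> i) (b i 0) \<theta> $ j / base_val i \<theta>)"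
      by (simp only: sum_subtractf sum_distrib_right minus_diff_eq)
    also have "\<dots> = - (y $ i * tgrad (\<Lambda> i) (b i 0) \<theta> $ j + (\<Sum>k\<in>{1..<d i}. r (i, k) * tgrad (\<Lambda> i) (b i k) \<theta> $ j))"
      unfolding G z using p by simp
    finally have J: "y $ i * tgrad (\<Lambda> i) (b i 0) \<theta> $ j + (\<Sum>k\<in>{1..<d i}. r (i, k) * tgrad (\<Lambda> i) (b i k) \<theta> $ j)
        = - (base_val i \<theta> * fiber_jac r \<theta> $ i $ j)" by simp
    have "tgrad (\<Lambda> i) (sample (coefs r y) i) \<theta> $ j
        = (1 / N) * (y $ i * tgrad (\<Lambda> i) (b i 0) \<theta> $ j + (\<Sum>k\<in>{1..<d i}. r (i, k) * tgrad (\<Lambda> i) (b i k) \<theta> $ j))"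
      unfolding t by simp
    also have "\<dots> = ((- (base_val i \<theta> / N)) *s (fiber_jac r \<theta> $ i)) $ j" unfolding J by simp
    finally show "tgrad (\<Lambda> i) (sample (coefs r y) i) \<theta> $ j = ((- (base_val i \<theta> / N)) *s (fiber_jac r \<theta> $ i)) $ j" .
  qed
  then show "\<exists>c. c \<noteq> 0 \<and> tgrad (\<Lambda> i) (sample (coefs r y) i) \<theta> = c *s (fiber_jac r \<theta> $ i)"
    using p N by (intro exI[of _ "- (base_val i \<theta> / N)"]) auto
qed

text \<open>The rows of the two Jacobian matrices differ by nonzero factors, so the determinants
  vanish together.\<close>

lemma sample_zeros:
  assumes y: "\<And>i. y $ i \<noteq> 0" and \<theta>: "\<theta> \<in> base_pos"
  shows "(\<forall>i. sample (coefs r y) i (expt \<theta>) = 0) \<longleftrightarrow> fiber_map r \<theta> = y"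
    and "fiber_map r \<theta> = y \<Longrightarrow> det (Jac (sample (coefs r y)) \<theta>) = 0 \<longleftrightarrow> det (fiber_jac r \<theta>) = 0"
proof -
  show "(\<forall>i. sample (coefs r y) i (expt \<theta>) = 0) \<longleftrightarrow> fiber_map r \<theta> = y"
    unfolding sample_zero(1)[OF y \<theta>] vec_eq_iff ..
  assume "fiber_map r \<theta> = y"
  then have "\<forall>i. \<exists>c. c \<noteq> 0 \<and> tgrad (\<Lambda> i) (sample (coefs r y) i) \<theta> = c *s (fiber_jac r \<theta> $ i)"
    using sample_zero(2)[OF y \<theta>] by simp
  then obtain c where c: "\<And>i. c i \<noteq> 0" "\<And>i. tgrad (\<Lambda> i) (sample (coefs r y) i) \<theta> = c i *s (fiber_jac r \<theta> $ i)"
    by metis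
  have "Jac (sample (coefs r y)) \<theta> = (\<chi> i. c i *s (fiber_jac r \<theta> $ i))"
    unfolding Jac_def c(2) by (simp only: vec_lambda_eta)
  also have "det \<dots> = prod c UNIV * det (\<chi> i. fiber_jac r \<theta> $ i)" by (rule det_rows_mul)
  also have "(\<chi> i. fiber_jac r \<theta> $ i) = fiber_jac r \<theta>" by (rule vec_lambda_eta)
  finally show "det (Jac (sample (coefs r y)) \<theta>) = 0 \<longleftrightarrow> det (fiber_jac r \<theta>) = 0" using c(1) by simp
qed

lemma AE_lborel_not_negligible:
  assumes "negligible S"
  shows "AE y in lborel. y \<notin> S"
proof -
  have "AE y in lebesgue. y \<notin> S"
    using assms unfolding negligible_iff_null_sets by (rule AE_not_in)
  then show ?thesis by (simp add: AE_completion_iff)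
qed

lemma AE_components_nonzero: "AE y in lborel. \<forall>i. (y :: real ^ 'n) $ i \<noteq> 0"
proof -
  have "AE y in lborel. (y :: real ^ 'n) \<notin> {x. x $ i = 0}" for i
    by (rule AE_lborel_not_negligible[OF negligible_standard_hyperplane_cart])
  then show ?thesis by (simp add: AE_all_countable)
qed

lemma \<gamma>_nonneg: "\<gamma> y \<ge> 0" and \<gamma>_le: "\<gamma> y \<le> 1" and \<gamma>_0: "\<gamma> 0 = (1 / sqrt (2 * pi)) ^ CARD('n)"
  and continuous_\<gamma>: "continuous_on S \<gamma>"
proof -
  have le1: "std_normal_density x \<le> 1" for x
  proof -
    have "1 / sqrt (2 * pi) \<le> 1" using pi_ge_two by simp
    moreover have "exp (- x\<^sup>2 / 2) \<le> 1" by simp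
    ultimately have "1 / sqrt (2 * pi) * exp (- x\<^sup>2 / 2) \<le> 1 * 1" by (intro mult_mono) auto
    then show ?thesis by (simp add: std_normal_density_def)
  qed
  show "\<gamma> y \<ge> 0" by (simp add: \<gamma>_def prod_nonneg)
  show "\<gamma> y \<le> 1" unfolding \<gamma>_def by (intro prod_le_1) (simp add: le1)
  show "\<gamma> 0 = (1 / sqrt (2 * pi)) ^ CARD('n)" by (simp add: \<gamma>_def std_normal_density_def)
  show "continuous_on S \<gamma>" unfolding \<gamma>_def[abs_def] std_normal_density_def by (intro continuous_intros) auto
qed

lemma measurable_\<gamma>: "\<gamma> \<in> borel_measurable borel"
  by (intro borel_measurable_continuous_onI continuous_\<gamma>)

text \<open>The total mass of the sample space, computed through the split of the coefficients,
  shows that \<open>\<gamma>\<close> has integral 1.\<close>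

lemma integrable_\<gamma>: "integrable lborel \<gamma>"
proof (rule integrableI_nonneg)
  show "\<gamma> \<in> borel_measurable lborel" unfolding measurable_lborel2 by (rule measurable_\<gamma>)
  have "(\<integral>\<^sup>+ s. 1 \<partial>sphere_prod) = (\<integral>\<^sup>+ r. (\<integral>\<^sup>+ y. ennreal (\<gamma> y) * 1 \<partial>lborel) \<partial>gauss rest_index)"
    by (rule nn_integral_sphere_prod) simp
  then have "(\<integral>\<^sup>+ y. ennreal (\<gamma> y) \<partial>lborel) = 1"
    using prob_space.emeasure_space_1[OF prob_space_gauss[of rest_index]] by (simp add: sphere_prod.emeasure_space_1)
  then show "(\<integral>\<^sup>+ y. ennreal (\<gamma> y) \<partial>lborel) < \<infinity>" by simp
qed (simp add: \<gamma>_nonneg)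

text \<open>For fixed \<open>r\<close> this is the area formula for \<open>fiber_map r\<close> with
  weight \<open>\<gamma>\<close>; the match of zeros and preimages can fail only if some
  \<open>y $ i\<close> is 0, which is a null set.\<close>

lemma nn_integral_zero_count:
  assumes B: "\<And>l::nat. compact (C l)" "B = (\<Union>l. C l)" "B \<subseteq> base_pos"
  shows "(\<integral>\<^sup>+ s. zero_count B s \<partial>sphere_prod) = (\<integral>\<^sup>+ r. (\<integral>\<^sup>+ \<theta>\<in>B. ennreal (\<bar>det (fiber_jac r \<theta>)\<bar> * \<gamma> (fiber_map r \<theta>)) \<partial>lborel) \<partial>gauss rest_index)"
  unfolding nn_integral_sphere_prod[OF measurable_zero_count[OF B(1,2)]]
proof (rule nn_integral_cong)
  fix r
  have "(\<integral>\<^sup>+ y. ennreal (\<gamma> y) * zero_count B (sample (coefs r y)) \<partial>lborel)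
      = (\<integral>\<^sup>+ y. ennreal (\<gamma> y) * emeasure (count_space UNIV) {x \<in> B. fiber_map r x = y \<and> det (fiber_jac r x) \<noteq> 0} \<partial>lborel)"
  proof (rule nn_integral_cong_AE)
    show "AE y in lborel. ennreal (\<gamma> y) * zero_count B (sample (coefs r y))
        = ennreal (\<gamma> y) * emeasure (count_space UNIV) {x \<in> B. fiber_map r x = y \<and> det (fiber_jac r x) \<noteq> 0}"
      using AE_components_nonzero
    proof eventually_elim
      fix y :: "real ^ 'n" assume "\<forall>i. y $ i \<noteq> 0"
      then have y: "\<And>i. y $ i \<noteq> 0" by blast
      have "regular_zeros B (sample (coefs r y)) = {x \<in> B. fiber_map r x = y \<and> det (fiber_jac r x) \<noteq> 0}"
        unfolding regular_zeros_def using B(3) sample_zeros[OF y] by (intro Collect_cong) blast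
      then show "ennreal (\<gamma> y) * zero_count B (sample (coefs r y))
        = ennreal (\<gamma> y) * emeasure (count_space UNIV) {x \<in> B. fiber_map r x = y \<and> det (fiber_jac r x) \<noteq> 0}"
        by (simp only: zero_count_def)
    qed
  qed
  also have "\<dots> = (\<integral>\<^sup>+ \<theta>\<in>B. ennreal (\<bar>det (fiber_jac r \<theta>)\<bar> * \<gamma> (fiber_map r \<theta>)) \<partial>lborel)"
    by (rule nn_integral_card_preimage[OF open_base_pos fiber_map_derivative continuous_fiber_jac B integrable_\<gamma> \<gamma>_nonneg continuous_\<gamma>])
  finally show "(\<integral>\<^sup>+ y. ennreal (\<gamma> y) * zero_count B (sample (coefs r y)) \<partial>lborel)
      = (\<integral>\<^sup>+ \<theta>\<in>B. ennreal (\<bar>det (fiber_jac r \<theta>)\<bar> * \<gamma> (fiber_map r \<theta>)) \<partial>lborel)" .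
qed

text \<open>A degenerate zero makes \<open>y\<close> a critical value of \<open>fiber_map r\<close>,
  and critical values form a null set.\<close>

lemma AE_no_degenerate_zeros:
  assumes B: "\<And>l::nat. compact (C l)" "B = (\<Union>l. C l)" "B \<subseteq> base_pos"
  shows "AE s in sphere_prod. degenerate_zeros B s = {}"
proof -
  define Z where "Z = {s \<in> space sphere_prod. degenerate_zeros B s \<noteq> {}}"
  have Z: "Z \<in> sets sphere_prod" unfolding Z_def by (rule measurable_degenerate_zeros[OF B(1,2)])
  have "emeasure sphere_prod Z = (\<integral>\<^sup>+ s. indicator Z s \<partial>sphere_prod)" using Z by simp
  also have "\<dots> = (\<integral>\<^sup>+ r. (\<integral>\<^sup>+ y. ennreal (\<gamma> y) * indicator Z (sample (coefs r y)) \<partial>lborel) \<partial>gauss rest_index)"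
    by (rule nn_integral_sphere_prod) (use Z in simp)
  also have "\<dots> = (\<integral>\<^sup>+ r. 0 \<partial>gauss rest_index)"
  proof (rule nn_integral_cong)
    fix r
    define S where "S = {x \<in> B. det (fiber_jac r x) = 0}"
    have "negligible (fiber_map r ` S)"
    proof (rule negligible_critical_values)
      fix x assume "x \<in> S"
      then show "det (fiber_jac r x) = 0" by (simp add: S_def)
      have "x \<in> base_pos" using \<open>x \<in> S\<close> B(3) by (auto simp: S_def)
      from fiber_map_derivative[OF this]
      show "(fiber_map r has_derivative (\<lambda>h. fiber_jac r x *v h)) (at x within S)" by (rule has_derivative_at_withinI)
    qed
    from AE_lborel_not_negligible[OF this] AE_components_nonzero
    have "AE y in lborel. ennreal (\<gamma> y) * indicator Z (sample (coefs r y)) = 0"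
    proof eventually_elim
      fix y assume n: "y \<notin> fiber_map r ` S" and "\<forall>i. y $ i \<noteq> 0"
      then have y: "\<And>i. y $ i \<noteq> 0" by blast
      have "degenerate_zeros B (sample (coefs r y)) = {}"
      proof -
        have False if "x \<in> B" "\<forall>i. sample (coefs r y) i (expt x) = 0" "det (Jac (sample (coefs r y)) x) = 0" for x
        proof -
          have x: "x \<in> base_pos" using that(1) B(3) by blast
          have G: "fiber_map r x = y" using sample_zeros(1)[OF y x] that(2) by (rule iffD1)
          then have "x \<in> S" using sample_zeros(2)[OF y x G] that by (simp add: S_def)
          then show False using n G by blast
        qed
        then show ?thesis unfolding degenerate_zeros_def by blast
      qed
      then show "ennreal (\<gamma> y) * indicator Z (sample (coefs r y)) = 0" by (simp add: Z_def)
    qed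
    then have "(\<integral>\<^sup>+ y. ennreal (\<gamma> y) * indicator Z (sample (coefs r y)) \<partial>lborel) = (\<integral>\<^sup>+ y. 0 \<partial>(lborel :: (real ^ 'n) measure))"
      by (rule nn_integral_cong_AE)
    then show "(\<integral>\<^sup>+ y. ennreal (\<gamma> y) * indicator Z (sample (coefs r y)) \<partial>lborel) = 0" by simp
  qed
  finally have "Z \<in> null_sets sphere_prod" using Z by (simp add: null_setsI)
  then have "AE s in sphere_prod. s \<notin> Z" by (rule AE_not_in)
  with AE_space show ?thesis by eventually_elim (simp add: Z_def)
qed

end

section \<open>The density of zeros\<close>

lemma sum_le_prod_1_add:
  fixes a :: "'i \<Rightarrow> real"
  assumes "finite I" "\<And>i. i \<in> I \<Longrightarrow> a i \<ge> 0"
  shows "1 + (\<Sum>i\<in>I. a i) \<le> (\<Prod>i\<in>I. 1 + a i)"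
  using assms
proof (induction I rule: finite_induct)
  case (insert x F)
  have "1 \<le> (\<Prod>i\<in>F. 1 + a i)" using insert.prems by (intro prod_ge_1) auto
  then have "a x * 1 \<le> a x * (\<Prod>i\<in>F. 1 + a i)" using insert.prems by (intro mult_left_mono) auto
  moreover have "1 + (\<Sum>i\<in>F. a i) \<le> (\<Prod>i\<in>F. 1 + a i)" using insert by auto
  ultimately show ?case using insert.hyps by (simp add: algebra_simps)
qed simp

lemma nn_integral_scaleR:
  fixes f :: "real ^ 'n::finite \<Rightarrow> ennreal"
  assumes c: "c > 0" and f: "f \<in> borel_measurable borel"
  shows "(\<integral>\<^sup>+ x. f x \<partial>lborel) = ennreal (c ^ CARD('n)) * (\<integral>\<^sup>+ x. f (c *\<^sub>R x) \<partial>lborel)"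
proof -
  have m: "(\<lambda>x :: real ^ 'n. 0 + c *\<^sub>R x) \<in> measurable lborel borel" by simp
  have "(\<integral>\<^sup>+ x. f x \<partial>lborel) = (\<integral>\<^sup>+ x. f x \<partial>density (distr lborel borel (\<lambda>x :: real ^ 'n. 0 + c *\<^sub>R x)) (\<lambda>_. ennreal (\<bar>c\<bar>^DIM(real ^ 'n))))"
    using lborel_affine[of c "0 :: real ^ 'n"] c by simp
  also have "\<dots> = (\<integral>\<^sup>+ x. ennreal (\<bar>c\<bar>^DIM(real ^ 'n)) * f x \<partial>distr lborel borel (\<lambda>x :: real ^ 'n. 0 + c *\<^sub>R x))"
    by (rule nn_integral_density) (use f in simp_all)
  also have "\<dots> = (\<integral>\<^sup>+ x. ennreal (\<bar>c\<bar>^DIM(real ^ 'n)) * f (0 + c *\<^sub>R x) \<partial>lborel)"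
    by (rule nn_integral_distr[OF m]) (use f in simp)
  also have "\<dots> = ennreal (c ^ CARD('n)) * (\<integral>\<^sup>+ x. f (c *\<^sub>R x) \<partial>lborel)"
    using c f by (subst nn_integral_cmult) (auto intro!: measurable_compose[OF _ f])
  finally show ?thesis .
qed

section \<open>Tilings by half-open boxes\<close>

definition origin_box :: "real \<Rightarrow> (real ^ 'n::finite) set" where
  "origin_box c = {\<theta>. \<forall>j. 0 \<le> \<theta> $ j \<and> \<theta> $ j < c}"

lemma origin_box_compact_union: "\<exists>C :: nat \<Rightarrow> (real ^ 'n::finite) set. (\<forall>l. compact (C l)) \<and> origin_box c = (\<Union>l. C l)"
proof -
  have "origin_box c = {x :: real ^ 'n. \<forall>j. (0 :: real ^ 'n) $ j \<le> x $ j \<and> x $ j < (\<chi> j. c) $ j}"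
    by (simp add: origin_box_def)
  also have "\<dots> = (\<Union>l::nat. cbox 0 (\<chi> j. (\<chi> j. c) $ j - 1 / real (Suc l)))"
    by (rule halfopen_box_compact_union)
  finally show ?thesis by (metis compact_cbox)
qed

lemma sets_origin_box: "(origin_box c :: (real ^ 'n::finite) set) \<in> sets borel"
proof -
  obtain C :: "nat \<Rightarrow> (real ^ 'n) set" where C: "\<forall>l. compact (C l)" "origin_box c = (\<Union>l. C l)"
    using origin_box_compact_union by blast
  show ?thesis unfolding C(2) by (rule sets.countable_UN) (use C(1) in \<open>auto intro: borel_closed compact_imp_closed\<close>)
qed

text \<open>Squeezed between the open and the closed box.\<close>

lemma emeasure_origin_box:
  assumes "c > 0"
  shows "emeasure lborel (origin_box c :: (real ^ 'n::finite) set) = ennreal (c ^ CARD('n))"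
proof -
  have dim: "(\<Prod>e\<in>(Basis :: (real ^ 'n) set). ((\<chi> j. c) - 0) \<bullet> e) = c ^ CARD('n)"
    using prod_Basis_cart[of "\<lambda>x. x" "(\<chi> j. c) - 0 :: real ^ 'n"] by simp
  have le: "(0 :: real ^ 'n) \<bullet> e \<le> (\<chi> j. c) \<bullet> e" if "e \<in> Basis" for e :: "real ^ 'n"
    using that assms by (auto simp: Basis_vec_def inner_axis)
  have "emeasure lborel (box 0 (\<chi> j. c) :: (real ^ 'n) set) = ennreal (c ^ CARD('n))"
    using le dim by (subst emeasure_lborel_box) auto
  moreover have "emeasure lborel (cbox 0 (\<chi> j. c) :: (real ^ 'n) set) = ennreal (c ^ CARD('n))"
    using le dim by (subst emeasure_lborel_cbox) auto
  moreover have "emeasure lborel (box 0 (\<chi> j. c) :: (real ^ 'n) set) \<le> emeasure lborel (origin_box c :: (real ^ 'n) set)"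
    by (rule emeasure_mono) (use sets_origin_box in \<open>auto simp: origin_box_def mem_box_cart less_imp_le\<close>)
  moreover have "emeasure lborel (origin_box c :: (real ^ 'n) set) \<le> emeasure lborel (cbox 0 (\<chi> j. c) :: (real ^ 'n) set)"
    by (rule emeasure_mono) (auto simp: origin_box_def mem_box_cart less_imp_le)
  ultimately show ?thesis by simp
qed

definition box_shift :: "real \<Rightarrow> ('n \<Rightarrow> nat) \<Rightarrow> real ^ 'n::finite" where
  "box_shift c m = (\<chi> j. c * real (m j))"

lemma translate_origin_box: "x \<in> (+) (box_shift c m) ` origin_box c \<longleftrightarrow> (\<forall>j. c * real (m j) \<le> x $ j \<and> x $ j < c * real (m j) + c)"
proof -
  have "x \<in> (+) (box_shift c m) ` origin_box c \<longleftrightarrow> x - box_shift c m \<in> origin_box c"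
  proof
    show "x - box_shift c m \<in> origin_box c" if "x \<in> (+) (box_shift c m) ` origin_box c" using that by auto
    show "x \<in> (+) (box_shift c m) ` origin_box c" if "x - box_shift c m \<in> origin_box c"
      by (rule image_eqI[OF _ that]) simp
  qed
  then show ?thesis by (simp add: origin_box_def box_shift_def le_diff_eq diff_less_eq add.commute)
qed

text \<open>The tile of \<open>x\<close> is found by rounding \<open>x $ j / c\<close> down;
  half-open boxes leave neither gaps nor overlaps.\<close>

lemma origin_box_tiling:
  fixes c :: real
  assumes c: "c > 0"
  shows "(origin_box (real M * c) :: (real ^ 'n::finite) set) = (\<Union>m\<in>PiE UNIV (\<lambda>_. {..<M}). (+) (box_shift c m) ` origin_box c)" (is "?L = ?R")
    and "disjoint_family_on (\<lambda>m. (+) (box_shift c m) ` (origin_box c :: (real ^ 'n) set)) A"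
proof -
  have fl: "c * of_int \<lfloor>t / c\<rfloor> \<le> t" "t < c * of_int \<lfloor>t / c\<rfloor> + c" for t
  proof -
    have "of_int \<lfloor>t / c\<rfloor> * c \<le> (t / c) * c" "(t / c) * c < (of_int \<lfloor>t / c\<rfloor> + 1) * c"
      using c by (intro mult_right_mono mult_strict_right_mono; linarith)+
    then show "c * of_int \<lfloor>t / c\<rfloor> \<le> t" "t < c * of_int \<lfloor>t / c\<rfloor> + c"
      using c by (simp_all add: algebra_simps)
  qed
  show "?L = ?R"
  proof (intro set_eqI iffI)
    fix x :: "real ^ 'n" assume x: "x \<in> ?L"
    define m where "m j = nat \<lfloor>x $ j / c\<rfloor>" for j
    have m: "real (m j) = of_int \<lfloor>x $ j / c\<rfloor>" and mM: "m j < M" for j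
    proof -
      have "0 \<le> x $ j / c" "x $ j / c < real M"
        using x c by (auto simp: origin_box_def divide_less_eq)
      then have f: "0 \<le> \<lfloor>x $ j / c\<rfloor>" "\<lfloor>x $ j / c\<rfloor> < int M" by (simp_all add: floor_less_iff)
      then show "real (m j) = of_int \<lfloor>x $ j / c\<rfloor>" "m j < M" unfolding m_def by linarith+
    qed
    have "x \<in> (+) (box_shift c m) ` origin_box c" unfolding translate_origin_box m using fl by blast
    moreover have "m \<in> PiE UNIV (\<lambda>_. {..<M})" using mM by auto
    ultimately show "x \<in> ?R" by blast
  next
    fix x :: "real ^ 'n" assume "x \<in> ?R"
    then obtain m where m: "\<And>j. m j < M" "x \<in> (+) (box_shift c m) ` origin_box c" by (auto simp: PiE_iff)
    show "x \<in> ?L"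
      unfolding origin_box_def
    proof (intro CollectI allI)
      fix j
      have "c * real (m j) + c \<le> real M * c"
      proof -
        have "real (m j) + 1 \<le> real M" using m(1)[of j] by linarith
        then have "c * (real (m j) + 1) \<le> c * real M" using c by (intro mult_left_mono) auto
        then show ?thesis by (simp add: algebra_simps)
      qed
      moreover have "0 \<le> c * real (m j)" using c by simp
      moreover have "c * real (m j) \<le> x $ j" "x $ j < c * real (m j) + c" using m(2) unfolding translate_origin_box by auto
      ultimately show "0 \<le> x $ j \<and> x $ j < real M * c" by linarith
    qed
  qed
  show "disjoint_family_on (\<lambda>m. (+) (box_shift c m) ` (origin_box c :: (real ^ 'n) set)) A"
    unfolding disjoint_family_on_def
  proof (intro ballI impI)
    fix m m' :: "'n \<Rightarrow> nat" assume "m \<noteq> m'"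
    then obtain j where j: "m j \<noteq> m' j" by blast
    have ub: "real (k :: nat) < real l + 1" if "c * real k \<le> t" "t < c * real l + c" for t k l
    proof -
      have "c * real k < c * (real l + 1)" using that by (simp add: algebra_simps)
      then show ?thesis using c by simp
    qed
    show "(+) (box_shift c m) ` origin_box c \<inter> (+) (box_shift c m') ` origin_box c = ({} :: (real ^ 'n) set)"
    proof (rule ccontr)
      assume "(+) (box_shift c m) ` origin_box c \<inter> (+) (box_shift c m') ` origin_box c \<noteq> ({} :: (real ^ 'n) set)"
      then obtain x where x: "x \<in> (+) (box_shift c m) ` origin_box c" "x \<in> (+) (box_shift c m') ` origin_box c" by blast
      have "real (m j) < real (m' j) + 1" "real (m' j) < real (m j) + 1"
        using x unfolding translate_origin_box by (auto intro: ub)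
      then show False using j by linarith
    qed
  qed
qed

section \<open>Localization at the identity\<close>

context trig_system
begin

lemma base_val_0: "base_val i 0 = sqrt (real (card (\<Lambda> i)))"
  unfolding base_val_def by (rule onb_at_0(1)[OF fin ne sym onb b0])

lemma card_pos: "real (card (\<Lambda> i)) > 0"
  using fin ne by (simp add: card_gt_0_iff)

lemma zero_in_base_pos: "0 \<in> base_pos"
  using card_pos by (simp add: base_pos_def base_val_0)

text \<open>The density in the angles, near the identity, of the expected number of zeros for fixed
  \<open>r\<close>.\<close>

definition \<Phi> :: "('n \<times> nat \<Rightarrow> real) \<Rightarrow> real ^ 'n \<Rightarrow> real" where
  "\<Phi> r \<theta> = \<bar>det (fiber_jac r \<theta>)\<bar> * \<gamma> (fiber_map r \<theta>)"

lemma measurable_r: "(i, k) \<in> rest_index \<Longrightarrow> (\<lambda>x. fst x (i, k)) \<in> borel_measurable (gauss rest_index \<Otimes>\<^sub>M borel)"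
  by (rule measurable_compose[OF measurable_fst measurable_gauss_component])

lemma measurable_\<Phi>: "(\<lambda>x. \<Phi> (fst x) (snd x)) \<in> borel_measurable (gauss rest_index \<Otimes>\<^sub>M borel)"
proof -
  have rm: "(\<lambda>x. fst x (i, k)) \<in> borel_measurable (gauss rest_index \<Otimes>\<^sub>M (borel :: (real ^ 'n) measure))" if "k \<in> {1..<d i}" for i k
    by (rule measurable_r) (use that in \<open>simp add: rest_index_def\<close>)
  have J: "(\<lambda>x. fiber_jac (fst x) (snd x) $ i $ j) \<in> borel_measurable (gauss rest_index \<Otimes>\<^sub>M (borel :: (real ^ 'n) measure))" for i j
    unfolding fiber_jac_def vec_lambda_beta
    by (intro borel_measurable_uminus borel_measurable_sum borel_measurable_times rm
        measurable_compose[OF measurable_snd measurable_ratio_grad]) auto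
  have G: "(\<lambda>x. fiber_map (fst x) (snd x) $ i) \<in> borel_measurable (gauss rest_index \<Otimes>\<^sub>M (borel :: (real ^ 'n) measure))" for i
    unfolding fiber_map_def vec_lambda_beta
    by (intro borel_measurable_uminus borel_measurable_sum borel_measurable_times rm
        measurable_compose[OF measurable_snd measurable_ratio]) auto
  have n: "std_normal_density \<in> borel_measurable borel" by simp
  show ?thesis
    unfolding \<Phi>_def \<gamma>_def det_def
    by (intro borel_measurable_times borel_measurable_abs borel_measurable_sum borel_measurable_const
        borel_measurable_prod J measurable_compose[OF G n])
qed

lemma measurable_\<Phi>_scaled:
  "(\<lambda>x. ennreal (\<Phi> (fst x) (a *\<^sub>R snd x)) * indicator (origin_box c) (snd x)) \<in> borel_measurable (gauss rest_index \<Otimes>\<^sub>M lborel)"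
proof -
  have "(\<lambda>x. (fst x, a *\<^sub>R snd x)) \<in> measurable (gauss rest_index \<Otimes>\<^sub>M (borel :: (real ^ 'n) measure)) (gauss rest_index \<Otimes>\<^sub>M borel)"
    by (intro measurable_Pair measurable_fst borel_measurable_scaleR borel_measurable_const measurable_snd)
  from measurable_compose[OF this measurable_\<Phi>]
  have \<Phi>: "(\<lambda>x. \<Phi> (fst x) (a *\<^sub>R snd x)) \<in> borel_measurable (gauss rest_index \<Otimes>\<^sub>M (borel :: (real ^ 'n) measure))"
    by (simp only: fst_conv snd_conv)
  have "(\<lambda>x. ennreal (\<Phi> (fst x) (a *\<^sub>R snd x)) * indicator (origin_box c) (snd x)) \<in> borel_measurable (gauss rest_index \<Otimes>\<^sub>M (borel :: (real ^ 'n) measure))"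
    by (intro borel_measurable_times_ennreal measurable_compose[OF \<Phi> measurable_ennreal]
        measurable_compose[OF measurable_snd borel_measurable_indicator[OF sets_origin_box]])
  then show ?thesis
    by (subst measurable_cong_sets[OF sets_pair_measure_cong[OF refl sets_lborel] refl])
qed

lemma continuous_\<Phi>: "continuous_on base_pos (\<Phi> r)"
proof -
  have "continuous_on base_pos (\<lambda>\<theta>. det (fiber_jac r \<theta>))"
    unfolding det_def
    by (intro continuous_on_sum continuous_on_mult continuous_on_const continuous_on_prod continuous_fiber_jac)
  moreover have "continuous_on base_pos (fiber_map r)"
    by (meson fiber_map_derivative continuous_at_imp_continuous_on has_derivative_continuous)
  ultimately show ?thesis
    unfolding \<Phi>_def[abs_def] by (intro continuous_intros continuous_on_compose2[OF continuous_\<gamma>[of UNIV]]) auto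
qed

text \<open>An integrable majorant; the product form lets its expectation factor over the
  independent coordinates.\<close>

definition growth :: "('n \<times> nat \<Rightarrow> real) \<Rightarrow> real" where "growth r = (\<Prod>q\<in>rest_index. 1 + \<bar>r q\<bar>)"

lemma nn_integral_growth: "(\<integral>\<^sup>+ r. ennreal (growth r) \<partial>gauss rest_index) < \<infinity>"
proof -
  have i: "integrable stdn (\<lambda>t. 2 + t\<^sup>2)"
    using integrable_stdn_square by simp
  have "(\<integral>\<^sup>+ t. ennreal (1 + \<bar>t\<bar>) \<partial>stdn) \<le> (\<integral>\<^sup>+ t. ennreal (2 + t\<^sup>2) \<partial>stdn)"
  proof (intro nn_integral_mono ennreal_leI)
    fix t :: real
    have "0 \<le> (\<bar>t\<bar> - 1) * (\<bar>t\<bar> - 1)" by simp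
    then have "2 * \<bar>t\<bar> \<le> 1 + t\<^sup>2" by (simp add: algebra_simps power2_eq_square)
    then show "1 + \<bar>t\<bar> \<le> 2 + t\<^sup>2" using zero_le_power2[of t] by linarith
  qed
  also have "\<dots> < \<infinity>" using i by (subst nn_integral_eq_integral) auto
  finally have f: "(\<integral>\<^sup>+ t. ennreal (1 + \<bar>t\<bar>) \<partial>stdn) < \<infinity>" .
  have "(\<integral>\<^sup>+ r. ennreal (growth r) \<partial>gauss rest_index) = (\<integral>\<^sup>+ r. (\<Prod>q\<in>rest_index. ennreal (1 + \<bar>r q\<bar>)) \<partial>gauss rest_index)"
    unfolding growth_def by (intro nn_integral_cong prod_ennreal[symmetric]) simp
  also have "\<dots> = (\<Prod>q\<in>rest_index. \<integral>\<^sup>+ t. ennreal (1 + \<bar>t\<bar>) \<partial>stdn)"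
    unfolding gauss_def
  proof (rule stdn_prod.product_nn_integral_prod[OF index_split(2)])
    show "(\<lambda>t. ennreal (1 + \<bar>t\<bar>)) \<in> borel_measurable stdn"
      unfolding measurable_cong_sets[OF sets_stdn refl] by measurable
  qed
  also have "\<dots> < \<infinity>" using f by (simp add: power_less_top_ennreal)
  finally show ?thesis .
qed

lemma measurable_growth: "growth \<in> borel_measurable (gauss rest_index)"
  unfolding growth_def[abs_def]
  by (intro borel_measurable_prod borel_measurable_add borel_measurable_const borel_measurable_abs measurable_gauss_component)

text \<open>Row \<open>i\<close> of \<open>fiber_jac\<close> is linear in the coefficients
  \<open>r (i, k)\<close>, and a term of the Leibniz formula contains one entry from each row. So
  the determinant is bounded by a multiple of the product of the row bounds, and
  \<open>\<gamma>\<close> by 1.\<close>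

lemma \<Phi>_bound:
  assumes K: "compact K" "K \<subseteq> base_pos"
  shows "\<exists>C\<ge>0. \<forall>r. \<forall>\<theta>\<in>K. \<Phi> r \<theta> \<le> C * growth r"
proof -
  \<comment> \<open>One continuous function that dominates all entries
    \<open>ratio_grad i k \<theta> $ j\<close>, so that compactness of \<open>K\<close> bounds them
    together.\<close>
  define S where "S \<theta> = (\<Sum>i\<in>UNIV. \<Sum>k<d i. \<Sum>j\<in>UNIV. \<bar>ratio_grad i k \<theta> $ j\<bar>)" for \<theta>
  have "continuous_on K S"
    unfolding S_def[abs_def]
    by (intro continuous_on_sum continuous_on_rabs continuous_on_subset[OF continuous_ratio_grad K(2)]) auto
  then have "compact (S ` K)" using K(1) by (rule compact_continuous_image)
  then have "bounded (S ` K)" by (rule compact_imp_bounded)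
  then obtain C where C: "C > 0" "\<And>\<theta>. \<theta> \<in> K \<Longrightarrow> norm (S \<theta>) \<le> C" by (auto simp: bounded_pos)
  have ratio_grad: "\<bar>ratio_grad i k \<theta> $ j\<bar> \<le> C" if "\<theta> \<in> K" "k < d i" for \<theta> i k j
  proof -
    have "\<bar>ratio_grad i k \<theta> $ j\<bar> \<le> (\<Sum>j\<in>UNIV. \<bar>ratio_grad i k \<theta> $ j\<bar>)"
      by (rule member_le_sum) auto
    also have "\<dots> \<le> (\<Sum>k<d i. \<Sum>j\<in>UNIV. \<bar>ratio_grad i k \<theta> $ j\<bar>)"
      by (rule member_le_sum[of k _ "\<lambda>k. \<Sum>j\<in>UNIV. \<bar>ratio_grad i k \<theta> $ j\<bar>"]) (use that in \<open>auto intro: sum_nonneg\<close>)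
    also have "\<dots> \<le> S \<theta>"
      unfolding S_def by (rule member_le_sum[of i _ "\<lambda>i. \<Sum>k<d i. \<Sum>j\<in>UNIV. \<bar>ratio_grad i k \<theta> $ j\<bar>"]) (auto intro: sum_nonneg)
    also have "\<dots> \<le> C" using C(2)[OF that(1)] by simp
    finally show ?thesis .
  qed
  define w where "w r i = (\<Prod>k\<in>{1..<d i}. 1 + \<bar>r (i, k)\<bar>)" for r :: "'n \<times> nat \<Rightarrow> real" and i
  have J: "\<bar>fiber_jac r \<theta> $ i $ j\<bar> \<le> C * w r i" if "\<theta> \<in> K" for r \<theta> i j
  proof -
    have "\<bar>fiber_jac r \<theta> $ i $ j\<bar> \<le> (\<Sum>k\<in>{1..<d i}. \<bar>r (i, k) * ratio_grad i k \<theta> $ j\<bar>)"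
      unfolding fiber_jac_def vec_lambda_beta abs_minus_cancel by (rule sum_abs)
    also have "\<dots> \<le> (\<Sum>k\<in>{1..<d i}. \<bar>r (i, k)\<bar> * C)"
      unfolding abs_mult by (intro sum_mono mult_left_mono ratio_grad that) auto
    also have "\<dots> = C * (\<Sum>k\<in>{1..<d i}. \<bar>r (i, k)\<bar>)" by (simp add: sum_distrib_left mult.commute)
    also have "\<dots> \<le> C * w r i"
      using sum_le_prod_1_add[of "{1..<d i}" "\<lambda>k. \<bar>r (i, k)\<bar>"] C(1) by (intro mult_left_mono) (auto simp: w_def)
    finally show ?thesis .
  qed
  have Ww: "(\<Prod>i\<in>UNIV. w r i) = growth r" for r
    unfolding w_def growth_def rest_index_def by (subst prod.Sigma) auto
  define C' where "C' = real (card {\<pi>. \<pi> permutes (UNIV :: 'n set)}) * C ^ CARD('n)"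
  have "\<Phi> r \<theta> \<le> C' * growth r" if "\<theta> \<in> K" for r \<theta>
  proof -
    have "\<bar>det (fiber_jac r \<theta>)\<bar> \<le> (\<Sum>\<pi> | \<pi> permutes UNIV. \<bar>of_int (sign \<pi>) * (\<Prod>i\<in>UNIV. fiber_jac r \<theta> $ i $ \<pi> i)\<bar>)"
      unfolding det_def by (rule sum_abs)
    also have "\<dots> \<le> (\<Sum>\<pi> | \<pi> permutes (UNIV :: 'n set). \<Prod>i\<in>UNIV. C * w r i)"
    proof (rule sum_mono)
      fix \<pi> :: "'n \<Rightarrow> 'n"
      have "\<bar>of_int (sign \<pi>) :: real\<bar> = 1" by (simp add: sign_def)
      then have "\<bar>of_int (sign \<pi>) * (\<Prod>i\<in>UNIV. fiber_jac r \<theta> $ i $ \<pi> i)\<bar> = (\<Prod>i\<in>UNIV. \<bar>fiber_jac r \<theta> $ i $ \<pi> i\<bar>)"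
        by (simp add: abs_mult abs_prod)
      also have "\<dots> \<le> (\<Prod>i\<in>UNIV. C * w r i)" by (intro prod_mono conjI J that) auto
      finally show "\<bar>of_int (sign \<pi>) * (\<Prod>i\<in>UNIV. fiber_jac r \<theta> $ i $ \<pi> i)\<bar> \<le> (\<Prod>i\<in>UNIV. C * w r i)" .
    qed
    also have "\<dots> = C' * growth r" by (simp add: prod.distrib C'_def Ww)
    finally have "\<bar>det (fiber_jac r \<theta>)\<bar> * \<gamma> (fiber_map r \<theta>) \<le> (C' * growth r) * 1"
      by (intro mult_mono \<gamma>_le) (auto simp: \<gamma>_nonneg)
    then show ?thesis by (simp add: \<Phi>_def)
  qed
  then show ?thesis using C(1) by (intro exI[of _ C']) (auto simp: C'_def)
qed

lemma zero_count_partition: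
  assumes "c > 0"
  shows "zero_count (origin_box (real M * c)) s = (\<Sum>m\<in>PiE UNIV (\<lambda>_. {..<M}). zero_count ((+) (box_shift c m) ` origin_box c) s)"
proof -
  have "regular_zeros (origin_box (real M * c)) s = (\<Union>m\<in>PiE UNIV (\<lambda>_. {..<M}). regular_zeros ((+) (box_shift c m) ` origin_box c) s)"
    unfolding origin_box_tiling(1)[OF assms] regular_zeros_def by blast
  moreover have "(\<Sum>m\<in>PiE UNIV (\<lambda>_. {..<M}). zero_count ((+) (box_shift c m) ` origin_box c) s)
      = emeasure (count_space UNIV) (\<Union>m\<in>PiE UNIV (\<lambda>_. {..<M}). regular_zeros ((+) (box_shift c m) ` origin_box c) s)"
    unfolding zero_count_def
  proof (rule sum_emeasure)
    show "disjoint_family_on (\<lambda>m. regular_zeros ((+) (box_shift c m) ` origin_box c) s) (PiE UNIV (\<lambda>_. {..<M}))"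
    proof -
      have "disjoint_family_on (\<lambda>m. (+) (box_shift c m) ` (origin_box c :: (real ^ 'n) set)) (PiE UNIV (\<lambda>_. {..<M}))"
        by (rule origin_box_tiling(2)[OF assms])
      then show ?thesis unfolding disjoint_family_on_def regular_zeros_def by blast
    qed
  qed (auto intro: finite_PiE)
  ultimately show ?thesis by (simp only: zero_count_def)
qed

text \<open>The number \<open>M^n\<close> of boxes cancels the scaling factor
  \<open>(1 / M)^n\<close>. The left side does not depend on \<open>M\<close>, so the limit may be
  taken on the right alone.\<close>

lemma nn_integral_zero_count_scaled:
  assumes M: "M > 0" and base_pos: "origin_box (2 * pi / real M) \<subseteq> base_pos"
  shows "(\<integral>\<^sup>+ s. zero_count (origin_box (2 * pi)) s \<partial>sphere_prod)
    = (\<integral>\<^sup>+ r. (\<integral>\<^sup>+ u\<in>origin_box (2 * pi). ennreal (\<Phi> r ((1 / real M) *\<^sub>R u)) \<partial>lborel) \<partial>gauss rest_index)"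
proof -
  define c where "c = 2 * pi / real M"
  have c: "c > 0" and Mc: "real M * c = 2 * pi" using M by (simp_all add: c_def)
  obtain C :: "nat \<Rightarrow> (real ^ 'n) set" where C: "\<And>l. compact (C l)" "origin_box c = (\<Union>l. C l)"
    using origin_box_compact_union by blast
  have tC: "compact ((+) v ` C l)" "(+) v ` origin_box c = (\<Union>l. (+) v ` C l)" for v :: "real ^ 'n" and l
    using C(1) unfolding C(2) by (auto intro: compact_translation)
  have "(\<integral>\<^sup>+ s. zero_count (origin_box (2 * pi)) s \<partial>sphere_prod) = (\<integral>\<^sup>+ s. (\<Sum>m\<in>PiE UNIV (\<lambda>_. {..<M}). zero_count ((+) (box_shift c m) ` origin_box c) s) \<partial>sphere_prod)"
    unfolding Mc[symmetric] zero_count_partition[OF c] ..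
  also have "\<dots> = (\<Sum>m\<in>PiE UNIV (\<lambda>_. {..<M}). \<integral>\<^sup>+ s. zero_count ((+) (box_shift c m) ` origin_box c) s \<partial>sphere_prod)"
    by (rule nn_integral_sum) (rule measurable_zero_count[OF tC])
  also have "\<dots> = (\<Sum>m\<in>PiE (UNIV :: 'n set) (\<lambda>_. {..<M}). \<integral>\<^sup>+ s. zero_count (origin_box c) s \<partial>sphere_prod)"
    by (intro sum.cong refl nn_integral_zero_count_shift[OF C])
  also have "\<dots> = ennreal (real M ^ CARD('n)) * (\<integral>\<^sup>+ s. zero_count (origin_box c) s \<partial>sphere_prod)"
    by (simp add: card_PiE ennreal_of_nat_eq_real_of_nat flip: of_nat_power)
  also have "(\<integral>\<^sup>+ s. zero_count (origin_box c) s \<partial>sphere_prod) = (\<integral>\<^sup>+ r. (\<integral>\<^sup>+ \<theta>\<in>origin_box c. ennreal (\<Phi> r \<theta>) \<partial>lborel) \<partial>gauss rest_index)"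
    unfolding \<Phi>_def by (rule nn_integral_zero_count[OF C]) (use base_pos in \<open>simp add: c_def\<close>)
  also have "\<dots> = (\<integral>\<^sup>+ r. ennreal ((1 / real M) ^ CARD('n)) *
      (\<integral>\<^sup>+ u\<in>origin_box (2 * pi). ennreal (\<Phi> r ((1 / real M) *\<^sub>R u)) \<partial>lborel) \<partial>gauss rest_index)"
  proof (rule nn_integral_cong)
    fix r assume r: "r \<in> space (gauss rest_index)"
    have ind: "indicator (origin_box c) ((1 / real M) *\<^sub>R u) = (indicator (origin_box (2 * pi)) u :: ennreal)" for u :: "real ^ 'n"
      using M by (auto simp: indicator_def origin_box_def c_def field_simps)
    have m: "(\<lambda>\<theta>. ennreal (\<Phi> r \<theta>) * indicator (origin_box c) \<theta>) \<in> borel_measurable borel"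
    proof -
      have "\<Phi> r \<in> borel_measurable borel"
        using measurable_compose[OF measurable_Pair1'[OF r] measurable_\<Phi>] by (simp only: fst_conv snd_conv)
      then show ?thesis
        by (intro borel_measurable_times_ennreal borel_measurable_indicator sets_origin_box measurable_compose[OF _ measurable_ennreal])
    qed
    show "(\<integral>\<^sup>+ \<theta>\<in>origin_box c. ennreal (\<Phi> r \<theta>) \<partial>lborel)
        = ennreal ((1 / real M) ^ CARD('n)) * (\<integral>\<^sup>+ u\<in>origin_box (2 * pi). ennreal (\<Phi> r ((1 / real M) *\<^sub>R u)) \<partial>lborel)"
      using M by (subst nn_integral_scaleR[OF _ m, of "1 / real M"]) (simp_all only: ind, simp)
  qed
  also have "\<dots> = ennreal ((1 / real M) ^ CARD('n)) *
      (\<integral>\<^sup>+ r. (\<integral>\<^sup>+ u\<in>origin_box (2 * pi). ennreal (\<Phi> r ((1 / real M) *\<^sub>R u)) \<partial>lborel) \<partial>gauss rest_index)"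
  proof (rule nn_integral_cmult)
    from lborel.borel_measurable_nn_integral_fst[OF measurable_\<Phi>_scaled[of "1 / real M" "2 * pi"]]
    show "(\<lambda>r. \<integral>\<^sup>+ u\<in>origin_box (2 * pi). ennreal (\<Phi> r ((1 / real M) *\<^sub>R u)) \<partial>lborel) \<in> borel_measurable (gauss rest_index)"
      by (simp only: fst_conv snd_conv)
  qed
  finally have eq: "(\<integral>\<^sup>+ s. zero_count (origin_box (2 * pi)) s \<partial>sphere_prod) = ennreal (real M ^ CARD('n)) * (ennreal ((1 / real M) ^ CARD('n)) *
      (\<integral>\<^sup>+ r. (\<integral>\<^sup>+ u\<in>origin_box (2 * pi). ennreal (\<Phi> r ((1 / real M) *\<^sub>R u)) \<partial>lborel) \<partial>gauss rest_index))" .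
  show ?thesis
  proof -
    have "ennreal (real M ^ CARD('n)) * ennreal ((1 / real M) ^ CARD('n)) = ennreal ((real M * (1 / real M)) ^ CARD('n))"
      unfolding power_mult_distrib by (rule ennreal_mult[symmetric]) simp_all
    then show ?thesis unfolding eq using M by (simp add: mult.assoc[symmetric])
  qed
qed

text \<open>Dominated convergence: continuity of \<open>\<Phi> r\<close> at 0 gives the limit of the
  integrand, and the bound on a small ball gives the majorant.\<close>

lemma nn_integral_zero_count_limit:
  "(\<integral>\<^sup>+ s. zero_count (origin_box (2 * pi)) s \<partial>sphere_prod) = ennreal ((2 * pi) ^ CARD('n)) * (\<integral>\<^sup>+ r. ennreal (\<Phi> r 0) \<partial>gauss rest_index)"
proof -
  obtain \<epsilon> where \<epsilon>: "\<epsilon> > 0" "cball 0 \<epsilon> \<subseteq> base_pos"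
    using open_base_pos zero_in_base_pos open_contains_cball by blast
  obtain C where C: "C \<ge> 0" "\<And>r \<theta>. \<theta> \<in> cball 0 \<epsilon> \<Longrightarrow> \<Phi> r \<theta> \<le> C * growth r"
    using \<Phi>_bound[OF compact_cball \<epsilon>(2)] by blast
  define D where "D = real CARD('n) * (2 * pi)"
  have D: "norm u \<le> D" if "u \<in> origin_box (2 * pi)" for u :: "real ^ 'n"
  proof -
    have "norm u \<le> (\<Sum>i\<in>UNIV. \<bar>u $ i\<bar>)" by (rule norm_le_l1_cart)
    also have "\<dots> \<le> (\<Sum>i\<in>(UNIV :: 'n set). 2 * pi)"
      by (rule sum_mono) (use that in \<open>auto simp: origin_box_def less_imp_le\<close>)
    finally show ?thesis by (simp add: D_def)
  qed
  obtain K :: nat where K: "D / \<epsilon> < real K" using reals_Archimedean2 by blast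
  \<comment> \<open>\<open>D\<close> bounds the norm on the box of angles; beyond \<open>K\<close>
    the scaled box stays in the ball of radius \<open>\<epsilon>\<close>, where every
    \<open>b i 0\<close> is positive.\<close>
  define M where "M n = Suc (n + K)" for n
  have Mb: "(1 / real (M n)) *\<^sub>R u \<in> cball 0 \<epsilon>" if "u \<in> origin_box (2 * pi)" for u :: "real ^ 'n" and n
  proof -
    have "D \<le> \<epsilon> * real (M n)" using K \<epsilon>(1) by (simp add: M_def field_simps)
        (smt (verit, ccfv_SIG) mult_nonneg_nonneg of_nat_0_le_iff)
    then have "norm u \<le> \<epsilon> * real (M n)" using D[OF that] by linarith
    then show ?thesis by (simp add: M_def field_simps)
  qed
  have MU: "origin_box (2 * pi / real (M n)) \<subseteq> base_pos" for n
  proof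
    fix \<theta> :: "real ^ 'n" assume "\<theta> \<in> origin_box (2 * pi / real (M n))"
    then have "real (M n) *\<^sub>R \<theta> \<in> origin_box (2 * pi)" by (auto simp: origin_box_def M_def field_simps)
    from Mb[OF this, of n] have "\<theta> \<in> cball 0 \<epsilon>" by (simp add: M_def)
    then show "\<theta> \<in> base_pos" using \<epsilon>(2) by blast
  qed
  let ?P = "gauss rest_index \<Otimes>\<^sub>M (lborel :: (real ^ 'n) measure)"
  define u where "u n x = ennreal (\<Phi> (fst x) ((1 / real (M n)) *\<^sub>R snd x)) * indicator (origin_box (2 * pi)) (snd x)"
    for n :: nat and x :: "('n \<times> nat \<Rightarrow> real) \<times> (real ^ 'n)"
  define u' where "u' x = ennreal (\<Phi> (fst x) 0) * indicator (origin_box (2 * pi)) (snd x)"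
    for x :: "('n \<times> nat \<Rightarrow> real) \<times> (real ^ 'n)"
  define w where "w x = ennreal (C * growth (fst x)) * indicator (origin_box (2 * pi)) (snd x)"
    for x :: "('n \<times> nat \<Rightarrow> real) \<times> (real ^ 'n)"
  have Psets: "measurable ?P N = measurable (gauss rest_index \<Otimes>\<^sub>M borel) N" for N :: "ennreal measure"
    by (rule measurable_cong_sets[OF sets_pair_measure_cong[OF refl sets_lborel] refl])
  have ind: "(\<lambda>x. indicator (origin_box (2 * pi)) (snd x) :: ennreal) \<in> borel_measurable (gauss rest_index \<Otimes>\<^sub>M (borel :: (real ^ 'n) measure))"
    by (rule measurable_compose[OF measurable_snd borel_measurable_indicator[OF sets_origin_box]])
  have um: "u n \<in> borel_measurable ?P" for n
    unfolding u_def[abs_def] by (rule measurable_\<Phi>_scaled)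
  have u'm: "u' \<in> borel_measurable ?P"
    using measurable_\<Phi>_scaled[of 0 "2 * pi"] unfolding u'_def[abs_def] scaleR_zero_left .
  have wm: "w \<in> borel_measurable ?P"
    unfolding Psets w_def[abs_def]
    by (intro borel_measurable_times_ennreal ind measurable_compose[OF _ measurable_ennreal] borel_measurable_times
        borel_measurable_const measurable_compose[OF measurable_fst measurable_growth])
  have "(\<lambda>n. \<integral>\<^sup>+ x. u n x \<partial>?P) \<longlonglongrightarrow> (\<integral>\<^sup>+ x. u' x \<partial>?P)"
  proof (rule nn_integral_dominated_convergence[OF um u'm wm])
    show "AE x in ?P. u n x \<le> w x" for n
    proof (rule AE_I2)
      fix x
      show "u n x \<le> w x"
        unfolding u_def w_def using C(2)[OF Mb] by (auto simp: indicator_def intro!: ennreal_leI)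
    qed
    have "(\<integral>\<^sup>+ x. w x \<partial>?P) = (\<integral>\<^sup>+ r. (\<integral>\<^sup>+ y. ennreal (C * growth r) * indicator (origin_box (2 * pi)) y \<partial>(lborel :: (real ^ 'n) measure)) \<partial>gauss rest_index)"
      unfolding lborel.nn_integral_fst[OF wm, symmetric] by (simp add: w_def)
    also have "\<dots> = (\<integral>\<^sup>+ r. ennreal C * ennreal ((2 * pi) ^ CARD('n)) * ennreal (growth r) \<partial>gauss rest_index)"
    proof (rule nn_integral_cong)
      fix r
      have "growth r \<ge> 0" unfolding growth_def by (intro prod_nonneg) auto
      then show "(\<integral>\<^sup>+ y. ennreal (C * growth r) * indicator (origin_box (2 * pi)) y \<partial>(lborel :: (real ^ 'n) measure))
          = ennreal C * ennreal ((2 * pi) ^ CARD('n)) * ennreal (growth r)"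
        using C(1) sets_origin_box by (subst nn_integral_cmult_indicator) (auto simp: emeasure_origin_box ennreal_mult mult_ac)
    qed
    also have "\<dots> = ennreal C * ennreal ((2 * pi) ^ CARD('n)) * (\<integral>\<^sup>+ r. ennreal (growth r) \<partial>gauss rest_index)"
      by (rule nn_integral_cmult) (rule measurable_compose[OF measurable_growth measurable_ennreal])
    also have "\<dots> < \<infinity>" using nn_integral_growth by (simp add: ennreal_mult_less_top)
    finally show "(\<integral>\<^sup>+ x. w x \<partial>?P) < \<infinity>" .
    show "AE x in ?P. (\<lambda>n. u n x) \<longlonglongrightarrow> u' x"
    proof (rule AE_I2)
      fix x :: "('n \<times> nat \<Rightarrow> real) \<times> (real ^ 'n)"
      have "(\<lambda>n. 1 / real (M n)) \<longlonglongrightarrow> 0"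
        unfolding M_def using LIMSEQ_ignore_initial_segment[OF lim_1_over_n, of "Suc K"] by simp
      then have 0: "(\<lambda>n. (1 / real (M n)) *\<^sub>R snd x) \<longlonglongrightarrow> 0"
        using tendsto_scaleR[OF _ tendsto_const, of _ 0 sequentially "snd x"] by simp
      have "isCont (\<Phi> (fst x)) 0"
        using continuous_\<Phi> open_base_pos zero_in_base_pos continuous_on_eq_continuous_at by blast
      from isCont_tendsto_compose[OF this 0]
      have "(\<lambda>n. ennreal (\<Phi> (fst x) ((1 / real (M n)) *\<^sub>R snd x))) \<longlonglongrightarrow> ennreal (\<Phi> (fst x) 0)"
        by (rule tendsto_ennrealI)
      then show "(\<lambda>n. u n x) \<longlonglongrightarrow> u' x"
        unfolding u_def u'_def by (auto simp: indicator_def)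
    qed
  qed
  moreover have "(\<integral>\<^sup>+ x. u n x \<partial>?P) = (\<integral>\<^sup>+ s. zero_count (origin_box (2 * pi)) s \<partial>sphere_prod)" for n
    unfolding lborel.nn_integral_fst[OF um, symmetric]
    by (subst nn_integral_zero_count_scaled[OF _ MU[of n]]) (simp_all add: u_def M_def)
  ultimately have "(\<integral>\<^sup>+ s. zero_count (origin_box (2 * pi)) s \<partial>sphere_prod) = (\<integral>\<^sup>+ x. u' x \<partial>?P)"
    by (simp add: LIMSEQ_const_iff)
  also have "\<dots> = (\<integral>\<^sup>+ r. (\<integral>\<^sup>+ y. ennreal (\<Phi> r 0) * indicator (origin_box (2 * pi)) y \<partial>(lborel :: (real ^ 'n) measure)) \<partial>gauss rest_index)"
    unfolding lborel.nn_integral_fst[OF u'm, symmetric] by (simp add: u'_def)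
  also have "\<dots> = (\<integral>\<^sup>+ r. ennreal ((2 * pi) ^ CARD('n)) * ennreal (\<Phi> r 0) \<partial>gauss rest_index)"
  proof (rule nn_integral_cong)
    fix r
    show "(\<integral>\<^sup>+ y. ennreal (\<Phi> r 0) * indicator (origin_box (2 * pi)) y \<partial>(lborel :: (real ^ 'n) measure)) = ennreal ((2 * pi) ^ CARD('n)) * ennreal (\<Phi> r 0)"
      using sets_origin_box by (subst nn_integral_cmult_indicator) (auto simp: emeasure_origin_box mult.commute)
  qed
  also have "\<dots> = ennreal ((2 * pi) ^ CARD('n)) * (\<integral>\<^sup>+ r. ennreal (\<Phi> r 0) \<partial>gauss rest_index)"
  proof (rule nn_integral_cmult)
    have "(\<lambda>r. (r, 0 :: real ^ 'n)) \<in> measurable (gauss rest_index) (gauss rest_index \<Otimes>\<^sub>M borel)"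
      by (rule measurable_Pair) simp_all
    from measurable_compose[OF this measurable_\<Phi>]
    have "(\<lambda>r. \<Phi> r 0) \<in> borel_measurable (gauss rest_index)" by (simp only: fst_conv snd_conv)
    then show "(\<lambda>r. ennreal (\<Phi> r 0)) \<in> borel_measurable (gauss rest_index)"
      by (rule measurable_compose[OF _ measurable_ennreal])
  qed
  finally show ?thesis .
qed

text \<open>Row \<open>i\<close> is the gradient at the identity of the Gaussian combination of the
  members \<open>b i k\<close> with \<open>k \<ge> 1\<close>, divided by the root of the number of
  exponents; its covariance matrix is \<open>Q i\<close>.\<close>

definition Y :: "('n \<times> nat \<Rightarrow> real) \<Rightarrow> real ^ 'n ^ 'n" where
  "Y r = (\<chi> i j. \<Sum>k\<in>{1..<d i}. r (i, k) * (tgrad (\<Lambda> i) (b i k) 0 $ j / sqrt (real (card (\<Lambda> i)))))"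

text \<open>At the identity the members with \<open>k \<ge> 1\<close> vanish, so
  \<open>fiber_map r 0 = 0\<close> and the quotient rule loses its second term; the denominator is
  the root of the number of exponents. The constant is \<open>\<gamma> 0\<close>.\<close>

lemma \<Phi>_0: "\<Phi> r 0 = (1 / sqrt (2 * pi)) ^ CARD('n) * \<bar>det (Y r)\<bar>"
proof -
  have bk: "b i k (expt 0) = 0" if "k \<in> {1..<d i}" for i k
    by (rule onb_at_0(3)[OF fin ne sym onb b0]) (use that in auto)
  then have G: "fiber_map r 0 = 0" by (simp add: fiber_map_def ratio_def vec_eq_iff)
  have "ratio_grad i k 0 $ j = tgrad (\<Lambda> i) (b i k) 0 $ j / sqrt (real (card (\<Lambda> i)))" if "k \<in> {1..<d i}" for i k j
    using bk[OF that] by (simp add: ratio_grad_def base_val_0)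
  then have "fiber_jac r 0 $ i $ j = - Y r $ i $ j" for i j
    unfolding fiber_jac_def Y_def vec_lambda_beta by (intro arg_cong[where f=uminus] sum.cong) simp_all
  then have "fiber_jac r 0 = (\<chi> i. (- 1) *s (Y r $ i))" by (simp add: vec_eq_iff)
  then have "det (fiber_jac r 0) = (\<Prod>i\<in>(UNIV :: 'n set). - 1) * det (\<chi> i. Y r $ i)" by (simp only: det_rows_mul)
  then have "\<bar>det (fiber_jac r 0)\<bar> = \<bar>det (Y r)\<bar>" by (simp only: vec_lambda_eta abs_mult abs_prod) simp
  then show ?thesis by (simp add: \<Phi>_def G \<gamma>_0)
qed

lemma nn_integral_zero_count_full:
  "(\<integral>\<^sup>+ s. zero_count (origin_box (2 * pi)) s \<partial>sphere_prod) = ennreal (sqrt (2 * pi) ^ CARD('n)) * (\<integral>\<^sup>+ r. ennreal \<bar>det (Y r)\<bar> \<partial>gauss rest_index)"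
proof -
  have Ym: "(\<lambda>r. Y r $ i $ j) \<in> borel_measurable (gauss rest_index)" for i j
    unfolding Y_def vec_lambda_beta
    by (intro borel_measurable_sum borel_measurable_times borel_measurable_const measurable_gauss_component) (simp add: rest_index_def)
  have "(\<lambda>r. \<bar>det (Y r)\<bar>) \<in> borel_measurable (gauss rest_index)"
    unfolding det_def by (intro borel_measurable_abs borel_measurable_sum borel_measurable_times borel_measurable_const borel_measurable_prod Ym)
  then have "(\<integral>\<^sup>+ r. ennreal (\<Phi> r 0) \<partial>gauss rest_index) = ennreal ((1 / sqrt (2 * pi)) ^ CARD('n)) * (\<integral>\<^sup>+ r. ennreal \<bar>det (Y r)\<bar> \<partial>gauss rest_index)"
  proof -
    have "(\<integral>\<^sup>+ r. ennreal (\<Phi> r 0) \<partial>gauss rest_index) = (\<integral>\<^sup>+ r. ennreal ((1 / sqrt (2 * pi)) ^ CARD('n)) * ennreal \<bar>det (Y r)\<bar> \<partial>gauss rest_index)"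
      unfolding \<Phi>_0 by (intro nn_integral_cong ennreal_mult) simp_all
    also have "\<dots> = ennreal ((1 / sqrt (2 * pi)) ^ CARD('n)) * (\<integral>\<^sup>+ r. ennreal \<bar>det (Y r)\<bar> \<partial>gauss rest_index)"
      by (rule nn_integral_cmult) (rule measurable_compose[OF \<open>(\<lambda>r. \<bar>det (Y r)\<bar>) \<in> borel_measurable (gauss rest_index)\<close> measurable_ennreal])
    finally show ?thesis .
  qed
  moreover have "ennreal ((2 * pi) ^ CARD('n)) * ennreal ((1 / sqrt (2 * pi)) ^ CARD('n)) = ennreal (sqrt (2 * pi) ^ CARD('n))"
  proof -
    have "2 * pi * (1 / sqrt (2 * pi)) = sqrt (2 * pi)" by (simp add: real_div_sqrt)
    then have "(2 * pi) ^ CARD('n) * (1 / sqrt (2 * pi)) ^ CARD('n) = sqrt (2 * pi) ^ CARD('n)"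
      by (simp only: power_mult_distrib[symmetric])
    then show ?thesis by (subst ennreal_mult[symmetric]) (simp_all only: zero_le_power, simp_all)
  qed
  ultimately show ?thesis unfolding nn_integral_zero_count_limit by (simp add: mult.assoc[symmetric])
qed

end

section \<open>The average number of roots\<close>

context trig_system
begin

lemma small_origin_box: "\<exists>M>0. origin_box (2 * pi / real M) \<subseteq> base_pos"
proof -
  obtain \<epsilon> where \<epsilon>: "\<epsilon> > 0" "ball 0 \<epsilon> \<subseteq> base_pos"
    using open_base_pos zero_in_base_pos open_contains_ball by blast
  obtain K :: nat where K: "real CARD('n) * (2 * pi) / \<epsilon> < real K" using reals_Archimedean2 by blast
  define M where "M = Suc K"
  have M: "real CARD('n) * (2 * pi / real M) < \<epsilon>"
  proof -
    have "real CARD('n) * (2 * pi) / \<epsilon> < real M" using K by (simp add: M_def)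
    then have "real CARD('n) * (2 * pi) < real M * \<epsilon>" using \<epsilon>(1) by (simp only: pos_divide_less_eq)
    then show ?thesis by (simp add: M_def field_simps)
  qed
  have "origin_box (2 * pi / real M) \<subseteq> base_pos"
  proof
    fix \<theta> :: "real ^ 'n" assume \<theta>: "\<theta> \<in> origin_box (2 * pi / real M)"
    have "norm \<theta> \<le> (\<Sum>i\<in>UNIV. \<bar>\<theta> $ i\<bar>)" by (rule norm_le_l1_cart)
    also have "\<dots> \<le> (\<Sum>i\<in>(UNIV :: 'n set). 2 * pi / real M)"
      by (rule sum_mono) (use \<theta> in \<open>auto simp: origin_box_def less_imp_le\<close>)
    also have "\<dots> < \<epsilon>" using M by simp
    finally show "\<theta> \<in> base_pos" using \<epsilon>(2) by auto
  qed
  then show ?thesis by (intro exI[of _ M]) (simp add: M_def)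
qed

lemma AE_no_degenerate_zeros_origin_box: "AE s in sphere_prod. degenerate_zeros (origin_box (2 * pi)) s = {}"
proof -
  obtain M :: nat where M: "M > 0" "origin_box (2 * pi / real M) \<subseteq> base_pos" using small_origin_box by blast
  define c where "c = 2 * pi / real M"
  have c: "c > 0" and Mc: "real M * c = 2 * pi" using M by (simp_all add: c_def)
  obtain C :: "nat \<Rightarrow> (real ^ 'n) set" where C: "\<And>l. compact (C l)" "origin_box c = (\<Union>l. C l)"
    using origin_box_compact_union by blast
  have "AE s in sphere_prod. degenerate_zeros (origin_box c) s = {}"
    by (rule AE_no_degenerate_zeros[OF C]) (use M in \<open>simp add: c_def\<close>)
  then have "AE s in sphere_prod. \<forall>m\<in>PiE UNIV (\<lambda>_. {..<M}). degenerate_zeros ((+) (box_shift c m) ` origin_box c) s = {}"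
    by (intro AE_finite_allI AE_degenerate_zeros_shift finite_PiE) auto
  then show ?thesis
  proof eventually_elim
    fix s assume "\<forall>m\<in>PiE UNIV (\<lambda>_. {..<M}). degenerate_zeros ((+) (box_shift c m) ` origin_box c) s = {}"
    then show "degenerate_zeros (origin_box (2 * pi)) s = {}"
      unfolding Mc[symmetric] origin_box_tiling(1)[OF c] degenerate_zeros_def by blast
  qed
qed

lemma inj_expt_origin_box: "inj_on expt (origin_box (2 * pi) :: (real ^ 'n) set)"
proof (rule inj_onI)
  fix x y :: "real ^ 'n" assume x: "x \<in> origin_box (2 * pi)" and y: "y \<in> origin_box (2 * pi)" and eq: "expt x = expt y"
  show "x = y"
  proof (rule vec_eq_iff[THEN iffD2], rule allI)
    fix j
    have "cis (x $ j) = cis (y $ j)" using eq by (simp add: expt_def vec_eq_iff)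
    then have "cos (x $ j) = cos (y $ j)" "sin (x $ j) = sin (y $ j)" by (simp_all add: complex_eq_iff)
    then obtain k :: int where k: "x $ j = y $ j + 2 * pi * of_int k"
      using sin_cos_eq_iff by metis
    have b: "0 \<le> x $ j" "x $ j < 2 * pi" "0 \<le> y $ j" "y $ j < 2 * pi" using x y by (auto simp: origin_box_def)
    have 1: "2 * pi * of_int k < 2 * pi * 1" and 2: "2 * pi * (- 1) < 2 * pi * of_int k" using k b by linarith+
    have "real_of_int k < 1" "- 1 < real_of_int k"
      using mult_left_less_imp_less[OF 1] mult_left_less_imp_less[OF 2] by simp_all
    then have "k = 0" by linarith
    then show "x $ j = y $ j" using k by simp
  qed
qed

lemma torus_expt_origin_box: "z \<in> torus \<Longrightarrow> \<exists>\<theta>\<in>origin_box (2 * pi). expt \<theta> = z"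
proof (intro bexI[of _ "\<chi> j. Arg2pi (z $ j)"])
  assume z: "z \<in> torus"
  have "cis (Arg2pi w) = w" if "cmod w = 1" for w
    using Arg2pi[of w] that by (simp add: is_Arg_def cis_conv_exp)
  then show "expt (\<chi> j. Arg2pi (z $ j)) = z" using z by (simp add: expt_def torus_def vec_eq_iff)
  show "(\<chi> j. Arg2pi (z $ j)) \<in> origin_box (2 * pi)" using Arg2pi by (simp add: origin_box_def)
qed

text \<open>As a function of the angles the system is injective near \<open>\<theta>\<close>; a
  section of \<open>expt\<close> that is continuous at the point carries this over to the
  torus.\<close>

lemma regular_zero_isolated:
  assumes s: "s \<in> space sphere_prod" and z: "\<And>i. s i (expt \<theta>) = 0" and det: "det (Jac s \<theta>) \<noteq> 0"
  shows "expt \<theta> isolated_in {z \<in> torus. \<forall>i. s i z = 0}"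
proof -
  define F where "F \<theta> = (\<chi> i. s i (expt \<theta>))" for \<theta> :: "real ^ 'n"
  have der: "(F has_derivative (\<lambda>h. Jac s x *v h)) (at x)" for x
  proof (subst has_derivative_componentwise_within, rule ballI)
    fix e :: "real ^ 'n" assume "e \<in> Basis"
    then obtain i where e: "e = axis i 1" by (auto simp: Basis_vec_def)
    have 1: "(\<lambda>x. F x \<bullet> e) = (\<lambda>\<theta>. s i (expt \<theta>))" by (simp add: F_def e inner_axis)
    have 2: "(\<lambda>h. (Jac s x *v h) \<bullet> e) = (\<lambda>h. tgrad (\<Lambda> i) (s i) x \<bullet> h)"
      unfolding e inner_axis by (simp add: Jac_def matrix_vector_mult_def inner_vec_def)
    show "((\<lambda>x. F x \<bullet> e) has_derivative (\<lambda>h. (Jac s x *v h) \<bullet> e)) (at x)"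
      unfolding 1 2 by (rule tgrad_has_derivative[OF fin ne sym sphere_prod_V[OF s]])
  qed
  have cont: "continuous_on UNIV (\<lambda>x. Jac s x $ i $ j)" for i j
    unfolding Jac_def vec_lambda_beta by (rule continuous_on_component[OF continuous_on_tgrad[OF fin ne sym]])
  obtain r where r: "r > 0" "inj_on F (ball \<theta> r)"
    using locally_injective[OF open_UNIV UNIV_I der cont det] by blast
  \<comment> \<open>Lifts points of the torus near \<open>expt \<theta>\<close> to angles near
    \<open>\<theta>\<close>. The principal argument is taken of the quotient by
    \<open>expt \<theta>\<close>, which is then near 1 and away from the branch cut.\<close>
  define \<psi> where "\<psi> z = (\<chi> j. \<theta> $ j + Arg (z $ j / expt \<theta> $ j))" for z :: "complex ^ 'n"
  have x1: "cmod (expt \<theta> $ j) = 1" for j by (simp add: expt_def)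
  have \<psi>0: "\<psi> (expt \<theta>) = \<theta>"
  proof -
    have "expt \<theta> $ j \<noteq> 0" for j using x1[of j] by auto
    then show ?thesis by (simp add: \<psi>_def vec_eq_iff)
  qed
  have \<psi>e: "expt (\<psi> z) = z" if "z \<in> torus" for z
  proof (rule vec_eq_iff[THEN iffD2], rule allI)
    fix j
    define w where "w = z $ j / expt \<theta> $ j"
    have "cmod w = 1" using that x1[of j] by (simp add: w_def torus_def norm_divide)
    then have "w \<noteq> 0" "sgn w = w" by (auto simp: sgn_div_norm)
    then have w: "cis (Arg w) = w" by (simp add: cis_Arg)
    have "expt (\<psi> z) $ j = cis (\<theta> $ j) * cis (Arg w)"
      by (simp add: \<psi>_def w_def expt_def cis_mult)
    also have "\<dots> = expt \<theta> $ j * w" unfolding w by (simp add: expt_def)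
    also have "\<dots> = z $ j" using x1[of j] by (auto simp: w_def)
    finally show "expt (\<psi> z) $ j = z $ j" .
  qed
  have "(\<psi> \<longlongrightarrow> \<psi> (expt \<theta>)) (at (expt \<theta>))"
    unfolding \<psi>_def
  proof (intro tendsto_vec_lambda tendsto_add tendsto_const)
    fix j
    have x0: "expt \<theta> $ j \<noteq> 0" using x1[of j] by auto
    have l: "((\<lambda>z. z $ j / expt \<theta> $ j) \<longlongrightarrow> expt \<theta> $ j / expt \<theta> $ j) (at (expt \<theta>))"
      by (intro tendsto_intros x0)
    have "isCont Arg (expt \<theta> $ j / expt \<theta> $ j)"
      using x0 by (intro continuous_at_Arg) (simp add: complex_nonpos_Reals_iff)
    from isCont_tendsto_compose[OF this l]
    show "((\<lambda>x. Arg (x $ j / expt \<theta> $ j)) \<longlongrightarrow> Arg (expt \<theta> $ j / expt \<theta> $ j)) (at (expt \<theta>))" .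
  qed
  then have "isCont \<psi> (expt \<theta>)" by (simp only: isCont_def)
  then obtain \<delta> where \<delta>: "\<delta> > 0" "\<And>z. dist z (expt \<theta>) < \<delta> \<Longrightarrow> dist (\<psi> z) (\<psi> (expt \<theta>)) < r"
    using r(1) unfolding continuous_at_eps_delta by blast
  have only: "z = expt \<theta>" if "z \<in> torus" "\<forall>i. s i z = 0" "dist z (expt \<theta>) < \<delta>" for z
  proof -
    have "\<psi> z \<in> ball \<theta> r" using \<delta>(2)[OF that(3)] by (simp add: \<psi>0 dist_commute)
    moreover have "\<theta> \<in> ball \<theta> r" using r(1) by simp
    moreover have "F (\<psi> z) = F \<theta>" using that(2) z by (simp add: F_def \<psi>e[OF that(1)])
    ultimately have "\<psi> z = \<theta>" using r(2) by (blast dest: inj_onD)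
    then show ?thesis using \<psi>e[OF that(1)] by simp
  qed
  have "ball (expt \<theta>) \<delta> \<inter> {z \<in> torus. \<forall>i. s i z = 0} = {expt \<theta>}"
    using only \<delta>(1) z by (auto simp: dist_commute)
  then show ?thesis
    unfolding isolated_in_def using z by (intro conjI exI[of _ "ball (expt \<theta>) \<delta>"]) auto
qed

text \<open>Without degenerate zeros every zero is regular and hence isolated, and
  \<open>expt\<close> maps the half-open box bijectively onto the torus.\<close>

lemma num_roots_eq_zero_count:
  assumes s: "s \<in> space sphere_prod" and d: "degenerate_zeros (origin_box (2 * pi)) s = {}"
  shows "num_roots s = zero_count (origin_box (2 * pi)) s"
proof -
  define Z where "Z = {z \<in> torus. \<forall>i. s i z = 0}"
  have reg: "det (Jac s \<theta>) \<noteq> 0" if "\<theta> \<in> origin_box (2 * pi)" "\<forall>i. s i (expt \<theta>) = 0" for \<theta>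
    using d that unfolding degenerate_zeros_def by blast
  have img: "expt ` regular_zeros (origin_box (2 * pi)) s = Z"
  proof
    show "expt ` regular_zeros (origin_box (2 * pi)) s \<subseteq> Z" by (auto simp: regular_zeros_def Z_def)
    show "Z \<subseteq> expt ` regular_zeros (origin_box (2 * pi)) s"
    proof
      fix z assume z: "z \<in> Z"
      then obtain \<theta> where \<theta>: "\<theta> \<in> origin_box (2 * pi)" "expt \<theta> = z" using torus_expt_origin_box by (auto simp: Z_def)
      then have "\<theta> \<in> regular_zeros (origin_box (2 * pi)) s" using z reg[OF \<theta>(1)] by (auto simp: regular_zeros_def Z_def)
      then show "z \<in> expt ` regular_zeros (origin_box (2 * pi)) s" using \<theta>(2) by blast
    qed
  qed
  have "{x. x isolated_in Z} = Z"
  proof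
    show "{x. x isolated_in Z} \<subseteq> Z" by (auto simp: isolated_in_def)
    show "Z \<subseteq> {x. x isolated_in Z}"
    proof
      fix z assume "z \<in> Z"
      then obtain \<theta> where \<theta>: "\<theta> \<in> regular_zeros (origin_box (2 * pi)) s" "z = expt \<theta>" using img by blast
      then show "z \<in> {x. x isolated_in Z}"
        unfolding Z_def using regular_zero_isolated[OF s, of \<theta>] by (simp add: regular_zeros_def)
    qed
  qed
  moreover have "inj_on expt (regular_zeros (origin_box (2 * pi)) s)"
    by (rule inj_on_subset[OF inj_expt_origin_box]) (auto simp: regular_zeros_def)
  ultimately show ?thesis
    unfolding num_roots_def Z_def[symmetric] zero_count_def img[symmetric] emeasure_count_space[OF subset_UNIV]
    by (simp add: finite_image_iff card_image)
qed

lemma avg_roots_eq: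
  "avg_roots \<Lambda> = ennreal (sqrt (2 * pi) ^ CARD('n)) * (\<integral>\<^sup>+ r. ennreal \<bar>det (Y r)\<bar> \<partial>gauss rest_index)"
proof -
  have "AE s in sphere_prod. num_roots s = zero_count (origin_box (2 * pi)) s"
    using AE_no_degenerate_zeros_origin_box AE_space by eventually_elim (rule num_roots_eq_zero_count)
  then have "(\<integral>\<^sup>+ s. num_roots s \<partial>sphere_prod) = (\<integral>\<^sup>+ s. zero_count (origin_box (2 * pi)) s \<partial>sphere_prod)" by (rule nn_integral_cong_AE)
  then show ?thesis unfolding nn_integral_zero_count_full unfolding avg_roots_def sphere_prod_def .
qed

section \<open>Covariances, ellipsoids and the conclusion\<close>

definition Q :: "'n \<Rightarrow> real ^ 'n ^ 'n" where
  "Q i = (\<chi> a c. (\<Sum>\<mu>\<in>\<Lambda> i. of_int (\<mu> $ a) * of_int (\<mu> $ c)) / real (card (\<Lambda> i)))"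

lemma Q_quadratic: "x \<bullet> (Q i *v x) = 1 / real (card (\<Lambda> i)) * (\<Sum>\<mu>\<in>\<Lambda> i. (\<Sum>j\<in>UNIV. real_of_int (\<mu> $ j) * x $ j)\<^sup>2)"
proof -
  have "x \<bullet> (Q i *v x) = (\<Sum>a\<in>UNIV. \<Sum>c\<in>UNIV. \<Sum>\<mu>\<in>\<Lambda> i. (real_of_int (\<mu> $ a) * x $ a) * (real_of_int (\<mu> $ c) * x $ c) / real (card (\<Lambda> i)))"
    unfolding inner_vec_def matrix_vector_mult_def Q_def vec_lambda_beta inner_real_def sum_distrib_left sum_divide_distrib sum_distrib_right
    by (intro sum.cong refl) (simp add: mult_ac)
  also have "\<dots> = (\<Sum>a\<in>UNIV. \<Sum>\<mu>\<in>\<Lambda> i. \<Sum>c\<in>UNIV. (real_of_int (\<mu> $ a) * x $ a) * (real_of_int (\<mu> $ c) * x $ c) / real (card (\<Lambda> i)))"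
    by (intro sum.cong refl sum.swap)
  also have "\<dots> = (\<Sum>\<mu>\<in>\<Lambda> i. \<Sum>a\<in>UNIV. \<Sum>c\<in>UNIV. (real_of_int (\<mu> $ a) * x $ a) * (real_of_int (\<mu> $ c) * x $ c) / real (card (\<Lambda> i)))"
    by (rule sum.swap)
  also have "\<dots> = 1 / real (card (\<Lambda> i)) * (\<Sum>\<mu>\<in>\<Lambda> i. (\<Sum>j\<in>UNIV. real_of_int (\<mu> $ j) * x $ j)\<^sup>2)"
    unfolding power2_eq_square sum_product by (simp only: sum_distrib_left) simp
  finally show ?thesis .
qed

text \<open>A compact convex set is determined by its support function, by separation with a
  hyperplane; this turns the definite description of \<open>ell\<close> into inequalities.\<close>

lemma mem_ell_iff: "a \<in> ell (\<Lambda> i) \<longleftrightarrow> (\<forall>x. a \<bullet> x \<le> sqrt (x \<bullet> (Q i *v x)))"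
proof -
  have sup: "sqrt (x \<bullet> (Q i *v x)) = ell_support (\<Lambda> i) x" for x
    by (simp only: Q_quadratic ell_support_def)
  let ?B = "ell (\<Lambda> i)"
  have B: "?B \<noteq> {}" "compact ?B" "convex ?B" "support_fun ?B = ell_support (\<Lambda> i)"
    using theI'[OF ell_unique[OF fin ne, of i]] unfolding ell_def[symmetric] by auto
  have bdd: "bdd_above ((\<lambda>a. a \<bullet> \<xi>) ` ?B)" for \<xi>
    by (intro compact_imp_bounded[THEN bounded_imp_bdd_above] compact_continuous_image B(2) continuous_intros)
  show ?thesis
    unfolding sup
  proof
    assume a: "a \<in> ?B"
    show "\<forall>x. a \<bullet> x \<le> ell_support (\<Lambda> i) x"
      unfolding B(4)[symmetric] support_fun_def by (intro allI cSUP_upper a bdd)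
  next
    assume a: "\<forall>x. a \<bullet> x \<le> ell_support (\<Lambda> i) x"
    show "a \<in> ?B"
    proof (rule ccontr)
      assume "a \<notin> ?B"
      then obtain \<xi> c where c: "\<xi> \<bullet> a < c" "\<forall>x\<in>?B. c < \<xi> \<bullet> x"
        using separating_hyperplane_closed_point[of ?B a] B compact_imp_closed by blast
      have "support_fun ?B (- \<xi>) \<le> - c"
        unfolding support_fun_def using c B(1)
        by (intro cSUP_least) (auto simp: inner_commute less_imp_le)
      moreover have "a \<bullet> (- \<xi>) \<le> ell_support (\<Lambda> i) (- \<xi>)" using a by blast
      ultimately show False using c(1) by (simp add: B(4) inner_commute)
    qed
  qed
qed

text \<open>The rows of \<open>Y\<close> use disjoint blocks of coefficients, so the expectation of
  the product factors. Each factor is a weighted second moment of Gaussian linear forms, and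
  Parseval identifies its parameters with \<open>Q j\<close>, \<open>Q j *v x\<close> and
  \<open>x \<bullet> (Q j *v x)\<close>.\<close>

lemma Y_integral:
  "has_bochner_integral (gauss rest_index)
    (\<lambda>r. \<Prod>j\<in>UNIV. exp (- (Y r $ j \<bullet> x)\<^sup>2 / 2) * (Y r $ j $ \<pi> j * Y r $ j $ \<tau> j))
    (\<Prod>j\<in>UNIV. sqrt1_hess (Q j) x $ \<pi> j $ \<tau> j)"
proof -
  interpret G: prob_space "gauss rest_index" by (rule prob_space_gauss)
  define y where "y q a = tgrad (\<Lambda> (fst q)) (b (fst q) (snd q)) 0 $ a / sqrt (real (card (\<Lambda> (fst q))))" for q :: "'n \<times> nat" and a
  define yx where "yx q = (\<Sum>a\<in>UNIV. y q a * x $ a)" for q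
  define B where "B j = {j} \<times> {1..<d j}" for j
  have B: "B j \<subseteq> rest_index" "finite (B j)" "disjoint_family B" for j
    by (auto simp: B_def rest_index_def disjoint_family_on_def)
  define g where "g j c = expsq (\<Sum>q\<in>B j. yx q * c q) * ((\<Sum>q\<in>B j. y q (\<pi> j) * c q) * (\<Sum>q\<in>B j. y q (\<tau> j) * c q))"
    for j and c :: "'n \<times> nat \<Rightarrow> real"
  have sumB: "(\<Sum>q\<in>B j. f q) = (\<Sum>k\<in>{1..<d j}. f (j, k))" for j and f :: "'n \<times> nat \<Rightarrow> real"
    unfolding B_def by (rule sum.reindex_bij_witness[of _ "\<lambda>k. (j, k)" snd]) auto
  have Yj: "Y r $ j $ a = (\<Sum>q\<in>B j. y q a * r q)" for r j a
    unfolding sumB Y_def vec_lambda_beta y_def by (intro sum.cong) (simp_all add: mult.commute)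
  have Yx: "Y r $ j \<bullet> x = (\<Sum>q\<in>B j. yx q * r q)" for r j
    unfolding inner_vec_def inner_real_def Yj yx_def sum_distrib_right
    by (subst sum.swap) (intro sum.cong refl, simp add: mult_ac)
  have fg: "exp (- (Y r $ j \<bullet> x)\<^sup>2 / 2) * (Y r $ j $ \<pi> j * Y r $ j $ \<tau> j) = g j (restrict r (B j))" for r j
    unfolding Yx Yj g_def by (intro arg_cong2[where f="(*)"] arg_cong[where f=expsq] sum.cong refl) simp_all
  have yQ: "(\<Sum>q\<in>B j. y q a * y q c) = Q j $ a $ c" for j a c
  proof -
    have "(\<Sum>q\<in>B j. y q a * y q c) = (\<Sum>k\<in>{1..<d j}. tgrad (\<Lambda> j) (b j k) 0 $ a * tgrad (\<Lambda> j) (b j k) 0 $ c) / real (card (\<Lambda> j))"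
      unfolding sumB y_def sum_divide_distrib using card_pos[of j] by (intro sum.cong refl) simp
    also have "(\<Sum>k\<in>{1..<d j}. tgrad (\<Lambda> j) (b j k) 0 $ a * tgrad (\<Lambda> j) (b j k) 0 $ c) = (\<Sum>\<mu>\<in>\<Lambda> j. of_int (\<mu> $ a) * of_int (\<mu> $ c))"
      by (rule onb_at_0(4)[OF fin ne sym onb b0])
    finally show ?thesis by (simp only: Q_def vec_lambda_beta)
  qed
  have yxQ: "(\<Sum>q\<in>B j. y q a * yx q) = (Q j *v x) $ a" for j a
  proof -
    have "(\<Sum>q\<in>B j. y q a * yx q) = (\<Sum>c\<in>UNIV. (\<Sum>q\<in>B j. y q a * y q c) * x $ c)"
      unfolding yx_def sum_distrib_left sum_distrib_right
      by (subst sum.swap) (intro sum.cong refl, simp add: mult_ac)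
    then show ?thesis unfolding yQ by (simp add: matrix_vector_mult_def)
  qed
  have yxx: "(\<Sum>q\<in>B j. (yx q)\<^sup>2) = x \<bullet> (Q j *v x)" for j
  proof -
    have "(\<Sum>q\<in>B j. (yx q)\<^sup>2) = (\<Sum>a\<in>UNIV. x $ a * (\<Sum>q\<in>B j. y q a * yx q))"
      unfolding sum_distrib_left
    proof (subst sum.swap, rule sum.cong[OF refl])
      fix q
      have "(\<Sum>a\<in>UNIV. x $ a * (y q a * yx q)) = (\<Sum>a\<in>UNIV. y q a * x $ a) * yx q"
        unfolding sum_distrib_right by (intro sum.cong refl) (simp add: mult_ac)
      then show "(yx q)\<^sup>2 = (\<Sum>a\<in>UNIV. x $ a * (y q a * yx q))" by (simp add: yx_def[symmetric] power2_eq_square)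
    qed
    then show ?thesis unfolding yxQ by (simp add: inner_vec_def)
  qed
  have gi: "has_bochner_integral (gauss (B j)) (g j) (sqrt1_hess (Q j) x $ \<pi> j $ \<tau> j)" for j
    using gauss_expsq_quadratic[OF B(2)[of j], of yx "\<lambda>q. y q (\<pi> j)" "\<lambda>q. y q (\<tau> j)"]
    unfolding yQ yxQ yxx by (simp only: g_def[abs_def] sqrt1_hess_def sqrt1_def vec_lambda_beta)
  have rm: "(\<lambda>r. restrict r (B j)) \<in> measurable (gauss rest_index) (gauss (B j))" for j
    unfolding gauss_def by (rule measurable_restrict_subset[OF B(1)])
  have dr: "distr (gauss rest_index) (gauss (B j)) (\<lambda>r. restrict r (B j)) = gauss (B j)" for j
    using distr_PiM_reindex[of rest_index "\<lambda>_. stdn" "\<lambda>q. q" "B j"] B(1)[of j] prob_space_stdn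
    by (auto simp: gauss_def)
  define X where "X j r = g j (restrict r (B j))" for j r
  have gm: "g j \<in> borel_measurable (gauss (B j))" for j
    using gi[of j] by (rule borel_measurable_has_bochner_integral)
  have Xi: "has_bochner_integral (gauss rest_index) (X j) (sqrt1_hess (Q j) x $ \<pi> j $ \<tau> j)" for j
  proof -
    have "has_bochner_integral (distr (gauss rest_index) (gauss (B j)) (\<lambda>r. restrict r (B j))) (g j) (sqrt1_hess (Q j) x $ \<pi> j $ \<tau> j)"
      unfolding dr by (rule gi)
    then have "integrable (distr (gauss rest_index) (gauss (B j)) (\<lambda>r. restrict r (B j))) (g j)"
      "(\<integral>r. g j r \<partial>distr (gauss rest_index) (gauss (B j)) (\<lambda>r. restrict r (B j))) = sqrt1_hess (Q j) x $ \<pi> j $ \<tau> j"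
      unfolding has_bochner_integral_iff by blast+
    then show ?thesis
      unfolding has_bochner_integral_iff X_def[abs_def]
      by (simp add: integrable_distr_eq[OF rm gm] integral_distr[OF rm gm])
  qed
  have "G.indep_vars (\<lambda>j. gauss (B j)) (\<lambda>j r. restrict r (B j)) UNIV"
    by (rule gauss_indep_blocks[OF B(1,3)])
  from G.indep_vars_compose2[OF this, of g "\<lambda>_. borel"] gm
  have ind: "G.indep_vars (\<lambda>_. borel) X UNIV" unfolding X_def[abs_def] by blast
  have int: "integrable (gauss rest_index) (X j)" for j using Xi[of j] by (rule integrable.intros)
  have "integrable (gauss rest_index) (\<lambda>r. \<Prod>j\<in>UNIV. X j r)"
    by (rule G.indep_vars_integrable[OF finite ind int])
  moreover have "(\<integral>r. (\<Prod>j\<in>UNIV. X j r) \<partial>gauss rest_index) = (\<Prod>j\<in>UNIV. \<integral>r. X j r \<partial>gauss rest_index)"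
    by (rule G.indep_vars_lebesgue_integral[OF finite ind int])
  moreover have "(\<integral>r. X j r \<partial>gauss rest_index) = sqrt1_hess (Q j) x $ \<pi> j $ \<tau> j" for j
    by (rule has_bochner_integral_integral_eq[OF Xi])
  ultimately have "has_bochner_integral (gauss rest_index) (\<lambda>r. \<Prod>j\<in>UNIV. X j r) (\<Prod>j\<in>UNIV. sqrt1_hess (Q j) x $ \<pi> j $ \<tau> j)"
    by (simp add: has_bochner_integral_iff)
  then show ?thesis unfolding fg X_def .
qed

lemma avg_roots_mixed_volume:
  "avg_roots \<Lambda> = ennreal (fact CARD('n) * mixed_volume (\<lambda>i. ell (\<Lambda> i)))"
proof -
  have "ennreal (fact CARD('n) * mixed_volume (\<lambda>i. ell (\<Lambda> i)))
    = ennreal (sqrt (2 * pi) ^ CARD('n)) * (\<integral>\<^sup>+ r. ennreal \<bar>det (Y r)\<bar> \<partial>gauss rest_index)"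
  proof (rule mixed_volume_ellipsoids[where Q = Q])
    show "transpose (Q j) = Q j" for j
      by (simp add: Q_def transpose_def vec_eq_iff mult.commute)
    show "h \<bullet> (Q j *v h) \<ge> 0" for j h
      unfolding Q_quadratic by (intro mult_nonneg_nonneg sum_nonneg) auto
    show "a \<in> ell (\<Lambda> j) \<longleftrightarrow> (\<forall>x. a \<bullet> x \<le> sqrt (x \<bullet> (Q j *v x)))" for j a
      by (rule mem_ell_iff)
    show "sigma_finite_measure (gauss rest_index)"
      by (rule prob_space_imp_sigma_finite[OF prob_space_gauss])
    show "(\<lambda>r. Y r $ i $ j) \<in> borel_measurable (gauss rest_index)" for i j
      unfolding Y_def vec_lambda_beta
      by (intro borel_measurable_sum borel_measurable_times borel_measurable_const measurable_gauss_component) (simp add: rest_index_def)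
  qed (rule Y_integral)
  then show ?thesis using avg_roots_eq by simp
qed

end

theorem theorem1:
  fixes \<Lambda> :: "'n :: finite \<Rightarrow> (int ^ 'n) set"
  assumes "\<And>i. finite (\<Lambda> i)"
    and "\<And>i. \<Lambda> i \<noteq> {}"
    and "\<And>i. uminus ` \<Lambda> i = \<Lambda> i"
  shows "avg_roots \<Lambda> = ennreal (fact CARD('n) * mixed_volume (\<lambda>i. ell (\<Lambda> i)))"
proof -
  \<comment> \<open>The bases appear on neither side of the claim; they are chosen here to enter the
    locale.\<close>
  have "\<forall>i. \<exists>d b. onb (\<Lambda> i) d b \<and> b 0 = (\<lambda>z. kern (\<Lambda> i) z / sqrt (real (card (\<Lambda> i))))"
    using onb_exists[OF assms] by blast
  then obtain d b where "\<And>i. onb (\<Lambda> i) (d i) (b i)"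
      and "\<And>i. b i 0 = (\<lambda>z. kern (\<Lambda> i) z / sqrt (real (card (\<Lambda> i))))"
    by metis
  then interpret trig_system \<Lambda> d b
    by unfold_locales (use assms in auto)
  show ?thesis by (rule avg_roots_mixed_volume)
qed

end
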